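(* Let $S=(S_1,\ldots,S_k)$ be the standard $k$-tuple of doubly $\Lambda$-commuting row isometries $S_i=[S_{i,1}\cdots S_{i,n_i}]$ and let $\mathcal J_\Lambda$ be the closed two-sided ideal generated by the projections $I-\sum_{s=1}^{n_1}S_{1,s}S_{1,s}^*,\ \ldots,\ I-\sum_{s=1}^{n_k}S_{k,s}S_{k,s}^*$ in the $C^*$-algebra $C^*(\{S_{i,s}\})$. Then the sequence of $C^*$-algebras $$0\to\mathcal J_\Lambda\to C^*(\{S_{i,s}\})\to\otimes^\Lambda_{i\in\{1,\ldots,k\}}\mathcal O_{n_i}\to0$$ is exact.
   Context: Fix integers $k\ge1$, $n_1,\ldots,n_k\ge 1$ and, for $i\ne j$ in $\{1,\ldots,k\}$, an $n_i\times n_j$ matrix $\Lambda_{i,j}=[\lambda_{i,j}(s,t)]$ with entries in $\mathbb T=\{z\in\mathbb C:|z|=1\}$, such that $\lambda_{j,i}(t,s)=\overline{\lambda_{i,j}(s,t)}$. $\mathbb F_{n_i}^+$ is the unital free semigroup with generators $g_1^i,\ldots,g_{n_i}^i$ and neutral element $g_0^i$. The standard $k$-tuple $S$ acts on $\ell^2(\mathbb F_{n_1}^+\times\cdots\times\mathbb F_{n_k}^+)$ with standard basis $\chi_{(\alpha_1,\ldots,\alpha_k)}$ by $$S_{i,s}\chi_{(\alpha_1,\ldots,\alpha_k)}=\boldsymbol\lambda_{i,1}(s,\alpha_1)\cdots\boldsymbol\lambda_{i,i-1}(s,\alpha_{i-1})\chi_{(\alpha_1,\ldots,\alpha_{i-1},g_s^i\alpha_i,\alpha_{i+1},\ldots,\alpha_k)},$$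 where $\boldsymbol\lambda_{i,j}(s,g^j_{j_1}\cdots g^j_{j_q})=\prod_{b=1}^q\lambda_{i,j}(s,j_b)$, $\boldsymbol\lambda_{i,j}(s,g_0^j)=1$ (no factor if $i=1$). $C^*(\{S_{i,s}\})$ is the $C^*$-algebra generated by all $S_{i,s}$. $\otimes^\Lambda_{i\in\{1,\ldots,k\}}\mathcal O_{n_i}$ is the universal unital $C^*$-algebra generated by isometries $W_{i,s}$, $1\le i\le k$, $1\le s\le n_i$, satisfying $\sum_{s=1}^{n_i}W_{i,s}W_{i,s}^*=1$ for each $i$ and $W_{i,s}^*W_{j,t}=\overline{\lambda_{i,j}(s,t)}W_{j,t}W_{i,s}^*$ for all $i\ne j$ and all $s,t$. The first map of the sequence is the inclusion and the second is the canonical $*$-homomorphism sending $S_{i,s}$ to the generator $W_{i,s}$. *)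

theory Defs
  imports
    "HOL-Analysis.Analysis"
    "HOL-Algebra.Algebraic_Closure_Type"
begin

section \<open>C*-algebras with explicit carriers\<close>

record 'a cstar_algebra = "(complex, 'a) module" +
  star :: "'a \<Rightarrow> 'a"
  cnorm :: "'a \<Rightarrow> real"

text \<open>
  The value outside the carrier is irrelevant; it is fixed to 0 because \<open>Metric_space\<close> requires
  symmetry and nonnegativity on the whole type.
\<close>
definition cdist :: "('a, 'm) cstar_algebra_scheme \<Rightarrow> 'a \<Rightarrow> 'a \<Rightarrow> real" where
  "cdist A x y = (if x \<in> carrier A \<and> y \<in> carrier A then cnorm A (x \<ominus>\<^bsub>A\<^esub> y) else 0)"

text \<open>
  Not necessarily unital: the field \<open>one\<close> of the record is unconstrained here, so that a closed
  two-sided ideal is again a C*-algebra in this sense.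
\<close>
locale cstar_algebra =
  Module.module "ring_of_type_algebra :: complex ring" A
  for A :: "('a, 'm) cstar_algebra_scheme" (structure) +
  assumes mult_closed: "\<lbrakk>x \<in> carrier A; y \<in> carrier A\<rbrakk> \<Longrightarrow> x \<otimes> y \<in> carrier A"
    and mult_assoc: "\<lbrakk>x \<in> carrier A; y \<in> carrier A; z \<in> carrier A\<rbrakk>
      \<Longrightarrow> (x \<otimes> y) \<otimes> z = x \<otimes> (y \<otimes> z)"
    and distrib_right: "\<lbrakk>x \<in> carrier A; y \<in> carrier A; z \<in> carrier A\<rbrakk>
      \<Longrightarrow> (x \<oplus> y) \<otimes> z = x \<otimes> z \<oplus> y \<otimes> z"
    and distrib_left: "\<lbrakk>x \<in> carrier A; y \<in> carrier A; z \<in> carrier A\<rbrakk>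
      \<Longrightarrow> z \<otimes> (x \<oplus> y) = z \<otimes> x \<oplus> z \<otimes> y"
    and smult_mult_left: "\<lbrakk>x \<in> carrier A; y \<in> carrier A\<rbrakk>
      \<Longrightarrow> (c \<odot>\<^bsub>A\<^esub> x) \<otimes> y = c \<odot>\<^bsub>A\<^esub> (x \<otimes> y)"
    and smult_mult_right: "\<lbrakk>x \<in> carrier A; y \<in> carrier A\<rbrakk>
      \<Longrightarrow> x \<otimes> (c \<odot>\<^bsub>A\<^esub> y) = c \<odot>\<^bsub>A\<^esub> (x \<otimes> y)"
    and star_closed: "x \<in> carrier A \<Longrightarrow> star A x \<in> carrier A"
    and star_star: "x \<in> carrier A \<Longrightarrow> star A (star A x) = x"
    and star_add: "\<lbrakk>x \<in> carrier A; y \<in> carrier A\<rbrakk> \<Longrightarrow> star A (x \<oplus> y) = star A x \<oplus> star A y"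
    and star_smult: "x \<in> carrier A \<Longrightarrow> star A (c \<odot>\<^bsub>A\<^esub> x) = cnj c \<odot>\<^bsub>A\<^esub> star A x"
    and star_mult: "\<lbrakk>x \<in> carrier A; y \<in> carrier A\<rbrakk> \<Longrightarrow> star A (x \<otimes> y) = star A y \<otimes> star A x"
    and cnorm_nonneg: "x \<in> carrier A \<Longrightarrow> 0 \<le> cnorm A x"
    and cnorm_eq_zero: "x \<in> carrier A \<Longrightarrow> cnorm A x = 0 \<longleftrightarrow> x = \<zero>"
    and cnorm_triangle: "\<lbrakk>x \<in> carrier A; y \<in> carrier A\<rbrakk>
      \<Longrightarrow> cnorm A (x \<oplus> y) \<le> cnorm A x + cnorm A y"
    and cnorm_smult: "x \<in> carrier A \<Longrightarrow> cnorm A (c \<odot>\<^bsub>A\<^esub> x) = cmod c * cnorm A x"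
    and cnorm_mult: "\<lbrakk>x \<in> carrier A; y \<in> carrier A\<rbrakk>
      \<Longrightarrow> cnorm A (x \<otimes> y) \<le> cnorm A x * cnorm A y"
    and cstar_identity: "x \<in> carrier A \<Longrightarrow> cnorm A (star A x \<otimes> x) = (cnorm A x)\<^sup>2"
    and complete: "Metric_space.mcomplete (carrier A) (cdist A)"

locale unital_cstar_algebra = cstar_algebra A + monoid A
  for A :: "('a, 'm) cstar_algebra_scheme" (structure)

definition closed_in_norm :: "('a, 'm) cstar_algebra_scheme \<Rightarrow> 'a set \<Rightarrow> bool" where
  "closed_in_norm A B \<longleftrightarrow> closedin (Metric_space.mtopology (carrier A) (cdist A)) B"

definition unital_cstar_subalgebra :: "('a, 'm) cstar_algebra_scheme \<Rightarrow> 'a set \<Rightarrow> bool" where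
  "unital_cstar_subalgebra A B \<longleftrightarrow> subring B A \<and> (\<forall>c. \<forall>x\<in>B. c \<odot>\<^bsub>A\<^esub> x \<in> B) \<and>
     (\<forall>x\<in>B. star A x \<in> B) \<and> closed_in_norm A B"

text \<open>
  The C*-subalgebra generated by \<open>G\<close>, with the unit included.  Whenever \<open>G\<close> contains an isometry
  \<open>x\<close>, the unit is \<open>star x * x\<close>, so this is also the C*-subalgebra generated without adjoining it.
\<close>
definition cstar_generated :: "('a, 'm) cstar_algebra_scheme \<Rightarrow> 'a set \<Rightarrow> 'a set" where
  "cstar_generated A G = \<Inter>{B. unital_cstar_subalgebra A B \<and> G \<subseteq> B}"

definition closed_ideal_generated :: "('a, 'm) cstar_algebra_scheme \<Rightarrow> 'a set \<Rightarrow> 'a set" where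
  "closed_ideal_generated A P = \<Inter>{J. ideal J A \<and> closed_in_norm A J \<and> P \<subseteq> J}"

definition star_hom ::
    "('a, 'm) cstar_algebra_scheme \<Rightarrow> ('b, 'n) cstar_algebra_scheme \<Rightarrow> ('a \<Rightarrow> 'b) set" where
  "star_hom A B = {\<phi>. \<phi> \<in> carrier A \<rightarrow> carrier B \<and>
     (\<forall>x\<in>carrier A. \<forall>y\<in>carrier A. \<phi> (x \<oplus>\<^bsub>A\<^esub> y) = \<phi> x \<oplus>\<^bsub>B\<^esub> \<phi> y) \<and>
     (\<forall>x\<in>carrier A. \<forall>y\<in>carrier A. \<phi> (x \<otimes>\<^bsub>A\<^esub> y) = \<phi> x \<otimes>\<^bsub>B\<^esub> \<phi> y) \<and>
     (\<forall>c. \<forall>x\<in>carrier A. \<phi> (c \<odot>\<^bsub>A\<^esub> x) = c \<odot>\<^bsub>B\<^esub> \<phi> x) \<and>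
     (\<forall>x\<in>carrier A. \<phi> (star A x) = star B (\<phi> x))}"

definition short_exact_cstar ::
    "('a, 'l) cstar_algebra_scheme \<Rightarrow> ('b, 'm) cstar_algebra_scheme \<Rightarrow>
     ('c, 'n) cstar_algebra_scheme \<Rightarrow> ('a \<Rightarrow> 'b) \<Rightarrow> ('b \<Rightarrow> 'c) \<Rightarrow> bool" where
  "short_exact_cstar A B C f g \<longleftrightarrow>
     cstar_algebra A \<and> cstar_algebra B \<and> cstar_algebra C \<and>
     f \<in> star_hom A B \<and> g \<in> star_hom B C \<and>
     inj_on f (carrier A) \<and> f ` carrier A = a_kernel B C g \<and> g ` carrier B = carrier C"


section \<open>Bounded operators on \<open>\<ell>\<^sup>2(I)\<close>\<close>

text \<open>Vectors of \<open>\<ell>\<^sup>2(I)\<close> are functions on the whole type that vanish outside \<open>I\<close>.\<close>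
definition ell2 :: "'x set \<Rightarrow> ('x \<Rightarrow> complex) set" where
  "ell2 I = {f. (\<forall>x. x \<notin> I \<longrightarrow> f x = 0) \<and> (\<lambda>x. (cmod (f x))\<^sup>2) summable_on I}"

definition ell2_inner :: "'x set \<Rightarrow> ('x \<Rightarrow> complex) \<Rightarrow> ('x \<Rightarrow> complex) \<Rightarrow> complex" where
  "ell2_inner I f g = (\<Sum>\<^sub>\<infinity>x\<in>I. f x * cnj (g x))"

definition ell2_norm :: "'x set \<Rightarrow> ('x \<Rightarrow> complex) \<Rightarrow> real" where
  "ell2_norm I f = sqrt (\<Sum>\<^sub>\<infinity>x\<in>I. (cmod (f x))\<^sup>2)"

definition chi :: "'x \<Rightarrow> 'x \<Rightarrow> complex" where
  "chi a = (\<lambda>x. if x = a then 1 else 0)"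

text \<open>Operators are \<open>extensional\<close> on \<open>\<ell>\<^sup>2(I)\<close>, so that equal operators are equal functions.\<close>
definition bounded_ops :: "'x set \<Rightarrow> (('x \<Rightarrow> complex) \<Rightarrow> ('x \<Rightarrow> complex)) set" where
  "bounded_ops I = {T \<in> ell2 I \<rightarrow>\<^sub>E ell2 I.
     (\<forall>f\<in>ell2 I. \<forall>g\<in>ell2 I. T (\<lambda>x. f x + g x) = (\<lambda>x. T f x + T g x)) \<and>
     (\<forall>c. \<forall>f\<in>ell2 I. T (\<lambda>x. c * f x) = (\<lambda>x. c * T f x)) \<and>
     (\<exists>M. \<forall>f\<in>ell2 I. ell2_norm I (T f) \<le> M * ell2_norm I f)}"

definition op_algebra :: "'x set \<Rightarrow> (('x \<Rightarrow> complex) \<Rightarrow> ('x \<Rightarrow> complex)) cstar_algebra" where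
  "op_algebra I = \<lparr>
     carrier = bounded_ops I,
     monoid.mult = (\<lambda>T U. \<lambda>f\<in>ell2 I. T (U f)),
     one = (\<lambda>f\<in>ell2 I. f),
     ring.zero = (\<lambda>f\<in>ell2 I. (\<lambda>x. 0)),
     add = (\<lambda>T U. \<lambda>f\<in>ell2 I. (\<lambda>x. T f x + U f x)),
     smult = (\<lambda>c T. \<lambda>f\<in>ell2 I. (\<lambda>x. c * T f x)),
     star = (\<lambda>T. THE U. U \<in> bounded_ops I \<and>
               (\<forall>f\<in>ell2 I. \<forall>g\<in>ell2 I. ell2_inner I (T f) g = ell2_inner I f (U g))),
     cnorm = (\<lambda>T. SUP f\<in>{f \<in> ell2 I. ell2_norm I f \<le> 1}. ell2_norm I (T f))\<rparr>"


section \<open>The standard tuple of doubly \<open>\<Lambda>\<close>-commuting row isometries\<close>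

text \<open>
  The word \<open>g\<^sub>j\<^sub>1 \<dots> g\<^sub>j\<^sub>q\<close> of the free semigroup on \<open>n i\<close> generators is the list of its indices
  \<open>[j1, \<dots>, jq]\<close>; the neutral element is \<open>[]\<close>.  A \<open>k\<close>-tuple of words is an extensional function
  on \<open>{1..k}\<close>.  The entry \<open>\<lambda>\<^sub>i\<^sub>,\<^sub>j(s, t)\<close> is \<open>lam i j s t\<close>.
\<close>
definition word_tuples :: "nat \<Rightarrow> (nat \<Rightarrow> nat) \<Rightarrow> (nat \<Rightarrow> nat list) set" where
  "word_tuples k n = (\<Pi>\<^sub>E i\<in>{1..k}. lists {1..n i})"

definition lam_word ::
    "(nat \<Rightarrow> nat \<Rightarrow> nat \<Rightarrow> nat \<Rightarrow> complex) \<Rightarrow> nat \<Rightarrow> nat \<Rightarrow> nat \<Rightarrow> nat list \<Rightarrow> complex" where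
  "lam_word lam i j s w = prod_list (map (\<lambda>t. lam i j s t) w)"

text \<open>
  Coordinates of \<open>S\<^sub>i\<^sub>,\<^sub>s f\<close>: the basis vector indexed by \<open>b\<close> is hit only if the \<open>i\<close>-th word of \<open>b\<close>
  starts with \<open>s\<close>, and then only by the tuple in which this letter is removed.  The action on basis
  vectors is lemma \<open>std_isometry_chi\<close>.
\<close>
definition std_isometry ::
    "nat \<Rightarrow> (nat \<Rightarrow> nat) \<Rightarrow> (nat \<Rightarrow> nat \<Rightarrow> nat \<Rightarrow> nat \<Rightarrow> complex) \<Rightarrow> nat \<Rightarrow> nat \<Rightarrow>
     ((nat \<Rightarrow> nat list) \<Rightarrow> complex) \<Rightarrow> ((nat \<Rightarrow> nat list) \<Rightarrow> complex)" where
  "std_isometry k n lam i s = (\<lambda>f\<in>ell2 (word_tuples k n). \<lambda>b.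
     if b \<in> word_tuples k n \<and> b i \<noteq> [] \<and> hd (b i) = s
     then (\<Prod>j\<in>{1..<i}. lam_word lam i j s (b j)) * f (b(i := tl (b i)))
     else 0)"

lemma chi_in_ell2:
  assumes "a \<in> I" shows "chi a \<in> ell2 I"
proof -
  have "(\<lambda>x. (cmod (chi a x))\<^sup>2) summable_on I \<longleftrightarrow> (\<lambda>x. (cmod (chi a x))\<^sup>2) summable_on {a}"
    by (rule summable_on_cong_neutral) (auto simp: chi_def assms)
  then show ?thesis
    using assms by (auto simp: ell2_def chi_def)
qed

lemma std_isometry_chi:
  assumes i: "i \<in> {1..k}" and s: "s \<in> {1..n i}" and a: "a \<in> word_tuples k n"
  shows "std_isometry k n lam i s (chi a) =
    (\<lambda>b. (\<Prod>j\<in>{1..<i}. lam_word lam i j s (a j)) * chi (a(i := s # a i)) b)"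
proof
  fix b
  have up: "a(i := s # a i) \<in> word_tuples k n"
    using a i s unfolding word_tuples_def
    by (auto simp: PiE_iff extensional_def)
  have eq: "b \<in> word_tuples k n \<and> b i \<noteq> [] \<and> hd (b i) = s \<and> b(i := tl (b i)) = a
      \<longleftrightarrow> b = a(i := s # a i)"
  proof
    assume *: "b \<in> word_tuples k n \<and> b i \<noteq> [] \<and> hd (b i) = s \<and> b(i := tl (b i)) = a"
    then have "a i = tl (b i)" by auto
    then have "s # a i = b i" using * by (metis list.collapse)
    moreover have "a(i := b i) = b" using * by auto
    ultimately show "b = a(i := s # a i)" by simp
  qed (use up in auto)
  show "std_isometry k n lam i s (chi a) b =
    (\<Prod>j\<in>{1..<i}. lam_word lam i j s (a j)) * chi (a(i := s # a i)) b"
  proof (cases "b = a(i := s # a i)")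
    case True
    then show ?thesis
      using up chi_in_ell2[OF a] by (auto simp: std_isometry_def chi_def intro!: prod.cong)
  next
    case False
    then have "\<not> (b \<in> word_tuples k n \<and> b i \<noteq> [] \<and> hd (b i) = s \<and> b(i := tl (b i)) = a)"
      using eq by blast
    then show ?thesis
      using False chi_in_ell2[OF a] by (auto simp: std_isometry_def chi_def)
  qed
qed

definition std_cstar_algebra ::
    "nat \<Rightarrow> (nat \<Rightarrow> nat) \<Rightarrow> (nat \<Rightarrow> nat \<Rightarrow> nat \<Rightarrow> nat \<Rightarrow> complex) \<Rightarrow>
     (((nat \<Rightarrow> nat list) \<Rightarrow> complex) \<Rightarrow> ((nat \<Rightarrow> nat list) \<Rightarrow> complex)) cstar_algebra" where
  "std_cstar_algebra k n lam =
     (let B = op_algebra (word_tuples k n)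
      in B\<lparr>carrier := cstar_generated B {std_isometry k n lam i s |i s. i \<in> {1..k} \<and> s \<in> {1..n i}}\<rparr>)"

definition defect_projection ::
    "nat \<Rightarrow> (nat \<Rightarrow> nat) \<Rightarrow> (nat \<Rightarrow> nat \<Rightarrow> nat \<Rightarrow> nat \<Rightarrow> complex) \<Rightarrow> nat \<Rightarrow>
     ((nat \<Rightarrow> nat list) \<Rightarrow> complex) \<Rightarrow> ((nat \<Rightarrow> nat list) \<Rightarrow> complex)" where
  "defect_projection k n lam i =
     (let C = std_cstar_algebra k n lam; S = std_isometry k n lam
      in \<one>\<^bsub>C\<^esub> \<ominus>\<^bsub>C\<^esub> (\<Oplus>\<^bsub>C\<^esub>s\<in>{1..n i}. S i s \<otimes>\<^bsub>C\<^esub> star C (S i s)))"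

definition defect_ideal ::
    "nat \<Rightarrow> (nat \<Rightarrow> nat) \<Rightarrow> (nat \<Rightarrow> nat \<Rightarrow> nat \<Rightarrow> nat \<Rightarrow> complex) \<Rightarrow>
     (((nat \<Rightarrow> nat list) \<Rightarrow> complex) \<Rightarrow> ((nat \<Rightarrow> nat list) \<Rightarrow> complex)) cstar_algebra" where
  "defect_ideal k n lam =
     (let C = std_cstar_algebra k n lam
      in C\<lparr>carrier := closed_ideal_generated C (defect_projection k n lam ` {1..k})\<rparr>)"


section \<open>The universal algebra\<close>

definition cuntz_relations ::
    "nat \<Rightarrow> (nat \<Rightarrow> nat) \<Rightarrow> (nat \<Rightarrow> nat \<Rightarrow> nat \<Rightarrow> nat \<Rightarrow> complex) \<Rightarrow>
     ('a, 'm) cstar_algebra_scheme \<Rightarrow> (nat \<Rightarrow> nat \<Rightarrow> 'a) \<Rightarrow> bool" where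
  "cuntz_relations k n lam A W \<longleftrightarrow>
     (\<forall>i\<in>{1..k}. \<forall>s\<in>{1..n i}. W i s \<in> carrier A \<and> star A (W i s) \<otimes>\<^bsub>A\<^esub> W i s = \<one>\<^bsub>A\<^esub>) \<and>
     (\<forall>i\<in>{1..k}. (\<Oplus>\<^bsub>A\<^esub>s\<in>{1..n i}. W i s \<otimes>\<^bsub>A\<^esub> star A (W i s)) = \<one>\<^bsub>A\<^esub>) \<and>
     (\<forall>i\<in>{1..k}. \<forall>j\<in>{1..k}. i \<noteq> j \<longrightarrow> (\<forall>s\<in>{1..n i}. \<forall>t\<in>{1..n j}.
        star A (W i s) \<otimes>\<^bsub>A\<^esub> W j t = cnj (lam i j s t) \<odot>\<^bsub>A\<^esub> (W j t \<otimes>\<^bsub>A\<^esub> star A (W i s))))"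

text \<open>
  \<open>A\<close> with the generators \<open>W\<close> is the universal unital C*-algebra for the relations above; this
  determines \<open>(A, W)\<close> up to isomorphism.

  HOL cannot quantify over the type of the test algebras \<open>B\<close>, so their carriers are subsets of
  \<open>nat \<Rightarrow> complex\<close>.  This loses nothing: only the C*-subalgebra generated by the countably many
  \<open>V i s\<close> and the unit matters, it is separable, hence has at most the cardinality of the continuum,
  and is therefore isomorphic to one carried by a subset of that type.

  The homomorphism \<open>\<phi>\<close> is automatically unital, by \<open>star (W i s) * W i s = 1\<close>, and unique on the
  carrier, because \<open>W\<close> generates \<open>A\<close>.
\<close>
definition is_universal_cuntz ::
    "nat \<Rightarrow> (nat \<Rightarrow> nat) \<Rightarrow> (nat \<Rightarrow> nat \<Rightarrow> nat \<Rightarrow> nat \<Rightarrow> complex) \<Rightarrow>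
     ('a, 'm) cstar_algebra_scheme \<Rightarrow> (nat \<Rightarrow> nat \<Rightarrow> 'a) \<Rightarrow> bool" where
  "is_universal_cuntz k n lam A W \<longleftrightarrow>
     unital_cstar_algebra A \<and> cuntz_relations k n lam A W \<and>
     cstar_generated A {W i s |i s. i \<in> {1..k} \<and> s \<in> {1..n i}} = carrier A \<and>
     (\<forall>(B :: (nat \<Rightarrow> complex) cstar_algebra) V.
        unital_cstar_algebra B \<and> cuntz_relations k n lam B V \<longrightarrow>
        (\<exists>\<phi>\<in>star_hom A B. \<forall>i\<in>{1..k}. \<forall>s\<in>{1..n i}. \<phi> (W i s) = V i s))"

end

theory Submission
  imports Defs
begin

text \<open>
  Words \<open>W\<^sub>\<alpha> = W\<^sub>1\<^sub>,\<^sub>\<alpha>\<^sub>1 \<dots> W\<^sub>k\<^sub>,\<^sub>\<alpha>\<^sub>k\<close> of a fixed multi-length are isometries with orthogonal ranges summing to 1,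
  and a polynomial \<open>q\<close> of degree \<open>d\<close> acts on \<open>W\<^sub>\<alpha>\<close> by left multiplication with the same coefficients as
  \<open>q(S)\<close> on \<open>\<chi>\<^sub>\<alpha>\<close>, provided all components of \<open>\<alpha>\<close> have length at least \<open>d\<close>.  Cutting the matrix of \<open>q(S)\<close> into
  blocks between multi-lengths gives \<open>\<parallel>q(W)\<parallel> \<le> (2d+1)\<^sup>k \<parallel>q(S)\<parallel>\<close>.  Replacing \<open>q\<close> by iterates of \<open>q \<mapsto> q\<^sup>* q\<close> removes
  the polynomial factor, so that \<open>S\<^sub>i\<^sub>,\<^sub>s \<mapsto> W\<^sub>i\<^sub>,\<^sub>s\<close> extends to a homomorphism \<open>\<pi>\<close>, which kills the defect ideal \<open>J\<close>.

  Conversely, let \<open>Q\<^sub>m\<close> be the projection onto the tuples of words of length at least \<open>m\<close>.  Then \<open>1 - Q\<^sub>m \<in> J\<close>, and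
  \<open>\<parallel>x Q\<^sub>m\<parallel> \<longlonglongrightarrow> 0\<close> for \<open>x \<in> J\<close>, so the quotient norm of \<open>x\<close> is the limit of \<open>\<parallel>x Q\<^sub>m\<parallel>\<close> and inherits the C*-identity.
  The quotient satisfies the Cuntz relations, and universality gives a contraction \<open>\<psi>\<close> with \<open>\<psi> \<circ> \<pi>\<close> the quotient
  map; hence \<open>\<pi>\<close> has kernel \<open>J\<close> and closed range.
\<close>

section \<open>Sequential limits in normed modules\<close>

text \<open>\<open>A\<close> is an abstract algebra, not represented on a Hilbert space, so every
  estimate in it rests on the C*-identity and the triangle inequality for finite sums. This is the
  reason for the blocks: between two fixed multi-lengths the matrix of \<open>q(S)\<close> is
  finite, counting its entries gives a crude bound, and the same squaring device that removes the
  polynomial factor removes the count. The factor \<open>2d+1\<close> per component counts the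
  lengths that \<open>d\<close> letters and adjoints can reach from length \<open>d\<close>.

  Long words are forced: the adjoint of \<open>S\<^sub>i\<^sub>,\<^sub>s\<close> kills an empty
  component, whereas the ranges of the words in \<open>W\<close> exhaust the unit, so the two
  families agree only away from short words. The defect ideal measures this discrepancy.

  Universality enters through \<psi> alone, and its test algebras are carried by sets of type
  \<open>nat \<Rightarrow> complex\<close>. Hence the quotient is built inside that type: operators
  are coded by their countably many matrix entries, and a coset by the code of a chosen
  representative. As \<psi> is given only as a homomorphism, its contractivity is proved separately,
  by an iterated square root.\<close>

definition clim :: "('a, 'm) cstar_algebra_scheme \<Rightarrow> (nat \<Rightarrow> 'a) \<Rightarrow> 'a \<Rightarrow> bool" where
  "clim A u x \<longleftrightarrow> range u \<subseteq> carrier A \<and> x \<in> carrier A \<and>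
     (\<lambda>n. cnorm A (u n \<ominus>\<^bsub>A\<^esub> x)) \<longlonglongrightarrow> 0"

definition ccauchy :: "('a, 'm) cstar_algebra_scheme \<Rightarrow> (nat \<Rightarrow> 'a) \<Rightarrow> bool" where
  "ccauchy A u \<longleftrightarrow> range u \<subseteq> carrier A \<and>
     (\<forall>e>0. \<exists>N. \<forall>m\<ge>N. \<forall>n\<ge>N. cnorm A (u m \<ominus>\<^bsub>A\<^esub> u n) < e)"

lemma ring_of_type_algebra_simps [simp]:
  "carrier ring_of_type_algebra = UNIV"
  "add ring_of_type_algebra = (+)"
  "monoid.mult ring_of_type_algebra = (*)"
  "one ring_of_type_algebra = 1"
  "ring.zero ring_of_type_algebra = 0"
  by (auto simp: ring_of_type_algebra_def)

text \<open>The part of the structure on which limits depend. Isolating it makes sequences available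
  in \<open>op_algebra\<close> and in the quotient while completeness, and with it the C*-axioms, is
  still to be shown there.\<close>

locale normed_module =
  Module.module "ring_of_type_algebra :: complex ring" A
  for A :: "('a, 'm) cstar_algebra_scheme" (structure) +
  assumes nrm_nonneg: "x \<in> carrier A \<Longrightarrow> 0 \<le> cnorm A x"
    and nrm_eq_zero: "x \<in> carrier A \<Longrightarrow> cnorm A x = 0 \<longleftrightarrow> x = \<zero>"
    and nrm_triangle: "\<lbrakk>x \<in> carrier A; y \<in> carrier A\<rbrakk>
      \<Longrightarrow> cnorm A (x \<oplus> y) \<le> cnorm A x + cnorm A y"
    and nrm_smult: "x \<in> carrier A \<Longrightarrow> cnorm A (c \<odot>\<^bsub>A\<^esub> x) = cmod c * cnorm A x"

sublocale cstar_algebra \<subseteq> normed_module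
  by unfold_locales (auto simp: cnorm_nonneg cnorm_eq_zero cnorm_triangle cnorm_smult)

context normed_module
begin

lemma sm_closed [simp, intro]: "x \<in> carrier A \<Longrightarrow> c \<odot>\<^bsub>A\<^esub> x \<in> carrier A"
  by (rule smult_closed) auto

lemma sm_add_left: "x \<in> carrier A \<Longrightarrow> (a + b) \<odot>\<^bsub>A\<^esub> x = a \<odot>\<^bsub>A\<^esub> x \<oplus> b \<odot>\<^bsub>A\<^esub> x"
  using smult_l_distr[of a b x] by simp

lemma sm_add_right:
  "x \<in> carrier A \<Longrightarrow> y \<in> carrier A \<Longrightarrow> a \<odot>\<^bsub>A\<^esub> (x \<oplus> y) = a \<odot>\<^bsub>A\<^esub> x \<oplus> a \<odot>\<^bsub>A\<^esub> y"
  using smult_r_distr[of a x y] by simp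

lemma sm_sm: "x \<in> carrier A \<Longrightarrow> a \<odot>\<^bsub>A\<^esub> (b \<odot>\<^bsub>A\<^esub> x) = (a * b) \<odot>\<^bsub>A\<^esub> x"
  using smult_assoc1[of a b x] by simp

lemma sm_one [simp]: "x \<in> carrier A \<Longrightarrow> 1 \<odot>\<^bsub>A\<^esub> x = x"
  using smult_one[of x] by simp

lemma sm_zero [simp]: "x \<in> carrier A \<Longrightarrow> 0 \<odot>\<^bsub>A\<^esub> x = \<zero>"
  using smult_l_null[of x] by simp

lemma sm_rzero [simp]: "a \<odot>\<^bsub>A\<^esub> \<zero> = \<zero>"
  using smult_r_null[of a] by simp

lemma neg_conv_sm: "x \<in> carrier A \<Longrightarrow> \<ominus> x = (-1) \<odot>\<^bsub>A\<^esub> x"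
  by (metis M.add.inv_closed M.minus_equality add.right_inverse add.commute sm_add_left sm_closed sm_one sm_zero)

lemma minus_conv_sm: "x \<in> carrier A \<Longrightarrow> y \<in> carrier A \<Longrightarrow> x \<ominus> y = x \<oplus> (-1) \<odot>\<^bsub>A\<^esub> y"
  by (simp add: a_minus_def neg_conv_sm)

lemma sm_minus_right:
  "x \<in> carrier A \<Longrightarrow> y \<in> carrier A \<Longrightarrow> a \<odot>\<^bsub>A\<^esub> (x \<ominus> y) = a \<odot>\<^bsub>A\<^esub> x \<ominus> a \<odot>\<^bsub>A\<^esub> y"
  by (simp add: minus_conv_sm sm_add_right sm_sm)

lemma mi_closed [simp, intro]: "x \<in> carrier A \<Longrightarrow> y \<in> carrier A \<Longrightarrow> x \<ominus> y \<in> carrier A"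
  by (simp add: a_minus_def)

lemma mi_self [simp]: "x \<in> carrier A \<Longrightarrow> x \<ominus> x = \<zero>"
  by (simp add: a_minus_def M.r_neg)

lemma mi_zero [simp]: "x \<in> carrier A \<Longrightarrow> x \<ominus> \<zero> = x"
  by (simp add: a_minus_def)

lemma mi_add_cancel: "x \<in> carrier A \<Longrightarrow> y \<in> carrier A \<Longrightarrow> (x \<ominus> y) \<oplus> y = x"
  by (simp add: a_minus_def M.a_assoc M.l_neg)

lemma mi_eq_zero: "x \<in> carrier A \<Longrightarrow> y \<in> carrier A \<Longrightarrow> x \<ominus> y = \<zero> \<longleftrightarrow> x = y"
  by (metis mi_self mi_add_cancel M.l_zero)

lemma mi_trans:
  "x \<in> carrier A \<Longrightarrow> y \<in> carrier A \<Longrightarrow> z \<in> carrier A \<Longrightarrow> (x \<ominus> y) \<oplus> (y \<ominus> z) = x \<ominus> z"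
  by (simp add: a_minus_def M.a_assoc M.r_neg1)

lemma mi_swap: "x \<in> carrier A \<Longrightarrow> y \<in> carrier A \<Longrightarrow> \<ominus> (x \<ominus> y) = y \<ominus> x"
  by (simp add: a_minus_def M.minus_add M.a_comm)

lemma mi_add_add:
  "\<lbrakk>x \<in> carrier A; y \<in> carrier A; z \<in> carrier A; w \<in> carrier A\<rbrakk>
    \<Longrightarrow> (x \<oplus> y) \<ominus> (z \<oplus> w) = (x \<ominus> z) \<oplus> (y \<ominus> w)"
  by (simp add: a_minus_def M.minus_add M.a_ac)

lemma mi_mi_swap:
  "\<lbrakk>x \<in> carrier A; y \<in> carrier A; z \<in> carrier A; w \<in> carrier A\<rbrakk>
    \<Longrightarrow> (x \<ominus> y) \<ominus> (z \<ominus> w) = (x \<ominus> z) \<ominus> (y \<ominus> w)"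
  by (simp add: a_minus_def M.minus_add M.a_ac)

lemma nrm_zero [simp]: "cnorm A \<zero> = 0"
  by (simp add: nrm_eq_zero)

lemma nrm_neg: "x \<in> carrier A \<Longrightarrow> cnorm A (\<ominus> x) = cnorm A x"
  by (simp add: neg_conv_sm nrm_smult)

lemma nrm_mi_commute: "x \<in> carrier A \<Longrightarrow> y \<in> carrier A \<Longrightarrow> cnorm A (x \<ominus> y) = cnorm A (y \<ominus> x)"
  by (metis mi_swap nrm_neg mi_closed)

lemma nrm_mi_triangle:
  "\<lbrakk>x \<in> carrier A; y \<in> carrier A; z \<in> carrier A\<rbrakk>
    \<Longrightarrow> cnorm A (x \<ominus> z) \<le> cnorm A (x \<ominus> y) + cnorm A (y \<ominus> z)"
  using nrm_triangle[of "x \<ominus> y" "y \<ominus> z"] by (simp add: mi_trans)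

lemma nrm_mi_le:
  "\<lbrakk>x \<in> carrier A; y \<in> carrier A\<rbrakk> \<Longrightarrow> cnorm A (x \<ominus> y) \<le> cnorm A x + cnorm A y"
  using nrm_triangle[of x "\<ominus> y"] by (simp add: a_minus_def nrm_neg)

lemma nrm_le_add_mi:
  "\<lbrakk>x \<in> carrier A; y \<in> carrier A\<rbrakk> \<Longrightarrow> cnorm A x \<le> cnorm A (x \<ominus> y) + cnorm A y"
  using nrm_mi_triangle[of x y \<zero>] by simp

lemma metric: "Metric_space (carrier A) (cdist A)"
proof
  show "0 \<le> cdist A x y" for x y
    by (simp add: cdist_def nrm_nonneg)
  show "cdist A x y = cdist A y x" for x y
    by (simp add: cdist_def nrm_mi_commute)
  show "cdist A x y = 0 \<longleftrightarrow> x = y" if "x \<in> carrier A" "y \<in> carrier A" for x y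
    using that by (simp add: cdist_def nrm_eq_zero mi_eq_zero)
  show "cdist A x z \<le> cdist A x y + cdist A y z"
    if "x \<in> carrier A" "y \<in> carrier A" "z \<in> carrier A" for x y z
    using that by (simp add: cdist_def nrm_mi_triangle)
qed

lemma limitin_iff_clim:
  assumes "range u \<subseteq> carrier A"
  shows "limitin (Metric_space.mtopology (carrier A) (cdist A)) u x sequentially \<longleftrightarrow> clim A u x"
proof -
  interpret Metric_space "carrier A" "cdist A" by (rule metric)
  have m: "u n \<in> carrier A" for n using assms by auto
  show ?thesis
    using assms by (auto simp: limitin_metric_dist_null clim_def cdist_def m)
qed

lemma MCauchy_iff_ccauchy:
  "Metric_space.MCauchy (carrier A) (cdist A) u \<longleftrightarrow> ccauchy A u"
proof -
  interpret Metric_space "carrier A" "cdist A" by (rule metric)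
  show ?thesis
  proof (cases "range u \<subseteq> carrier A")
    case True
    then have m: "u n \<in> carrier A" for n by auto
    show ?thesis
      by (auto simp: MCauchy_def ccauchy_def cdist_def m)
  qed (auto simp: MCauchy_def ccauchy_def)
qed

lemma mcomplete_iff:
  "Metric_space.mcomplete (carrier A) (cdist A) \<longleftrightarrow> (\<forall>u. ccauchy A u \<longrightarrow> (\<exists>x. clim A u x))"
proof -
  interpret Metric_space "carrier A" "cdist A" by (rule metric)
  show ?thesis
    unfolding mcomplete_def MCauchy_iff_ccauchy
    using limitin_iff_clim by (metis ccauchy_def)
qed

text \<open>Sequences suffice because the topology is metric. All later closedness arguments use
  this form and never return to \<open>closedin\<close>.\<close>

lemma closed_in_norm_iff:
  "closed_in_norm A B \<longleftrightarrow> B \<subseteq> carrier A \<and> (\<forall>u x. range u \<subseteq> B \<longrightarrow> clim A u x \<longrightarrow> x \<in> B)"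
proof -
  interpret Metric_space "carrier A" "cdist A" by (rule metric)
  show ?thesis
    unfolding closed_in_norm_def metric_closedin_iff_sequentially_closed
    using limitin_iff_clim by (meson subset_trans)
qed

lemma climD:
  assumes "clim A u x"
  shows "u n \<in> carrier A" "x \<in> carrier A" "(\<lambda>n. cnorm A (u n \<ominus> x)) \<longlonglongrightarrow> 0"
  using assms by (auto simp: clim_def)

lemma climI:
  assumes "\<And>n. u n \<in> carrier A" "x \<in> carrier A" "f \<longlonglongrightarrow> 0"
    "\<And>n. cnorm A (u n \<ominus> x) \<le> f n"
  shows "clim A u x"
  unfolding clim_def
proof (intro conjI)
  show "(\<lambda>n. cnorm A (u n \<ominus> x)) \<longlonglongrightarrow> 0"
    by (rule tendsto_sandwich[OF _ _ tendsto_const assms(3)])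
      (auto simp: assms nrm_nonneg)
qed (use assms in auto)

lemma clim_const: "x \<in> carrier A \<Longrightarrow> clim A (\<lambda>n. x) x"
  by (auto simp: clim_def)

lemma clim_add:
  assumes "clim A u x" "clim A v y" shows "clim A (\<lambda>n. u n \<oplus> v n) (x \<oplus> y)"
proof (rule climI)
  show "(\<lambda>n. cnorm A (u n \<ominus> x) + cnorm A (v n \<ominus> y)) \<longlonglongrightarrow> 0"
    using tendsto_add[OF climD(3)[OF assms(1)] climD(3)[OF assms(2)]] by simp
  show "cnorm A (u n \<oplus> v n \<ominus> (x \<oplus> y)) \<le> cnorm A (u n \<ominus> x) + cnorm A (v n \<ominus> y)" for n
    using climD[OF assms(1)] climD[OF assms(2)]
    by (simp add: mi_add_add nrm_triangle)
qed (use climD[OF assms(1)] climD[OF assms(2)] in auto)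

lemma clim_smult:
  assumes "clim A u x" shows "clim A (\<lambda>n. c \<odot>\<^bsub>A\<^esub> u n) (c \<odot>\<^bsub>A\<^esub> x)"
proof (rule climI)
  show "(\<lambda>n. cmod c * cnorm A (u n \<ominus> x)) \<longlonglongrightarrow> 0"
    using tendsto_mult_right_zero[OF climD(3)[OF assms]] by simp
  show "cnorm A (c \<odot>\<^bsub>A\<^esub> u n \<ominus> c \<odot>\<^bsub>A\<^esub> x) \<le> cmod c * cnorm A (u n \<ominus> x)" for n
    using climD[OF assms] by (simp add: sm_minus_right[symmetric] nrm_smult)
qed (use climD[OF assms] in auto)

lemma clim_unique:
  assumes "clim A u x" "clim A u y" shows "x = y"
proof -
  note d = climD[OF assms(1)] climD[OF assms(2)]
  have "(\<lambda>n. cnorm A (u n \<ominus> x) + cnorm A (u n \<ominus> y)) \<longlonglongrightarrow> 0"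
    using tendsto_add[OF d(3) d(6)] by simp
  moreover have "cnorm A (x \<ominus> y) \<le> cnorm A (u n \<ominus> x) + cnorm A (u n \<ominus> y)" for n
    using nrm_mi_triangle[of x "u n" y] d by (simp add: nrm_mi_commute)
  ultimately have "cnorm A (x \<ominus> y) \<le> 0"
    by (intro tendsto_lowerbound) auto
  then have "cnorm A (x \<ominus> y) = 0"
    using nrm_nonneg[of "x \<ominus> y"] d by auto
  then show ?thesis
    using d by (simp add: nrm_eq_zero mi_eq_zero)
qed

lemma clim_nrm:
  assumes "clim A u x" shows "(\<lambda>n. cnorm A (u n)) \<longlonglongrightarrow> cnorm A x"
proof -
  note d = climD[OF assms]
  have "\<bar>cnorm A (u n) - cnorm A x\<bar> \<le> cnorm A (u n \<ominus> x)" for n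
    using nrm_le_add_mi[of "u n" x] nrm_le_add_mi[of x "u n"] d by (simp add: nrm_mi_commute)
  then have "(\<lambda>n. cnorm A (u n) - cnorm A x) \<longlonglongrightarrow> 0"
    by (intro Lim_null_comparison[OF _ d(3)]) auto
  then show ?thesis
    by (simp add: LIM_zero_iff)
qed

lemma clim_ccauchy:
  assumes "clim A u x" shows "ccauchy A u"
  unfolding ccauchy_def
proof (intro conjI allI impI)
  fix e :: real assume "e > 0"
  note d = climD[OF assms]
  have "\<exists>N. \<forall>n\<ge>N. cnorm A (u n \<ominus> x) < e/2"
    using LIMSEQ_D[OF d(3), of "e/2"] \<open>e > 0\<close> d by (auto simp: nrm_nonneg)
  then obtain N where N: "\<And>n. n \<ge> N \<Longrightarrow> cnorm A (u n \<ominus> x) < e/2" by auto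
  have "cnorm A (u m \<ominus> u n) < e" if "m \<ge> N" "n \<ge> N" for m n
    using nrm_mi_triangle[of "u m" x "u n"] N[OF that(1)] N[OF that(2)] d(1,2)
    by (simp add: nrm_mi_commute[of x])
  then show "\<exists>N. \<forall>m\<ge>N. \<forall>n\<ge>N. cnorm A (u m \<ominus> u n) < e" by blast
qed (use assms in \<open>auto simp: clim_def\<close>)

text \<open>Takes the radii 1/(n+1). Together with \<open>closed_in_norm_iff\<close> this places an
  element at distance 0 from a closed set inside that set.\<close>

lemma clim_approx:
  assumes "x \<in> carrier A" "\<And>e::real. e > 0 \<Longrightarrow> \<exists>y\<in>B. y \<in> carrier A \<and> cnorm A (y \<ominus> x) < e"
  obtains u where "range u \<subseteq> B" "clim A u x"
proof -
  have "\<forall>n. \<exists>y. y \<in> B \<and> y \<in> carrier A \<and> cnorm A (y \<ominus> x) < inverse (real (Suc n))"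
    using assms(2) by (meson inverse_positive_iff_positive of_nat_0_less_iff zero_less_Suc)
  then obtain u where s: "\<And>n. u n \<in> B \<and> u n \<in> carrier A \<and> cnorm A (u n \<ominus> x) < inverse (real (Suc n))"
    by metis
  have "clim A u x"
    by (rule climI[OF _ assms(1) LIMSEQ_inverse_real_of_nat]) (use s in \<open>auto simp: less_imp_le\<close>)
  then show ?thesis using that s by blast
qed

lemma nrm_finsum_le:
  assumes "finite F" "\<And>i. i \<in> F \<Longrightarrow> f i \<in> carrier A" "\<And>i. i \<in> F \<Longrightarrow> cnorm A (f i) \<le> g i"
  shows "cnorm A (\<Oplus>i\<in>F. f i) \<le> sum g F"
  using assms
proof (induction F rule: finite_induct)
  case (insert i F)
  have "cnorm A (\<Oplus>j\<in>insert i F. f j) = cnorm A (f i \<oplus> (\<Oplus>j\<in>F. f j))"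
    using insert by (simp add: Pi_def)
  also have "\<dots> \<le> cnorm A (f i) + cnorm A (\<Oplus>j\<in>F. f j)"
    using insert by (intro nrm_triangle) (auto simp: Pi_def)
  also have "\<dots> \<le> g i + sum g F"
    using insert by (intro add_mono) auto
  finally show ?case using insert by simp
qed simp

lemma sm_finsum:
  assumes "finite F" "\<And>i. i \<in> F \<Longrightarrow> f i \<in> carrier A"
  shows "c \<odot>\<^bsub>A\<^esub> (\<Oplus>i\<in>F. f i) = (\<Oplus>i\<in>F. c \<odot>\<^bsub>A\<^esub> f i)"
  using finsum_smult_ldistr[of F c f] assms by (simp add: Pi_def)

lemma finsum_mono_neutral:
  assumes "finite G" "F \<subseteq> G" "\<And>i. i \<in> F \<Longrightarrow> f i \<in> carrier A" "\<And>i. i \<in> G - F \<Longrightarrow> f i = \<zero>"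
  shows "(\<Oplus>i\<in>G. f i) = (\<Oplus>i\<in>F. f i)"
proof (rule M.add.finprod_mono_neutral_cong_left[symmetric])
  show "f \<in> G \<rightarrow> carrier A" using assms by (metis DiffI M.zero_closed Pi_I)
qed (use assms in auto)

end

section \<open>Restricting the carrier\<close>

text \<open>The additive inverse is a definite description over the carrier and could a priori
  change when the carrier shrinks. The form \<open>x \<oplus> (-1) y\<close> refers only to
  operations that the restriction leaves alone.\<close>

lemma a_minus_restrict:
  assumes "normed_module A" "normed_module (A\<lparr>carrier := H\<rparr>)" "H \<subseteq> carrier A" "x \<in> H" "y \<in> H"
  shows "x \<ominus>\<^bsub>A\<lparr>carrier := H\<rparr>\<^esub> y = x \<ominus>\<^bsub>A\<^esub> y"
  using assms by (simp add: normed_module.minus_conv_sm[OF assms(2)]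
      normed_module.minus_conv_sm[OF assms(1)] subset_iff)

lemma clim_restrict:
  assumes "normed_module A" "normed_module (A\<lparr>carrier := H\<rparr>)" "H \<subseteq> carrier A"
  shows "clim (A\<lparr>carrier := H\<rparr>) u x \<longleftrightarrow> range u \<subseteq> H \<and> x \<in> H \<and> clim A u x"
proof (cases "range u \<subseteq> H \<and> x \<in> H")
  case True
  then have "u n \<ominus>\<^bsub>A\<lparr>carrier := H\<rparr>\<^esub> x = u n \<ominus>\<^bsub>A\<^esub> x" for n
    using a_minus_restrict[OF assms] by (auto simp: image_subset_iff)
  with True assms(3) show ?thesis by (auto simp: clim_def)
qed (auto simp: clim_def)

lemma ccauchy_restrict:
  assumes "normed_module A" "normed_module (A\<lparr>carrier := H\<rparr>)" "H \<subseteq> carrier A"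
  shows "ccauchy (A\<lparr>carrier := H\<rparr>) u \<longleftrightarrow> range u \<subseteq> H \<and> ccauchy A u"
proof (cases "range u \<subseteq> H")
  case True
  then have "u m \<ominus>\<^bsub>A\<lparr>carrier := H\<rparr>\<^esub> u n = u m \<ominus>\<^bsub>A\<^esub> u n" for n m
    using a_minus_restrict[OF assms] by (auto simp: image_subset_iff)
  with True assms(3) show ?thesis by (auto simp: ccauchy_def)
qed (auto simp: ccauchy_def)

lemma normed_module_restrict:
  fixes A (structure)
  assumes "normed_module A" and H: "H \<subseteq> carrier A" "\<zero>\<^bsub>A\<^esub> \<in> H"
    "\<And>x y. x \<in> H \<Longrightarrow> y \<in> H \<Longrightarrow> x \<oplus>\<^bsub>A\<^esub> y \<in> H" "\<And>c x. x \<in> H \<Longrightarrow> c \<odot>\<^bsub>A\<^esub> x \<in> H"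
  shows "normed_module (A\<lparr>carrier := H\<rparr>)"
proof -
  interpret normed_module A by fact
  have HA: "x \<in> H \<Longrightarrow> x \<in> carrier A" for x using H by auto
  have g: "abelian_group (A\<lparr>carrier := H\<rparr>)"
  proof (rule abelian_groupI)
    fix x assume "x \<in> carrier (A\<lparr>carrier := H\<rparr>)"
    then have "(-1) \<odot>\<^bsub>A\<^esub> x \<in> H" "(-1) \<odot>\<^bsub>A\<^esub> x \<oplus> x = \<zero>"
      using H(4)[of x "-1"] HA M.l_neg[of x] by (simp_all add: neg_conv_sm)
    then show "\<exists>y\<in>carrier (A\<lparr>carrier := H\<rparr>). y \<oplus>\<^bsub>A\<lparr>carrier := H\<rparr>\<^esub> x = \<zero>\<^bsub>A\<lparr>carrier := H\<rparr>\<^esub>"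
      by auto
  qed (use H HA in \<open>auto simp: M.a_ac\<close>)
  have "Module.module (ring_of_type_algebra :: complex ring) (A\<lparr>carrier := H\<rparr>)"
    by (rule moduleI) (use g H HA in \<open>auto simp: sm_add_left sm_add_right sm_sm\<close>)
  then show ?thesis
    unfolding normed_module_def normed_module_axioms_def
    using HA by (auto simp: nrm_nonneg nrm_eq_zero nrm_triangle nrm_smult)
qed

text \<open>Serves both a generated subalgebra and a closed ideal, and therefore asks for no unit in
  \<open>H\<close>. Closedness enters through completeness: a Cauchy sequence in \<open>H\<close>
  converges in \<open>A\<close>, and its limit stays in \<open>H\<close>.\<close>

lemma cstar_algebra_restrict:
  assumes "cstar_algebra A" and cl: "closed_in_norm A H" and H: "\<zero>\<^bsub>A\<^esub> \<in> H"
    "\<And>x y. x \<in> H \<Longrightarrow> y \<in> H \<Longrightarrow> x \<oplus>\<^bsub>A\<^esub> y \<in> H" "\<And>c x. x \<in> H \<Longrightarrow> c \<odot>\<^bsub>A\<^esub> x \<in> H"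
    "\<And>x y. x \<in> H \<Longrightarrow> y \<in> H \<Longrightarrow> x \<otimes>\<^bsub>A\<^esub> y \<in> H" "\<And>x. x \<in> H \<Longrightarrow> star A x \<in> H"
  shows "cstar_algebra (A\<lparr>carrier := H\<rparr>)"
proof -
  interpret cstar_algebra A by fact
  have sub: "H \<subseteq> carrier A" using cl by (simp add: closed_in_norm_iff)
  then have HA: "x \<in> H \<Longrightarrow> x \<in> carrier A" for x by auto
  have nm: "normed_module (A\<lparr>carrier := H\<rparr>)"
    by (rule normed_module_restrict) (use sub H normed_module_axioms in auto)
  interpret N: normed_module "A\<lparr>carrier := H\<rparr>" by (rule nm)
  have "\<exists>x. clim (A\<lparr>carrier := H\<rparr>) u x" if u: "ccauchy (A\<lparr>carrier := H\<rparr>) u" for u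
  proof -
    have u': "range u \<subseteq> H" "ccauchy A u"
      using u ccauchy_restrict[OF normed_module_axioms nm sub] by auto
    obtain x where x: "clim A u x" using u'(2) complete unfolding mcomplete_iff by auto
    then have "x \<in> H" using cl u'(1) unfolding closed_in_norm_iff by auto
    with x u' show ?thesis using clim_restrict[OF normed_module_axioms nm sub] by auto
  qed
  then have "Metric_space.mcomplete (carrier (A\<lparr>carrier := H\<rparr>)) (cdist (A\<lparr>carrier := H\<rparr>))"
    unfolding N.mcomplete_iff by auto
  then show ?thesis
    unfolding cstar_algebra_def cstar_algebra_axioms_def
    using N.module_axioms H HA
    by (simp add: mult_closed mult_assoc distrib_right distrib_left smult_mult_left smult_mult_right
        star_closed star_star star_add star_smult star_mult cnorm_nonneg cnorm_eq_zero
        cnorm_triangle cnorm_smult cnorm_mult cstar_identity)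
qed

lemma finsum_restrict:
  assumes "normed_module A" "normed_module (A\<lparr>carrier := H\<rparr>)" "H \<subseteq> carrier A"
    and "finite F" "\<And>i. i \<in> F \<Longrightarrow> f i \<in> H"
  shows "finsum (A\<lparr>carrier := H\<rparr>) f F = finsum A f F"
proof -
  interpret A: normed_module A by fact
  interpret N: normed_module "A\<lparr>carrier := H\<rparr>" by fact
  show ?thesis using assms(4,5)
  proof (induction F rule: finite_induct)
    case (insert i F)
    then have "f i \<in> carrier A" "f \<in> F \<rightarrow> carrier A" using assms(3) by (auto simp: Pi_def)
    with insert show ?case by (simp add: Pi_def)
  qed simp
qed

section \<open>Unital C*-algebras\<close>

sublocale unital_cstar_algebra \<subseteq> ring A
  by (rule ringI) (auto simp: M.abelian_group_axioms monoid_axioms distrib_right distrib_left)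

lemma (in cstar_algebra) cnorm_star: "x \<in> carrier A \<Longrightarrow> cnorm A (star A x) = cnorm A x"
proof -
  have le: "cnorm A x \<le> cnorm A (star A x)" if x: "x \<in> carrier A" for x
  proof (cases "cnorm A x = 0")
    case False
    then have "cnorm A x > 0" using cnorm_nonneg[OF x] by simp
    moreover have "cnorm A x * cnorm A x \<le> cnorm A (star A x) * cnorm A x"
      using cstar_identity[OF x] cnorm_mult[OF star_closed[OF x] x] by (simp add: power2_eq_square)
    ultimately show ?thesis by simp
  qed (simp add: x cnorm_nonneg star_closed)
  assume "x \<in> carrier A"
  then show ?thesis using le[of x] le[of "star A x"] by (simp add: star_closed star_star)
qed

context unital_cstar_algebra
begin

lemma mi_mult_right:
  "\<lbrakk>x \<in> carrier A; y \<in> carrier A; z \<in> carrier A\<rbrakk> \<Longrightarrow> (x \<ominus> y) \<otimes> z = x \<otimes> z \<ominus> y \<otimes> z"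
  by (simp add: a_minus_def l_distr l_minus)

lemma mi_mult_left:
  "\<lbrakk>x \<in> carrier A; y \<in> carrier A; z \<in> carrier A\<rbrakk> \<Longrightarrow> z \<otimes> (x \<ominus> y) = z \<otimes> x \<ominus> z \<otimes> y"
  by (simp add: a_minus_def r_distr r_minus)

lemma star_zero [simp]: "star A \<zero> = \<zero>"
  using star_smult[of \<zero> 0] by (simp add: star_closed)

lemma star_minus: "x \<in> carrier A \<Longrightarrow> y \<in> carrier A \<Longrightarrow> star A (x \<ominus> y) = star A x \<ominus> star A y"
  by (simp add: minus_conv_sm star_add star_smult star_closed)

lemma star_one [simp]: "star A \<one> = \<one>"
  by (metis one_closed l_one r_one star_closed star_mult star_star)

lemma projection_norm_le:
  assumes "e \<in> carrier A" "star A e = e" "e \<otimes> e = e" shows "cnorm A e \<le> 1"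
proof -
  have "cnorm A e ^ 2 = cnorm A e" using cstar_identity[of e] assms by simp
  then have "cnorm A e = 0 \<or> cnorm A e = 1" by (simp add: power2_eq_square)
  then show ?thesis by auto
qed

lemma isometry_norm_le:
  assumes "v \<in> carrier A" "star A v \<otimes> v = \<one>" shows "cnorm A v \<le> 1"
proof -
  have "cnorm A v ^ 2 = cnorm A \<one>" using cstar_identity[of v] assms by simp
  also have "\<dots> \<le> 1" by (rule projection_norm_le) auto
  finally show ?thesis using assms cnorm_nonneg power2_le_imp_le[of "cnorm A v" 1] by simp
qed

lemma clim_star: "clim A u x \<Longrightarrow> clim A (\<lambda>n. star A (u n)) (star A x)"
  unfolding clim_def
  by (auto simp: star_minus[symmetric] cnorm_star image_subset_iff star_closed)

lemma clim_mult:
  assumes "clim A u x" "clim A v y" shows "clim A (\<lambda>n. u n \<otimes> v n) (x \<otimes> y)"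
proof (rule climI)
  note d = climD[OF assms(1)] climD[OF assms(2)]
  have "(\<lambda>n. cnorm A (u n) * cnorm A (v n \<ominus> y) + cnorm A (u n \<ominus> x) * cnorm A y)
      \<longlonglongrightarrow> cnorm A x * 0 + 0 * cnorm A y"
    by (intro tendsto_intros clim_nrm assms d)
  then show "(\<lambda>n. cnorm A (u n) * cnorm A (v n \<ominus> y) + cnorm A (u n \<ominus> x) * cnorm A y) \<longlonglongrightarrow> 0"
    by simp
  show "cnorm A (u n \<otimes> v n \<ominus> x \<otimes> y)
      \<le> cnorm A (u n) * cnorm A (v n \<ominus> y) + cnorm A (u n \<ominus> x) * cnorm A y" for n
  proof -
    have "u n \<otimes> v n \<ominus> x \<otimes> y = (u n \<otimes> (v n \<ominus> y)) \<oplus> ((u n \<ominus> x) \<otimes> y)"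
      using d by (simp add: mi_mult_left mi_mult_right mi_trans)
    then have "cnorm A (u n \<otimes> v n \<ominus> x \<otimes> y)
        \<le> cnorm A (u n \<otimes> (v n \<ominus> y)) + cnorm A ((u n \<ominus> x) \<otimes> y)"
      using d by (simp add: nrm_triangle)
    also have "\<dots> \<le> cnorm A (u n) * cnorm A (v n \<ominus> y) + cnorm A (u n \<ominus> x) * cnorm A y"
      using d by (intro add_mono cnorm_mult) auto
    finally show ?thesis .
  qed
qed (use climD[OF assms(1)] climD[OF assms(2)] in auto)

section \<open>Unital C*-subalgebras and the subalgebra generated by a set\<close>

lemma unital_cstar_subalgebraI:
  assumes "B \<subseteq> carrier A" "\<one> \<in> B"
    and "\<And>x y. x \<in> B \<Longrightarrow> y \<in> B \<Longrightarrow> x \<oplus> y \<in> B" "\<And>c x. x \<in> B \<Longrightarrow> c \<odot>\<^bsub>A\<^esub> x \<in> B"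
    and "\<And>x y. x \<in> B \<Longrightarrow> y \<in> B \<Longrightarrow> x \<otimes> y \<in> B" "\<And>x. x \<in> B \<Longrightarrow> star A x \<in> B"
    and "\<And>u x. range u \<subseteq> B \<Longrightarrow> clim A u x \<Longrightarrow> x \<in> B"
  shows "unital_cstar_subalgebra A B"
proof -
  have "\<ominus> x \<in> B" if "x \<in> B" for x
    using assms(4)[OF that, of "-1"] that assms(1) by (auto simp: neg_conv_sm)
  then have "subring B A"
    by (intro subringI) (use assms in auto)
  moreover have "closed_in_norm A B"
    unfolding closed_in_norm_iff using assms(1,7) by auto
  ultimately show ?thesis
    unfolding unital_cstar_subalgebra_def using assms(4,6) by auto
qed

lemma unital_cstar_subalgebraD:
  assumes "unital_cstar_subalgebra A B"
  shows "B \<subseteq> carrier A" "\<one> \<in> B" "\<zero> \<in> B"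
    "\<And>x y. x \<in> B \<Longrightarrow> y \<in> B \<Longrightarrow> x \<oplus> y \<in> B" "\<And>c x. x \<in> B \<Longrightarrow> c \<odot>\<^bsub>A\<^esub> x \<in> B"
    "\<And>x y. x \<in> B \<Longrightarrow> y \<in> B \<Longrightarrow> x \<otimes> y \<in> B" "\<And>x. x \<in> B \<Longrightarrow> star A x \<in> B"
    "\<And>u x. range u \<subseteq> B \<Longrightarrow> clim A u x \<Longrightarrow> x \<in> B"
proof -
  have s: "subring B A" and r: "\<And>c x. x \<in> B \<Longrightarrow> c \<odot>\<^bsub>A\<^esub> x \<in> B" "\<And>x. x \<in> B \<Longrightarrow> star A x \<in> B"
    and c: "closed_in_norm A B"
    using assms by (auto simp: unital_cstar_subalgebra_def)
  show "B \<subseteq> carrier A" "\<one> \<in> B" "\<zero> \<in> B"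
    "\<And>x y. x \<in> B \<Longrightarrow> y \<in> B \<Longrightarrow> x \<oplus> y \<in> B" "\<And>c x. x \<in> B \<Longrightarrow> c \<odot>\<^bsub>A\<^esub> x \<in> B"
    "\<And>x y. x \<in> B \<Longrightarrow> y \<in> B \<Longrightarrow> x \<otimes> y \<in> B" "\<And>x. x \<in> B \<Longrightarrow> star A x \<in> B"
    "\<And>u x. range u \<subseteq> B \<Longrightarrow> clim A u x \<Longrightarrow> x \<in> B"
    using subringE[OF s] r c unfolding closed_in_norm_iff by simp_all
qed

lemma unital_cstar_subalgebra_carrier: "unital_cstar_subalgebra A (carrier A)"
  by (rule unital_cstar_subalgebraI) (auto simp: star_closed clim_def)

lemma unital_cstar_subalgebra_generated:
  assumes "G \<subseteq> carrier A" shows "unital_cstar_subalgebra A (cstar_generated A G)"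
proof (rule unital_cstar_subalgebraI)
  show "cstar_generated A G \<subseteq> carrier A"
    unfolding cstar_generated_def using assms unital_cstar_subalgebra_carrier by blast
next
  fix u x assume u: "range u \<subseteq> cstar_generated A G" "clim A u x"
  show "x \<in> cstar_generated A G"
    unfolding cstar_generated_def
  proof (rule InterI, clarify)
    fix B assume B: "unital_cstar_subalgebra A B" "G \<subseteq> B"
    then have "cstar_generated A G \<subseteq> B" unfolding cstar_generated_def by blast
    then show "x \<in> B" using unital_cstar_subalgebraD(8)[OF B(1) _ u(2)] u(1) by simp
  qed
qed (simp_all add: cstar_generated_def unital_cstar_subalgebraD)

lemma cstar_generated_incl: "G \<subseteq> cstar_generated A G"
  unfolding cstar_generated_def by blast

lemma cstar_generated_minimal:
  "unital_cstar_subalgebra A B \<Longrightarrow> G \<subseteq> B \<Longrightarrow> cstar_generated A G \<subseteq> B"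
  unfolding cstar_generated_def by blast

lemma unital_cstar_algebra_restrict:
  assumes "unital_cstar_subalgebra A H"
  shows "unital_cstar_algebra (A\<lparr>carrier := H\<rparr>)"
proof -
  note D = unital_cstar_subalgebraD[OF assms]
  have c: "cstar_algebra (A\<lparr>carrier := H\<rparr>)"
    by (rule cstar_algebra_restrict)
      (use cstar_algebra_axioms D assms in \<open>auto simp: unital_cstar_subalgebra_def\<close>)
  have "monoid (A\<lparr>carrier := H\<rparr>)"
    by (rule monoidI) (use D in \<open>auto simp: subset_iff m_assoc\<close>)
  with c show ?thesis by (simp add: unital_cstar_algebra_def)
qed

section \<open>Closed two-sided ideals and the ideal generated by a set\<close>

lemma ideal_closedI:
  assumes "J \<subseteq> carrier A" "\<zero> \<in> J" "\<And>x y. x \<in> J \<Longrightarrow> y \<in> J \<Longrightarrow> x \<oplus> y \<in> J"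
    and "\<And>x b. x \<in> J \<Longrightarrow> b \<in> carrier A \<Longrightarrow> x \<otimes> b \<in> J" "\<And>x b. x \<in> J \<Longrightarrow> b \<in> carrier A \<Longrightarrow> b \<otimes> x \<in> J"
  shows "ideal J A"
proof (rule idealI)
  show "subgroup J (add_monoid A)"
  proof (rule add.subgroupI)
    show "\<ominus> x \<in> J" if "x \<in> J" for x
    proof -
      have "(\<ominus> \<one>) \<otimes> x \<in> J" using assms(5)[OF that, of "\<ominus> \<one>"] by simp
      moreover have "x \<in> carrier A" using that assms(1) by auto
      ultimately show ?thesis by (simp add: l_minus)
    qed
  qed (use assms in auto)
qed (use assms ring_axioms in auto)

text \<open>An ideal is a priori only a ring ideal. The unit makes it a subspace, since multiplying
  by a scalar is multiplying by that multiple of \<one>.\<close>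

lemma ideal_smult:
  assumes "ideal J A" "x \<in> J" shows "c \<odot>\<^bsub>A\<^esub> x \<in> J"
proof -
  interpret J: ideal J A by fact
  have "(c \<odot>\<^bsub>A\<^esub> \<one>) \<otimes> x \<in> J" using assms J.I_l_closed by auto
  then show ?thesis using assms J.a_subset by (simp add: smult_mult_left subset_iff)
qed

lemma closed_ideal_generated_ideal:
  assumes "P \<subseteq> carrier A" shows "ideal (closed_ideal_generated A P) A"
proof (rule ideal_closedI)
  have "ideal (carrier A) A" by (rule ideal_closedI) auto
  moreover have "closed_in_norm A (carrier A)" by (auto simp: closed_in_norm_iff clim_def)
  ultimately show "closed_ideal_generated A P \<subseteq> carrier A"
    using assms unfolding closed_ideal_generated_def by blast
  have a: "additive_subgroup I A" if "ideal I A" for I using that by (rule ideal.axioms)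
  show "\<zero> \<in> closed_ideal_generated A P"
    unfolding closed_ideal_generated_def by (auto dest!: a additive_subgroup.zero_closed)
  show "x \<oplus> y \<in> closed_ideal_generated A P"
    if "x \<in> closed_ideal_generated A P" "y \<in> closed_ideal_generated A P" for x y
    using that unfolding closed_ideal_generated_def by (auto intro: additive_subgroup.a_closed[OF a])
qed (simp_all add: closed_ideal_generated_def ideal.I_l_closed ideal.I_r_closed)

lemma closed_ideal_generated_closed:
  assumes "P \<subseteq> carrier A" shows "closed_in_norm A (closed_ideal_generated A P)"
  unfolding closed_in_norm_iff
proof (intro conjI allI impI)
  show "closed_ideal_generated A P \<subseteq> carrier A"
    using additive_subgroup.a_subset ideal.axioms(1) closed_ideal_generated_ideal[OF assms] by blast
next
  fix u x assume u: "range u \<subseteq> closed_ideal_generated A P" "clim A u x"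
  show "x \<in> closed_ideal_generated A P"
    unfolding closed_ideal_generated_def
  proof (rule InterI, clarify)
    fix J assume J: "ideal J A" "closed_in_norm A J" "P \<subseteq> J"
    then have "closed_ideal_generated A P \<subseteq> J" unfolding closed_ideal_generated_def by blast
    then have "range u \<subseteq> J" using u(1) by blast
    then show "x \<in> J" using J(2) u(2) unfolding closed_in_norm_iff by auto
  qed
qed

lemma closed_ideal_generated_incl: "P \<subseteq> closed_ideal_generated A P"
  unfolding closed_ideal_generated_def by blast

lemma closed_ideal_generated_minimal:
  "ideal J A \<Longrightarrow> closed_in_norm A J \<Longrightarrow> P \<subseteq> J \<Longrightarrow> closed_ideal_generated A P \<subseteq> J"
  unfolding closed_ideal_generated_def by blast

text \<open>No approximate unit is involved: the elements whose adjoint lies in the ideal form again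
  a closed ideal, and self-adjoint generators belong to it, so minimality applies.\<close>

lemma closed_ideal_generated_star:
  assumes "P \<subseteq> carrier A" "\<And>p. p \<in> P \<Longrightarrow> star A p = p" "x \<in> closed_ideal_generated A P"
  shows "star A x \<in> closed_ideal_generated A P"
proof -
  define J where "J = closed_ideal_generated A P"
  interpret J: ideal J A unfolding J_def by (rule closed_ideal_generated_ideal[OF assms(1)])
  have cl: "\<And>u x. range u \<subseteq> J \<Longrightarrow> clim A u x \<Longrightarrow> x \<in> J"
    using closed_ideal_generated_closed[OF assms(1)] unfolding J_def closed_in_norm_iff by blast
  define K where "K = {x \<in> carrier A. star A x \<in> J}"
  have "closed_ideal_generated A P \<subseteq> K"
  proof (rule closed_ideal_generated_minimal)
    show "ideal K A"
      by (rule ideal_closedI)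
        (auto simp: K_def star_add star_mult star_closed J.I_l_closed J.I_r_closed)
    show "closed_in_norm A K"
      unfolding closed_in_norm_iff
    proof (intro conjI allI impI)
      fix u x assume "range u \<subseteq> K" "clim A u x"
      then show "x \<in> K" using cl[OF _ clim_star[of u x]] by (auto simp: K_def clim_def)
    qed (auto simp: K_def)
    show "P \<subseteq> K"
      using assms(1,2) closed_ideal_generated_incl[of P] by (auto simp: K_def J_def)
  qed
  then show ?thesis using assms(3) by (auto simp: K_def J_def)
qed

end

section \<open>Subexponential bounds improve to contractivity\<close>

lemma power_le_poly_imp_le_one:
  fixes r c :: real
  assumes "r > 0" "\<And>j. r ^ (2 ^ j) \<le> c * real (2 * (2 ^ j * d) + 1) ^ k"
  shows "r \<le> 1"
proof (rule ccontr)
  assume "\<not> r \<le> 1"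
  \<comment> \<open>The root of order k+1 makes Bernoulli's inequality yield growth of order N^(k+1)
    for r^N, one power of N more than the right-hand side allows.\<close>
  define s where "s = root (Suc k) r - 1"
  have s: "s > 0" using \<open>\<not> r \<le> 1\<close> by (simp add: s_def)
  have rs: "r = (1 + s) ^ Suc k" using assms(1) by (simp add: s_def del: power_Suc)
  have c: "c > 0" using assms(1) assms(2)[of 0]
    by (smt (verit) mult_nonpos_nonneg of_nat_0_le_iff zero_le_power zero_less_power)
  \<comment> \<open>What remains on the right after N^k is cancelled: a bound that every power of 2
    would have to obey.\<close>
  define M where "M = c * real (2 * d + 1) ^ k / s ^ Suc k"
  have "real (2 ^ j) \<le> M" for j
  proof -
    define N :: nat where "N = 2 ^ j"
    have N: "N \<ge> 1" by (simp add: N_def)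
    have "(real N * s) ^ Suc k \<le> ((1 + s) ^ N) ^ Suc k"
      using Bernoulli_inequality[of s N] s by (intro power_mono) auto
    also have "\<dots> = r ^ N" by (simp add: rs power_mult[symmetric] mult.commute del: power_Suc)
    also have "\<dots> \<le> c * real (2 * (N * d) + 1) ^ k" using assms(2)[of j] by (simp add: N_def)
    also have "\<dots> \<le> c * (real N * real (2 * d + 1)) ^ k"
    proof -
      have "2 * (N * d) + 1 \<le> N * (2 * d + 1)" using N by (simp add: algebra_simps)
      then have "real (2 * (N * d) + 1) \<le> real N * real (2 * d + 1)"
        by (metis of_nat_le_iff of_nat_mult)
      then show ?thesis using c by (intro mult_left_mono power_mono) auto
    qed
    finally have "real N ^ k * (real N * s ^ Suc k) \<le> real N ^ k * (c * real (2 * d + 1) ^ k)"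
      by (simp add: power_mult_distrib mult_ac)
    then have "real N * s ^ Suc k \<le> c * real (2 * d + 1) ^ k"
      using N by (simp del: power_Suc)
    then show ?thesis using s by (simp add: M_def N_def pos_le_divide_eq del: power_Suc)
  qed
  moreover obtain j where "M < 2 ^ j" using real_arch_pow[of 2 M] by auto
  ultimately show False by (metis not_le of_nat_numeral of_nat_power)
qed

text \<open>Iterating \<open>z \<mapsto> z\<^sup>* z\<close> squares norms by the C*-identity but only doubles the degree \<open>d\<close>.\<close>
lemma contractive_of_poly_bound:
  assumes C: "cstar_algebra C" and D: "cstar_algebra D"
    and sub: "\<And>d x y. R d x y \<Longrightarrow> x \<in> carrier C \<and> y \<in> carrier D"
    and sq: "\<And>d x y. R d x y \<Longrightarrow> R (2 * d) (star C x \<otimes>\<^bsub>C\<^esub> x) (star D y \<otimes>\<^bsub>D\<^esub> y)"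
    and bd: "\<And>d x y. R d x y \<Longrightarrow> cnorm D y \<le> c * real (2 * d + 1) ^ k * cnorm C x"
    and R: "R d x y"
  shows "cnorm D y \<le> cnorm C x"
proof -
  interpret C: cstar_algebra C by fact
  interpret D: cstar_algebra D by fact
  have it: "\<exists>x' y'. R (2 ^ j * d) x' y' \<and> cnorm C x' = cnorm C x ^ 2 ^ j \<and> cnorm D y' = cnorm D y ^ 2 ^ j" for j
  proof (induction j)
    case (Suc j)
    then obtain x' y' where *: "R (2 ^ j * d) x' y'" "cnorm C x' = cnorm C x ^ 2 ^ j"
      "cnorm D y' = cnorm D y ^ 2 ^ j" by blast
    then show ?case
      using sq[OF *(1)] sub[OF *(1)]
      by (intro exI[of _ "star C x' \<otimes>\<^bsub>C\<^esub> x'"] exI[of _ "star D y' \<otimes>\<^bsub>D\<^esub> y'"])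
        (simp add: C.cstar_identity D.cstar_identity power_mult[symmetric] mult.commute mult.left_commute)
  qed (use R in auto)
  have le: "cnorm D y ^ 2 ^ j \<le> c * real (2 * (2 ^ j * d) + 1) ^ k * cnorm C x ^ 2 ^ j" for j
    using it[of j] bd by metis
  have nn: "cnorm D y \<ge> 0" "cnorm C x \<ge> 0"
    using sub[OF R] by (auto simp: C.cnorm_nonneg D.cnorm_nonneg)
  show ?thesis
  proof (cases "cnorm D y = 0 \<or> cnorm C x = 0")
    case True
    then show ?thesis using le[of 0] nn by auto
  next
    case False
    then have "cnorm D y / cnorm C x \<le> 1"
      using nn le by (intro power_le_poly_imp_le_one[of _ c d k])
        (auto simp: power_divide pos_divide_le_eq)
    then show ?thesis using False nn by (simp add: pos_divide_le_eq)
  qed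
qed

section \<open>The Hilbert space \<open>\<ell>\<^sup>2(I)\<close>\<close>

lemma ell2D: "f \<in> ell2 I \<Longrightarrow> x \<notin> I \<Longrightarrow> f x = 0"
  by (simp add: ell2_def)

lemma ell2_summable: "f \<in> ell2 I \<Longrightarrow> (\<lambda>x. (cmod (f x))\<^sup>2) summable_on I"
  by (simp add: ell2_def)

lemma ell2_norm_nonneg [simp]: "0 \<le> ell2_norm I f"
  by (simp add: ell2_norm_def infsum_nonneg)

lemma ell2_norm_sq: "(ell2_norm I f)\<^sup>2 = (\<Sum>\<^sub>\<infinity>x\<in>I. (cmod (f x))\<^sup>2)"
  by (simp add: ell2_norm_def infsum_nonneg)

lemma ell2_finite_sum_le:
  assumes "f \<in> ell2 I" "finite F" "F \<subseteq> I"
  shows "(\<Sum>x\<in>F. (cmod (f x))\<^sup>2) \<le> (ell2_norm I f)\<^sup>2"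
  unfolding ell2_norm_sq
  by (rule finite_sum_le_infsum) (use assms ell2_summable in auto)

lemma L2_set_le_ell2_norm:
  assumes "f \<in> ell2 I" "finite F" "F \<subseteq> I"
  shows "L2_set (\<lambda>x. cmod (f x)) F \<le> ell2_norm I f"
  unfolding L2_set_def using ell2_finite_sum_le[OF assms] by (simp add: real_le_lsqrt sum_nonneg)

lemma ell2_bounded_finite_sums:
  assumes "\<And>x. x \<notin> I \<Longrightarrow> f x = 0" "b \<ge> 0"
    and le: "\<And>F. finite F \<Longrightarrow> F \<subseteq> I \<Longrightarrow> (\<Sum>x\<in>F. (cmod (f x))\<^sup>2) \<le> b\<^sup>2"
  shows "f \<in> ell2 I" "ell2_norm I f \<le> b"
proof -
  have s: "(\<lambda>x. (cmod (f x))\<^sup>2) summable_on I"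
    by (rule nonneg_bdd_above_summable_on) (use le in \<open>auto intro!: bdd_aboveI2\<close>)
  then show "f \<in> ell2 I" using assms(1) by (auto simp: ell2_def)
  have "(ell2_norm I f)\<^sup>2 \<le> b\<^sup>2"
    unfolding ell2_norm_sq by (rule infsum_le_finite_sums[OF s]) (use le in auto)
  then show "ell2_norm I f \<le> b" using assms(2) power2_le_imp_le by blast
qed

lemma ell2_coord_le: "f \<in> ell2 I \<Longrightarrow> cmod (f x) \<le> ell2_norm I f"
  using L2_set_le_ell2_norm[of f I "{x}"] by (cases "x \<in> I") (auto simp: L2_set_def ell2D)

lemma ell2_zero [simp]: "(\<lambda>x. 0) \<in> ell2 I" and ell2_norm_zero [simp]: "ell2_norm I (\<lambda>x. 0) = 0"
  by (auto simp: ell2_def ell2_norm_def)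

lemma ell2_norm_eq_zero: "f \<in> ell2 I \<Longrightarrow> ell2_norm I f = 0 \<longleftrightarrow> f = (\<lambda>x. 0)"
  using ell2_coord_le[of f I] by fastforce

lemma ell2_add:
  assumes "f \<in> ell2 I" "g \<in> ell2 I"
  shows "(\<lambda>x. f x + g x) \<in> ell2 I" "ell2_norm I (\<lambda>x. f x + g x) \<le> ell2_norm I f + ell2_norm I g"
proof -
  have le: "(\<Sum>x\<in>F. (cmod (f x + g x))\<^sup>2) \<le> (ell2_norm I f + ell2_norm I g)\<^sup>2"
    if F: "finite F" "F \<subseteq> I" for F
  proof -
    have "L2_set (\<lambda>x. cmod (f x + g x)) F \<le> L2_set (\<lambda>x. cmod (f x) + cmod (g x)) F"
      by (rule L2_set_mono) (auto simp: norm_triangle_ineq)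
    also have "\<dots> \<le> L2_set (\<lambda>x. cmod (f x)) F + L2_set (\<lambda>x. cmod (g x)) F"
      by (rule L2_set_triangle_ineq)
    also have "\<dots> \<le> ell2_norm I f + ell2_norm I g"
      using L2_set_le_ell2_norm F assms by (intro add_mono) auto
    finally have "(L2_set (\<lambda>x. cmod (f x + g x)) F)\<^sup>2 \<le> (ell2_norm I f + ell2_norm I g)\<^sup>2"
      by (intro power_mono) auto
    then show ?thesis by (simp add: L2_set_def sum_nonneg)
  qed
  show "(\<lambda>x. f x + g x) \<in> ell2 I" "ell2_norm I (\<lambda>x. f x + g x) \<le> ell2_norm I f + ell2_norm I g"
    by (rule ell2_bounded_finite_sums; use le assms in \<open>auto simp: ell2D\<close>)+
qed

lemma ell2_cmult:
  assumes "f \<in> ell2 I"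
  shows "(\<lambda>x. c * f x) \<in> ell2 I" "ell2_norm I (\<lambda>x. c * f x) = cmod c * ell2_norm I f"
proof -
  have "(\<lambda>x. (cmod c)\<^sup>2 * (cmod (f x))\<^sup>2) summable_on I"
    using ell2_summable[OF assms] by (rule summable_on_cmult_right)
  then show "(\<lambda>x. c * f x) \<in> ell2 I"
    using assms by (auto simp: ell2_def norm_mult power_mult_distrib)
  show "ell2_norm I (\<lambda>x. c * f x) = cmod c * ell2_norm I f"
    unfolding ell2_norm_def
    by (simp add: norm_mult power_mult_distrib infsum_cmult_right' real_sqrt_mult)
qed

lemma ell2_diff:
  assumes "f \<in> ell2 I" "g \<in> ell2 I"
  shows "(\<lambda>x. f x - g x) \<in> ell2 I" "ell2_norm I (\<lambda>x. f x - g x) \<le> ell2_norm I f + ell2_norm I g"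
  using ell2_add[OF assms(1) ell2_cmult(1)[OF assms(2)], of "-1"] ell2_cmult(2)[OF assms(2), of "-1"]
  by simp_all

lemma ell2_sum:
  assumes "finite F" "\<And>i. i \<in> F \<Longrightarrow> f i \<in> ell2 I"
  shows "(\<lambda>x. \<Sum>i\<in>F. f i x) \<in> ell2 I"
  using assms by (induction F rule: finite_induct) (auto simp: ell2_add)

lemma ell2_inner_summable:
  assumes "f \<in> ell2 I" "g \<in> ell2 I"
  shows "(\<lambda>x. f x * cnj (g x)) summable_on I" "cmod (ell2_inner I f g) \<le> ell2_norm I f * ell2_norm I g"
proof -
  have le: "(\<Sum>x\<in>F. cmod (f x * cnj (g x))) \<le> ell2_norm I f * ell2_norm I g"
    if F: "finite F" "F \<subseteq> I" for F
  proof -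
    have "(\<Sum>x\<in>F. cmod (f x * cnj (g x))) \<le> L2_set (\<lambda>x. cmod (f x)) F * L2_set (\<lambda>x. cmod (g x)) F"
      using L2_set_mult_ineq[of "\<lambda>x. cmod (f x)" "\<lambda>x. cmod (g x)" F] by (simp add: norm_mult)
    also have "\<dots> \<le> ell2_norm I f * ell2_norm I g"
      using L2_set_le_ell2_norm F assms by (intro mult_mono) auto
    finally show ?thesis .
  qed
  have s: "(\<lambda>x. cmod (f x * cnj (g x))) summable_on I"
    by (rule nonneg_bdd_above_summable_on) (use le in \<open>auto intro!: bdd_aboveI2\<close>)
  then show "(\<lambda>x. f x * cnj (g x)) summable_on I" by (rule abs_summable_summable)
  have "cmod (ell2_inner I f g) \<le> (\<Sum>\<^sub>\<infinity>x\<in>I. cmod (f x * cnj (g x)))"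
    unfolding ell2_inner_def by (rule norm_infsum_bound[OF s])
  also have "\<dots> \<le> ell2_norm I f * ell2_norm I g"
    by (rule infsum_le_finite_sums[OF s]) (use le in auto)
  finally show "cmod (ell2_inner I f g) \<le> ell2_norm I f * ell2_norm I g" .
qed

lemma ell2_inner_add_left:
  assumes "f \<in> ell2 I" "g \<in> ell2 I" "h \<in> ell2 I"
  shows "ell2_inner I (\<lambda>x. f x + g x) h = ell2_inner I f h + ell2_inner I g h"
  unfolding ell2_inner_def using assms
  by (simp add: ring_distribs infsum_add ell2_inner_summable)

lemma ell2_inner_cmult_left: "ell2_inner I (\<lambda>x. c * f x) h = c * ell2_inner I f h"
  unfolding ell2_inner_def by (simp add: mult.assoc infsum_cmult_right')

lemma ell2_inner_cnj: "ell2_inner I f g = cnj (ell2_inner I g f)"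
  unfolding ell2_inner_def by (simp flip: infsum_cnj add: mult.commute)

lemma ell2_inner_add_right:
  assumes "f \<in> ell2 I" "g \<in> ell2 I" "h \<in> ell2 I"
  shows "ell2_inner I h (\<lambda>x. f x + g x) = ell2_inner I h f + ell2_inner I h g"
  using ell2_inner_add_left[OF assms] by (metis ell2_inner_cnj complex_cnj_add)

lemma ell2_inner_cmult_right: "ell2_inner I h (\<lambda>x. c * f x) = cnj c * ell2_inner I h f"
  by (metis ell2_inner_cnj ell2_inner_cmult_left complex_cnj_mult)

lemma ell2_inner_sum_right:
  assumes "finite F" "\<And>i. i \<in> F \<Longrightarrow> f i \<in> ell2 I" "h \<in> ell2 I"
  shows "ell2_inner I h (\<lambda>x. \<Sum>i\<in>F. f i x) = (\<Sum>i\<in>F. ell2_inner I h (f i))"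
  using assms(1,2)
proof (induction F rule: finite_induct)
  case empty then show ?case by (simp add: ell2_inner_def)
next
  case (insert i F)
  then show ?case using assms(3) by (simp add: ell2_inner_add_right ell2_sum)
qed

lemma ell2_inner_self:
  assumes "f \<in> ell2 I"
  shows "ell2_inner I f f = complex_of_real ((ell2_norm I f)\<^sup>2)"
proof -
  have "ell2_inner I f f = (\<Sum>\<^sub>\<infinity>x\<in>I. complex_of_real ((cmod (f x))\<^sup>2))"
    unfolding ell2_inner_def by (intro infsum_cong) (metis complex_norm_square of_real_power)
  also have "\<dots> = complex_of_real (\<Sum>\<^sub>\<infinity>x\<in>I. (cmod (f x))\<^sup>2)"
    by (rule infsumI) (simp only: has_sum_of_real_iff has_sum_infsum[OF ell2_summable[OF assms]])
  finally show ?thesis by (simp only: ell2_norm_sq)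
qed

lemma cmod_ell2_inner_self: "f \<in> ell2 I \<Longrightarrow> cmod (ell2_inner I f f) = (ell2_norm I f)\<^sup>2"
  by (simp add: ell2_inner_self del: of_real_power)

lemma ell2_inner_chi:
  assumes "a \<in> I" "f \<in> ell2 I"
  shows "ell2_inner I f (chi a) = f a" "ell2_inner I (chi a) f = cnj (f a)"
proof -
  have "ell2_inner I f (chi a) = (\<Sum>\<^sub>\<infinity>x\<in>{a}. f x * cnj (chi a x))"
    unfolding ell2_inner_def by (rule infsum_cong_neutral) (use assms in \<open>auto simp: chi_def\<close>)
  then show "ell2_inner I f (chi a) = f a" by (simp add: chi_def)
  then show "ell2_inner I (chi a) f = cnj (f a)" using ell2_inner_cnj by metis
qed

lemma sum_mult_chi:
  assumes "finite F" shows "(\<Sum>a\<in>F. f a * chi a x) = (if x \<in> F then f x else 0)"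
proof -
  have "(\<Sum>a\<in>F. f a * chi a x) = (\<Sum>a\<in>F. if x = a then f a else 0)"
    by (rule sum.cong) (auto simp: chi_def)
  then show ?thesis using assms by simp
qed

text \<open>The squared norm of the tail outside \<open>F\<close> is the total sum minus the partial
  sum over \<open>F\<close>, which tends to 0 along the finite subsets.\<close>

lemma ell2_truncation:
  assumes "f \<in> ell2 I" "e > 0"
  obtains F where "finite F" "F \<subseteq> I" "ell2_norm I (\<lambda>x. f x - (\<Sum>a\<in>F. f a * chi a x)) < e"
proof -
  have "((\<lambda>F. \<Sum>x\<in>F. (cmod (f x))\<^sup>2) \<longlongrightarrow> (ell2_norm I f)\<^sup>2) (finite_subsets_at_top I)"
    unfolding ell2_norm_sq by (rule infsum_tendsto[OF ell2_summable[OF assms(1)]])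
  then have "\<forall>\<^sub>F F in finite_subsets_at_top I. \<bar>(\<Sum>x\<in>F. (cmod (f x))\<^sup>2) - (ell2_norm I f)\<^sup>2\<bar> < e\<^sup>2"
    using assms(2) by (auto dest!: tendstoD[of _ _ _ "e\<^sup>2"] simp: dist_real_def)
  then obtain F where F: "finite F" "F \<subseteq> I" "\<bar>(\<Sum>x\<in>F. (cmod (f x))\<^sup>2) - (ell2_norm I f)\<^sup>2\<bar> < e\<^sup>2"
    unfolding eventually_finite_subsets_at_top by blast
  define g where "g x = f x - (\<Sum>a\<in>F. f a * chi a x)" for x
  have g: "g x = (if x \<in> F then 0 else f x)" for x
    using F(1) by (auto simp: g_def sum_mult_chi)
  have "(\<Sum>\<^sub>\<infinity>x\<in>I. (cmod (f x))\<^sup>2) = (\<Sum>\<^sub>\<infinity>x\<in>F. (cmod (f x))\<^sup>2) + (\<Sum>\<^sub>\<infinity>x\<in>I-F. (cmod (f x))\<^sup>2)"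
    using infsum_Un_disjoint[of "\<lambda>x. (cmod (f x))\<^sup>2" F "I - F"] F(1,2) ell2_summable[OF assms(1)]
    by (simp add: Un_absorb1 summable_on_subset_banach)
  moreover have "(\<Sum>\<^sub>\<infinity>x\<in>I. (cmod (g x))\<^sup>2) = (\<Sum>\<^sub>\<infinity>x\<in>I-F. (cmod (f x))\<^sup>2)"
    by (rule infsum_cong_neutral) (auto simp: g)
  ultimately have "(ell2_norm I g)\<^sup>2 < e\<^sup>2"
    using F unfolding ell2_norm_sq by auto
  then have "ell2_norm I g < e"
    using assms(2) by (meson less_eq_real_def power2_less_imp_less)
  then show ?thesis using that F g_def by (metis (no_types, lifting) ext)
qed

section \<open>Bounded operators\<close>

lemma bounded_opsD:
  assumes "T \<in> bounded_ops I"
  shows "f \<in> ell2 I \<Longrightarrow> T f \<in> ell2 I"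
    "f \<in> ell2 I \<Longrightarrow> g \<in> ell2 I \<Longrightarrow> T (\<lambda>x. f x + g x) = (\<lambda>x. T f x + T g x)"
    "f \<in> ell2 I \<Longrightarrow> T (\<lambda>x. c * f x) = (\<lambda>x. c * T f x)"
  using assms by (auto simp: bounded_ops_def)

lemma bounded_ops_bound:
  assumes "T \<in> bounded_ops I"
  obtains M where "M \<ge> 0" "\<And>f. f \<in> ell2 I \<Longrightarrow> ell2_norm I (T f) \<le> M * ell2_norm I f"
proof -
  obtain M where M: "\<And>f. f \<in> ell2 I \<Longrightarrow> ell2_norm I (T f) \<le> M * ell2_norm I f"
    using assms by (auto simp: bounded_ops_def) blast
  have "ell2_norm I (T f) \<le> max 0 M * ell2_norm I f" if "f \<in> ell2 I" for f
    using M[OF that] mult_right_mono[of M "max 0 M" "ell2_norm I f"] by simp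
  then show ?thesis using that by (metis max.cobounded1)
qed

lemma bounded_opsI:
  assumes "\<And>f. f \<in> ell2 I \<Longrightarrow> t f \<in> ell2 I"
    "\<And>f g. f \<in> ell2 I \<Longrightarrow> g \<in> ell2 I \<Longrightarrow> t (\<lambda>x. f x + g x) = (\<lambda>x. t f x + t g x)"
    "\<And>c f. f \<in> ell2 I \<Longrightarrow> t (\<lambda>x. c * f x) = (\<lambda>x. c * t f x)"
    "\<And>f. f \<in> ell2 I \<Longrightarrow> ell2_norm I (t f) \<le> M * ell2_norm I f"
  shows "(\<lambda>f\<in>ell2 I. t f) \<in> bounded_ops I"
proof -
  have "\<exists>M. \<forall>f\<in>ell2 I. ell2_norm I ((\<lambda>f\<in>ell2 I. t f) f) \<le> M * ell2_norm I f"
    using assms(4) by (intro exI[of _ M]) simp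
  then show ?thesis
    unfolding bounded_ops_def using assms(1-3) by (auto simp: ell2_add ell2_cmult)
qed

lemma bounded_ops_eqI:
  assumes "T \<in> bounded_ops I" "U \<in> bounded_ops I" "\<And>f. f \<in> ell2 I \<Longrightarrow> T f = U f"
  shows "T = U"
proof (rule PiE_ext)
  show "T \<in> ell2 I \<rightarrow>\<^sub>E ell2 I" "U \<in> ell2 I \<rightarrow>\<^sub>E ell2 I"
    using assms(1,2) by (simp_all add: bounded_ops_def)
qed (rule assms(3))

lemma bounded_ops_sum:
  assumes "T \<in> bounded_ops I" "finite F" "\<And>i. i \<in> F \<Longrightarrow> f i \<in> ell2 I"
  shows "T (\<lambda>x. \<Sum>i\<in>F. c i * f i x) = (\<lambda>x. \<Sum>i\<in>F. c i * T (f i) x)"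
  using assms(2,3)
proof (induction F rule: finite_induct)
  case empty
  then show ?case using bounded_opsD(3)[OF assms(1), of "\<lambda>x. 0" 0] by simp
next
  case (insert i F)
  then have "(\<lambda>x. c i * f i x) \<in> ell2 I" by (auto intro: ell2_cmult)
  moreover have "(\<lambda>x. \<Sum>i\<in>F. c i * f i x) \<in> ell2 I"
    using insert by (intro ell2_sum) (auto intro: ell2_cmult)
  ultimately show ?case
    using insert bounded_opsD(2,3)[OF assms(1)] by simp
qed

lemma op_algebra_simps [simp]:
  "carrier (op_algebra I) = bounded_ops I"
  "f \<in> ell2 I \<Longrightarrow> (T \<otimes>\<^bsub>op_algebra I\<^esub> U) f = T (U f)"
  "f \<in> ell2 I \<Longrightarrow> \<one>\<^bsub>op_algebra I\<^esub> f = f"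
  "f \<in> ell2 I \<Longrightarrow> \<zero>\<^bsub>op_algebra I\<^esub> f = (\<lambda>x. 0)"
  "f \<in> ell2 I \<Longrightarrow> (T \<oplus>\<^bsub>op_algebra I\<^esub> U) f = (\<lambda>x. T f x + U f x)"
  "f \<in> ell2 I \<Longrightarrow> (c \<odot>\<^bsub>op_algebra I\<^esub> T) f = (\<lambda>x. c * T f x)"
  by (simp_all add: op_algebra_def)

lemma op_norm_def: "cnorm (op_algebra I) T = (SUP f\<in>{f \<in> ell2 I. ell2_norm I f \<le> 1}. ell2_norm I (T f))"
  by (simp add: op_algebra_def)

lemma op_star_def: "star (op_algebra I) T = (THE U. U \<in> bounded_ops I \<and>
    (\<forall>f\<in>ell2 I. \<forall>g\<in>ell2 I. ell2_inner I (T f) g = ell2_inner I f (U g)))"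
  by (simp add: op_algebra_def)

lemma op_norm_bdd:
  assumes "T \<in> bounded_ops I"
  shows "bdd_above ((\<lambda>f. ell2_norm I (T f)) ` {f \<in> ell2 I. ell2_norm I f \<le> 1})"
proof -
  obtain M where M: "M \<ge> 0" "\<And>f. f \<in> ell2 I \<Longrightarrow> ell2_norm I (T f) \<le> M * ell2_norm I f"
    using bounded_ops_bound[OF assms] by blast
  then have "ell2_norm I (T f) \<le> M" if "f \<in> ell2 I" "ell2_norm I f \<le> 1" for f
    using M(2)[OF that(1)] mult_left_mono[OF that(2) M(1)] by simp
  then show ?thesis by (auto intro!: bdd_aboveI2)
qed

lemma op_norm_nonneg: "T \<in> bounded_ops I \<Longrightarrow> 0 \<le> cnorm (op_algebra I) T"
  unfolding op_norm_def
  by (rule cSUP_upper2[OF op_norm_bdd, of _ _ "\<lambda>x. 0"]) auto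

lemma op_norm_bound:
  assumes T: "T \<in> bounded_ops I" and f: "f \<in> ell2 I"
  shows "ell2_norm I (T f) \<le> cnorm (op_algebra I) T * ell2_norm I f"
proof (cases "ell2_norm I f = 0")
  case True
  then show ?thesis
    using bounded_ops_bound[OF T] f by (metis mult_zero_right order_refl)
next
  case False
  define r where "r = ell2_norm I f"
  have r: "r > 0" using False by (simp add: r_def less_le)
  define g where "g = (\<lambda>x. complex_of_real (1 / r) * f x)"
  have g: "g \<in> ell2 I" "ell2_norm I g = 1"
    unfolding g_def using ell2_cmult[OF f, of "complex_of_real (1 / r)"] r
    by (auto simp: r_def norm_divide)
  have "ell2_norm I (T g) \<le> cnorm (op_algebra I) T"
    unfolding op_norm_def by (rule cSUP_upper2[OF op_norm_bdd[OF T]]) (use g in auto)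
  moreover have "ell2_norm I (T g) = ell2_norm I (T f) / r"
    unfolding g_def bounded_opsD(3)[OF T f] ell2_cmult(2)[OF bounded_opsD(1)[OF T f]] using r
    by (simp add: norm_divide)
  ultimately show ?thesis using r by (simp add: r_def pos_divide_le_eq)
qed

lemma op_norm_le:
  assumes "M \<ge> 0" "\<And>f. f \<in> ell2 I \<Longrightarrow> ell2_norm I (T f) \<le> M * ell2_norm I f"
  shows "cnorm (op_algebra I) T \<le> M"
  unfolding op_norm_def
proof (rule cSUP_least)
  have "(\<lambda>x. 0) \<in> {f \<in> ell2 I. ell2_norm I f \<le> 1}" by simp
  then show "{f \<in> ell2 I. ell2_norm I f \<le> 1} \<noteq> {}" by blast
  fix f assume "f \<in> {f \<in> ell2 I. ell2_norm I f \<le> 1}"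
  then show "ell2_norm I (T f) \<le> M"
    using assms(2)[of f] mult_left_mono[of "ell2_norm I f" 1 M] assms(1) by simp
qed

lemma op_coord_le:
  assumes "T \<in> bounded_ops I" "f \<in> ell2 I"
  shows "cmod (T f x) \<le> cnorm (op_algebra I) T * ell2_norm I f"
  using ell2_coord_le[OF bounded_opsD(1)[OF assms]] op_norm_bound[OF assms] by (rule order_trans)

lemma op_one_closed: "\<one>\<^bsub>op_algebra I\<^esub> \<in> bounded_ops I"
proof -
  have "(\<lambda>f\<in>ell2 I. f) \<in> bounded_ops I"
    by (rule bounded_opsI[where M = 1]) auto
  then show ?thesis by (simp add: op_algebra_def)
qed

lemma op_zero_closed: "\<zero>\<^bsub>op_algebra I\<^esub> \<in> bounded_ops I"
proof -
  have "(\<lambda>f\<in>ell2 I. (\<lambda>x. 0)) \<in> bounded_ops I"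
    by (rule bounded_opsI[where M = 0]) auto
  then show ?thesis by (simp add: op_algebra_def)
qed

lemma op_smult_closed:
  assumes T: "T \<in> bounded_ops I"
  shows "c \<odot>\<^bsub>op_algebra I\<^esub> T \<in> bounded_ops I"
proof -
  note DT = bounded_opsD[OF T]
  obtain M where M: "M \<ge> 0" "\<And>f. f \<in> ell2 I \<Longrightarrow> ell2_norm I (T f) \<le> M * ell2_norm I f"
    using bounded_ops_bound[OF T] by blast
  have "(\<lambda>f\<in>ell2 I. (\<lambda>x. c * T f x)) \<in> bounded_ops I"
  proof (rule bounded_opsI)
    fix f assume f: "f \<in> ell2 I"
    show "ell2_norm I (\<lambda>x. c * T f x) \<le> (cmod c * M) * ell2_norm I f"
      using M(2)[OF f] by (simp add: ell2_cmult(2)[OF DT(1)[OF f]] mult_left_mono mult.assoc)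
  qed (auto simp: DT ell2_cmult algebra_simps)
  then show ?thesis by (simp add: op_algebra_def)
qed

lemma op_mult_add_closed:
  assumes T: "T \<in> bounded_ops I" and U: "U \<in> bounded_ops I"
  shows "T \<otimes>\<^bsub>op_algebra I\<^esub> U \<in> bounded_ops I" "T \<oplus>\<^bsub>op_algebra I\<^esub> U \<in> bounded_ops I"
proof -
  note DT = bounded_opsD[OF T] and DU = bounded_opsD[OF U]
  obtain M where M: "M \<ge> 0" "\<And>f. f \<in> ell2 I \<Longrightarrow> ell2_norm I (T f) \<le> M * ell2_norm I f"
    using bounded_ops_bound[OF T] by blast
  obtain N where N: "N \<ge> 0" "\<And>f. f \<in> ell2 I \<Longrightarrow> ell2_norm I (U f) \<le> N * ell2_norm I f"
    using bounded_ops_bound[OF U] by blast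
  have "(\<lambda>f\<in>ell2 I. T (U f)) \<in> bounded_ops I"
  proof (rule bounded_opsI)
    fix f assume f: "f \<in> ell2 I"
    show "ell2_norm I (T (U f)) \<le> (M * N) * ell2_norm I f"
      using M(2)[OF DU(1)[OF f]] mult_left_mono[OF N(2)[OF f] M(1)] by (simp add: mult.assoc)
  qed (auto simp: DT DU)
  then show "T \<otimes>\<^bsub>op_algebra I\<^esub> U \<in> bounded_ops I" by (simp add: op_algebra_def)
  have "(\<lambda>f\<in>ell2 I. (\<lambda>x. T f x + U f x)) \<in> bounded_ops I"
  proof (rule bounded_opsI)
    fix f assume f: "f \<in> ell2 I"
    show "ell2_norm I (\<lambda>x. T f x + U f x) \<le> (M + N) * ell2_norm I f"
      using ell2_add(2)[OF DT(1)[OF f] DU(1)[OF f]] M(2)[OF f] N(2)[OF f]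
      by (simp add: algebra_simps)
  qed (auto simp: DT DU ell2_add algebra_simps)
  then show "T \<oplus>\<^bsub>op_algebra I\<^esub> U \<in> bounded_ops I" by (simp add: op_algebra_def)
qed

lemmas op_closed = op_mult_add_closed op_smult_closed op_one_closed op_zero_closed

lemma op_norm_triangle:
  assumes T: "T \<in> bounded_ops I" and U: "U \<in> bounded_ops I"
  shows "cnorm (op_algebra I) (T \<oplus>\<^bsub>op_algebra I\<^esub> U) \<le> cnorm (op_algebra I) T + cnorm (op_algebra I) U"
proof (rule op_norm_le)
  fix f assume f: "f \<in> ell2 I"
  show "ell2_norm I ((T \<oplus>\<^bsub>op_algebra I\<^esub> U) f)
      \<le> (cnorm (op_algebra I) T + cnorm (op_algebra I) U) * ell2_norm I f"
    using ell2_add(2)[OF bounded_opsD(1)[OF T f] bounded_opsD(1)[OF U f]]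
      op_norm_bound[OF T f] op_norm_bound[OF U f] f by (simp add: distrib_right)
qed (simp add: op_norm_nonneg T U)

lemma op_norm_smult:
  assumes T: "T \<in> bounded_ops I"
  shows "cnorm (op_algebra I) (c \<odot>\<^bsub>op_algebra I\<^esub> T) = cmod c * cnorm (op_algebra I) T"
proof (rule antisym)
  have le: "cnorm (op_algebra I) (c \<odot>\<^bsub>op_algebra I\<^esub> T) \<le> cmod c * cnorm (op_algebra I) T"
    if T: "T \<in> bounded_ops I" for c T
  proof (rule op_norm_le)
    fix f assume f: "f \<in> ell2 I"
    show "ell2_norm I ((c \<odot>\<^bsub>op_algebra I\<^esub> T) f) \<le> cmod c * cnorm (op_algebra I) T * ell2_norm I f"
      using op_norm_bound[OF T f] f
      by (simp add: ell2_cmult(2)[OF bounded_opsD(1)[OF T f]] mult_left_mono mult.assoc)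
  qed (simp add: op_norm_nonneg T)
  show "cnorm (op_algebra I) (c \<odot>\<^bsub>op_algebra I\<^esub> T) \<le> cmod c * cnorm (op_algebra I) T"
    by (rule le[OF T])
  show "cmod c * cnorm (op_algebra I) T \<le> cnorm (op_algebra I) (c \<odot>\<^bsub>op_algebra I\<^esub> T)"
  proof (cases "c = 0")
    case False
    have "inverse c \<odot>\<^bsub>op_algebra I\<^esub> (c \<odot>\<^bsub>op_algebra I\<^esub> T) = T"
      by (rule bounded_ops_eqI) (use T False in \<open>auto intro!: op_closed simp: mult.assoc[symmetric]\<close>)
    then have "cnorm (op_algebra I) T \<le> cmod (inverse c) * cnorm (op_algebra I) (c \<odot>\<^bsub>op_algebra I\<^esub> T)"
      using le[OF op_smult_closed[OF T], of "inverse c" c] by simp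
    then show ?thesis using False by (simp add: norm_inverse norm_divide field_simps)
  qed (simp add: op_norm_nonneg op_closed T)
qed

lemma normed_module_op_algebra: "normed_module (op_algebra I)"
proof -
  have g: "abelian_group (op_algebra I)"
  proof (rule abelian_groupI)
    fix T assume T: "T \<in> carrier (op_algebra I)"
    have "(-1) \<odot>\<^bsub>op_algebra I\<^esub> T \<oplus>\<^bsub>op_algebra I\<^esub> T = \<zero>\<^bsub>op_algebra I\<^esub>"
      by (rule bounded_ops_eqI[of _ I]) (use T in \<open>auto intro!: op_closed\<close>)
    then show "\<exists>U\<in>carrier (op_algebra I). U \<oplus>\<^bsub>op_algebra I\<^esub> T = \<zero>\<^bsub>op_algebra I\<^esub>"
      using T op_closed by (metis op_algebra_simps(1))
  next
    fix T U V assume "T \<in> carrier (op_algebra I)" "U \<in> carrier (op_algebra I)" "V \<in> carrier (op_algebra I)"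
    then show "T \<oplus>\<^bsub>op_algebra I\<^esub> U \<oplus>\<^bsub>op_algebra I\<^esub> V = T \<oplus>\<^bsub>op_algebra I\<^esub> (U \<oplus>\<^bsub>op_algebra I\<^esub> V)"
      by (intro bounded_ops_eqI[of _ I]) (auto simp: op_closed add.assoc)
  next
    fix T U assume "T \<in> carrier (op_algebra I)" "U \<in> carrier (op_algebra I)"
    then show "T \<oplus>\<^bsub>op_algebra I\<^esub> U = U \<oplus>\<^bsub>op_algebra I\<^esub> T"
      by (intro bounded_ops_eqI[of _ I]) (auto simp: op_closed add.commute)
  next
    fix T assume "T \<in> carrier (op_algebra I)"
    then show "\<zero>\<^bsub>op_algebra I\<^esub> \<oplus>\<^bsub>op_algebra I\<^esub> T = T"
      by (intro bounded_ops_eqI[of _ I]) (auto simp: op_closed)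
  next
    show "\<zero>\<^bsub>op_algebra I\<^esub> \<in> carrier (op_algebra I)"
      by (simp add: op_zero_closed)
  qed (auto simp: op_closed)
  have m: "Module.module (ring_of_type_algebra :: complex ring) (op_algebra I)"
    by (rule moduleI)
      (use g in \<open>auto intro!: op_closed bounded_ops_eqI[of _ I] simp: ring_distribs mult.assoc\<close>)
  have z: "T = \<zero>\<^bsub>op_algebra I\<^esub>" if "T \<in> bounded_ops I" "cnorm (op_algebra I) T = 0" for T
  proof (rule bounded_ops_eqI[OF that(1)])
    fix f assume f: "f \<in> ell2 I"
    then have "ell2_norm I (T f) \<le> 0" using op_norm_bound[OF that(1) f] that(2) by simp
    then have "T f = (\<lambda>x. 0)"
      using ell2_norm_eq_zero[OF bounded_opsD(1)[OF that(1) f]] ell2_norm_nonneg[of I "T f"] by linarith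
    then show "T f = \<zero>\<^bsub>op_algebra I\<^esub> f" using f by simp
  qed (rule op_zero_closed)
  have "cnorm (op_algebra I) \<zero>\<^bsub>op_algebra I\<^esub> \<le> 0"
    by (rule op_norm_le) auto
  moreover have "\<zero>\<^bsub>op_algebra I\<^esub> \<in> bounded_ops I"
    using abelian_group.a_inv_closed g abelian_monoid.zero_closed[OF abelian_group.axioms(1)[OF g]] by simp
  ultimately have z': "cnorm (op_algebra I) \<zero>\<^bsub>op_algebra I\<^esub> = 0"
    using op_norm_nonneg by fastforce
  show ?thesis
    unfolding normed_module_def normed_module_axioms_def
    using m z z' by (simp add: op_norm_nonneg op_norm_triangle op_norm_smult) metis
qed

lemma op_minus_apply:
  assumes "T \<in> bounded_ops I" "U \<in> bounded_ops I" "f \<in> ell2 I"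
  shows "(T \<ominus>\<^bsub>op_algebra I\<^esub> U) f = (\<lambda>x. T f x - U f x)"
proof -
  interpret normed_module "op_algebra I" by (rule normed_module_op_algebra)
  show ?thesis using assms by (simp add: minus_conv_sm)
qed

text \<open>The adjoint has the coordinates \<open>\<langle>g, T \<chi>\<^sub>x\<rangle>\<close>.\<close>
lemma adjoint_exists:
  assumes T: "T \<in> bounded_ops I"
  obtains U where "U \<in> bounded_ops I"
    "\<And>f g. f \<in> ell2 I \<Longrightarrow> g \<in> ell2 I \<Longrightarrow> ell2_inner I (T f) g = ell2_inner I f (U g)"
proof -
  note D = bounded_opsD[OF T]
  obtain M where M: "M \<ge> 0" "\<And>f. f \<in> ell2 I \<Longrightarrow> ell2_norm I (T f) \<le> M * ell2_norm I f"
    using bounded_ops_bound[OF T] by blast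
  define v where "v g x = (if x \<in> I then ell2_inner I g (T (chi x)) else 0)" for g x
  have Tc: "T (chi x) \<in> ell2 I" if "x \<in> I" for x using D(1) chi_in_ell2 that by metis
  have fin: "(\<lambda>x. \<Sum>a\<in>F. h a * chi a x) \<in> ell2 I"
    "T (\<lambda>x. \<Sum>a\<in>F. h a * chi a x) = (\<lambda>x. \<Sum>a\<in>F. h a * T (chi a) x)"
    "g \<in> ell2 I \<Longrightarrow> ell2_inner I g (T (\<lambda>x. \<Sum>a\<in>F. h a * chi a x)) = (\<Sum>a\<in>F. cnj (h a) * v g a)"
    if F: "finite F" "F \<subseteq> I" for F h g
  proof -
    have c: "chi a \<in> ell2 I" if "a \<in> F" for a using F that by (intro chi_in_ell2) auto
    show "(\<lambda>x. \<Sum>a\<in>F. h a * chi a x) \<in> ell2 I"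
      using F c by (intro ell2_sum) (auto intro: ell2_cmult)
    show t: "T (\<lambda>x. \<Sum>a\<in>F. h a * chi a x) = (\<lambda>x. \<Sum>a\<in>F. h a * T (chi a) x)"
      by (rule bounded_ops_sum[OF T F(1)]) (use c in auto)
    assume g: "g \<in> ell2 I"
    have "ell2_inner I g (\<lambda>x. \<Sum>a\<in>F. h a * T (chi a) x) = (\<Sum>a\<in>F. ell2_inner I g (\<lambda>x. h a * T (chi a) x))"
      using F g by (intro ell2_inner_sum_right) (auto intro!: ell2_cmult Tc)
    also have "\<dots> = (\<Sum>a\<in>F. cnj (h a) * v g a)"
      using F by (intro sum.cong) (auto simp: ell2_inner_cmult_right v_def)
    finally show "ell2_inner I g (T (\<lambda>x. \<Sum>a\<in>F. h a * chi a x)) = (\<Sum>a\<in>F. cnj (h a) * v g a)"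
      by (simp add: t)
  qed
  have v_le: "(\<Sum>x\<in>F. (cmod (v g x))\<^sup>2) \<le> (M * ell2_norm I g)\<^sup>2"
    if g: "g \<in> ell2 I" and F: "finite F" "F \<subseteq> I" for g F
  proof -
    define s where "s = L2_set (\<lambda>x. cmod (v g x)) F"
    have s: "s \<ge> 0" "s\<^sup>2 = (\<Sum>x\<in>F. (cmod (v g x))\<^sup>2)"
      by (auto simp: s_def L2_set_def sum_nonneg)
    \<comment> \<open>The test vector that is extremal for Cauchy-Schwarz: pairing \<open>g\<close>
      with \<open>T h\<close> gives s\<cdot>s, while \<open>h\<close> itself has norm
      \<open>s\<close>. Cancelling one factor \<open>s\<close> leaves the desired bound.\<close>
    define h where "h = (\<lambda>x. \<Sum>a\<in>F. v g a * chi a x)"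
    have h: "h \<in> ell2 I" unfolding h_def by (rule fin(1)[OF F])
    have hx: "h x = (if x \<in> F then v g x else 0)" for x
      using F(1) by (simp add: h_def sum_mult_chi)
    have "(ell2_norm I h)\<^sup>2 = (\<Sum>\<^sub>\<infinity>x\<in>F. (cmod (v g x))\<^sup>2)"
      unfolding ell2_norm_sq by (rule infsum_cong_neutral) (use F in \<open>auto simp: hx\<close>)
    then have nh: "ell2_norm I h = s"
      using F(1) s by (metis infsum_finite power2_eq_iff_nonneg ell2_norm_nonneg)
    have "s\<^sup>2 = cmod (ell2_inner I g (T h))"
      unfolding h_def fin(3)[OF F g] s(2)
      by (simp add: complex_norm_square[symmetric] mult.commute sum_nonneg flip: of_real_sum of_real_power)
    also have "\<dots> \<le> ell2_norm I g * ell2_norm I (T h)"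
      by (rule ell2_inner_summable(2)[OF g D(1)[OF h]])
    also have "\<dots> \<le> ell2_norm I g * (M * s)"
      using M(2)[OF h] nh by (intro mult_left_mono) auto
    finally have "s * s \<le> (M * ell2_norm I g) * s" by (simp add: power2_eq_square mult_ac)
    then have "s \<le> M * ell2_norm I g"
      using s(1) M(1) by (cases "s = 0") auto
    then show ?thesis using s power_mono by metis
  qed
  have v: "v g \<in> ell2 I" "ell2_norm I (v g) \<le> M * ell2_norm I g" if "g \<in> ell2 I" for g
    by (rule ell2_bounded_finite_sums[where b = "M * ell2_norm I g"]; use v_le that M in \<open>auto simp: v_def\<close>)+
  have v_lin: "v (\<lambda>x. f x + g x) = (\<lambda>x. v f x + v g x)" "v (\<lambda>x. c * f x) = (\<lambda>x. c * v f x)"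
    if "f \<in> ell2 I" "g \<in> ell2 I" for f g c
    using that by (auto simp: v_def ell2_inner_add_left ell2_inner_cmult_left Tc)
  define U where "U = (\<lambda>g\<in>ell2 I. v g)"
  show ?thesis
  proof (rule that)
    show "U \<in> bounded_ops I"
      unfolding U_def
      by (rule bounded_opsI[where M = M])
        (use v in \<open>auto simp: v_lin\<close>)
    fix f g assume f: "f \<in> ell2 I" and g: "g \<in> ell2 I"
    \<comment> \<open>For a truncation error \<open>d\<close> of \<open>f\<close>, the two sides
      differ by at most the norm of \<open>d\<close> times the first two summands. The summand 1
      only makes \<open>K\<close> positive, so that e / K is a legitimate precision.\<close>
    define K where "K = M * ell2_norm I g + ell2_norm I (v g) + 1"
    have K: "K > 0" using M(1) by (simp add: K_def add_nonneg_pos)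
    have "cmod (ell2_inner I (T f) g - ell2_inner I f (v g)) \<le> e" if "e > 0" for e
    proof -
      obtain F where F: "finite F" "F \<subseteq> I" "ell2_norm I (\<lambda>x. f x - (\<Sum>a\<in>F. f a * chi a x)) < e / K"
        using ell2_truncation[OF f, of "e / K"] \<open>e > 0\<close> K by auto
      define h where "h = (\<lambda>x. \<Sum>a\<in>F. f a * chi a x)"
      have h: "h \<in> ell2 I" unfolding h_def by (rule fin(1)[OF F(1,2)])
      define d where "d = (\<lambda>x. f x - h x)"
      have d: "d \<in> ell2 I" unfolding d_def by (rule ell2_diff[OF f h])
      have f_eq: "f = (\<lambda>x. d x + h x)" by (auto simp: d_def)
      have "ell2_inner I (T h) g = cnj (\<Sum>a\<in>F. cnj (f a) * v g a)"
        unfolding h_def using fin(3)[OF F(1,2) g] ell2_inner_cnj by metis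
      also have "\<dots> = cnj (\<Sum>a\<in>F. ell2_inner I (v g) (\<lambda>x. f a * chi a x))"
        using F(2) by (intro arg_cong[where f = cnj] sum.cong)
          (auto simp: ell2_inner_cmult_right ell2_inner_chi v(1)[OF g] subset_iff)
      also have "\<dots> = cnj (ell2_inner I (v g) h)"
        unfolding h_def using F v(1)[OF g]
        by (subst ell2_inner_sum_right) (auto intro!: ell2_cmult chi_in_ell2)
      also have "\<dots> = ell2_inner I h (v g)" by (rule ell2_inner_cnj[symmetric])
      finally have h_eq: "ell2_inner I (T h) g = ell2_inner I h (v g)" .
      have "ell2_inner I (T f) g - ell2_inner I f (v g) = ell2_inner I (T d) g - ell2_inner I d (v g)"
        unfolding f_eq D(2)[OF d h]
        using h_eq by (simp add: ell2_inner_add_left D(1) d h g v)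
      also have "cmod \<dots> \<le> ell2_norm I (T d) * ell2_norm I g + ell2_norm I d * ell2_norm I (v g)"
        using ell2_inner_summable(2)[OF D(1)[OF d] g] ell2_inner_summable(2)[OF d v(1)[OF g]]
        by (intro order_trans[OF norm_triangle_ineq4]) simp
      also have "\<dots> \<le> ell2_norm I d * K"
        using mult_right_mono[OF M(2)[OF d] ell2_norm_nonneg[of I g]] ell2_norm_nonneg[of I d]
        by (simp add: K_def algebra_simps del: ell2_norm_nonneg)
      also have "\<dots> \<le> e"
        using F(3) K by (simp add: d_def h_def pos_less_divide_eq less_imp_le)
      finally show ?thesis .
    qed
    then have "cmod (ell2_inner I (T f) g - ell2_inner I f (v g)) \<le> 0"
      by (rule field_le_epsilon[of _ 0, simplified])
    then show "ell2_inner I (T f) g = ell2_inner I f (U g)"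
      using g by (simp add: U_def)
  qed
qed

lemma adjoint_unique:
  assumes "U \<in> bounded_ops I" "V \<in> bounded_ops I"
    "\<And>f g. f \<in> ell2 I \<Longrightarrow> g \<in> ell2 I \<Longrightarrow> ell2_inner I f (U g) = ell2_inner I f (V g)"
  shows "U = V"
proof (rule bounded_ops_eqI[OF assms(1,2)])
  fix g assume g: "g \<in> ell2 I"
  show "U g = V g"
  proof
    fix x
    show "U g x = V g x"
    proof (cases "x \<in> I")
      case True
      have "cnj (U g x) = cnj (V g x)"
        using assms(3)[OF chi_in_ell2[OF True] g]
        by (simp add: ell2_inner_chi[OF True] bounded_opsD(1)[OF assms(1) g] bounded_opsD(1)[OF assms(2) g])
      then show ?thesis by simp
    qed (use ell2D bounded_opsD(1) assms g in metis)
  qed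
qed

lemma op_star_eqI:
  assumes "U \<in> bounded_ops I"
    "\<And>f g. f \<in> ell2 I \<Longrightarrow> g \<in> ell2 I \<Longrightarrow> ell2_inner I (T f) g = ell2_inner I f (U g)"
  shows "star (op_algebra I) T = U"
  unfolding op_star_def
  by (rule the_equality) (use assms adjoint_unique in metis)+

lemma op_star:
  assumes "T \<in> bounded_ops I"
  shows "star (op_algebra I) T \<in> bounded_ops I"
    "\<And>f g. f \<in> ell2 I \<Longrightarrow> g \<in> ell2 I \<Longrightarrow> ell2_inner I (T f) g = ell2_inner I f (star (op_algebra I) T g)"
proof -
  obtain U where "U \<in> bounded_ops I"
    "\<And>f g. f \<in> ell2 I \<Longrightarrow> g \<in> ell2 I \<Longrightarrow> ell2_inner I (T f) g = ell2_inner I f (U g)"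
    using adjoint_exists[OF assms] by blast
  moreover from this have "star (op_algebra I) T = U" by (rule op_star_eqI)
  ultimately show "star (op_algebra I) T \<in> bounded_ops I"
    "\<And>f g. f \<in> ell2 I \<Longrightarrow> g \<in> ell2 I \<Longrightarrow> ell2_inner I (T f) g = ell2_inner I f (star (op_algebra I) T g)"
    by auto
qed

lemma op_star':
  assumes "T \<in> bounded_ops I" "f \<in> ell2 I" "g \<in> ell2 I"
  shows "ell2_inner I (star (op_algebra I) T f) g = ell2_inner I f (T g)"
  using op_star(2)[OF assms(1,3,2)] by (metis ell2_inner_cnj)

lemma op_norm_star_le:
  assumes T: "T \<in> bounded_ops I"
  shows "cnorm (op_algebra I) (star (op_algebra I) T) \<le> cnorm (op_algebra I) T"
proof (rule op_norm_le[OF op_norm_nonneg[OF T]])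
  fix g assume g: "g \<in> ell2 I"
  let ?s = "star (op_algebra I) T g"
  have s: "?s \<in> ell2 I" using bounded_opsD(1)[OF op_star(1)[OF T] g] .
  have "(ell2_norm I ?s)\<^sup>2 = cmod (ell2_inner I g (T ?s))"
    using op_star'[OF T g s] cmod_ell2_inner_self[OF s] by simp
  also have "\<dots> \<le> ell2_norm I g * (cnorm (op_algebra I) T * ell2_norm I ?s)"
    using ell2_inner_summable(2)[OF g bounded_opsD(1)[OF T s]] op_norm_bound[OF T s]
    by (meson ell2_norm_nonneg mult_left_mono order_trans)
  finally have "ell2_norm I ?s * ell2_norm I ?s \<le> (cnorm (op_algebra I) T * ell2_norm I g) * ell2_norm I ?s"
    by (simp add: power2_eq_square mult_ac)
  then show "ell2_norm I ?s \<le> cnorm (op_algebra I) T * ell2_norm I g"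
    using op_norm_nonneg[OF T] by (cases "ell2_norm I ?s = 0") (auto simp: less_le)
qed

lemma op_norm_mult:
  assumes T: "T \<in> bounded_ops I" and U: "U \<in> bounded_ops I"
  shows "cnorm (op_algebra I) (T \<otimes>\<^bsub>op_algebra I\<^esub> U) \<le> cnorm (op_algebra I) T * cnorm (op_algebra I) U"
proof (rule op_norm_le)
  fix f assume f: "f \<in> ell2 I"
  show "ell2_norm I ((T \<otimes>\<^bsub>op_algebra I\<^esub> U) f)
      \<le> cnorm (op_algebra I) T * cnorm (op_algebra I) U * ell2_norm I f"
    using op_norm_bound[OF T bounded_opsD(1)[OF U f]] f
      mult_left_mono[OF op_norm_bound[OF U f] op_norm_nonneg[OF T]]
    by (simp add: mult.assoc)
qed (simp add: op_norm_nonneg T U)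

lemma op_cstar_identity:
  assumes T: "T \<in> bounded_ops I"
  shows "cnorm (op_algebra I) (star (op_algebra I) T \<otimes>\<^bsub>op_algebra I\<^esub> T) = (cnorm (op_algebra I) T)\<^sup>2"
proof (rule antisym)
  let ?S = "star (op_algebra I) T"
  let ?P = "?S \<otimes>\<^bsub>op_algebra I\<^esub> T"
  have S: "?S \<in> bounded_ops I" and P: "?P \<in> bounded_ops I"
    using op_star(1)[OF T] op_closed T by blast+
  show "cnorm (op_algebra I) ?P \<le> (cnorm (op_algebra I) T)\<^sup>2"
    using op_norm_mult[OF S T] mult_right_mono[OF op_norm_star_le[OF T] op_norm_nonneg[OF T]]
    by (simp add: power2_eq_square)
  have "ell2_norm I (T f) \<le> sqrt (cnorm (op_algebra I) ?P) * ell2_norm I f" if f: "f \<in> ell2 I" for f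
  proof -
    have "(ell2_norm I (T f))\<^sup>2 = cmod (ell2_inner I f (?P f))"
      using op_star(2)[OF T f bounded_opsD(1)[OF T f]] f
        cmod_ell2_inner_self[OF bounded_opsD(1)[OF T f]] by simp
    also have "\<dots> \<le> ell2_norm I f * (cnorm (op_algebra I) ?P * ell2_norm I f)"
      using ell2_inner_summable(2)[OF f bounded_opsD(1)[OF P f]] op_norm_bound[OF P f]
      by (meson ell2_norm_nonneg mult_left_mono order_trans)
    also have "\<dots> = (sqrt (cnorm (op_algebra I) ?P) * ell2_norm I f)\<^sup>2"
      by (simp add: power_mult_distrib op_norm_nonneg[OF P]) (simp add: power2_eq_square)
    finally show ?thesis
      using op_norm_nonneg[OF P] by (auto intro: power2_le_imp_le)
  qed
  then have "cnorm (op_algebra I) T \<le> sqrt (cnorm (op_algebra I) ?P)"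
    using op_norm_nonneg[OF P] by (intro op_norm_le) auto
  then show "(cnorm (op_algebra I) T)\<^sup>2 \<le> cnorm (op_algebra I) ?P"
    using op_norm_nonneg[OF P] op_norm_nonneg[OF T]
    by (metis power_mono real_sqrt_pow2)
qed

text \<open>The limit operator is built coordinate by coordinate from complete scalars. Uniform
  control over finite sets of coordinates then upgrades this weak limit to a limit in norm.\<close>

lemma op_complete: "Metric_space.mcomplete (carrier (op_algebra I)) (cdist (op_algebra I))"
proof -
  interpret normed_module "op_algebra I" by (rule normed_module_op_algebra)
  have "\<exists>T. clim (op_algebra I) u T" if u: "ccauchy (op_algebra I) u" for u
  proof -
    have uc: "u n \<in> bounded_ops I" for n using u by (auto simp: ccauchy_def)
    have D: "ell2_norm I (\<lambda>x. u m f x - u n f x)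
        \<le> cnorm (op_algebra I) (u m \<ominus>\<^bsub>op_algebra I\<^esub> u n) * ell2_norm I f"
      "(\<lambda>x. u m f x - u n f x) \<in> ell2 I" if f: "f \<in> ell2 I" for m n f
      using op_norm_bound[OF _ f, of "u m \<ominus>\<^bsub>op_algebra I\<^esub> u n"] uc mi_closed[of "u m" "u n"] f
      by (auto simp: op_minus_apply ell2_diff bounded_opsD(1))
    have C: "\<exists>N. \<forall>m\<ge>N. \<forall>n\<ge>N. \<forall>f\<in>ell2 I. ell2_norm I (\<lambda>x. u m f x - u n f x) \<le> e * ell2_norm I f"
      if "e > 0" for e
    proof -
      obtain N where N: "\<forall>m\<ge>N. \<forall>n\<ge>N. cnorm (op_algebra I) (u m \<ominus>\<^bsub>op_algebra I\<^esub> u n) < e"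
        using u \<open>e > 0\<close> by (auto simp: ccauchy_def)
      have "ell2_norm I (\<lambda>x. u m f x - u n f x) \<le> e * ell2_norm I f"
        if "m \<ge> N" "n \<ge> N" "f \<in> ell2 I" for m n f
        using D(1)[OF that(3), of m n] N that mult_right_mono[of _ e "ell2_norm I f"]
        by (meson ell2_norm_nonneg less_imp_le order_trans)
      then show ?thesis by blast
    qed
    have conv: "convergent (\<lambda>n. u n f x)" if f: "f \<in> ell2 I" for f x
    proof (rule Cauchy_convergent, rule CauchyI)
      fix e :: real assume e: "e > 0"
      define e' where "e' = e / (ell2_norm I f + 1)"
      have p: "ell2_norm I f + 1 > 0" by (simp add: add_nonneg_pos)
      then have "e' > 0" using e by (simp add: e'_def)
      then obtain N where N: "\<forall>m\<ge>N. \<forall>n\<ge>N. ell2_norm I (\<lambda>x. u m f x - u n f x) \<le> e' * ell2_norm I f"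
        using C f by blast
      have "e' * ell2_norm I f < e" using p e by (simp add: e'_def field_simps)
      then show "\<exists>N. \<forall>m\<ge>N. \<forall>n\<ge>N. cmod (u m f x - u n f x) < e"
        using N ell2_coord_le[OF D(2)[OF f]] by (meson order_le_less_trans)
    qed
    define t where "t f x = lim (\<lambda>n. u n f x)" for f x
    have t: "(\<lambda>n. u n f x) \<longlonglongrightarrow> t f x" if "f \<in> ell2 I" for f x
      using conv[OF that] by (simp add: t_def convergent_LIMSEQ_iff)
    \<comment> \<open>The Cauchy estimate is uniform in the second index, so for a finite set of
      coordinates that index may tend to infinity. That \<open>t f\<close> itself is square summable
      is not known yet; only the difference is treated.\<close>
    have tb: "(\<lambda>x. u m f x - t f x) \<in> ell2 I \<and> ell2_norm I (\<lambda>x. u m f x - t f x) \<le> e * ell2_norm I f"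
      if e: "e > 0" and N: "\<forall>m\<ge>N. \<forall>n\<ge>N. \<forall>f\<in>ell2 I. ell2_norm I (\<lambda>x. u m f x - u n f x) \<le> e * ell2_norm I f"
        and m: "m \<ge> N" and f: "f \<in> ell2 I" for e N m f
    proof -
      have le: "(\<Sum>x\<in>F. (cmod (u m f x - t f x))\<^sup>2) \<le> (e * ell2_norm I f)\<^sup>2"
        if F: "finite F" "F \<subseteq> I" for F
      proof (rule LIMSEQ_le_const2)
        show "(\<lambda>n. \<Sum>x\<in>F. (cmod (u m f x - u n f x))\<^sup>2) \<longlonglongrightarrow> (\<Sum>x\<in>F. (cmod (u m f x - t f x))\<^sup>2)"
          by (intro tendsto_intros t[OF f])
        have "(\<Sum>x\<in>F. (cmod (u m f x - u n f x))\<^sup>2) \<le> (e * ell2_norm I f)\<^sup>2" if "n \<ge> N" for n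
          using ell2_finite_sum_le[OF D(2)[OF f] F, of m n] N m that f
          by (meson ell2_norm_nonneg order_trans power_mono)
        then show "\<exists>N. \<forall>n\<ge>N. (\<Sum>x\<in>F. (cmod (u m f x - u n f x))\<^sup>2) \<le> (e * ell2_norm I f)\<^sup>2" by blast
      qed
      have z: "u m f x - t f x = 0" if "x \<notin> I" for x
      proof -
        have "(\<lambda>n. u n f x) = (\<lambda>n. 0)" using ell2D[OF bounded_opsD(1)[OF uc f] that] by auto
        then show ?thesis using t[OF f, of x] LIMSEQ_unique[of "\<lambda>n. 0::complex" 0 "t f x"]
            ell2D[OF bounded_opsD(1)[OF uc f] that] by simp
      qed
      show ?thesis
        using ell2_bounded_finite_sums[of I "\<lambda>x. u m f x - t f x" "e * ell2_norm I f"] le z e by simp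
    qed
    define T where "T = (\<lambda>f\<in>ell2 I. t f)"
    obtain N1 where N1: "\<forall>m\<ge>N1. \<forall>n\<ge>N1. \<forall>f\<in>ell2 I. ell2_norm I (\<lambda>x. u m f x - u n f x) \<le> 1 * ell2_norm I f"
      using C[of 1] by auto
    \<comment> \<open>Exhibits \<open>t f\<close> as a difference of two vectors already known to be
      square summable, at the fixed precision 1.\<close>
    have td: "(\<lambda>x. u N1 f x - (u N1 f x - t f x)) = t f" for f by auto
    have T: "T \<in> bounded_ops I"
      unfolding T_def
    proof (rule bounded_opsI)
      fix f assume f: "f \<in> ell2 I"
      note b = tb[OF zero_less_one N1 order_refl f]
      show "t f \<in> ell2 I" using ell2_diff(1)[OF bounded_opsD(1)[OF uc f] conjunct1[OF b], of N1] by (simp only: td)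
      show "ell2_norm I (t f) \<le> (cnorm (op_algebra I) (u N1) + 1) * ell2_norm I f"
        using ell2_diff(2)[OF bounded_opsD(1)[OF uc f] conjunct1[OF b], of N1, unfolded td] conjunct2[OF b]
          op_norm_bound[OF uc f, of N1] by (simp add: distrib_right)
    next
      fix f g assume f: "f \<in> ell2 I" and g: "g \<in> ell2 I"
      show "t (\<lambda>x. f x + g x) = (\<lambda>x. t f x + t g x)"
      proof
        fix x
        show "t (\<lambda>x. f x + g x) x = t f x + t g x"
          using t[OF ell2_add(1)[OF f g], of x] tendsto_add[OF t[OF f] t[OF g], of x x]
          by (simp add: bounded_opsD(2)[OF uc f g] LIMSEQ_unique)
      qed
    next
      fix c f assume f: "f \<in> ell2 I"
      show "t (\<lambda>x. c * f x) = (\<lambda>x. c * t f x)"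
      proof
        fix x
        show "t (\<lambda>x. c * f x) x = c * t f x"
          using t[OF ell2_cmult(1)[OF f], of c x] tendsto_mult[OF tendsto_const t[OF f], of c x]
          by (simp add: bounded_opsD(3)[OF uc f] LIMSEQ_unique)
      qed
    qed
    have lim: "\<exists>N. \<forall>n\<ge>N. cnorm (op_algebra I) (u n \<ominus>\<^bsub>op_algebra I\<^esub> T) \<le> e" if e: "e > 0" for e
    proof -
      obtain N where N: "\<forall>m\<ge>N. \<forall>n\<ge>N. \<forall>f\<in>ell2 I. ell2_norm I (\<lambda>x. u m f x - u n f x) \<le> e * ell2_norm I f"
        using C[OF e] by auto
      have "cnorm (op_algebra I) (u n \<ominus>\<^bsub>op_algebra I\<^esub> T) \<le> e" if "n \<ge> N" for n
      proof (rule op_norm_le)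
        fix f assume f: "f \<in> ell2 I"
        show "ell2_norm I ((u n \<ominus>\<^bsub>op_algebra I\<^esub> T) f) \<le> e * ell2_norm I f"
          using tb[OF e N that f] f uc T by (simp add: op_minus_apply T_def)
      qed (use e in simp)
      then show ?thesis by blast
    qed
    then have "\<exists>N. \<forall>n\<ge>N. cnorm (op_algebra I) (u n \<ominus>\<^bsub>op_algebra I\<^esub> T) < e" if e: "e > 0" for e
    proof -
      obtain N where "\<forall>n\<ge>N. cnorm (op_algebra I) (u n \<ominus>\<^bsub>op_algebra I\<^esub> T) \<le> e / 2"
        using lim[of "e / 2"] e by auto
      then show ?thesis using e by (intro exI[of _ N]) fastforce
    qed
    then have "(\<lambda>n. cnorm (op_algebra I) (u n \<ominus>\<^bsub>op_algebra I\<^esub> T)) \<longlonglongrightarrow> 0"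
      by (intro LIMSEQ_I) (use uc T nrm_nonneg mi_closed in auto)
    then show ?thesis using uc T by (auto simp: clim_def)
  qed
  then show ?thesis by (simp only: mcomplete_iff) blast
qed

theorem unital_cstar_algebra_op_algebra: "unital_cstar_algebra (op_algebra I)"
proof -
  interpret normed_module "op_algebra I" by (rule normed_module_op_algebra)
  note cl = op_closed op_star(1)
  note D = bounded_opsD
  have c: "cstar_algebra (op_algebra I)"
    unfolding cstar_algebra_def cstar_algebra_axioms_def
  proof (intro conjI allI impI)
    fix T U V assume T: "T \<in> carrier (op_algebra I)" and U: "U \<in> carrier (op_algebra I)"
    then have TU: "T \<in> bounded_ops I" "U \<in> bounded_ops I" by auto
    show "star (op_algebra I) (T \<oplus>\<^bsub>op_algebra I\<^esub> U) = star (op_algebra I) T \<oplus>\<^bsub>op_algebra I\<^esub> star (op_algebra I) U"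
      by (rule op_star_eqI)
        (use TU in \<open>auto intro!: cl simp: D ell2_inner_add_left ell2_inner_add_right op_star(1) op_star(2)\<close>)
    show "star (op_algebra I) (T \<otimes>\<^bsub>op_algebra I\<^esub> U) = star (op_algebra I) U \<otimes>\<^bsub>op_algebra I\<^esub> star (op_algebra I) T"
      by (rule op_star_eqI)
        (use TU in \<open>auto intro!: cl simp: D op_star(1) op_star(2)\<close>)
  next
    fix T c assume "T \<in> carrier (op_algebra I)"
    then have T: "T \<in> bounded_ops I" by simp
    show "star (op_algebra I) (star (op_algebra I) T) = T"
      by (rule op_star_eqI) (use T op_star' in auto)
    show "star (op_algebra I) (c \<odot>\<^bsub>op_algebra I\<^esub> T) = cnj c \<odot>\<^bsub>op_algebra I\<^esub> star (op_algebra I) T"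
      by (rule op_star_eqI)
        (use T in \<open>auto intro!: cl simp: D ell2_inner_cmult_left ell2_inner_cmult_right op_star(2)\<close>)
  qed (use module_axioms nrm_eq_zero op_complete in \<open>auto intro!: cl bounded_ops_eqI[of _ I]
      simp: D op_norm_nonneg op_norm_triangle op_norm_smult op_norm_mult op_cstar_identity\<close>)
  have "monoid (op_algebra I)"
    by (intro monoidI) (auto intro!: cl bounded_ops_eqI[of _ I] simp: D)
  with c show ?thesis by (simp add: unital_cstar_algebra_def)
qed

text \<open>The adjoint replaces a density argument: coordinate \<open>b\<close> of
  \<open>T f\<close> pairs \<open>f\<close> with the adjoint at \<open>chi b\<close>, and the
  coordinates of that vector are the conjugated matrix entries of \<open>T\<close>.\<close>

lemma bounded_ops_eq_chiI:
  assumes "T \<in> bounded_ops I" "U \<in> bounded_ops I" "\<And>a. a \<in> I \<Longrightarrow> T (chi a) = U (chi a)"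
  shows "T = U"
proof (rule bounded_ops_eqI[OF assms(1,2)])
  fix f assume f: "f \<in> ell2 I"
  have e: "star (op_algebra I) T (chi b) = star (op_algebra I) U (chi b)" if b: "b \<in> I" for b
  proof
    fix a
    show "star (op_algebra I) T (chi b) a = star (op_algebra I) U (chi b) a"
    proof (cases "a \<in> I")
      case True
      have "star (op_algebra I) T (chi b) a = cnj (ell2_inner I (T (chi a)) (chi b))"
        "star (op_algebra I) U (chi b) a = cnj (ell2_inner I (U (chi a)) (chi b))"
        using True b assms(1,2)
        by (simp_all add: op_star(2) chi_in_ell2 ell2_inner_chi bounded_opsD(1) op_star(1))
      then show ?thesis using assms(3)[OF True] by simp
    qed (use b assms(1,2) chi_in_ell2 bounded_opsD(1) op_star(1) ell2D in metis)
  qed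
  show "T f = U f"
  proof
    fix b
    show "T f b = U f b"
    proof (cases "b \<in> I")
      case True
      have "T f b = ell2_inner I (T f) (chi b)" "U f b = ell2_inner I (U f) (chi b)"
        using True f assms(1,2) by (simp_all add: ell2_inner_chi bounded_opsD(1))
      then show ?thesis
        using e[OF True] True f assms(1,2) by (simp add: op_star(2) chi_in_ell2)
    qed (use f assms(1,2) bounded_opsD(1) ell2D in metis)
  qed
qed

section \<open>Star homomorphisms are contractive\<close>

lemma (in normed_module) ccauchy_of_summable_steps:
  assumes u: "\<And>n. u n \<in> carrier A" and g: "summable g"
    and le: "\<And>n. cnorm A (u (Suc n) \<ominus> u n) \<le> g n"
  shows "ccauchy A u"
proof -
  have tel: "cnorm A (u (n + k) \<ominus> u n) \<le> sum g {n..<n + k}" for n k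
  proof (induction k)
    case (Suc k)
    then show ?case
      using nrm_mi_triangle[of "u (Suc (n + k))" "u (n + k)" "u n"] u le[of "n + k"] by simp
  qed (simp add: u)
  have tel': "cnorm A (u m \<ominus> u n) \<le> \<bar>sum g {n..<m}\<bar>" if "n \<le> m" for m n
    using tel[of n "m - n"] that by simp
  show ?thesis
    unfolding ccauchy_def
  proof (intro conjI allI impI)
    fix e :: real assume "e > 0"
    then obtain N where N: "\<And>m n. m \<ge> N \<Longrightarrow> norm (sum g {m..<n}) < e"
      using g unfolding summable_Cauchy by blast
    have "cnorm A (u m \<ominus> u n) < e" if "m \<ge> N" "n \<ge> N" for m n
    proof (cases "n \<le> m")
      case True
      then show ?thesis using tel'[OF True] N[OF that(2), of m] by simp
    next
      case False
      then show ?thesis using tel'[of m n] N[OF that(1), of n] nrm_mi_commute[OF u u, of m n] by simp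
    qed
    then show "\<exists>N. \<forall>m\<ge>N. \<forall>n\<ge>N. cnorm A (u m \<ominus> u n) < e" by blast
  qed (use u in auto)
qed

lemma (in normed_module) clim_Suc: "clim A u x \<Longrightarrow> clim A (\<lambda>n. u (Suc n)) x"
  unfolding clim_def using LIMSEQ_Suc by (auto simp: image_subset_iff)

lemma (in cstar_algebra) ccauchy_converges: "ccauchy A u \<Longrightarrow> \<exists>x. clim A u x"
  using complete unfolding mcomplete_iff by blast

text \<open>With \<open>c = 1 - y\<close>, the equation \<open>c\<^sup>2 = 1 - t\<close> says that \<open>y\<close> is a fixed point of
  \<open>y \<mapsto> (t + y\<^sup>2) / 2\<close>, which is a contraction on a ball of radius \<open>r < 1\<close>.\<close>
lemma (in unital_cstar_algebra) sqrt_one_minus: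
  assumes t: "t \<in> carrier A" "star A t = t" "cnorm A t < 1"
  obtains c where "c \<in> carrier A" "star A c = c" "c \<otimes> c = \<one> \<ominus> t"
    "\<And>h. h \<in> carrier A \<Longrightarrow> h \<otimes> t = t \<otimes> h \<Longrightarrow> h \<otimes> c = c \<otimes> h"
proof -
  \<comment> \<open>The smaller root of r\<cdot>r - 2r + \<open>cnorm A t\<close> = 0. For this
    radius the iteration maps the ball into itself, and r < 1 is the contraction factor.\<close>
  define r where "r = 1 - sqrt (1 - cnorm A t)"
  have t0: "cnorm A t \<ge> 0" using cnorm_nonneg t by simp
  have r: "0 \<le> r" "r < 1" using t(3) t0 by (auto simp: r_def)
  have rr: "cnorm A t + r * r = 2 * r"
    using t(3) by (simp add: r_def algebra_simps)
  define F where "F y = (1/2) \<odot>\<^bsub>A\<^esub> (t \<oplus> y \<otimes> y)" for y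
  define u where "u n = (F ^^ n) \<zero>" for n
  have u0: "u 0 = \<zero>" and uS: "u (Suc n) = F (u n)" for n by (simp_all add: u_def)
  have uc: "u n \<in> carrier A" for n
    by (induction n) (auto simp: u0 uS F_def t)
  have ub: "cnorm A (u n) \<le> r" for n
  proof (induction n)
    case (Suc n)
    have "cnorm A (t \<oplus> u n \<otimes> u n) \<le> cnorm A t + cnorm A (u n) * cnorm A (u n)"
      using cnorm_triangle[of t "u n \<otimes> u n"] cnorm_mult[of "u n" "u n"] t uc by auto
    also have "\<dots> \<le> cnorm A t + r * r"
      using mult_mono'[OF Suc Suc] uc by (simp add: cnorm_nonneg)
    finally show ?case
      using rr t uc by (simp add: uS F_def cnorm_smult)
  qed (simp add: u0 r)
  have step: "cnorm A (u (Suc n) \<ominus> u n) \<le> r ^ n * r" for n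
  proof (induction n)
    case 0 then show ?case using ub[of 1] uc by (simp add: u0)
  next
    case (Suc n)
    let ?y = "u (Suc n)" and ?z = "u n"
    have "u (Suc (Suc n)) \<ominus> u (Suc n) = (1/2) \<odot>\<^bsub>A\<^esub> ((t \<oplus> ?y \<otimes> ?y) \<ominus> (t \<oplus> ?z \<otimes> ?z))"
      unfolding uS[of "Suc n"] using uc t by (simp add: uS[of n] F_def sm_minus_right)
    \<comment> \<open>The difference of the squares telescopes through the product of the two
      iterates, which avoids commuting them.\<close>
    also have "(t \<oplus> ?y \<otimes> ?y) \<ominus> (t \<oplus> ?z \<otimes> ?z) = ?y \<otimes> (?y \<ominus> ?z) \<oplus> (?y \<ominus> ?z) \<otimes> ?z"
      using uc t by (simp add: mi_add_add mi_mult_left mi_mult_right mi_trans)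
    finally have "cnorm A (u (Suc (Suc n)) \<ominus> u (Suc n))
        = 1/2 * cnorm A (?y \<otimes> (?y \<ominus> ?z) \<oplus> (?y \<ominus> ?z) \<otimes> ?z)"
      using uc by (simp add: cnorm_smult)
    also have "\<dots> \<le> 1/2 * (cnorm A ?y * cnorm A (?y \<ominus> ?z) + cnorm A (?y \<ominus> ?z) * cnorm A ?z)"
      using uc by (intro mult_left_mono order_trans[OF cnorm_triangle] add_mono cnorm_mult) auto
    also have "\<dots> \<le> 1/2 * (r * cnorm A (?y \<ominus> ?z) + cnorm A (?y \<ominus> ?z) * r)"
      using uc ub by (intro mult_left_mono add_mono mult_right_mono) (auto intro: cnorm_nonneg mult_left_mono)
    also have "\<dots> = r * cnorm A (?y \<ominus> ?z)" by simp
    also have "\<dots> \<le> r * (r ^ n * r)" using Suc r(1) by (rule mult_left_mono)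
    finally show ?case by (simp add: mult_ac)
  qed
  have "summable (\<lambda>n. r ^ n * r)" using r by (intro summable_mult2 summable_geometric) auto
  then have "ccauchy A u" using uc step by (intro ccauchy_of_summable_steps[of u "\<lambda>n. r ^ n * r"]) auto
  then obtain y where y: "clim A u y" using ccauchy_converges by blast
  have yc: "y \<in> carrier A" using climD[OF y] by simp
  have "clim A (\<lambda>n. u (Suc n)) ((1/2) \<odot>\<^bsub>A\<^esub> (t \<oplus> y \<otimes> y))"
    unfolding uS F_def by (intro clim_smult clim_add clim_mult clim_const t y)
  then have yfix: "y = (1/2) \<odot>\<^bsub>A\<^esub> (t \<oplus> y \<otimes> y)" using clim_Suc[OF y] clim_unique by blast
  have yy: "y \<oplus> y = t \<oplus> y \<otimes> y"
  proof -
    have "y \<oplus> y = (1/2) \<odot>\<^bsub>A\<^esub> (t \<oplus> y \<otimes> y) \<oplus> (1/2) \<odot>\<^bsub>A\<^esub> (t \<oplus> y \<otimes> y)"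
      using yfix by simp
    also have "\<dots> = (1/2 + 1/2) \<odot>\<^bsub>A\<^esub> (t \<oplus> y \<otimes> y)"
      using t yc by (intro sm_add_left[symmetric]) auto
    finally show ?thesis using t yc by simp
  qed
  have us: "star A (u n) = u n" for n
    by (induction n) (simp_all add: u0 uS F_def star_smult star_add star_mult t uc)
  have ys: "star A y = y" using clim_unique[OF clim_star[OF y]] y by (simp add: us)
  show ?thesis
  proof (rule that)
    show "\<one> \<ominus> y \<in> carrier A" using yc by simp
    show "star A (\<one> \<ominus> y) = \<one> \<ominus> y" using yc ys by (simp add: star_minus)
    have "(\<one> \<ominus> y) \<otimes> (\<one> \<ominus> y) = (\<one> \<ominus> y) \<ominus> (y \<ominus> y \<otimes> y)"
      using yc by (simp add: mi_mult_left mi_mult_right)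
    also have "\<dots> = (\<one> \<oplus> y \<otimes> y) \<ominus> (y \<oplus> y)"
      using yc by (simp add: a_minus_def minus_add a_ac)
    also have "\<dots> = (\<one> \<ominus> t) \<oplus> (y \<otimes> y \<ominus> y \<otimes> y)"
      unfolding yy using yc t by (intro mi_add_add) auto
    finally show "(\<one> \<ominus> y) \<otimes> (\<one> \<ominus> y) = \<one> \<ominus> t" using yc t by simp
    \<comment> \<open>Every iterate is a polynomial in \<open>t\<close>, so commutation with
      \<open>t\<close> passes to the iterates and then to their limit.\<close>
    fix h assume h: "h \<in> carrier A" "h \<otimes> t = t \<otimes> h"
    have "h \<otimes> u n = u n \<otimes> h" for n
    proof (induction n)
      case (Suc n)
      have "h \<otimes> (u n \<otimes> u n) = u n \<otimes> u n \<otimes> h"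
        using Suc h(1) uc by (metis m_assoc)
      then show ?case using h t uc
        by (simp add: uS F_def smult_mult_left smult_mult_right l_distr r_distr)
    qed (simp add: u0 h)
    then have "h \<otimes> y = y \<otimes> h"
      using clim_unique[OF clim_mult[OF clim_const[OF h(1)] y]] clim_mult[OF y clim_const[OF h(1)]] by simp
    then show "h \<otimes> (\<one> \<ominus> y) = (\<one> \<ominus> y) \<otimes> h"
      using h yc by (simp add: mi_mult_left mi_mult_right)
  qed
qed

lemma star_homD:
  assumes "\<phi> \<in> star_hom A B"
  shows "x \<in> carrier A \<Longrightarrow> \<phi> x \<in> carrier B"
    "x \<in> carrier A \<Longrightarrow> y \<in> carrier A \<Longrightarrow> \<phi> (x \<oplus>\<^bsub>A\<^esub> y) = \<phi> x \<oplus>\<^bsub>B\<^esub> \<phi> y"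
    "x \<in> carrier A \<Longrightarrow> y \<in> carrier A \<Longrightarrow> \<phi> (x \<otimes>\<^bsub>A\<^esub> y) = \<phi> x \<otimes>\<^bsub>B\<^esub> \<phi> y"
    "x \<in> carrier A \<Longrightarrow> \<phi> (c \<odot>\<^bsub>A\<^esub> x) = c \<odot>\<^bsub>B\<^esub> \<phi> x"
    "x \<in> carrier A \<Longrightarrow> \<phi> (star A x) = star B (\<phi> x)"
  using assms by (auto simp: star_hom_def)

text \<open>If \<open>h\<close> is self-adjoint of norm less than 1 and \<open>c = (1 - h\<^sup>2)\<^sup>1\<^sup>/\<^sup>2\<close>, then \<open>\<phi> h\<close> is the real part of
  the partial isometry \<open>\<phi> h + i \<phi> c\<close>.\<close>
lemma star_hom_contractive:
  assumes A: "unital_cstar_algebra A" and B: "unital_cstar_algebra B"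
    and \<phi>: "\<phi> \<in> star_hom A B" and x: "x \<in> carrier A"
  shows "cnorm B (\<phi> x) \<le> cnorm A x"
proof -
  interpret A: unital_cstar_algebra A by fact
  interpret B: unital_cstar_algebra B by fact
  note D = star_homD[OF \<phi>]
  have unit: "cnorm B (\<phi> h) \<le> 1" if h: "h \<in> carrier A" "star A h = h" "cnorm A h < 1" for h
  proof -
    have "cnorm A (h \<otimes>\<^bsub>A\<^esub> h) < 1"
      using A.cnorm_mult[OF h(1) h(1)] A.cnorm_nonneg[OF h(1)] h(3)
      by (smt (verit) mult_left_le)
    then obtain c where c: "c \<in> carrier A" "star A c = c" "c \<otimes>\<^bsub>A\<^esub> c = \<one>\<^bsub>A\<^esub> \<ominus>\<^bsub>A\<^esub> h \<otimes>\<^bsub>A\<^esub> h"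
      "h \<otimes>\<^bsub>A\<^esub> c = c \<otimes>\<^bsub>A\<^esub> h"
      using A.sqrt_one_minus[of "h \<otimes>\<^bsub>A\<^esub> h"] h by (metis A.m_assoc A.m_closed A.star_mult)
    define a b where "a = \<phi> h" and "b = \<phi> c"
    have a: "a \<in> carrier B" "star B a = a" and b: "b \<in> carrier B" "star B b = b"
      using h c D(1) by (simp_all add: a_def b_def flip: D(5))
    have ab: "a \<otimes>\<^bsub>B\<^esub> b = b \<otimes>\<^bsub>B\<^esub> a"
      using h c by (simp add: a_def b_def flip: D(3))
    have "c \<otimes>\<^bsub>A\<^esub> c \<oplus>\<^bsub>A\<^esub> h \<otimes>\<^bsub>A\<^esub> h = \<one>\<^bsub>A\<^esub>"
      using c h by (simp add: A.mi_add_cancel)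
    then have sq: "a \<otimes>\<^bsub>B\<^esub> a \<oplus>\<^bsub>B\<^esub> b \<otimes>\<^bsub>B\<^esub> b = \<phi> \<one>\<^bsub>A\<^esub>"
      using h c by (simp add: a_def b_def A.a_comm flip: D(2,3))
    have one: "cnorm B (\<phi> \<one>\<^bsub>A\<^esub>) \<le> 1"
      by (rule B.projection_norm_le) (auto simp: D(1) simp flip: D(3,5))
    define u where "u = a \<oplus>\<^bsub>B\<^esub> \<i> \<odot>\<^bsub>B\<^esub> b"
    define v where "v = a \<oplus>\<^bsub>B\<^esub> (- \<i>) \<odot>\<^bsub>B\<^esub> b"
    have u: "u \<in> carrier B" "v \<in> carrier B" "star B u = v"
      using a b by (simp_all add: u_def v_def B.star_add B.star_smult)
    \<comment> \<open>Because \<open>a\<close> and \<open>b\<close> commute, the two mixed terms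
      have opposite coefficients and cancel; the squares add up to the image of the unit, a
      projection.\<close>
    have "v \<otimes>\<^bsub>B\<^esub> u = (a \<otimes>\<^bsub>B\<^esub> a \<oplus>\<^bsub>B\<^esub> b \<otimes>\<^bsub>B\<^esub> b)
        \<oplus>\<^bsub>B\<^esub> (\<i> \<odot>\<^bsub>B\<^esub> (b \<otimes>\<^bsub>B\<^esub> a) \<oplus>\<^bsub>B\<^esub> (- \<i>) \<odot>\<^bsub>B\<^esub> (b \<otimes>\<^bsub>B\<^esub> a))"
      using a b unfolding u_def v_def
      by (simp add: B.l_distr B.r_distr B.smult_mult_left B.smult_mult_right B.sm_sm
          B.sm_add_right ab B.a_ac)
    also have "\<i> \<odot>\<^bsub>B\<^esub> (b \<otimes>\<^bsub>B\<^esub> a) \<oplus>\<^bsub>B\<^esub> (- \<i>) \<odot>\<^bsub>B\<^esub> (b \<otimes>\<^bsub>B\<^esub> a) = \<zero>\<^bsub>B\<^esub>"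
      using a b B.sm_add_left[of "b \<otimes>\<^bsub>B\<^esub> a" \<i> "- \<i>"] by simp
    finally have "v \<otimes>\<^bsub>B\<^esub> u = \<phi> \<one>\<^bsub>A\<^esub>"
      using a b by (simp add: sq[symmetric])
    then have "(cnorm B u)\<^sup>2 \<le> 1"
      using B.cstar_identity[OF u(1)] one u by simp
    then have nu: "cnorm B u \<le> 1" using B.cnorm_nonneg[OF u(1)] by (simp add: power_le_one_iff)
    have "u \<oplus>\<^bsub>B\<^esub> v = (a \<oplus>\<^bsub>B\<^esub> a) \<oplus>\<^bsub>B\<^esub> (\<i> \<odot>\<^bsub>B\<^esub> b \<oplus>\<^bsub>B\<^esub> (- \<i>) \<odot>\<^bsub>B\<^esub> b)"
      using a b by (simp add: u_def v_def B.a_ac)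
    also have "\<dots> = 2 \<odot>\<^bsub>B\<^esub> a"
      using a b B.sm_add_left[of b \<i> "- \<i>"] B.sm_add_left[of a 1 1] by simp
    finally have "2 * cnorm B a = cnorm B (u \<oplus>\<^bsub>B\<^esub> v)" using a by (simp add: B.cnorm_smult)
    also have "\<dots> \<le> cnorm B u + cnorm B v" using u by (intro B.cnorm_triangle)
    also have "\<dots> \<le> 2" using nu B.cnorm_star[OF u(1)] u by simp
    finally show ?thesis by (simp add: a_def)
  qed
  \<comment> \<open>Rescaling by every r above the norm of \<open>h\<close> brings \<open>h\<close>
    into the open unit ball, where the square root exists.\<close>
  have sa: "cnorm B (\<phi> h) \<le> cnorm A h" if h: "h \<in> carrier A" "star A h = h" for h
  proof (rule dense_ge)
    fix r assume r: "cnorm A h < r"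
    then have r0: "r > 0" using A.cnorm_nonneg[OF h(1)] by linarith
    have "cnorm B (\<phi> (complex_of_real (1 / r) \<odot>\<^bsub>A\<^esub> h)) \<le> 1"
      by (rule unit) (use h r r0 in \<open>simp_all add: A.star_smult A.cnorm_smult norm_divide\<close>)
    then show "cnorm B (\<phi> h) \<le> r"
      using h r0 by (simp add: D B.cnorm_smult norm_divide)
  qed
  have "(cnorm B (\<phi> x))\<^sup>2 = cnorm B (\<phi> (star A x \<otimes>\<^bsub>A\<^esub> x))"
    using x by (simp add: D A.star_closed B.cstar_identity)
  also have "\<dots> \<le> cnorm A (star A x \<otimes>\<^bsub>A\<^esub> x)"
    by (rule sa) (use x in \<open>simp_all add: A.star_closed A.star_mult A.star_star\<close>)
  also have "\<dots> = (cnorm A x)\<^sup>2" using x by (rule A.cstar_identity)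
  finally show ?thesis using A.cnorm_nonneg[OF x] power2_le_imp_le by blast
qed

lemma star_hom_minus:
  assumes "unital_cstar_algebra A" "unital_cstar_algebra B" "\<phi> \<in> star_hom A B"
    "x \<in> carrier A" "y \<in> carrier A"
  shows "\<phi> (x \<ominus>\<^bsub>A\<^esub> y) = \<phi> x \<ominus>\<^bsub>B\<^esub> \<phi> y"
proof -
  interpret A: unital_cstar_algebra A by fact
  interpret B: unital_cstar_algebra B by fact
  show ?thesis using assms(4,5) star_homD[OF assms(3)] by (simp add: A.minus_conv_sm B.minus_conv_sm)
qed

lemma star_hom_zero:
  assumes "unital_cstar_algebra A" "unital_cstar_algebra B" "\<phi> \<in> star_hom A B"
  shows "\<phi> \<zero>\<^bsub>A\<^esub> = \<zero>\<^bsub>B\<^esub>"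
proof -
  interpret A: unital_cstar_algebra A by fact
  interpret B: unital_cstar_algebra B by fact
  show ?thesis using star_homD(4)[OF assms(3), of "\<zero>\<^bsub>A\<^esub>" 0] star_homD(1)[OF assms(3)] by simp
qed

lemma star_hom_clim:
  assumes A: "unital_cstar_algebra A" and B: "unital_cstar_algebra B"
    and \<phi>: "\<phi> \<in> star_hom A B" and u: "clim A u x"
  shows "clim B (\<lambda>n. \<phi> (u n)) (\<phi> x)"
proof -
  interpret A: unital_cstar_algebra A by fact
  interpret B: unital_cstar_algebra B by fact
  note d = A.climD[OF u]
  show ?thesis
    by (rule B.climI[OF _ _ d(3)])
      (use d star_homD[OF \<phi>] star_hom_contractive[OF A B \<phi>] star_hom_minus[OF A B \<phi>, symmetric] in auto)
qed

section \<open>Quotients by closed ideals\<close>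

definition coset_norm :: "('a, 'm) cstar_algebra_scheme \<Rightarrow> 'a set \<Rightarrow> 'a \<Rightarrow> real" where
  "coset_norm A J x = (INF j\<in>J. cnorm A (x \<ominus>\<^bsub>A\<^esub> j))"

text \<open>The quotient is carried by the values of a function \<open>\<rho>\<close> whose fibres are the cosets of \<open>J\<close>; this
  allows it to live in a prescribed type.  The C*-identity of the quotient norm is an assumption.\<close>
locale cstar_ideal = unital_cstar_algebra A
  for A :: "('a, 'm) cstar_algebra_scheme" (structure) +
  fixes J :: "'a set" and \<rho> :: "'a \<Rightarrow> 'b"
  assumes J: "ideal J A" and J_closed: "closed_in_norm A J"
    and J_star: "x \<in> J \<Longrightarrow> star A x \<in> J"
    and qnorm_sq_le: "x \<in> carrier A \<Longrightarrow> (coset_norm A J x)\<^sup>2 \<le> coset_norm A J (star A x \<otimes> x)"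
    and rho_eq_iff: "\<lbrakk>x \<in> carrier A; y \<in> carrier A\<rbrakk> \<Longrightarrow> \<rho> x = \<rho> y \<longleftrightarrow> x \<ominus> y \<in> J"
begin

abbreviation qnorm where "qnorm \<equiv> coset_norm A J"

lemma J_carrier: "x \<in> J \<Longrightarrow> x \<in> carrier A"
  using J_closed by (auto simp: closed_in_norm_iff)

lemma J_zero: "\<zero> \<in> J" and J_add: "x \<in> J \<Longrightarrow> y \<in> J \<Longrightarrow> x \<oplus> y \<in> J"
  using J by (auto simp: additive_subgroup.zero_closed additive_subgroup.a_closed ideal.axioms(1))

lemma J_mult: "x \<in> J \<Longrightarrow> y \<in> carrier A \<Longrightarrow> x \<otimes> y \<in> J"
  "x \<in> J \<Longrightarrow> y \<in> carrier A \<Longrightarrow> y \<otimes> x \<in> J"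
  using J by (auto simp: ideal.I_r_closed ideal.I_l_closed)

lemma J_smult: "x \<in> J \<Longrightarrow> c \<odot>\<^bsub>A\<^esub> x \<in> J"
  by (rule ideal_smult[OF J])

lemma J_minus: "x \<in> J \<Longrightarrow> y \<in> J \<Longrightarrow> x \<ominus> y \<in> J"
  using J_add[OF _ J_smult] by (simp add: minus_conv_sm J_carrier)

lemma qnorm_bdd: "x \<in> carrier A \<Longrightarrow> bdd_below ((\<lambda>j. cnorm A (x \<ominus> j)) ` J)"
  by (rule bdd_belowI2[where m = 0]) (auto intro: cnorm_nonneg J_carrier)

lemma qnorm_le: "x \<in> carrier A \<Longrightarrow> j \<in> J \<Longrightarrow> qnorm x \<le> cnorm A (x \<ominus> j)"
  unfolding coset_norm_def by (rule cINF_lower[OF qnorm_bdd])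

lemma qnorm_le_cnorm: "x \<in> carrier A \<Longrightarrow> qnorm x \<le> cnorm A x"
  using qnorm_le[of x \<zero>] J_zero by simp

lemma qnorm_ge: "x \<in> carrier A \<Longrightarrow> (\<And>j. j \<in> J \<Longrightarrow> r \<le> cnorm A (x \<ominus> j)) \<Longrightarrow> r \<le> qnorm x"
  unfolding coset_norm_def by (rule cINF_greatest) (use J_zero in auto)

lemma qnorm_nonneg: "x \<in> carrier A \<Longrightarrow> 0 \<le> qnorm x"
  by (rule qnorm_ge) (auto intro: cnorm_nonneg J_carrier)

lemma qnorm_approx:
  assumes "x \<in> carrier A" "qnorm x < r"
  obtains j where "j \<in> J" "cnorm A (x \<ominus> j) < r"
  using qnorm_ge[OF assms(1), of r] assms(2) by (meson not_le)

lemma qnorm_eq_zero: "x \<in> carrier A \<Longrightarrow> qnorm x = 0 \<longleftrightarrow> x \<in> J"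
proof
  assume x: "x \<in> carrier A" and q: "qnorm x = 0"
  have "\<exists>y\<in>J. y \<in> carrier A \<and> cnorm A (y \<ominus> x) < e" if "e > 0" for e
  proof -
    obtain j where "j \<in> J" "cnorm A (x \<ominus> j) < e" using qnorm_approx[OF x] q \<open>e > 0\<close> by metis
    then show ?thesis using x J_carrier by (auto simp: nrm_mi_commute)
  qed
  then obtain u where "range u \<subseteq> J" "clim A u x" using clim_approx[OF x] by blast
  then show "x \<in> J" using J_closed by (auto simp: closed_in_norm_iff)
next
  assume x: "x \<in> carrier A" "x \<in> J"
  then show "qnorm x = 0" using qnorm_le[OF x] qnorm_nonneg[OF x(1)] by simp
qed

lemma qnorm_triangle:
  assumes "x \<in> carrier A" "y \<in> carrier A"
  shows "qnorm (x \<oplus> y) \<le> qnorm x + qnorm y"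
proof (rule field_le_epsilon)
  fix e :: real assume "e > 0"
  obtain i where i: "i \<in> J" "cnorm A (x \<ominus> i) < qnorm x + e / 2"
    using qnorm_approx[OF assms(1), of "qnorm x + e / 2"] \<open>e > 0\<close> by auto
  obtain j where j: "j \<in> J" "cnorm A (y \<ominus> j) < qnorm y + e / 2"
    using qnorm_approx[OF assms(2), of "qnorm y + e / 2"] \<open>e > 0\<close> by auto
  have "qnorm (x \<oplus> y) \<le> cnorm A ((x \<oplus> y) \<ominus> (i \<oplus> j))"
    using assms J_add i j by (intro qnorm_le) auto
  also have "\<dots> \<le> cnorm A (x \<ominus> i) + cnorm A (y \<ominus> j)"
    using assms i j J_carrier by (simp add: mi_add_add cnorm_triangle)
  finally show "qnorm (x \<oplus> y) \<le> qnorm x + qnorm y + e" using i j by simp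
qed

lemma qnorm_smult_le: "x \<in> carrier A \<Longrightarrow> qnorm (c \<odot>\<^bsub>A\<^esub> x) \<le> cmod c * qnorm x"
proof (rule field_le_epsilon)
  fix e :: real assume x: "x \<in> carrier A" and "e > 0"
  define e' where "e' = e / (cmod c + 1)"
  have p: "cmod c + 1 > 0" by (simp add: add_nonneg_pos)
  then have e': "e' > 0" using \<open>e > 0\<close> by (simp add: e'_def)
  obtain j where j: "j \<in> J" "cnorm A (x \<ominus> j) < qnorm x + e'"
    using qnorm_approx[OF x, of "qnorm x + e'"] e' by auto
  have "qnorm (c \<odot>\<^bsub>A\<^esub> x) \<le> cnorm A (c \<odot>\<^bsub>A\<^esub> x \<ominus> c \<odot>\<^bsub>A\<^esub> j)"
    using x J_smult j by (intro qnorm_le) auto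
  also have "\<dots> = cmod c * cnorm A (x \<ominus> j)"
    using x j J_carrier by (simp add: sm_minus_right[symmetric] cnorm_smult)
  also have "\<dots> \<le> cmod c * (qnorm x + e')"
    using j by (intro mult_left_mono) auto
  also have "\<dots> \<le> cmod c * qnorm x + e"
    using p \<open>e > 0\<close> by (simp add: e'_def field_simps)
  finally show "qnorm (c \<odot>\<^bsub>A\<^esub> x) \<le> cmod c * qnorm x + e" .
qed

lemma qnorm_smult:
  assumes x: "x \<in> carrier A" shows "qnorm (c \<odot>\<^bsub>A\<^esub> x) = cmod c * qnorm x"
proof (cases "c = 0")
  case True
  then show ?thesis using x qnorm_eq_zero[of \<zero>] J_zero by simp
next
  case False
  have "qnorm x \<le> cmod (inverse c) * qnorm (c \<odot>\<^bsub>A\<^esub> x)"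
    using qnorm_smult_le[of "c \<odot>\<^bsub>A\<^esub> x" "inverse c"] x False by (simp add: sm_sm)
  then have "cmod c * qnorm x \<le> qnorm (c \<odot>\<^bsub>A\<^esub> x)"
    using False by (simp add: norm_inverse norm_divide field_simps)
  then show ?thesis using qnorm_smult_le[OF x, of c] by simp
qed

lemma qnorm_cong:
  assumes "x \<in> carrier A" "y \<in> carrier A" "x \<ominus> y \<in> J" shows "qnorm x = qnorm y"
proof -
  have le: "qnorm x \<le> qnorm y" if "x \<in> carrier A" "y \<in> carrier A" "x \<ominus> y \<in> J" for x y
    using qnorm_triangle[of "x \<ominus> y" y] that qnorm_eq_zero[of "x \<ominus> y"] by (simp add: mi_add_cancel)
  have "y \<ominus> x \<in> J" using J_smult[OF assms(3), of "-1"] assms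
    by (simp add: neg_conv_sm[symmetric] mi_swap)
  then show ?thesis using le assms by (simp add: antisym)
qed

text \<open>Replacing both factors by other representatives changes the product only by an element
  of \<open>J\<close>, as the ideal is two-sided. Nearly optimal representatives then give the
  bound.\<close>

lemma qnorm_mult:
  assumes "x \<in> carrier A" "y \<in> carrier A"
  shows "qnorm (x \<otimes> y) \<le> qnorm x * qnorm y"
proof -
  have *: "qnorm (x \<otimes> y) \<le> a * b" if ab: "qnorm x < a" "qnorm y < b" for a b
  proof -
    obtain i where i: "i \<in> J" "cnorm A (x \<ominus> i) < a" using qnorm_approx[OF assms(1) ab(1)] .
    obtain j where j: "j \<in> J" "cnorm A (y \<ominus> j) < b" using qnorm_approx[OF assms(2) ab(2)] .
    note c = assms J_carrier[OF i(1)] J_carrier[OF j(1)]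
    have "x \<otimes> y \<ominus> (x \<ominus> i) \<otimes> (y \<ominus> j) = (x \<otimes> y \<ominus> x \<otimes> (y \<ominus> j)) \<oplus> (x \<otimes> (y \<ominus> j) \<ominus> (x \<ominus> i) \<otimes> (y \<ominus> j))"
      using c by (simp add: mi_trans)
    also have "\<dots> = x \<otimes> (y \<ominus> (y \<ominus> j)) \<oplus> (x \<ominus> (x \<ominus> i)) \<otimes> (y \<ominus> j)"
      using c mi_mult_left[of y "y \<ominus> j" x] mi_mult_right[of x "x \<ominus> i" "y \<ominus> j"] by simp
    also have "y \<ominus> (y \<ominus> j) = j" using c by (simp add: a_minus_def minus_add r_neg2)
    also have "x \<ominus> (x \<ominus> i) = i" using c by (simp add: a_minus_def minus_add r_neg2)
    finally have "x \<otimes> y \<ominus> (x \<ominus> i) \<otimes> (y \<ominus> j) \<in> J"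
      using c i j by (simp add: J_add J_mult)
    then have "qnorm (x \<otimes> y) = qnorm ((x \<ominus> i) \<otimes> (y \<ominus> j))"
      using c by (intro qnorm_cong) auto
    also have "\<dots> \<le> cnorm A ((x \<ominus> i) \<otimes> (y \<ominus> j))" using c by (intro qnorm_le_cnorm) auto
    also have "\<dots> \<le> cnorm A (x \<ominus> i) * cnorm A (y \<ominus> j)" using c by (intro cnorm_mult) auto
    also have "\<dots> \<le> a * b" using i j c by (intro mult_mono') (auto intro: cnorm_nonneg)
    finally show ?thesis .
  qed
  \<comment> \<open>The infima need not be attained, so the strict upper bounds \<open>a\<close> and
    \<open>b\<close> are let down to them along 1/(n+1).\<close>
  have lim: "(\<lambda>n. (qnorm x + inverse (real (Suc n))) * (qnorm y + inverse (real (Suc n))))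
      \<longlonglongrightarrow> (qnorm x + 0) * (qnorm y + 0)"
    by (intro tendsto_intros LIMSEQ_inverse_real_of_nat)
  have "qnorm (x \<otimes> y) \<le> (qnorm x + 0) * (qnorm y + 0)"
    by (rule LIMSEQ_le_const[OF lim]) (intro exI[of _ 0] allI impI *, simp_all)
  then show ?thesis by simp
qed

section \<open>Operations on cosets through representatives\<close>

definition rep where "rep = inv_into (carrier A) \<rho>"

definition quot where "quot = \<lparr>
  carrier = \<rho> ` carrier A,
  monoid.mult = (\<lambda>u v. \<rho> (rep u \<otimes> rep v)),
  one = \<rho> \<one>,
  ring.zero = \<rho> \<zero>,
  add = (\<lambda>u v. \<rho> (rep u \<oplus> rep v)),
  smult = (\<lambda>c u. \<rho> (c \<odot>\<^bsub>A\<^esub> rep u)),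
  star = (\<lambda>u. \<rho> (star A (rep u))),
  cnorm = (\<lambda>u. qnorm (rep u))\<rparr>"

lemma rep:
  assumes "x \<in> carrier A"
  shows "rep (\<rho> x) \<in> carrier A" "\<rho> (rep (\<rho> x)) = \<rho> x" "rep (\<rho> x) \<ominus> x \<in> J"
proof -
  show 1: "rep (\<rho> x) \<in> carrier A" and 2: "\<rho> (rep (\<rho> x)) = \<rho> x"
    unfolding rep_def using assms by (auto intro: inv_into_into f_inv_into_f)
  then show "rep (\<rho> x) \<ominus> x \<in> J" using rho_eq_iff[OF 1 assms] by simp
qed

lemma quot_carrier: "carrier quot = \<rho> ` carrier A"
  by (simp add: quot_def)

lemma quot_mult: "x \<in> carrier A \<Longrightarrow> y \<in> carrier A \<Longrightarrow> \<rho> x \<otimes>\<^bsub>quot\<^esub> \<rho> y = \<rho> (x \<otimes> y)"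
proof -
  assume c: "x \<in> carrier A" "y \<in> carrier A"
  note r = rep[OF c(1)] rep[OF c(2)]
  have "rep (\<rho> x) \<otimes> rep (\<rho> y) \<ominus> x \<otimes> y = rep (\<rho> x) \<otimes> (rep (\<rho> y) \<ominus> y) \<oplus> (rep (\<rho> x) \<ominus> x) \<otimes> y"
    using c r by (simp add: mi_mult_left mi_mult_right mi_trans)
  also have "\<dots> \<in> J" using c r by (intro J_add J_mult) auto
  finally show ?thesis using c r by (simp add: quot_def rho_eq_iff)
qed

lemma quot_add: "x \<in> carrier A \<Longrightarrow> y \<in> carrier A \<Longrightarrow> \<rho> x \<oplus>\<^bsub>quot\<^esub> \<rho> y = \<rho> (x \<oplus> y)"
  using rep[of x] rep[of y] by (simp add: quot_def rho_eq_iff mi_add_add J_add)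

lemma quot_smult: "x \<in> carrier A \<Longrightarrow> c \<odot>\<^bsub>quot\<^esub> \<rho> x = \<rho> (c \<odot>\<^bsub>A\<^esub> x)"
  using rep[of x] by (simp add: quot_def rho_eq_iff sm_minus_right[symmetric] J_smult)

lemma quot_star: "x \<in> carrier A \<Longrightarrow> star quot (\<rho> x) = \<rho> (star A x)"
  using rep[of x] by (simp add: quot_def rho_eq_iff star_minus[symmetric] J_star star_closed)

lemma quot_norm: "x \<in> carrier A \<Longrightarrow> cnorm quot (\<rho> x) = qnorm x"
  using rep[of x] by (simp add: quot_def qnorm_cong)

lemma quot_one: "\<one>\<^bsub>quot\<^esub> = \<rho> \<one>" and quot_zero: "\<zero>\<^bsub>quot\<^esub> = \<rho> \<zero>"
  by (simp_all add: quot_def)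

lemmas quot_simps = quot_carrier quot_mult quot_add quot_smult quot_star quot_norm quot_one quot_zero

lemma normed_module_quot: "normed_module quot"
proof -
  have g: "abelian_group quot"
  proof (rule abelian_groupI)
    fix v assume "v \<in> carrier quot"
    then obtain x where x: "x \<in> carrier A" "v = \<rho> x" by (auto simp: quot_simps)
    then have "\<rho> (\<ominus> x) \<oplus>\<^bsub>quot\<^esub> v = \<zero>\<^bsub>quot\<^esub>" by (simp add: quot_simps l_neg)
    then show "\<exists>y\<in>carrier quot. y \<oplus>\<^bsub>quot\<^esub> v = \<zero>\<^bsub>quot\<^esub>" using x by (auto simp: quot_carrier)
  qed (auto simp: quot_simps a_ac)
  have "Module.module (ring_of_type_algebra :: complex ring) quot"
    by (rule moduleI) (use g in \<open>auto simp: quot_simps sm_add_left sm_add_right sm_sm\<close>)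
  then show ?thesis
    unfolding normed_module_def normed_module_axioms_def
    by (auto simp: quot_simps qnorm_nonneg qnorm_triangle qnorm_smult qnorm_eq_zero rho_eq_iff)
qed

lemma quot_minus: "x \<in> carrier A \<Longrightarrow> y \<in> carrier A \<Longrightarrow> \<rho> x \<ominus>\<^bsub>quot\<^esub> \<rho> y = \<rho> (x \<ominus> y)"
  using normed_module.minus_conv_sm[OF normed_module_quot, of "\<rho> x" "\<rho> y"]
  by (simp add: quot_simps minus_conv_sm)

text \<open>A rapidly convergent subsequence of a Cauchy sequence of cosets lifts to a Cauchy sequence.\<close>
lemma quot_complete: "Metric_space.mcomplete (carrier quot) (cdist quot)"
proof -
  interpret Q: normed_module quot by (rule normed_module_quot)
  have "\<exists>v. clim quot u v" if u: "ccauchy quot u" for u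
  proof -
    have uc: "u n \<in> carrier quot" for n using u by (auto simp: ccauchy_def)
    have "\<exists>N. \<forall>m\<ge>N. \<forall>n\<ge>N. cnorm quot (u m \<ominus>\<^bsub>quot\<^esub> u n) < (1/2) ^ i" for i
      using u by (auto simp: ccauchy_def)
    then obtain M where M: "\<And>i m n. m \<ge> M i \<Longrightarrow> n \<ge> M i \<Longrightarrow> cnorm quot (u m \<ominus>\<^bsub>quot\<^esub> u n) < (1/2) ^ i"
      by metis
    \<comment> \<open>Summing makes \<open>r\<close> dominate \<open>M i\<close> at both stages i
      and i+1, even if \<open>M\<close> is not monotone. Consecutive terms of the subsequence are
      then within the i-th power of 1/2.\<close>
    define r where "r i = (\<Sum>j\<le>i. M j) + i" for i
    have rM: "r i \<ge> M i" "r (Suc i) \<ge> M i" "r i \<ge> i" for i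
      by (auto simp: r_def intro: order_trans[OF member_le_sum[of i "{..i}" M]])
    have "\<exists>z. \<forall>i. (z i \<in> carrier A \<and> \<rho> (z i) = u (r i)) \<and> cnorm A (z (Suc i) \<ominus> z i) \<le> (1/2) ^ i"
    proof (rule dependent_nat_choice)
      show "\<exists>x. x \<in> carrier A \<and> \<rho> x = u (r 0)" using uc[of "r 0"] by (auto simp: quot_carrier)
    next
      fix x i assume x: "x \<in> carrier A \<and> \<rho> x = u (r i)"
      obtain y where y: "y \<in> carrier A" "\<rho> y = u (r (Suc i))" using uc[of "r (Suc i)"] by (auto simp: quot_carrier)
      have "qnorm (y \<ominus> x) < (1/2) ^ i"
        using M[OF rM(2) rM(1), of i] x y quot_norm[of "y \<ominus> x"] quot_minus[of y x] by simp
      \<comment> \<open>A small coset norm bounds some representative of the difference. Moving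
        \<open>j\<close> into the new lift keeps its coset and brings it close to the previous lift
        \<open>x\<close>.\<close>
      then obtain j where j: "j \<in> J" "cnorm A (y \<ominus> x \<ominus> j) < (1/2) ^ i"
        using qnorm_approx[of "y \<ominus> x"] x y by blast
      note c = J_carrier[OF j(1)] x y
      have "y \<ominus> j \<ominus> x = y \<ominus> x \<ominus> j" using c by (simp add: a_minus_def a_ac)
      moreover have "y \<ominus> j \<ominus> y \<in> J"
      proof -
        have "y \<ominus> j \<ominus> y = \<zero> \<ominus> j" using c mi_mi_swap[of y j y \<zero>] by simp
        then show ?thesis using J_minus[OF J_zero j(1)] by simp
      qed
      ultimately show "\<exists>z. (z \<in> carrier A \<and> \<rho> z = u (r (Suc i))) \<and> cnorm A (z \<ominus> x) \<le> (1/2) ^ i"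
        using c j rho_eq_iff[of "y \<ominus> j" y] by (intro exI[of _ "y \<ominus> j"]) auto
    qed
    then obtain z where z: "\<And>i. z i \<in> carrier A" "\<And>i. \<rho> (z i) = u (r i)"
      "\<And>i. cnorm A (z (Suc i) \<ominus> z i) \<le> (1/2) ^ i" by auto
    have "ccauchy A z"
      using z by (intro ccauchy_of_summable_steps[of z "\<lambda>i. (1/2) ^ i"]) (auto simp: summable_geometric)
    then obtain w where w: "clim A z w" using ccauchy_converges by blast
    have wc: "w \<in> carrier A" using climD[OF w] by simp
    then have wq: "\<rho> w \<in> carrier quot" by (simp add: quot_carrier)
    have lim: "(\<lambda>i. (1/2) ^ i + cnorm A (z i \<ominus> w)) \<longlonglongrightarrow> 0 + 0"
      by (intro tendsto_add climD(3)[OF w] LIMSEQ_power_zero) simp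
    have "\<exists>N. \<forall>n\<ge>N. cnorm quot (u n \<ominus>\<^bsub>quot\<^esub> \<rho> w) < e" if e: "e > 0" for e
    proof -
      obtain i where i: "(1/2) ^ i + cnorm A (z i \<ominus> w) < e"
        using LIMSEQ_D[OF lim, of e] e by (metis abs_less_iff add_0 diff_zero order_refl real_norm_def)
      have "cnorm quot (u n \<ominus>\<^bsub>quot\<^esub> \<rho> w) < e" if "n \<ge> M i" for n
      proof -
        have "cnorm quot (u n \<ominus>\<^bsub>quot\<^esub> \<rho> w)
            \<le> cnorm quot (u n \<ominus>\<^bsub>quot\<^esub> u (r i)) + cnorm quot (u (r i) \<ominus>\<^bsub>quot\<^esub> \<rho> w)"
          using uc wc by (intro Q.nrm_mi_triangle) (auto simp: quot_carrier)
        also have "cnorm quot (u (r i) \<ominus>\<^bsub>quot\<^esub> \<rho> w) = qnorm (z i \<ominus> w)"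
          using z wc by (simp add: z(2)[symmetric] quot_minus quot_norm)
        also have "\<dots> \<le> cnorm A (z i \<ominus> w)" using z wc by (intro qnorm_le_cnorm) auto
        finally show ?thesis using M[OF that rM(1)] i by simp
      qed
      then show ?thesis by blast
    qed
    then have "(\<lambda>n. cnorm quot (u n \<ominus>\<^bsub>quot\<^esub> \<rho> w)) \<longlonglongrightarrow> 0"
      using wq by (intro LIMSEQ_I) (simp add: uc Q.nrm_nonneg)
    then show ?thesis using uc wc by (auto simp: clim_def quot_carrier)
  qed
  then show ?thesis by (simp only: Q.mcomplete_iff) blast
qed

lemma qnorm_star_le: "x \<in> carrier A \<Longrightarrow> qnorm (star A x) \<le> qnorm x"
proof (rule qnorm_ge)
  fix j assume x: "x \<in> carrier A" and j: "j \<in> J"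
  have "qnorm (star A x) \<le> cnorm A (star A x \<ominus> star A j)"
    using x j by (intro qnorm_le J_star) (auto simp: star_closed)
  also have "\<dots> = cnorm A (x \<ominus> j)"
    using x j J_carrier by (simp add: star_minus[symmetric] cnorm_star)
  finally show "qnorm (star A x) \<le> cnorm A (x \<ominus> j)" .
qed

text \<open>One inequality is the locale assumption. The other follows from submultiplicativity, the
  star being contractive for the coset norm.\<close>

lemma qnorm_cstar: "x \<in> carrier A \<Longrightarrow> qnorm (star A x \<otimes> x) = (qnorm x)\<^sup>2"
  using qnorm_sq_le[of x] qnorm_mult[of "star A x" x] qnorm_star_le[of x]
    mult_right_mono[of "qnorm (star A x)" "qnorm x" "qnorm x"] qnorm_nonneg[of x]
  by (simp add: star_closed power2_eq_square)

theorem unital_cstar_algebra_quot: "unital_cstar_algebra quot"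
proof -
  interpret Q: normed_module quot by (rule normed_module_quot)
  have "cstar_algebra quot"
    unfolding cstar_algebra_def cstar_algebra_axioms_def
    using Q.module_axioms quot_complete
    by (auto simp: quot_simps m_assoc l_distr r_distr smult_mult_left smult_mult_right
        star_closed star_star star_add star_smult star_mult qnorm_nonneg qnorm_eq_zero rho_eq_iff
        qnorm_triangle qnorm_smult qnorm_mult qnorm_cstar)
  moreover have "monoid quot"
    by (rule monoidI) (auto simp: quot_simps m_assoc)
  ultimately show ?thesis by (simp add: unital_cstar_algebra_def)
qed

lemma rho_star_hom: "\<rho> \<in> star_hom A quot"
  by (auto simp: star_hom_def quot_simps)

end

text \<open>For congruent elements the choice operator selects from the same predicate and returns
  the same representative. Coding that representative by \<open>enc\<close> moves the cosets into
  the type \<open>'b\<close>.\<close>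

lemma (in unital_cstar_algebra) exists_coset_invariant:
  fixes enc :: "'a \<Rightarrow> 'b"
  assumes J: "ideal J A" and enc: "inj_on enc (carrier A)"
  obtains \<rho> :: "'a \<Rightarrow> 'b"
  where "\<And>x y. x \<in> carrier A \<Longrightarrow> y \<in> carrier A \<Longrightarrow> \<rho> x = \<rho> y \<longleftrightarrow> x \<ominus> y \<in> J"
proof -
  interpret J: ideal J A by fact
  define r where "r x = (SOME z. z \<in> carrier A \<and> z \<ominus> x \<in> J)" for x
  have r: "r x \<in> carrier A" "r x \<ominus> x \<in> J" if "x \<in> carrier A" for x
  proof -
    have "x \<in> carrier A \<and> x \<ominus> x \<in> J" using that by simp
    then have "r x \<in> carrier A \<and> r x \<ominus> x \<in> J" unfolding r_def by (rule someI)
    then show "r x \<in> carrier A" "r x \<ominus> x \<in> J" by auto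
  qed
  have tr: "x \<ominus> z \<in> J" if "x \<ominus> y \<in> J" "y \<ominus> z \<in> J" "x \<in> carrier A" "y \<in> carrier A" "z \<in> carrier A" for x y z
    using J.a_closed[OF that(1,2)] that by (simp add: mi_trans)
  have sy: "y \<ominus> x \<in> J" if "x \<ominus> y \<in> J" "x \<in> carrier A" "y \<in> carrier A" for x y
    using J.a_inv_closed[OF that(1)] that by (simp add: mi_swap)
  have "enc (r x) = enc (r y) \<longleftrightarrow> x \<ominus> y \<in> J" if x: "x \<in> carrier A" and y: "y \<in> carrier A" for x y
  proof
    assume "enc (r x) = enc (r y)"
    then have "r x = r y" using enc r x y by (auto dest: inj_onD)
    then show "x \<ominus> y \<in> J" using tr[OF sy[OF r(2)[OF x]]] r x y by metis
  next
    assume xy: "x \<ominus> y \<in> J"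
    have "z \<in> carrier A \<and> z \<ominus> x \<in> J \<longleftrightarrow> z \<in> carrier A \<and> z \<ominus> y \<in> J" for z
      using tr[of z x y] tr[of z y x] sy[OF xy] xy x y by blast
    then show "enc (r x) = enc (r y)" by (simp add: r_def)
  qed
  then show ?thesis using that[of "\<lambda>x. enc (r x)"] by blast
qed

text \<open>\<open>x \<mapsto> \<parallel>x Q\<^sub>m\<parallel>\<close> converges to the quotient norm, and satisfies the C*-identity in the limit.\<close>
lemma (in unital_cstar_algebra) quotient_cstar_identity:
  assumes J: "ideal J A" and x: "x \<in> carrier A"
    and Q: "\<And>m. Q m \<in> carrier A" "\<And>m. star A (Q m) = Q m" "\<And>m. Q m \<otimes> Q m = Q m"
    and QJ: "\<And>m. \<one> \<ominus> Q m \<in> J"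
    and lim: "\<And>j. j \<in> J \<Longrightarrow> (\<lambda>m::nat. cnorm A (j \<otimes> Q m)) \<longlonglongrightarrow> 0"
  shows "(coset_norm A J x)\<^sup>2 \<le> coset_norm A J (star A x \<otimes> x)"
  unfolding coset_norm_def
proof (rule cINF_greatest)
  interpret J: ideal J A by fact
  show ne: "J \<noteq> {}" using J.zero_closed by blast
  fix j assume j: "j \<in> J"
  have jc: "j \<in> carrier A" using j J.a_subset by auto
  have Jc: "i \<in> J \<Longrightarrow> i \<in> carrier A" for i using J.a_subset by auto
  have Q1: "cnorm A (Q m) \<le> 1" for m by (rule projection_norm_le) (use Q in auto)
  have bdd: "bdd_below ((\<lambda>j. cnorm A (x \<ominus> j)) ` J)"
    by (rule bdd_belowI2[where m = 0]) (use x Jc cnorm_nonneg in auto)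
  have inf0: "0 \<le> (INF j\<in>J. cnorm A (x \<ominus> j))"
    by (rule cINF_greatest[OF ne]) (use x Jc cnorm_nonneg in auto)
  have "(INF j\<in>J. cnorm A (x \<ominus> j))\<^sup>2 \<le> cnorm A (star A x \<otimes> x \<ominus> j) + cnorm A (j \<otimes> Q m)" for m
  proof -
    \<comment> \<open>Since \<open>\<one> \<ominus> Q m\<close> lies in \<open>J\<close>, the
      element \<open>x \<otimes> Q m\<close> is a representative of the coset of \<open>x\<close>
      and competes in the infimum.\<close>
    have "x \<ominus> x \<otimes> (\<one> \<ominus> Q m) = x \<otimes> Q m"
      using x Q by (simp add: mi_mult_left) (simp add: a_minus_def minus_add r_neg2)
    moreover have "x \<otimes> (\<one> \<ominus> Q m) \<in> J" using QJ x by (rule J.I_l_closed)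
    ultimately have "(INF j\<in>J. cnorm A (x \<ominus> j)) \<le> cnorm A (x \<otimes> Q m)"
      using cINF_lower[OF bdd, of "x \<otimes> (\<one> \<ominus> Q m)"] by simp
    then have "(INF j\<in>J. cnorm A (x \<ominus> j))\<^sup>2 \<le> (cnorm A (x \<otimes> Q m))\<^sup>2"
      using inf0 by (rule power_mono)
    also have "\<dots> = cnorm A (Q m \<otimes> (star A x \<otimes> x \<otimes> Q m))"
      using x Q by (simp add: cstar_identity[symmetric] star_mult star_closed m_assoc)
    also have "\<dots> \<le> cnorm A (Q m) * cnorm A (star A x \<otimes> x \<otimes> Q m)"
      using x Q by (intro cnorm_mult) (auto simp: star_closed)
    also have "\<dots> \<le> 1 * cnorm A (star A x \<otimes> x \<otimes> Q m)"
      using x Q Q1 by (intro mult_right_mono) (auto simp: star_closed cnorm_nonneg)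
    \<comment> \<open>Inserting an arbitrary \<open>j\<close> costs
      \<open>cnorm A (j \<otimes> Q m)\<close>, and this is what vanishes as \<open>m\<close>
      grows.\<close>
    also have "\<dots> \<le> cnorm A ((star A x \<otimes> x \<ominus> j) \<otimes> Q m) + cnorm A (j \<otimes> Q m)"
      using nrm_le_add_mi[of "star A x \<otimes> x \<otimes> Q m" "j \<otimes> Q m"] x Q jc
      by (simp add: star_closed mi_mult_right)
    also have "cnorm A ((star A x \<otimes> x \<ominus> j) \<otimes> Q m) \<le> cnorm A (star A x \<otimes> x \<ominus> j) * 1"
      using x Q jc Q1 by (intro order_trans[OF cnorm_mult] mult_left_mono) (auto simp: star_closed cnorm_nonneg)
    finally show ?thesis by simp
  qed
  moreover have "(\<lambda>m. cnorm A (star A x \<otimes> x \<ominus> j) + cnorm A (j \<otimes> Q m))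
      \<longlonglongrightarrow> cnorm A (star A x \<otimes> x \<ominus> j) + 0"
    by (intro tendsto_add tendsto_const lim j)
  ultimately have "(INF j\<in>J. cnorm A (x \<ominus> j))\<^sup>2 \<le> cnorm A (star A x \<otimes> x \<ominus> j) + 0"
    by (intro LIMSEQ_le_const) auto
  then show "(INF j\<in>J. cnorm A (x \<ominus> j))\<^sup>2 \<le> cnorm A (star A x \<otimes> x \<ominus> j)" by simp
qed

lemma star_hom_finsum:
  assumes "normed_module A" "normed_module B" "\<phi> \<in> star_hom A B"
    "finite F" "\<And>i. i \<in> F \<Longrightarrow> f i \<in> carrier A"
  shows "\<phi> (finsum A f F) = (\<Oplus>\<^bsub>B\<^esub>i\<in>F. \<phi> (f i))"
proof -
  interpret A: normed_module A by fact
  interpret B: normed_module B by fact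
  note D = star_homD[OF assms(3)]
  show ?thesis using assms(4,5)
  proof (induction F rule: finite_induct)
    case empty
    have "\<phi> (0 \<odot>\<^bsub>A\<^esub> \<zero>\<^bsub>A\<^esub>) = \<zero>\<^bsub>B\<^esub>" using D(1) by (subst D(4)) auto
    then show ?case by simp
  next
    case (insert i F)
    then show ?case using D(1,2) by (simp add: Pi_def)
  qed
qed

section \<open>Coordinate projections and matrix entries\<close>

declare op_algebra_simps(1) [simp del]

lemmas carrier_op_algebra = op_algebra_simps(1)

lemma op_finsum_apply:
  assumes "finite F" "\<And>i. i \<in> F \<Longrightarrow> T i \<in> carrier (op_algebra I)" "f \<in> ell2 I"
  shows "finsum (op_algebra I) T F f = (\<lambda>x. \<Sum>i\<in>F. T i f x)"
proof -
  interpret normed_module "op_algebra I" by (rule normed_module_op_algebra)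
  show ?thesis using assms(1,2)
    by (induction F rule: finite_induct) (use assms(3) in \<open>auto simp: Pi_def\<close>)
qed

definition op_proj :: "'x set \<Rightarrow> 'x set \<Rightarrow> ('x \<Rightarrow> complex) \<Rightarrow> ('x \<Rightarrow> complex)" where
  "op_proj I Z = (\<lambda>f\<in>ell2 I. \<lambda>x. if x \<in> Z then f x else 0)"

lemma op_proj_apply [simp]: "f \<in> ell2 I \<Longrightarrow> op_proj I Z f = (\<lambda>x. if x \<in> Z then f x else 0)"
  by (simp add: op_proj_def)

lemma ell2_restrict:
  assumes "f \<in> ell2 I"
  shows "(\<lambda>x. if x \<in> Z then f x else 0) \<in> ell2 I"
    "ell2_norm I (\<lambda>x. if x \<in> Z then f x else 0) \<le> ell2_norm I f"
proof -
  have le: "(\<Sum>x\<in>F. (cmod (if x \<in> Z then f x else 0))\<^sup>2) \<le> (ell2_norm I f)\<^sup>2"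
    if "finite F" "F \<subseteq> I" for F
  proof -
    have "(\<Sum>x\<in>F. (cmod (if x \<in> Z then f x else 0))\<^sup>2) \<le> (\<Sum>x\<in>F. (cmod (f x))\<^sup>2)"
      by (rule sum_mono) auto
    then show ?thesis using ell2_finite_sum_le[OF assms that] by simp
  qed
  show "(\<lambda>x. if x \<in> Z then f x else 0) \<in> ell2 I"
    "ell2_norm I (\<lambda>x. if x \<in> Z then f x else 0) \<le> ell2_norm I f"
    by (rule ell2_bounded_finite_sums; use le assms in \<open>auto simp: ell2D\<close>)+
qed

lemma ell2_If:
  assumes "f \<in> ell2 I" shows "(\<lambda>x. if R x then f x else 0) \<in> ell2 I"
  using ell2_restrict(1)[OF assms, of "Collect R"] by simp

lemma op_proj_closed [simp]: "op_proj I Z \<in> carrier (op_algebra I)"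
  unfolding op_proj_def carrier_op_algebra
  by (rule bounded_opsI[where M = 1]) (auto simp: ell2_restrict)

lemma op_proj_star: "star (op_algebra I) (op_proj I Z) = op_proj I Z"
  by (rule op_star_eqI)
    (use op_proj_closed in \<open>auto simp: carrier_op_algebra ell2_inner_def intro!: infsum_cong\<close>)

lemma op_eqI:
  assumes "T \<in> carrier (op_algebra I)" "U \<in> carrier (op_algebra I)"
    "\<And>f b. f \<in> ell2 I \<Longrightarrow> b \<in> I \<Longrightarrow> T f b = U f b"
  shows "T = U"
proof (rule bounded_ops_eqI)
  show "T \<in> bounded_ops I" "U \<in> bounded_ops I" using assms by (auto simp: carrier_op_algebra)
  then show "T f = U f" if "f \<in> ell2 I" for f
    using assms(3)[OF that] that ell2D[OF bounded_opsD(1)] by (metis ext)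
qed

lemma op_apply_ell2: "T \<in> carrier (op_algebra I) \<Longrightarrow> f \<in> ell2 I \<Longrightarrow> T f \<in> ell2 I"
  by (simp add: carrier_op_algebra bounded_opsD)

lemma op_proj_norm_le: "cnorm (op_algebra I) (op_proj I Z) \<le> 1"
proof -
  interpret unital_cstar_algebra "op_algebra I" by (rule unital_cstar_algebra_op_algebra)
  show ?thesis
    by (rule projection_norm_le) (auto simp: op_proj_star ell2_restrict intro!: op_eqI[of _ I])
qed

text \<open>A bounded operator is determined by its matrix, and for a countable index set the pairs
  of indices can be enumerated. This brings operators, and later their cosets, into the type over
  which the universal property quantifies.\<close>

lemma inj_on_matrix_entries:
  assumes "countable I"
  obtains enc :: "(('x \<Rightarrow> complex) \<Rightarrow> ('x \<Rightarrow> complex)) \<Rightarrow> nat \<Rightarrow> complex"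
  where "inj_on enc (bounded_ops I)"
proof -
  define e where "e = from_nat_into I"
  define enc where "enc T p = T (chi (e (fst (prod_decode p)))) (e (snd (prod_decode p)))"
    for T :: "('x \<Rightarrow> complex) \<Rightarrow> ('x \<Rightarrow> complex)" and p
  have "T = U" if TU: "T \<in> bounded_ops I" "U \<in> bounded_ops I" and eq: "enc T = enc U" for T U
  proof (rule bounded_ops_eq_chiI[OF TU])
    fix a assume a: "a \<in> I"
    have "T (chi a) b = U (chi a) b" if b: "b \<in> I" for b
    proof -
      obtain p q where "e p = a" "e q = b"
        using from_nat_into_surj[OF assms] a b unfolding e_def by metis
      then show ?thesis using fun_cong[OF eq, of "prod_encode (p, q)"] by (simp add: enc_def)
    qed
    then show "T (chi a) = U (chi a)"
      using ell2D[OF bounded_opsD(1)[OF TU(1) chi_in_ell2[OF a]]]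
        ell2D[OF bounded_opsD(1)[OF TU(2) chi_in_ell2[OF a]]] by (metis ext)
  qed
  then have "inj_on enc (bounded_ops I)" by (auto intro: inj_onI)
  then show ?thesis by (rule that)
qed

section \<open>The standard row isometries\<close>

locale lambda_tuple =
  fixes k :: nat and n :: "nat \<Rightarrow> nat" and lam :: "nat \<Rightarrow> nat \<Rightarrow> nat \<Rightarrow> nat \<Rightarrow> complex"
  assumes lam_mod: "\<lbrakk>i \<in> {1..k}; j \<in> {1..k}; i \<noteq> j; s \<in> {1..n i}; t \<in> {1..n j}\<rbrakk>
      \<Longrightarrow> cmod (lam i j s t) = 1"
    and lam_sym: "\<lbrakk>i \<in> {1..k}; j \<in> {1..k}; i \<noteq> j; s \<in> {1..n i}; t \<in> {1..n j}\<rbrakk>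
      \<Longrightarrow> lam j i t s = cnj (lam i j s t)"
begin

abbreviation WT where "WT \<equiv> word_tuples k n"
abbreviation B where "B \<equiv> op_algebra WT"
abbreviation C where "C \<equiv> std_cstar_algebra k n lam"
abbreviation S where "S \<equiv> std_isometry k n lam"
abbreviation J where "J \<equiv> closed_ideal_generated C (defect_projection k n lam ` {1..k})"

text \<open>The scalar of \<open>S i s\<close> at the basis vector of \<open>a\<close>. Only
  components before \<open>i\<close> enter, so adding or removing a letter in component
  \<open>i\<close> does not change it; the formulas for \<open>S\<close> and \<open>S_star\<close>
  both rely on this.\<close>

definition phase where "phase i s a = (\<Prod>j\<in>{1..<i}. lam_word lam i j s (a j))"

text \<open>The adjoint of \<open>S i s\<close> in coordinates, see \<open>star_S\<close>. On basis
  vectors it removes the leading letter \<open>s\<close> of component \<open>i\<close>, which in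
  coordinates means reading \<open>f\<close> at the tuple with \<open>s\<close> prepended.\<close>

definition S_star where "S_star i s = (\<lambda>f\<in>ell2 WT. \<lambda>b.
  if b \<in> WT then cnj (phase i s b) * f (b(i := s # b i)) else 0)"

lemma S_apply: "f \<in> ell2 WT \<Longrightarrow> S i s f b =
    (if b \<in> WT \<and> b i \<noteq> [] \<and> hd (b i) = s then phase i s b * f (b(i := tl (b i))) else 0)"
  by (simp add: std_isometry_def phase_def)

lemma S_star_apply: "f \<in> ell2 WT \<Longrightarrow> S_star i s f b =
    (if b \<in> WT then cnj (phase i s b) * f (b(i := s # b i)) else 0)"
  by (simp add: S_star_def)

lemma WT_letters: "a \<in> WT \<Longrightarrow> i \<in> {1..k} \<Longrightarrow> set (a i) \<subseteq> {1..n i}"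
  by (auto simp: word_tuples_def PiE_iff)

lemma WT_Cons: "a \<in> WT \<Longrightarrow> i \<in> {1..k} \<Longrightarrow> s \<in> {1..n i} \<Longrightarrow> a(i := s # a i) \<in> WT"
  by (auto simp: word_tuples_def PiE_iff extensional_def)

lemma WT_tl: "a \<in> WT \<Longrightarrow> i \<in> {1..k} \<Longrightarrow> a(i := tl (a i)) \<in> WT"
proof -
  assume a: "a \<in> WT" and i: "i \<in> {1..k}"
  have "tl (a i) \<in> lists {1..n i}"
    using WT_letters[OF a i] by (cases "a i") auto
  then show ?thesis using a i by (simp add: word_tuples_def PiE_iff extensional_def)
qed

lemma WT_hd: "a \<in> WT \<Longrightarrow> i \<in> {1..k} \<Longrightarrow> a i \<noteq> [] \<Longrightarrow> hd (a i) \<in> {1..n i}"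
  using WT_letters hd_in_set by blast

lemma phase_mod:
  assumes "a \<in> WT" "i \<in> {1..k}" "s \<in> {1..n i}" shows "cmod (phase i s a) = 1"
proof -
  have w: "cmod (lam_word lam i j s w) = 1" if "j \<in> {1..<i}" "set w \<subseteq> {1..n j}" for j w
    using that(2)
  proof (induction w)
    case (Cons t w)
    then show ?case using lam_mod[of i j s t] assms that(1) by (auto simp: lam_word_def norm_mult)
  qed (simp add: lam_word_def)
  have "cmod (phase i s a) = (\<Prod>j\<in>{1..<i}. cmod (lam_word lam i j s (a j)))"
    by (simp add: phase_def prod_norm)
  also have "\<dots> = 1" using assms by (intro prod.neutral ballI w WT_letters) auto
  finally show ?thesis .
qed

lemma phase_cnj:
  assumes "a \<in> WT" "i \<in> {1..k}" "s \<in> {1..n i}"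
  shows "phase i s a * cnj (phase i s a) = 1" "cnj (phase i s a) * phase i s a = 1"
  using phase_mod[OF assms] complex_norm_square[of "phase i s a"] by (simp_all add: mult.commute)

lemma phase_upd_ge [simp]: "i \<le> j \<Longrightarrow> phase i s (a(j := w)) = phase i s a"
  unfolding phase_def by (rule prod.cong) auto

text \<open>A letter \<open>t\<close> in an earlier component \<open>j\<close> is passed by
  \<open>s\<close> exactly once. This single factor is the origin of all commutation scalars
  below.\<close>

lemma phase_Cons:
  assumes "1 \<le> j" "j < i"
  shows "phase i s (a(j := t # w)) = lam i j s t * phase i s (a(j := w))"
proof -
  have "phase i s (a(j := v)) = lam_word lam i j s v * (\<Prod>l\<in>{1..<i} - {j}. lam_word lam i l s (a l))" for v
  proof -
    have "phase i s (a(j := v)) = lam_word lam i j s v * (\<Prod>l\<in>{1..<i} - {j}. lam_word lam i l s ((a(j := v)) l))"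
      unfolding phase_def using assms by (subst prod.remove[of _ j]) auto
    also have "(\<Prod>l\<in>{1..<i} - {j}. lam_word lam i l s ((a(j := v)) l)) = (\<Prod>l\<in>{1..<i} - {j}. lam_word lam i l s (a l))"
      by (rule prod.cong) auto
    finally show ?thesis .
  qed
  then show ?thesis by (simp add: lam_word_def)
qed

lemma S_ell2:
  assumes i: "i \<in> {1..k}" "s \<in> {1..n i}" and f: "f \<in> ell2 WT"
  shows "S i s f \<in> ell2 WT" "ell2_norm WT (S i s f) \<le> ell2_norm WT f"
proof -
  have le: "(\<Sum>b\<in>F. (cmod (S i s f b))\<^sup>2) \<le> (ell2_norm WT f)\<^sup>2" if F: "finite F" "F \<subseteq> WT" for F
  proof -
    define F' where "F' = {b \<in> F. b i \<noteq> [] \<and> hd (b i) = s}"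
    define d where "d b = b(i := tl (b i))" for b :: "nat \<Rightarrow> nat list"
    have "b = (d b)(i := s # d b i)" if "b \<in> F'" for b
      using that by (auto simp: F'_def d_def)
    then have inj: "inj_on d F'" by (metis inj_onI)
    have "(\<Sum>b\<in>F. (cmod (S i s f b))\<^sup>2) = (\<Sum>b\<in>F'. (cmod (f (d b)))\<^sup>2)"
      using F f i by (intro sum.mono_neutral_cong_right)
        (auto simp: F'_def d_def S_apply norm_mult phase_mod)
    also have "\<dots> = (\<Sum>b\<in>d ` F'. (cmod (f b))\<^sup>2)" by (simp add: sum.reindex[OF inj])
    also have "\<dots> \<le> (ell2_norm WT f)\<^sup>2"
      using F f i by (intro ell2_finite_sum_le) (auto simp: F'_def d_def WT_tl)
    finally show ?thesis .
  qed
  show "S i s f \<in> ell2 WT" "ell2_norm WT (S i s f) \<le> ell2_norm WT f"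
    by (rule ell2_bounded_finite_sums; use le f in \<open>auto simp: S_apply\<close>)+
qed

lemma S_star_ell2:
  assumes i: "i \<in> {1..k}" "s \<in> {1..n i}" and f: "f \<in> ell2 WT"
  shows "S_star i s f \<in> ell2 WT" "ell2_norm WT (S_star i s f) \<le> ell2_norm WT f"
proof -
  have le: "(\<Sum>b\<in>F. (cmod (S_star i s f b))\<^sup>2) \<le> (ell2_norm WT f)\<^sup>2" if F: "finite F" "F \<subseteq> WT" for F
  proof -
    define d where "d b = b(i := s # b i)" for b :: "nat \<Rightarrow> nat list"
    have "b = (d b)(i := tl (d b i))" for b by (auto simp: d_def)
    then have inj: "inj_on d F" by (metis inj_onI)
    have "(\<Sum>b\<in>F. (cmod (S_star i s f b))\<^sup>2) = (\<Sum>b\<in>F. (cmod (f (d b)))\<^sup>2)"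
      using F f i by (intro sum.cong) (auto simp: d_def S_star_apply norm_mult phase_mod)
    also have "\<dots> = (\<Sum>b\<in>d ` F. (cmod (f b))\<^sup>2)" by (simp add: sum.reindex[OF inj])
    also have "\<dots> \<le> (ell2_norm WT f)\<^sup>2"
      using F f i by (intro ell2_finite_sum_le) (auto simp: d_def intro: WT_Cons)
    finally show ?thesis .
  qed
  show "S_star i s f \<in> ell2 WT" "ell2_norm WT (S_star i s f) \<le> ell2_norm WT f"
    by (rule ell2_bounded_finite_sums; use le f in \<open>auto simp: S_star_apply\<close>)+
qed

lemma S_closed [simp]:
  assumes "i \<in> {1..k}" "s \<in> {1..n i}" shows "S i s \<in> carrier B"
proof -
  have "(\<lambda>f\<in>ell2 WT. S i s f) \<in> bounded_ops WT"
    by (rule bounded_opsI[where M = 1])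
      (use assms in \<open>auto simp: S_ell2 S_apply ell2_add ell2_cmult algebra_simps fun_eq_iff\<close>)
  moreover have "(\<lambda>f\<in>ell2 WT. S i s f) = S i s" by (auto simp: std_isometry_def)
  ultimately show ?thesis by (simp add: carrier_op_algebra)
qed

lemma S_star_closed [simp]:
  assumes "i \<in> {1..k}" "s \<in> {1..n i}" shows "S_star i s \<in> carrier B"
proof -
  have "(\<lambda>f\<in>ell2 WT. S_star i s f) \<in> bounded_ops WT"
    by (rule bounded_opsI[where M = 1])
      (use assms in \<open>auto simp: S_star_ell2 S_star_apply ell2_add ell2_cmult algebra_simps fun_eq_iff\<close>)
  moreover have "(\<lambda>f\<in>ell2 WT. S_star i s f) = S_star i s" by (auto simp: S_star_def)
  ultimately show ?thesis by (simp add: carrier_op_algebra)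
qed

lemma star_S:
  assumes i: "i \<in> {1..k}" "s \<in> {1..n i}" shows "star B (S i s) = S_star i s"
proof (rule op_star_eqI)
  show "S_star i s \<in> bounded_ops WT" using S_star_closed[OF i] by (simp add: carrier_op_algebra)
  fix f g assume f: "f \<in> ell2 WT" and g: "g \<in> ell2 WT"
  \<comment> \<open>Prepending \<open>s\<close> is a bijection from all tuples onto those whose i-th
    word starts with \<open>s\<close>, and outside the latter \<open>S i s f\<close> vanishes. The
    inner product is reindexed along it.\<close>
  define d where "d b = b(i := s # b i)" for b :: "nat \<Rightarrow> nat list"
  have dd: "(d b)(i := tl (d b i)) = b" for b by (auto simp: d_def)
  then have inj: "inj_on d WT" by (metis inj_onI)
  have im: "b \<in> d ` WT" if "b \<in> WT" "b i \<noteq> []" "hd (b i) = s" for b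
  proof -
    have "b = d (b(i := tl (b i)))" using that by (auto simp: d_def)
    then show ?thesis using WT_tl[OF that(1) i(1)] by blast
  qed
  have dW: "d b \<in> WT" if "b \<in> WT" for b using WT_Cons[OF that i] by (simp add: d_def)
  have "ell2_inner WT (S i s f) g = (\<Sum>\<^sub>\<infinity>b\<in>d ` WT. S i s f b * cnj (g b))"
    unfolding ell2_inner_def using im dW f
    by (intro infsum_cong_neutral) (auto simp: S_apply)
  also have "\<dots> = (\<Sum>\<^sub>\<infinity>b\<in>WT. S i s f (d b) * cnj (g (d b)))"
    by (simp add: infsum_reindex[OF inj] o_def)
  also have "\<dots> = ell2_inner WT f (S_star i s g)"
    unfolding ell2_inner_def
  proof (rule infsum_cong)
    fix b assume b: "b \<in> WT"
    have "S i s f (d b) = phase i s b * f b"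
      using dW[OF b] dd[of b] f by (simp add: S_apply) (simp add: d_def)
    then show "S i s f (d b) * cnj (g (d b)) = f b * cnj (S_star i s g b)"
      using b g by (simp add: S_star_apply d_def)
  qed
  finally show "ell2_inner WT (S i s f) g = ell2_inner WT f (S_star i s g)" .
qed

sublocale B: unital_cstar_algebra B
  by (rule unital_cstar_algebra_op_algebra)

lemma S_star_S_same:
  assumes i: "i \<in> {1..k}" "s \<in> {1..n i}" "t \<in> {1..n i}"
  shows "S_star i s \<otimes>\<^bsub>B\<^esub> S i t = (if s = t then \<one>\<^bsub>B\<^esub> else \<zero>\<^bsub>B\<^esub>)"
  by (rule op_eqI[of _ WT])
    (use i in \<open>auto simp: S_star_apply S_apply S_ell2 WT_Cons mult.assoc[symmetric] phase_cnj\<close>)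

text \<open>Both sides read \<open>f\<close> at the same tuple, so only scalars are compared.
  Exactly one of the two phases sees the other component: that of \<open>i\<close> if j < i, that of
  \<open>j\<close> if i < j, where the factor appears with the indices exchanged and
  \<open>lam_sym\<close> conjugates it.\<close>

lemma S_star_S_diff:
  assumes i: "i \<in> {1..k}" "s \<in> {1..n i}" and j: "j \<in> {1..k}" "t \<in> {1..n j}" and ij: "i \<noteq> j"
  shows "S_star i s \<otimes>\<^bsub>B\<^esub> S j t = cnj (lam i j s t) \<odot>\<^bsub>B\<^esub> (S j t \<otimes>\<^bsub>B\<^esub> S_star i s)"
proof (rule op_eqI[of _ WT])
  fix f b assume f: "f \<in> ell2 WT" and b: "b \<in> WT"
  define a where "a = b(j := tl (b j))"
  show "(S_star i s \<otimes>\<^bsub>B\<^esub> S j t) f b = (cnj (lam i j s t) \<odot>\<^bsub>B\<^esub> (S j t \<otimes>\<^bsub>B\<^esub> S_star i s)) f b"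
  proof (cases "b j \<noteq> [] \<and> hd (b j) = t")
    case True
    have ba: "b = b(j := t # tl (b j))" using True by auto
    have tw: "b(i := s # b i, j := tl (b j)) = b(j := tl (b j), i := s # b i)"
      using ij by (simp add: fun_upd_twist)
    have L: "(S_star i s \<otimes>\<^bsub>B\<^esub> S j t) f b
      = cnj (phase i s b) * (phase j t (b(i := s # b i)) * f (b(j := tl (b j), i := s # b i)))"
      using f b i j ij True by (simp add: S_star_apply S_apply S_ell2 WT_Cons tw)
    have R: "(S j t \<otimes>\<^bsub>B\<^esub> S_star i s) f b
      = phase j t b * (cnj (phase i s (b(j := tl (b j)))) * f (b(j := tl (b j), i := s # b i)))"
      using f b i j ij True by (simp add: S_star_apply S_apply S_star_ell2 WT_tl)
    have "cnj (phase i s b) * phase j t (b(i := s # b i))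
      = cnj (lam i j s t) * (phase j t b * cnj (phase i s (b(j := tl (b j)))))"
    proof (cases "j < i")
      case True
      have "phase i s b = lam i j s t * phase i s (b(j := tl (b j)))"
        by (subst ba, subst phase_Cons) (use True j in auto)
      then show ?thesis using True by simp
    next
      case False
      then have "i < j" using ij by simp
      then have "phase j t (b(i := s # b i)) = lam j i t s * phase j t b"
        using phase_Cons[of i j t b s "b i"] i by simp
      then show ?thesis using \<open>i < j\<close> lam_sym[of i j s t] i j ij by simp
    qed
    then show ?thesis using L R f by (simp add: mult.assoc)
  next
    case False
    then show ?thesis using f b i j ij by (auto simp: S_star_apply S_apply S_ell2 S_star_ell2 WT_Cons)
  qed
qed (use i j in auto)

section \<open>The algebra generated by the row isometries, as a subalgebra of all bounded
  operators\<close>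

lemma C_eq: "C = B\<lparr>carrier := cstar_generated B {S i s |i s. i \<in> {1..k} \<and> s \<in> {1..n i}}\<rparr>"
  by (simp add: std_cstar_algebra_def Let_def)

lemma C_subalgebra: "unital_cstar_subalgebra B (carrier C)"
  unfolding C_eq by (simp, rule B.unital_cstar_subalgebra_generated) auto

sublocale C: unital_cstar_algebra C
  using B.unital_cstar_algebra_restrict[OF C_subalgebra] by (simp add: C_eq)

lemma C_simps [simp]:
  "monoid.mult C = monoid.mult B" "one C = one B" "ring.zero C = ring.zero B" "add C = add B"
  "smult C = smult B" "star C = star B" "cnorm C = cnorm B"
  by (simp_all add: C_eq)

lemma C_restrict: "C = B\<lparr>carrier := carrier C\<rparr>"
  by (simp add: C_eq)

lemma C_sub: "x \<in> carrier C \<Longrightarrow> x \<in> carrier B"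
  using B.unital_cstar_subalgebraD(1)[OF C_subalgebra] by auto

lemma C_minus: "x \<in> carrier C \<Longrightarrow> y \<in> carrier C \<Longrightarrow> x \<ominus>\<^bsub>C\<^esub> y = x \<ominus>\<^bsub>B\<^esub> y"
  by (simp add: B.minus_conv_sm C.minus_conv_sm C_sub)

lemma C_finsum: "finite F \<Longrightarrow> (\<And>i. i \<in> F \<Longrightarrow> f i \<in> carrier C) \<Longrightarrow> finsum C f F = finsum B f F"
  using finsum_restrict[of B "carrier C" F f] C_restrict C_sub B.normed_module_axioms C.normed_module_axioms
  by (metis subsetI)

lemma C_clim: "clim C u x \<longleftrightarrow> range u \<subseteq> carrier C \<and> x \<in> carrier C \<and> clim B u x"
  using clim_restrict[of B "carrier C" u x] C_restrict C_sub B.normed_module_axioms C.normed_module_axioms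
  by (metis subsetI)

lemma S_C [simp]: "i \<in> {1..k} \<Longrightarrow> s \<in> {1..n i} \<Longrightarrow> S i s \<in> carrier C"
  unfolding C_eq using B.cstar_generated_incl[of "{S i s |i s. i \<in> {1..k} \<and> s \<in> {1..n i}}"] by auto

lemma S_star_C [simp]: "i \<in> {1..k} \<Longrightarrow> s \<in> {1..n i} \<Longrightarrow> S_star i s \<in> carrier C"
  using C.star_closed[of "S i s"] by (simp add: star_S)

text \<open>Plays the role of induction over noncommutative polynomials followed by a passage to
  limits.\<close>

lemma C_induct:
  assumes "unital_cstar_subalgebra B D" "\<And>i s. i \<in> {1..k} \<Longrightarrow> s \<in> {1..n i} \<Longrightarrow> S i s \<in> D"
  shows "carrier C \<subseteq> D"
proof -
  have "{S i s |i s. i \<in> {1..k} \<and> s \<in> {1..n i}} \<subseteq> D" using assms(2) by blast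
  then show ?thesis using B.cstar_generated_minimal[OF assms(1)] by (simp add: C_eq)
qed

section \<open>The defect ideal\<close>

text \<open>By \<open>defect_projection_eq\<close> this is the i-th defect projection: the ranges of
  the \<open>S i s\<close> fill out the basis vectors whose i-th word is nonempty.\<close>

definition P where "P i = op_proj WT {b. b i = []}"

lemma row_sum:
  assumes "i \<in> {1..k}" "T \<in> carrier B" "f \<in> ell2 WT" "b \<in> WT"
  shows "(\<Oplus>\<^bsub>B\<^esub>s\<in>{1..n i}. S i s \<otimes>\<^bsub>B\<^esub> (T \<otimes>\<^bsub>B\<^esub> S_star i s)) f b
    = (if b i = [] then 0 else phase i (hd (b i)) b * T (S_star i (hd (b i)) f) (b(i := tl (b i))))"
proof -
  have "(\<Oplus>\<^bsub>B\<^esub>s\<in>{1..n i}. S i s \<otimes>\<^bsub>B\<^esub> (T \<otimes>\<^bsub>B\<^esub> S_star i s)) f b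
    = (\<Sum>s\<in>{1..n i}. S i s (T (S_star i s f)) b)"
    using assms by (subst op_finsum_apply) (auto simp: S_star_ell2 op_apply_ell2)
  also have "\<dots> = (\<Sum>s\<in>{1..n i}. if s = hd (b i) then
      (if b i = [] then 0 else phase i s b * T (S_star i s f) (b(i := tl (b i)))) else 0)"
    using assms by (intro sum.cong) (auto simp: S_apply S_star_ell2 op_apply_ell2)
  also have "\<dots> = (if b i = [] then 0 else phase i (hd (b i)) b * T (S_star i (hd (b i)) f) (b(i := tl (b i))))"
    using WT_hd[OF assms(4,1)] by (cases "b i = []") (auto simp: sum.delta)
  finally show ?thesis .
qed

text \<open>Only the first letter of the i-th word contributes, and the phases of \<open>S\<close>
  and \<open>S_star\<close> cancel, so the row carries coordinate projections to coordinate
  projections. With \<open>Z\<close> everything it computes the defects; with \<open>Z\<close> a set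
  of short words it drives the induction in \<open>one_minus_Q_single\<close>.\<close>

lemma row_sum_proj:
  assumes i: "i \<in> {1..k}" and f: "f \<in> ell2 WT" and b: "b \<in> WT"
  shows "(\<Oplus>\<^bsub>B\<^esub>s\<in>{1..n i}. S i s \<otimes>\<^bsub>B\<^esub> (op_proj WT Z \<otimes>\<^bsub>B\<^esub> S_star i s)) f b
    = (if b i \<noteq> [] \<and> b(i := tl (b i)) \<in> Z then f b else 0)"
proof (cases "b i = []")
  case False
  have "b(i := hd (b i) # tl (b i)) = b" using False by simp
  then show ?thesis
    using WT_hd[OF b i False] WT_tl[OF b i] i f b False
    by (subst row_sum) (auto simp: S_star_apply S_star_ell2 mult.assoc[symmetric] phase_cnj)
qed (use assms row_sum in simp)

lemma defect_projection_eq: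
  assumes i: "i \<in> {1..k}" shows "defect_projection k n lam i = P i"
    "\<one>\<^bsub>C\<^esub> \<ominus>\<^bsub>C\<^esub> (\<Oplus>\<^bsub>C\<^esub>s\<in>{1..n i}. S i s \<otimes>\<^bsub>C\<^esub> star C (S i s)) = P i"
proof -
  define R where "R = (\<Oplus>\<^bsub>C\<^esub>s\<in>{1..n i}. S i s \<otimes>\<^bsub>C\<^esub> star C (S i s))"
  have RC: "R \<in> carrier C" unfolding R_def
    using i C.m_closed by (intro C.finsum_closed) (auto simp: star_S simp flip: C_simps(1))
  have "R = (\<Oplus>\<^bsub>B\<^esub>s\<in>{1..n i}. S i s \<otimes>\<^bsub>B\<^esub> star B (S i s))"
    unfolding R_def using i C.m_closed by (subst C_finsum) (auto simp: star_S simp flip: C_simps(1))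
  also have "\<dots> = (\<Oplus>\<^bsub>B\<^esub>s\<in>{1..n i}. S i s \<otimes>\<^bsub>B\<^esub> (op_proj WT UNIV \<otimes>\<^bsub>B\<^esub> S_star i s))"
  proof (rule B.finsum_cong')
    have "op_proj WT UNIV = \<one>\<^bsub>B\<^esub>" by (rule op_eqI[of _ WT]) auto
    then show "S i s \<otimes>\<^bsub>B\<^esub> star B (S i s) = S i s \<otimes>\<^bsub>B\<^esub> (op_proj WT UNIV \<otimes>\<^bsub>B\<^esub> S_star i s)"
      if "s \<in> {1..n i}" for s
      using that i by (simp add: star_S)
  qed (use i in auto)
  finally have R: "R = (\<Oplus>\<^bsub>B\<^esub>s\<in>{1..n i}. S i s \<otimes>\<^bsub>B\<^esub> (op_proj WT UNIV \<otimes>\<^bsub>B\<^esub> S_star i s))" .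
  have "\<one>\<^bsub>C\<^esub> \<ominus>\<^bsub>C\<^esub> R = \<one>\<^bsub>B\<^esub> \<ominus>\<^bsub>B\<^esub> R"
    using RC C.one_closed by (subst C_minus) auto
  also have "\<dots> = P i"
  proof (rule op_eqI[of _ WT])
    fix f b assume f: "f \<in> ell2 WT" and b: "b \<in> WT"
    show "(\<one>\<^bsub>B\<^esub> \<ominus>\<^bsub>B\<^esub> R) f b = P i f b"
      using op_minus_apply[of "\<one>\<^bsub>B\<^esub>" WT R f] C_sub[OF RC] B.one_closed f row_sum_proj[OF i f b, of UNIV]
      by (simp add: carrier_op_algebra R P_def)
  qed (use C_sub[OF RC] in \<open>auto simp: P_def\<close>)
  finally show "\<one>\<^bsub>C\<^esub> \<ominus>\<^bsub>C\<^esub> (\<Oplus>\<^bsub>C\<^esub>s\<in>{1..n i}. S i s \<otimes>\<^bsub>C\<^esub> star C (S i s)) = P i"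
    unfolding R_def .
  then show "defect_projection k n lam i = P i"
    by (simp only: defect_projection_def Let_def)
qed

lemma P_C: "i \<in> {1..k} \<Longrightarrow> P i \<in> carrier C"
proof -
  assume i: "i \<in> {1..k}"
  have "(\<Oplus>\<^bsub>C\<^esub>s\<in>{1..n i}. S i s \<otimes>\<^bsub>C\<^esub> star C (S i s)) \<in> carrier C"
    using i S_C C.star_closed C.m_closed by (intro C.finsum_closed) blast
  then show ?thesis
    unfolding defect_projection_eq(2)[OF i, symmetric] by (rule C.mi_closed[OF C.one_closed])
qed

lemma defects_C: "defect_projection k n lam ` {1..k} \<subseteq> carrier C"
  using P_C defect_projection_eq(1) by auto

lemma J_ideal: "ideal J C" and J_closed: "closed_in_norm C J"
  by (rule C.closed_ideal_generated_ideal[OF defects_C] C.closed_ideal_generated_closed[OF defects_C])+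

lemma J_star: "x \<in> J \<Longrightarrow> star C x \<in> J"
  by (rule C.closed_ideal_generated_star[OF defects_C])
    (auto simp: defect_projection_eq P_def op_proj_star)

lemma P_J: "i \<in> {1..k} \<Longrightarrow> P i \<in> J"
  using C.closed_ideal_generated_incl[of "defect_projection k n lam ` {1..k}"] defect_projection_eq(1)
  by (metis image_subset_iff)

section \<open>Elements of the ideal decay on long words\<close>

definition min_length where "min_length m b \<longleftrightarrow> (\<forall>i\<in>{1..k}. m \<le> length (b i))"
  for b :: "nat \<Rightarrow> nat list"

definition Q where "Q m = op_proj WT (Collect (min_length m))"

text \<open>The closed set that will be shown to contain \<open>J\<close>. Stability under left
  factors is immediate for all of \<open>B\<close>; right factors have to come from
  \<open>C\<close>, since they must not shorten words too much.\<close>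

definition N where "N = {x \<in> carrier B. (\<lambda>m. cnorm B (x \<otimes>\<^bsub>B\<^esub> Q m)) \<longlonglongrightarrow> 0}"

lemma Q_closed [simp]: "Q m \<in> carrier B"
  by (simp add: Q_def)

lemma Q_apply: "f \<in> ell2 WT \<Longrightarrow> Q m f = (\<lambda>b. if min_length m b then f b else 0)"
  by (simp add: Q_def)

text \<open>Expresses through coordinates that \<open>V\<close> maps the range of \<open>Q m\<close>
  into that of \<open>Q l\<close>.\<close>

lemma Q_absorb:
  assumes V: "V \<in> carrier B"
    and z: "\<And>f b. f \<in> ell2 WT \<Longrightarrow> b \<in> WT \<Longrightarrow> \<not> min_length l b \<Longrightarrow> V (Q m f) b = 0"
  shows "V \<otimes>\<^bsub>B\<^esub> Q m = Q l \<otimes>\<^bsub>B\<^esub> (V \<otimes>\<^bsub>B\<^esub> Q m)"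
proof (rule op_eqI[of _ WT])
  fix f b assume f: "f \<in> ell2 WT" and b: "b \<in> WT"
  have "Q m f \<in> ell2 WT" "V (Q m f) \<in> ell2 WT"
    using f V op_apply_ell2[OF Q_closed] op_apply_ell2[OF V] by blast+
  then show "(V \<otimes>\<^bsub>B\<^esub> Q m) f b = (Q l \<otimes>\<^bsub>B\<^esub> (V \<otimes>\<^bsub>B\<^esub> Q m)) f b"
    using f b z by (simp add: Q_apply[of "V (Q m f)"])
qed (use V in auto)

lemma Q_S:
  assumes i: "i \<in> {1..k}" "s \<in> {1..n i}"
  shows "S i s \<otimes>\<^bsub>B\<^esub> Q m = Q m \<otimes>\<^bsub>B\<^esub> (S i s \<otimes>\<^bsub>B\<^esub> Q m)"
proof (rule Q_absorb)
  fix f b assume f: "f \<in> ell2 WT" and b: "b \<in> WT" "\<not> min_length m b"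
  have "m \<le> length (b j)" if "m \<le> length ((b(i := tl (b i))) j)" for j
    using that by (cases "j = i") auto
  then have "\<not> min_length m (b(i := tl (b i)))" using b unfolding min_length_def by blast
  then show "S i s (Q m f) b = 0"
    using op_apply_ell2[OF Q_closed f] f by (simp add: S_apply Q_apply[OF f])
qed (use i in simp)

text \<open>The adjoint removes one letter and may lower the minimal length by one, hence the shift
  of the index; for \<open>S\<close> in \<open>Q_S\<close> there is no loss.\<close>

lemma Q_S_star:
  assumes i: "i \<in> {1..k}" "s \<in> {1..n i}"
  shows "S_star i s \<otimes>\<^bsub>B\<^esub> Q (Suc m) = Q m \<otimes>\<^bsub>B\<^esub> (S_star i s \<otimes>\<^bsub>B\<^esub> Q (Suc m))"
proof (rule Q_absorb)
  fix f b assume f: "f \<in> ell2 WT" and b: "b \<in> WT" "\<not> min_length m b"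
  have "m \<le> length (b j)" if "Suc m \<le> length ((b(i := s # b i)) j)" for j
    using that by (cases "j = i") auto
  then have "\<not> min_length (Suc m) (b(i := s # b i))" using b unfolding min_length_def by blast
  then show "S_star i s (Q (Suc m) f) b = 0"
    using op_apply_ell2[OF Q_closed f] f by (simp add: S_star_apply Q_apply[OF f])
qed (use i in simp)

lemma Q_norm_le: "cnorm B (Q m) \<le> 1"
  unfolding Q_def by (rule op_proj_norm_le)

lemma N_I:
  assumes "x \<in> carrier B" "g \<longlonglongrightarrow> 0" "\<And>m. cnorm B (x \<otimes>\<^bsub>B\<^esub> Q m) \<le> g m" shows "x \<in> N"
proof -
  have "(\<lambda>m. cnorm B (x \<otimes>\<^bsub>B\<^esub> Q m)) \<longlonglongrightarrow> 0"
    by (rule tendsto_sandwich[OF _ _ tendsto_const assms(2)])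
      (use assms in \<open>auto intro!: always_eventually B.cnorm_nonneg\<close>)
  then show ?thesis using assms by (simp add: N_def)
qed

lemma N_D: "x \<in> N \<Longrightarrow> x \<in> carrier B" "x \<in> N \<Longrightarrow> (\<lambda>m. cnorm B (x \<otimes>\<^bsub>B\<^esub> Q m)) \<longlonglongrightarrow> 0"
  by (auto simp: N_def)

lemma N_add: "x \<in> N \<Longrightarrow> y \<in> N \<Longrightarrow> x \<oplus>\<^bsub>B\<^esub> y \<in> N"
  by (rule N_I[where g = "\<lambda>m. cnorm B (x \<otimes>\<^bsub>B\<^esub> Q m) + cnorm B (y \<otimes>\<^bsub>B\<^esub> Q m)"])
    (auto simp: N_D B.l_distr intro!: B.cnorm_triangle tendsto_add_zero)

lemma N_mult_left: "x \<in> N \<Longrightarrow> y \<in> carrier B \<Longrightarrow> y \<otimes>\<^bsub>B\<^esub> x \<in> N"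
  by (rule N_I[where g = "\<lambda>m. cnorm B y * cnorm B (x \<otimes>\<^bsub>B\<^esub> Q m)"])
    (auto simp: N_D B.m_assoc intro!: B.cnorm_mult tendsto_mult_right_zero)

text \<open>As the \<open>Q m\<close> have norm at most 1, replacing \<open>x\<close> by
  \<open>u l\<close> costs an error that is uniform in \<open>m\<close>.\<close>

lemma N_closed: assumes "range u \<subseteq> N" "clim B u x" shows "x \<in> N"
proof -
  note d = B.climD[OF assms(2)]
  have un: "u l \<in> N" for l using assms(1) by auto
  have le: "cnorm B (x \<otimes>\<^bsub>B\<^esub> Q m) \<le> cnorm B (u l \<ominus>\<^bsub>B\<^esub> x) + cnorm B (u l \<otimes>\<^bsub>B\<^esub> Q m)" for l m
  proof -
    have "cnorm B (x \<otimes>\<^bsub>B\<^esub> Q m) \<le> cnorm B ((x \<ominus>\<^bsub>B\<^esub> u l) \<otimes>\<^bsub>B\<^esub> Q m) + cnorm B (u l \<otimes>\<^bsub>B\<^esub> Q m)"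
      using B.nrm_le_add_mi[of "x \<otimes>\<^bsub>B\<^esub> Q m" "u l \<otimes>\<^bsub>B\<^esub> Q m"] d by (simp add: B.mi_mult_right)
    also have "cnorm B ((x \<ominus>\<^bsub>B\<^esub> u l) \<otimes>\<^bsub>B\<^esub> Q m) \<le> cnorm B (x \<ominus>\<^bsub>B\<^esub> u l) * 1"
      using d Q_norm_le by (intro order_trans[OF B.cnorm_mult] mult_left_mono) (auto intro: B.cnorm_nonneg)
    finally show ?thesis using B.nrm_mi_commute[OF d(1,2)] by simp
  qed
  have "(\<lambda>m. cnorm B (x \<otimes>\<^bsub>B\<^esub> Q m)) \<longlonglongrightarrow> 0"
  proof (rule LIMSEQ_I)
    fix e :: real assume e: "e > 0"
    obtain l where l: "cnorm B (u l \<ominus>\<^bsub>B\<^esub> x) < e / 2"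
      using LIMSEQ_D[OF d(3), of "e / 2"] e d by (auto simp: B.nrm_nonneg)
    obtain M where M: "\<And>m. m \<ge> M \<Longrightarrow> cnorm B (u l \<otimes>\<^bsub>B\<^esub> Q m) < e / 2"
      using LIMSEQ_D[OF N_D(2)[OF un[of l]], of "e / 2"] e d by (auto simp: B.nrm_nonneg)
    have "cnorm B (x \<otimes>\<^bsub>B\<^esub> Q m) < e" if "m \<ge> M" for m
      using le[of m l] l M[OF that] by simp
    then show "\<exists>M. \<forall>m\<ge>M. norm (cnorm B (x \<otimes>\<^bsub>B\<^esub> Q m) - 0) < e"
      using d by (auto simp: B.nrm_nonneg)
  qed
  then show ?thesis using d by (simp add: N_def)
qed

text \<open>If \<open>V\<close> maps the range of \<open>Q m\<close> into that of
  \<open>Q l\<close>, then \<open>Q l\<close> can be inserted to the left of \<open>V\<close>, and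
  \<open>x V Q m\<close> is bounded by \<open>x Q l\<close>. For the generators \<open>l\<close> is
  \<open>m\<close>; for their adjoints it lags behind by one, which does not affect the
  limit.\<close>

lemma N_mult_generator:
  assumes i: "i \<in> {1..k}" "s \<in> {1..n i}" and x: "x \<in> N"
  shows "x \<otimes>\<^bsub>B\<^esub> S i s \<in> N" "x \<otimes>\<^bsub>B\<^esub> S_star i s \<in> N"
proof -
  have iso: "cnorm B (S i s) \<le> 1"
    by (rule B.isometry_norm_le) (use i in \<open>auto simp: star_S S_star_S_same\<close>)
  then have iso': "cnorm B (S_star i s) \<le> 1"
    using B.cnorm_star[of "S i s"] i by (simp add: star_S)
  have le: "cnorm B (x \<otimes>\<^bsub>B\<^esub> V \<otimes>\<^bsub>B\<^esub> Q m) \<le> cnorm B (x \<otimes>\<^bsub>B\<^esub> Q l)"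
    if V: "V \<in> carrier B" "cnorm B V \<le> 1" and e: "V \<otimes>\<^bsub>B\<^esub> Q m = Q l \<otimes>\<^bsub>B\<^esub> (V \<otimes>\<^bsub>B\<^esub> Q m)" for V m l
  proof -
    have "x \<otimes>\<^bsub>B\<^esub> V \<otimes>\<^bsub>B\<^esub> Q m = (x \<otimes>\<^bsub>B\<^esub> Q l) \<otimes>\<^bsub>B\<^esub> (V \<otimes>\<^bsub>B\<^esub> Q m)"
      using N_D[OF x] V(1) e by (metis B.m_assoc B.m_closed Q_closed)
    then have "cnorm B (x \<otimes>\<^bsub>B\<^esub> V \<otimes>\<^bsub>B\<^esub> Q m) = cnorm B ((x \<otimes>\<^bsub>B\<^esub> Q l) \<otimes>\<^bsub>B\<^esub> (V \<otimes>\<^bsub>B\<^esub> Q m))"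
      by (rule arg_cong)
    also have "\<dots> \<le> cnorm B (x \<otimes>\<^bsub>B\<^esub> Q l) * cnorm B (V \<otimes>\<^bsub>B\<^esub> Q m)"
      using N_D[OF x] V(1) by (intro B.cnorm_mult) auto
    also have "\<dots> \<le> cnorm B (x \<otimes>\<^bsub>B\<^esub> Q l) * (1 * 1)"
      using N_D[OF x] V Q_norm_le
      by (intro mult_left_mono order_trans[OF B.cnorm_mult] mult_mono') (auto intro: B.cnorm_nonneg)
    finally show ?thesis by simp
  qed
  show "x \<otimes>\<^bsub>B\<^esub> S i s \<in> N"
    by (rule N_I[OF _ N_D(2)[OF x]]) (use N_D[OF x] i le[OF S_closed[OF i] iso Q_S[OF i]] in auto)
  have xc: "x \<in> carrier B" using N_D[OF x] by simp
  have "(\<lambda>m. cnorm B (x \<otimes>\<^bsub>B\<^esub> S_star i s \<otimes>\<^bsub>B\<^esub> Q (Suc m))) \<longlonglongrightarrow> 0"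
    by (rule tendsto_sandwich[OF _ _ tendsto_const N_D(2)[OF x]])
      (use le[OF S_star_closed[OF i] iso' Q_S_star[OF i]] xc i in \<open>auto intro!: always_eventually B.cnorm_nonneg\<close>)
  then show "x \<otimes>\<^bsub>B\<^esub> S_star i s \<in> N"
    using xc i filterlim_sequentially_Suc[of "\<lambda>m. cnorm B (x \<otimes>\<^bsub>B\<^esub> S_star i s \<otimes>\<^bsub>B\<^esub> Q m)"]
    by (simp add: N_def)
qed

lemma N_mult_right:
  assumes "x \<in> N" "b \<in> carrier C" shows "x \<otimes>\<^bsub>B\<^esub> b \<in> N"
proof -
  \<comment> \<open>The second condition makes \<open>D\<close> self-adjoint by construction; a set
    of right multipliers alone need not be.\<close>
  define D where "D = {b \<in> carrier B. \<forall>x\<in>N. x \<otimes>\<^bsub>B\<^esub> b \<in> N \<and> x \<otimes>\<^bsub>B\<^esub> star B b \<in> N}"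
  have sm: "x \<otimes>\<^bsub>B\<^esub> (c \<odot>\<^bsub>B\<^esub> b) \<in> N" if "x \<otimes>\<^bsub>B\<^esub> b \<in> N" "x \<in> N" "b \<in> carrier B" for x b c
    using N_mult_left[OF that(1), of "c \<odot>\<^bsub>B\<^esub> \<one>\<^bsub>B\<^esub>"] that N_D[of x]
    by (simp add: B.smult_mult_left B.smult_mult_right)
  have "unital_cstar_subalgebra B D"
  proof (rule B.unital_cstar_subalgebraI)
    show "D \<subseteq> carrier B" by (auto simp: D_def)
    show "\<one>\<^bsub>B\<^esub> \<in> D" by (auto simp: D_def N_D)
    show "a \<oplus>\<^bsub>B\<^esub> b \<in> D" if "a \<in> D" "b \<in> D" for a b
      using that by (auto simp: D_def B.star_add B.star_closed B.r_distr N_D N_add)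
    show "a \<otimes>\<^bsub>B\<^esub> b \<in> D" if "a \<in> D" "b \<in> D" for a b
      using that by (auto simp: D_def B.star_mult B.star_closed N_D B.m_assoc[symmetric])
    show "c \<odot>\<^bsub>B\<^esub> a \<in> D" if "a \<in> D" for a c
      using that by (auto simp: D_def B.star_smult B.star_closed sm)
    show "star B a \<in> D" if "a \<in> D" for a
      using that by (auto simp: D_def B.star_closed B.star_star)
    fix u b assume u: "range u \<subseteq> D" "clim B u b"
    have "x \<otimes>\<^bsub>B\<^esub> b \<in> N \<and> x \<otimes>\<^bsub>B\<^esub> star B b \<in> N" if x: "x \<in> N" for x
    proof
      have xc: "clim B (\<lambda>n. x) x" using N_D[OF x] by (intro B.clim_const)
      show "x \<otimes>\<^bsub>B\<^esub> b \<in> N"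
        by (rule N_closed[OF _ B.clim_mult[OF xc u(2)]]) (use u x in \<open>auto simp: D_def\<close>)
      show "x \<otimes>\<^bsub>B\<^esub> star B b \<in> N"
        by (rule N_closed[OF _ B.clim_mult[OF xc B.clim_star[OF u(2)]]]) (use u x in \<open>auto simp: D_def\<close>)
    qed
    then show "b \<in> D" using B.climD[OF u(2)] by (simp add: D_def)
  qed
  then have "carrier C \<subseteq> D"
    by (rule C_induct) (auto simp: D_def star_S N_mult_generator)
  then show ?thesis using assms by (auto simp: D_def)
qed

lemma J_sub_N: "J \<subseteq> N"
proof -
  have "J \<subseteq> N \<inter> carrier C"
  proof (rule C.closed_ideal_generated_minimal)
    have z: "\<zero>\<^bsub>B\<^esub> \<in> N" by (simp add: N_def)
    show "ideal (N \<inter> carrier C) C"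
      by (rule C.ideal_closedI)
        (use z C.zero_closed C.a_closed C.m_closed in \<open>auto simp: N_add N_mult_right N_mult_left C_sub\<close>)
    show "closed_in_norm C (N \<inter> carrier C)"
      unfolding C.closed_in_norm_iff by (auto simp: C_clim intro: N_closed)
    have "P i \<in> N" if i: "i \<in> {1..k}" for i
    proof -
      \<comment> \<open>Disjoint supports: \<open>P i\<close> keeps tuples with an empty i-th word,
        while from index 1 on \<open>Q\<close> keeps only tuples without empty components.\<close>
      have "P i \<otimes>\<^bsub>B\<^esub> Q (Suc m) = \<zero>\<^bsub>B\<^esub>" for m
      proof (rule op_eqI[of _ WT])
        fix f b assume f: "f \<in> ell2 WT" and b: "b \<in> WT"
        have "b i = [] \<Longrightarrow> \<not> min_length (Suc m) b" using i by (auto simp: min_length_def intro!: bexI[of _ i])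
        then show "(P i \<otimes>\<^bsub>B\<^esub> Q (Suc m)) f b = \<zero>\<^bsub>B\<^esub> f b"
          using f by (simp add: P_def Q_apply ell2_If)
      qed (auto simp: P_def)
      then have "(\<lambda>m. cnorm B (P i \<otimes>\<^bsub>B\<^esub> Q (Suc m))) \<longlonglongrightarrow> 0" by simp
      then show ?thesis
        unfolding N_def using filterlim_sequentially_Suc[of "\<lambda>m. cnorm B (P i \<otimes>\<^bsub>B\<^esub> Q m)"] by (simp add: P_def)
    qed
    then show "defect_projection k n lam ` {1..k} \<subseteq> N \<inter> carrier C"
      using P_C defect_projection_eq(1) by auto
  qed
  then show ?thesis by blast
qed

lemma J_C: "x \<in> J \<Longrightarrow> x \<in> carrier C"
  using J_closed by (auto simp: C.closed_in_norm_iff)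

section \<open>Complements of the long-word projections lie in the defect ideal\<close>

lemma one_minus_proj_apply:
  "f \<in> ell2 WT \<Longrightarrow> (\<one>\<^bsub>B\<^esub> \<ominus>\<^bsub>B\<^esub> op_proj WT Z) f = (\<lambda>b. f b - (if b \<in> Z then f b else 0))"
  using op_minus_apply[of "\<one>\<^bsub>B\<^esub>" WT "op_proj WT Z"] B.one_closed op_proj_closed[of WT Z]
  by (simp add: carrier_op_algebra)

lemma one_minus_proj_C:
  assumes "\<one>\<^bsub>C\<^esub> \<ominus>\<^bsub>B\<^esub> op_proj WT Z \<in> J" shows "op_proj WT Z \<in> carrier C"
proof -
  have "op_proj WT Z = \<one>\<^bsub>C\<^esub> \<ominus>\<^bsub>C\<^esub> (\<one>\<^bsub>C\<^esub> \<ominus>\<^bsub>B\<^esub> op_proj WT Z)"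
    using J_C[OF assms] C.one_closed
    by (subst C_minus) (auto simp: a_minus_def B.minus_add B.r_neg2)
  then show ?thesis using J_C[OF assms] C.one_closed C.mi_closed by metis
qed

text \<open>Let \<open>p m\<close> project onto the tuples whose i-th word has length at least
  \<open>m\<close>. A word of length at most \<open>m\<close> is empty or a letter followed by a
  word of length less than \<open>m\<close>, so \<open>1 - p (m+1)\<close> is \<open>P i\<close>
  plus the sum of the conjugates of \<open>1 - p m\<close> by the \<open>S i s\<close>. Both parts
  lie in the ideal.\<close>

lemma one_minus_Q_single:
  assumes i: "i \<in> {1..k}"
  shows "\<one>\<^bsub>C\<^esub> \<ominus>\<^bsub>B\<^esub> op_proj WT {b. m \<le> length (b i)} \<in> J"
proof (induction m)
  case 0
  have "op_proj WT {b. 0 \<le> length (b i)} = \<one>\<^bsub>B\<^esub>" by (rule op_eqI[of _ WT]) auto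
  then show ?case
    using additive_subgroup.zero_closed[OF ideal.axioms(1)[OF J_ideal]] by simp
next
  case (Suc m)
  define Z Y where "Z = {b :: nat \<Rightarrow> nat list. m \<le> length (b i)}" and "Y = {b :: nat \<Rightarrow> nat list. Suc m \<le> length (b i)}"
  define T where "T = \<one>\<^bsub>B\<^esub> \<ominus>\<^bsub>B\<^esub> op_proj WT Z"
  have TB: "T \<in> carrier B" by (simp add: T_def)
  have TJ: "T \<in> J" using Suc by (simp add: T_def Z_def)
  have T: "T = op_proj WT (- Z)"
    by (intro op_eqI[of _ WT]) (auto simp: T_def one_minus_proj_apply)
  have sJ: "S i s \<otimes>\<^bsub>B\<^esub> (T \<otimes>\<^bsub>B\<^esub> S_star i s) \<in> J" if "s \<in> {1..n i}" for s
    using ideal.I_l_closed[OF J_ideal ideal.I_r_closed[OF J_ideal TJ S_star_C[OF i that]] S_C[OF i that]] by simp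
  define R where "R = (\<Oplus>\<^bsub>B\<^esub>s\<in>{1..n i}. S i s \<otimes>\<^bsub>B\<^esub> (T \<otimes>\<^bsub>B\<^esub> S_star i s))"
  have "R \<in> J"
  proof -
    have sum: "(\<Oplus>\<^bsub>B\<^esub>s\<in>F. S i s \<otimes>\<^bsub>B\<^esub> (T \<otimes>\<^bsub>B\<^esub> S_star i s)) \<in> J" if "finite F" "F \<subseteq> {1..n i}" for F
      using that
    proof (induction F rule: finite_induct)
      case empty
      then show ?case using additive_subgroup.zero_closed[OF ideal.axioms(1)[OF J_ideal]] by simp
    next
      case (insert s F)
      have "S i s \<otimes>\<^bsub>B\<^esub> (T \<otimes>\<^bsub>B\<^esub> S_star i s) \<oplus>\<^bsub>C\<^esub> (\<Oplus>\<^bsub>B\<^esub>s\<in>F. S i s \<otimes>\<^bsub>B\<^esub> (T \<otimes>\<^bsub>B\<^esub> S_star i s)) \<in> J"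
        using insert sJ by (intro additive_subgroup.a_closed[OF ideal.axioms(1)[OF J_ideal]]) auto
      then show ?case using insert TB i by (subst B.finsum_insert) auto
    qed
    then show ?thesis by (simp add: R_def)
  qed
  then have "P i \<oplus>\<^bsub>C\<^esub> R \<in> J"
    by (intro additive_subgroup.a_closed[OF ideal.axioms(1)[OF J_ideal]] P_J[OF i])
  moreover have "P i \<oplus>\<^bsub>B\<^esub> R = \<one>\<^bsub>B\<^esub> \<ominus>\<^bsub>B\<^esub> op_proj WT Y"
  proof (rule op_eqI[of _ WT])
    have RB: "R \<in> carrier B" using J_C[OF \<open>R \<in> J\<close>] C_sub by blast
    then show "P i \<oplus>\<^bsub>B\<^esub> R \<in> carrier B" by (simp add: P_def)
    fix f b assume f: "f \<in> ell2 WT" and b: "b \<in> WT"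
    have "R f b = (if b i \<noteq> [] \<and> b(i := tl (b i)) \<notin> Z then f b else 0)"
      using row_sum_proj[OF i f b, of "- Z"] by (simp add: R_def T)
    moreover have "b i \<noteq> [] \<Longrightarrow> b(i := tl (b i)) \<in> Z \<longleftrightarrow> b \<in> Y"
      by (cases "b i") (auto simp: Z_def Y_def)
    ultimately show "(P i \<oplus>\<^bsub>B\<^esub> R) f b = (\<one>\<^bsub>B\<^esub> \<ominus>\<^bsub>B\<^esub> op_proj WT Y) f b"
      using f by (auto simp: one_minus_proj_apply P_def Y_def)
  qed simp
  ultimately show ?case by (simp add: Y_def)
qed

text \<open>Adds one component at a time by 1 - zy = (1 - z) + z(1 - y). The factor z has to lie in
  \<open>C\<close> for the ideal to absorb it, which \<open>one_minus_proj_C\<close>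
  supplies.\<close>

lemma one_minus_Q: "\<one>\<^bsub>C\<^esub> \<ominus>\<^bsub>B\<^esub> Q m \<in> J"
proof -
  have "\<one>\<^bsub>C\<^esub> \<ominus>\<^bsub>B\<^esub> op_proj WT {b. \<forall>i\<in>{1..l}. m \<le> length (b i)} \<in> J" if "l \<le> k" for l
    using that
  proof (induction l)
    case 0
    have "op_proj WT {b. \<forall>i\<in>{1..0::nat}. m \<le> length (b i)} = \<one>\<^bsub>B\<^esub>" by (rule op_eqI[of _ WT]) auto
    then show ?case
      using additive_subgroup.zero_closed[OF ideal.axioms(1)[OF J_ideal]] by simp
  next
    case (Suc l)
    define Z Y where "Z = {b :: nat \<Rightarrow> nat list. \<forall>i\<in>{1..l}. m \<le> length (b i)}"
      and "Y = {b :: nat \<Rightarrow> nat list. m \<le> length (b (Suc l))}"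
    have XJ: "\<one>\<^bsub>C\<^esub> \<ominus>\<^bsub>B\<^esub> op_proj WT Z \<in> J" using Suc by (simp add: Z_def)
    have YJ: "\<one>\<^bsub>C\<^esub> \<ominus>\<^bsub>B\<^esub> op_proj WT Y \<in> J" unfolding Y_def by (rule one_minus_Q_single) (use Suc in auto)
    have "(\<one>\<^bsub>C\<^esub> \<ominus>\<^bsub>B\<^esub> op_proj WT Z) \<oplus>\<^bsub>C\<^esub> op_proj WT Z \<otimes>\<^bsub>C\<^esub> (\<one>\<^bsub>C\<^esub> \<ominus>\<^bsub>B\<^esub> op_proj WT Y) \<in> J"
      by (intro additive_subgroup.a_closed[OF ideal.axioms(1)[OF J_ideal]] XJ
          ideal.I_l_closed[OF J_ideal YJ] one_minus_proj_C)
    moreover have "(\<one>\<^bsub>B\<^esub> \<ominus>\<^bsub>B\<^esub> op_proj WT Z) \<oplus>\<^bsub>B\<^esub> op_proj WT Z \<otimes>\<^bsub>B\<^esub> (\<one>\<^bsub>B\<^esub> \<ominus>\<^bsub>B\<^esub> op_proj WT Y)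
        = \<one>\<^bsub>B\<^esub> \<ominus>\<^bsub>B\<^esub> op_proj WT (Z \<inter> Y)"
      by (intro op_eqI[of _ WT]) (auto simp: one_minus_proj_apply ell2_diff ell2_If)
    moreover have "Z \<inter> Y = {b. \<forall>i\<in>{1..Suc l}. m \<le> length (b i)}"
      by (auto simp: Z_def Y_def le_Suc_eq)
    ultimately show ?case by simp
  qed
  then show ?thesis unfolding Q_def min_length_def[abs_def] by simp
qed

lemma Q_C: "Q m \<in> carrier C"
  using one_minus_proj_C one_minus_Q unfolding Q_def by blast

text \<open>Two independent ingredients meet: the coding by matrix entries puts the cosets into the
  prescribed type, and the projections \<open>Q m\<close> yield the C*-identity for the coset
  norm.\<close>

theorem defect_quotient_exists:
  obtains \<rho> :: "(((nat \<Rightarrow> nat list) \<Rightarrow> complex) \<Rightarrow> ((nat \<Rightarrow> nat list) \<Rightarrow> complex)) \<Rightarrow> nat \<Rightarrow> complex"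
  where "cstar_ideal C J \<rho>"
proof -
  have "countable WT" unfolding word_tuples_def by (intro countable_PiE) auto
  then obtain enc :: "(((nat \<Rightarrow> nat list) \<Rightarrow> complex) \<Rightarrow> ((nat \<Rightarrow> nat list) \<Rightarrow> complex)) \<Rightarrow> nat \<Rightarrow> complex"
    where "inj_on enc (bounded_ops WT)" using inj_on_matrix_entries by blast
  then have enc: "inj_on enc (carrier C)"
    using C_sub by (auto simp: carrier_op_algebra intro: inj_on_subset)
  obtain \<rho> :: "(((nat \<Rightarrow> nat list) \<Rightarrow> complex) \<Rightarrow> ((nat \<Rightarrow> nat list) \<Rightarrow> complex)) \<Rightarrow> nat \<Rightarrow> complex"
    where \<rho>: "\<And>x y. x \<in> carrier C \<Longrightarrow> y \<in> carrier C \<Longrightarrow> \<rho> x = \<rho> y \<longleftrightarrow> x \<ominus>\<^bsub>C\<^esub> y \<in> J"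
    using C.exists_coset_invariant[OF J_ideal enc] by blast
  have "cstar_ideal C J \<rho>"
  proof (intro cstar_ideal.intro cstar_ideal_axioms.intro)
    fix x assume x: "x \<in> carrier C"
    show "(coset_norm C J x)\<^sup>2 \<le> coset_norm C J (star C x \<otimes>\<^bsub>C\<^esub> x)"
    proof (rule C.quotient_cstar_identity[OF J_ideal x Q_C])
      show "\<one>\<^bsub>C\<^esub> \<ominus>\<^bsub>C\<^esub> Q m \<in> J" for m using one_minus_Q C.one_closed Q_C by (subst C_minus) auto
      show "(\<lambda>m. cnorm C (j \<otimes>\<^bsub>C\<^esub> Q m)) \<longlonglongrightarrow> 0" if "j \<in> J" for j
        using J_sub_N that N_D by auto
      show "Q m \<otimes>\<^bsub>C\<^esub> Q m = Q m" for m
        by (simp, rule op_eqI[of _ WT]) (auto simp: Q_def ell2_If)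
    qed (simp add: Q_def op_proj_star)
  qed (use J_ideal J_closed J_star \<rho> C.unital_cstar_algebra_axioms in auto)
  then show ?thesis by (rule that)
qed

text \<open>The isometry and commutation relations hold in \<open>C\<close> and are merely
  transported. The sum relation is the one that uses the quotient: the defect is in
  \<open>J\<close>.\<close>

lemma cuntz_relations_quotient:
  assumes "cstar_ideal C J \<rho>"
  shows "cuntz_relations k n lam (cstar_ideal.quot C J \<rho>) (\<lambda>i s. \<rho> (S i s))"
proof -
  interpret I: cstar_ideal C J \<rho> by fact
  interpret Q: unital_cstar_algebra I.quot by (rule I.unital_cstar_algebra_quot)
  have mC: "S i s \<otimes>\<^bsub>C\<^esub> star C (S i s) \<in> carrier C" if "i \<in> {1..k}" "s \<in> {1..n i}" for i s
    using that by (intro C.m_closed C.star_closed) auto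
  have sum: "(\<Oplus>\<^bsub>I.quot\<^esub>s\<in>{1..n i}. \<rho> (S i s) \<otimes>\<^bsub>I.quot\<^esub> star I.quot (\<rho> (S i s))) = \<one>\<^bsub>I.quot\<^esub>"
    if i: "i \<in> {1..k}" for i
  proof -
    let ?R = "\<Oplus>\<^bsub>C\<^esub>s\<in>{1..n i}. S i s \<otimes>\<^bsub>C\<^esub> star C (S i s)"
    have RC: "?R \<in> carrier C" using i mC by (intro C.finsum_closed) auto
    have "(\<Oplus>\<^bsub>I.quot\<^esub>s\<in>{1..n i}. \<rho> (S i s) \<otimes>\<^bsub>I.quot\<^esub> star I.quot (\<rho> (S i s)))
        = (\<Oplus>\<^bsub>I.quot\<^esub>s\<in>{1..n i}. \<rho> (S i s \<otimes>\<^bsub>C\<^esub> star C (S i s)))"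
    proof (rule Q.finsum_cong')
      show "\<rho> (S i s) \<otimes>\<^bsub>I.quot\<^esub> star I.quot (\<rho> (S i s)) = \<rho> (S i s \<otimes>\<^bsub>C\<^esub> star C (S i s))"
        if "s \<in> {1..n i}" for s
        using that i S_C[of i s] C.star_closed[of "S i s"] by (simp only: I.quot_simps)
      show "(\<lambda>s. \<rho> (S i s \<otimes>\<^bsub>C\<^esub> star C (S i s))) \<in> {1..n i} \<rightarrow> carrier I.quot"
        unfolding I.quot_carrier using mC[OF i] by blast
    qed simp
    also have "\<dots> = \<rho> ?R"
      by (rule star_hom_finsum[symmetric, OF C.normed_module_axioms Q.normed_module_axioms I.rho_star_hom])
        (use mC[OF i] in auto)
    also have "\<dots> = \<rho> \<one>\<^bsub>C\<^esub>"
    proof -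
      have "\<one>\<^bsub>C\<^esub> \<ominus>\<^bsub>C\<^esub> ?R \<in> J" using defect_projection_eq(2)[OF i] P_J[OF i] by simp
      then show ?thesis using I.rho_eq_iff[OF C.one_closed RC] by simp
    qed
    finally show ?thesis unfolding I.quot_one .
  qed
  show ?thesis
    unfolding cuntz_relations_def
  proof (intro conjI ballI impI sum)
    fix i s assume i: "i \<in> {1..k}" "s \<in> {1..n i}"
    show "\<rho> (S i s) \<in> carrier I.quot" unfolding I.quot_carrier using S_C[OF i] by blast
    have "star C (S i s) \<otimes>\<^bsub>C\<^esub> S i s = \<one>\<^bsub>C\<^esub>" using i by (simp add: star_S S_star_S_same)
    then show "star I.quot (\<rho> (S i s)) \<otimes>\<^bsub>I.quot\<^esub> \<rho> (S i s) = \<one>\<^bsub>I.quot\<^esub>"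
      using S_C[OF i] C.star_closed[OF S_C[OF i]] by (simp only: I.quot_simps)
  next
    fix i j s t assume i: "i \<in> {1..k}" "j \<in> {1..k}" "i \<noteq> j" "s \<in> {1..n i}" "t \<in> {1..n j}"
    have "star C (S i s) \<otimes>\<^bsub>C\<^esub> S j t = cnj (lam i j s t) \<odot>\<^bsub>C\<^esub> (S j t \<otimes>\<^bsub>C\<^esub> star C (S i s))"
      using i by (simp add: star_S S_star_S_diff)
    then show "star I.quot (\<rho> (S i s)) \<otimes>\<^bsub>I.quot\<^esub> \<rho> (S j t)
        = cnj (lam i j s t) \<odot>\<^bsub>I.quot\<^esub> (\<rho> (S j t) \<otimes>\<^bsub>I.quot\<^esub> star I.quot (\<rho> (S i s)))"
      using S_C[of i s] S_C[of j t] C.star_closed[of "S i s"] i C.m_closed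
      by (simp only: I.quot_simps)
  qed
qed

end

section \<open>Orthogonality of isometries with range projections summing to one\<close>

context unital_cstar_algebra
begin

lemma one_norm_le: "cnorm A \<one> \<le> 1"
  by (rule projection_norm_le) auto

text \<open>Averaging the squares of \<open>1 + z x\<close> and \<open>1 + \<i> z x\<close> cancels the quadratic terms, which
  enlarges the radius by the factor \<open>\<bar>1 + \<i>\<bar> = \<surd>2\<close>.\<close>
lemma eq_zero_if_one_plus_disc:
  assumes x: "x \<in> carrier A" and r: "r > 0"
    and le: "\<And>z. cmod z \<le> r \<Longrightarrow> cnorm A (\<one> \<oplus> z \<odot>\<^bsub>A\<^esub> x) \<le> 1"
  shows "x = \<zero>"
proof -
  have all: "cnorm A (\<one> \<oplus> z \<odot>\<^bsub>A\<^esub> x) \<le> 1" if "cmod z \<le> r * sqrt 2 ^ j" for z j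
    using that
  proof (induction j arbitrary: z)
    case (Suc j)
    \<comment> \<open>Chosen so that w + \<i> w = z. Both summands have modulus smaller than that of
      \<open>z\<close> by the factor \<open>sqrt 2\<close>, hence lie in the disc of the induction
      hypothesis.\<close>
    define w where "w = z / (1 + \<i>)"
    have "1 + \<i> \<noteq> 0" by (simp add: complex_eq_iff)
    then have "z = w * (1 + \<i>)" by (simp add: w_def)
    then have z: "z = w + \<i> * w" by (simp add: algebra_simps)
    have "cmod (1 + \<i>) = sqrt 2" by (simp add: cmod_def)
    then have w: "cmod w \<le> r * sqrt 2 ^ j" "cmod (\<i> * w) \<le> r * sqrt 2 ^ j"
      using Suc.prems by (simp_all add: w_def norm_divide norm_mult pos_divide_le_eq mult_ac)
    define p q where "p = \<one> \<oplus> w \<odot>\<^bsub>A\<^esub> x" and "q = \<one> \<oplus> (\<i> * w) \<odot>\<^bsub>A\<^esub> x"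
    have pq: "p \<in> carrier A" "q \<in> carrier A" "cnorm A p \<le> 1" "cnorm A q \<le> 1"
      using x Suc.IH[OF w(1)] Suc.IH[OF w(2)] by (auto simp: p_def q_def)
    have sq: "(\<one> \<oplus> v \<odot>\<^bsub>A\<^esub> x) \<otimes> (\<one> \<oplus> v \<odot>\<^bsub>A\<^esub> x) = (\<one> \<oplus> (2 * v) \<odot>\<^bsub>A\<^esub> x) \<oplus> (v * v) \<odot>\<^bsub>A\<^esub> (x \<otimes> x)" for v
    proof -
      have "(2 * v) \<odot>\<^bsub>A\<^esub> x = v \<odot>\<^bsub>A\<^esub> x \<oplus> v \<odot>\<^bsub>A\<^esub> x"
        using x sm_add_left[of x v v] by simp
      then show ?thesis
        using x by (simp add: l_distr r_distr smult_mult_left smult_mult_right sm_sm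
            sm_add_right a_ac)
    qed
    have "p \<otimes> p \<oplus> q \<otimes> q = (\<one> \<oplus> (2 * w) \<odot>\<^bsub>A\<^esub> x) \<oplus> (\<one> \<oplus> (2 * (\<i> * w)) \<odot>\<^bsub>A\<^esub> x)
        \<oplus> ((w * w) \<odot>\<^bsub>A\<^esub> (x \<otimes> x) \<oplus> (\<i> * w * (\<i> * w)) \<odot>\<^bsub>A\<^esub> (x \<otimes> x))"
      unfolding p_def q_def sq using x by (simp add: a_ac)
    also have "(w * w) \<odot>\<^bsub>A\<^esub> (x \<otimes> x) \<oplus> (\<i> * w * (\<i> * w)) \<odot>\<^bsub>A\<^esub> (x \<otimes> x) = \<zero>"
      using x by (simp add: sm_add_left[symmetric] algebra_simps)
    also have "(\<one> \<oplus> (2 * w) \<odot>\<^bsub>A\<^esub> x) \<oplus> (\<one> \<oplus> (2 * (\<i> * w)) \<odot>\<^bsub>A\<^esub> x) \<oplus> \<zero>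
        = 2 \<odot>\<^bsub>A\<^esub> (\<one> \<oplus> z \<odot>\<^bsub>A\<^esub> x)"
    proof -
      have "2 \<odot>\<^bsub>A\<^esub> (\<one> \<oplus> z \<odot>\<^bsub>A\<^esub> x) = 2 \<odot>\<^bsub>A\<^esub> \<one> \<oplus> (2 * w + 2 * (\<i> * w)) \<odot>\<^bsub>A\<^esub> x"
        using x by (simp add: sm_add_right sm_sm z distrib_left)
      moreover have "2 \<odot>\<^bsub>A\<^esub> \<one> = \<one> \<oplus> \<one>" using sm_add_left[of \<one> 1 1] by simp
      ultimately show ?thesis using x by (simp add: sm_add_left a_ac)
    qed
    finally have "2 * cnorm A (\<one> \<oplus> z \<odot>\<^bsub>A\<^esub> x) = cnorm A (p \<otimes> p \<oplus> q \<otimes> q)"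
      using x by (simp add: cnorm_smult)
    also have "\<dots> \<le> cnorm A p * cnorm A p + cnorm A q * cnorm A q"
      using pq by (intro order_trans[OF cnorm_triangle] add_mono cnorm_mult) auto
    also have "\<dots> \<le> 1 * 1 + 1 * 1"
      using pq by (intro add_mono mult_mono) (auto simp: cnorm_nonneg)
    finally show ?case by simp
  qed (simp add: le)
  \<comment> \<open>A Liouville argument: \<open>z x\<close> is the difference of
    \<open>\<one> \<oplus> z x\<close> and \<open>\<one>\<close>, so its norm is at most 2 however
    large \<open>z\<close> is.\<close>
  have bd: "sqrt 2 ^ j * (r * cnorm A x) \<le> 2" for j
  proof -
    define z where "z = complex_of_real (r * sqrt 2 ^ j)"
    have cz: "cmod z = r * sqrt 2 ^ j" using r by (simp add: z_def norm_mult norm_power)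
    have "z \<odot>\<^bsub>A\<^esub> x = (\<one> \<oplus> z \<odot>\<^bsub>A\<^esub> x) \<ominus> \<one>"
      using x mi_add_add[of \<one> "z \<odot>\<^bsub>A\<^esub> x" \<one> \<zero>] by simp
    then have "cmod z * cnorm A x \<le> cnorm A (\<one> \<oplus> z \<odot>\<^bsub>A\<^esub> x) + cnorm A \<one>"
      using x nrm_mi_le[of "\<one> \<oplus> z \<odot>\<^bsub>A\<^esub> x" \<one>] by (metis a_closed cnorm_smult one_closed sm_closed)
    then show ?thesis using all[of z j] one_norm_le cz by (simp add: mult_ac)
  qed
  have "cnorm A x = 0"
  proof (rule ccontr)
    assume "cnorm A x \<noteq> 0"
    then have pos: "r * cnorm A x > 0" using r cnorm_nonneg[OF x] by simp
    obtain j where "2 / (r * cnorm A x) < sqrt 2 ^ j" using real_arch_pow[of "sqrt 2"] by auto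
    then show False using bd[of j] pos by (simp add: pos_divide_less_eq)
  qed
  then show ?thesis using x by (simp add: cnorm_eq_zero)
qed

text \<open>Spectrally, the two bounds confine the spectrum of \<open>x\<close> to [-2,0] and to
  [0,2]. The elementary substitute bounds \<open>\<one> \<oplus> z x\<close> on a complex disc
  through the C*-identity, after which \<open>eq_zero_if_one_plus_disc\<close> applies.\<close>

lemma self_adjoint_eq_zero:
  assumes x: "x \<in> carrier A" "star A x = x"
    and le: "cnorm A (\<one> \<oplus> x) \<le> 1" "cnorm A (\<one> \<ominus> x) \<le> 1"
  shows "x = \<zero>"
proof (rule eq_zero_if_one_plus_disc[OF x(1), of "1/4"])
  have conv: "cnorm A (\<one> \<oplus> complex_of_real t \<odot>\<^bsub>A\<^esub> y) \<le> 1"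
    if y: "y \<in> carrier A" and t: "0 \<le> t" "t \<le> 1" and yle: "cnorm A (\<one> \<oplus> y) \<le> 1" for t y
  proof -
    have "\<one> \<oplus> complex_of_real t \<odot>\<^bsub>A\<^esub> y
        = complex_of_real (1 - t) \<odot>\<^bsub>A\<^esub> \<one> \<oplus> complex_of_real t \<odot>\<^bsub>A\<^esub> (\<one> \<oplus> y)"
      using y sm_add_left[of \<one> "complex_of_real (1 - t)" "complex_of_real t"]
      by (simp add: sm_add_right a_assoc[symmetric] del: of_real_diff)
        (simp add: of_real_diff)
    then have "cnorm A (\<one> \<oplus> complex_of_real t \<odot>\<^bsub>A\<^esub> y)
        \<le> cnorm A (complex_of_real (1 - t) \<odot>\<^bsub>A\<^esub> \<one>) + cnorm A (complex_of_real t \<odot>\<^bsub>A\<^esub> (\<one> \<oplus> y))"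
      using y cnorm_triangle by simp
    also have "\<dots> = (1 - t) * cnorm A \<one> + t * cnorm A (\<one> \<oplus> y)"
      using y t by (simp add: cnorm_smult del: of_real_diff)
    also have "\<dots> \<le> (1 - t) * 1 + t * 1"
      using t yle one_norm_le by (intro add_mono mult_left_mono) auto
    finally show ?thesis by simp
  qed
  have lin: "cnorm A (\<one> \<oplus> complex_of_real t \<odot>\<^bsub>A\<^esub> x) \<le> 1" if "\<bar>t\<bar> \<le> 1" for t
  proof (cases "t \<ge> 0")
    case False
    have "complex_of_real (- t) \<odot>\<^bsub>A\<^esub> ((-1) \<odot>\<^bsub>A\<^esub> x) = complex_of_real t \<odot>\<^bsub>A\<^esub> x"
      using x by (simp add: sm_sm)
    then show ?thesis
      using conv[of "(-1) \<odot>\<^bsub>A\<^esub> x" "- t"] le(2) x that False by (simp add: minus_conv_sm)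
  qed (use conv[OF x(1)] le that in auto)
  \<comment> \<open>The mean of the squares of \<open>\<one> \<oplus> x\<close> and
    \<open>\<one> \<ominus> x\<close> is \<open>\<one> \<oplus> x \<otimes> x\<close>.\<close>
  have sq: "cnorm A (\<one> \<oplus> x \<otimes> x) \<le> 1"
  proof -
    have "(\<one> \<oplus> x) \<otimes> (\<one> \<oplus> x) \<oplus> (\<one> \<ominus> x) \<otimes> (\<one> \<ominus> x)
        = (\<one> \<oplus> x \<otimes> x) \<oplus> (\<one> \<oplus> x \<otimes> x) \<oplus> ((x \<ominus> x) \<oplus> (x \<ominus> x))"
    proof -
      have "(\<one> \<ominus> x) \<otimes> (\<one> \<ominus> x) = (\<one> \<ominus> x) \<ominus> (x \<ominus> x \<otimes> x)"
        using x by (simp add: mi_mult_left mi_mult_right)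
      moreover have "(\<one> \<oplus> x) \<otimes> (\<one> \<oplus> x) = (\<one> \<oplus> x) \<oplus> (x \<oplus> x \<otimes> x)"
        using x by (simp add: l_distr r_distr)
      ultimately show ?thesis using x by (simp add: a_minus_def minus_add a_ac)
    qed
    also have "\<dots> = 2 \<odot>\<^bsub>A\<^esub> (\<one> \<oplus> x \<otimes> x)"
      using x sm_add_left[of "\<one> \<oplus> x \<otimes> x" 1 1] by simp
    finally have "2 * cnorm A (\<one> \<oplus> x \<otimes> x) = cnorm A ((\<one> \<oplus> x) \<otimes> (\<one> \<oplus> x) \<oplus> (\<one> \<ominus> x) \<otimes> (\<one> \<ominus> x))"
      using x by (simp add: cnorm_smult)
    also have "\<dots> \<le> cnorm A (\<one> \<oplus> x) * cnorm A (\<one> \<oplus> x) + cnorm A (\<one> \<ominus> x) * cnorm A (\<one> \<ominus> x)"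
      using x by (intro order_trans[OF cnorm_triangle] add_mono cnorm_mult) auto
    also have "\<dots> \<le> 1 * 1 + 1 * 1"
      using x le by (intro add_mono mult_mono) (auto simp: cnorm_nonneg)
    finally show ?thesis by simp
  qed
  fix z assume z: "cmod z \<le> 1/4"
  define u where "u = \<one> \<oplus> z \<odot>\<^bsub>A\<^esub> x"
  \<comment> \<open>The product of \<open>u\<close> with its adjoint is the mean of
    \<open>a\<close>, which carries the linear term, and \<open>b\<close>, which carries the
    quadratic one. Taking a mean doubles the coefficients, and the radius 1/4 keeps 4 Re z in
    [-1,1].\<close>
  define a b where "a = \<one> \<oplus> complex_of_real (4 * Re z) \<odot>\<^bsub>A\<^esub> x"
    and "b = \<one> \<oplus> complex_of_real (2 * (cmod z)\<^sup>2) \<odot>\<^bsub>A\<^esub> (x \<otimes> x)"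
  have c: "u \<in> carrier A" "a \<in> carrier A" "b \<in> carrier A" using x by (auto simp: u_def a_def b_def)
  have zz: "cnj z + z = complex_of_real (2 * Re z)" "cnj z * z = complex_of_real ((cmod z)\<^sup>2)"
    using complex_norm_square[of z] by (simp_all add: complex_eq_iff mult.commute del: of_real_power)
  have "star A u \<otimes> u = \<one> \<oplus> (cnj z \<odot>\<^bsub>A\<^esub> x \<oplus> z \<odot>\<^bsub>A\<^esub> x) \<oplus> (cnj z * z) \<odot>\<^bsub>A\<^esub> (x \<otimes> x)"
    using x by (simp add: u_def star_add star_smult l_distr r_distr smult_mult_left smult_mult_right sm_sm
        sm_add_right a_ac mult.commute)
  also have "cnj z \<odot>\<^bsub>A\<^esub> x \<oplus> z \<odot>\<^bsub>A\<^esub> x = complex_of_real (2 * Re z) \<odot>\<^bsub>A\<^esub> x"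
    using x by (simp only: sm_add_left[symmetric] zz)
  finally have "2 \<odot>\<^bsub>A\<^esub> (star A u \<otimes> u) = 2 \<odot>\<^bsub>A\<^esub> (\<one> \<oplus> complex_of_real (2 * Re z) \<odot>\<^bsub>A\<^esub> x
      \<oplus> complex_of_real ((cmod z)\<^sup>2) \<odot>\<^bsub>A\<^esub> (x \<otimes> x))" by (simp only: zz)
  also have "\<dots> = 2 \<odot>\<^bsub>A\<^esub> \<one> \<oplus> complex_of_real (4 * Re z) \<odot>\<^bsub>A\<^esub> x
      \<oplus> complex_of_real (2 * (cmod z)\<^sup>2) \<odot>\<^bsub>A\<^esub> (x \<otimes> x)"
    using x by (simp add: sm_add_right sm_sm mult.assoc[symmetric])
  also have "\<dots> = a \<oplus> b"
    using x sm_add_left[of \<one> 1 1] by (simp add: a_def b_def a_ac)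
  finally have "2 * cnorm A (star A u \<otimes> u) = cnorm A (a \<oplus> b)"
    using c cnorm_smult[of "star A u \<otimes> u" 2] by (simp add: star_closed)
  also have "\<dots> \<le> cnorm A a + cnorm A b" using c by (intro cnorm_triangle)
  also have "\<dots> \<le> 1 + 1"
  proof (rule add_mono)
    have "\<bar>Re z\<bar> \<le> 1/4" using z abs_Re_le_cmod[of z] by linarith
    then show "cnorm A a \<le> 1" unfolding a_def by (intro lin) auto
    have "(cmod z)\<^sup>2 \<le> (1/4)\<^sup>2" using z by (intro power_mono) auto
    then show "cnorm A b \<le> 1" unfolding b_def using x sq by (intro conv) (auto simp: power2_eq_square)
  qed
  finally have "(cnorm A u)\<^sup>2 \<le> 1" using c by (simp add: cstar_identity)
  then show "cnorm A (\<one> \<oplus> z \<odot>\<^bsub>A\<^esub> x) \<le> 1"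
    using cnorm_nonneg[OF c(1)] by (simp add: power_le_one_iff u_def)
qed simp

text \<open>For self-adjoint \<open>b j\<close> the bound on \<open>\<one> \<ominus> b j\<close> is
  positivity stated by norms. With M = \<open>card F\<close>, the element M\<cdot>\<one> + b l
  equals \<open>\<one>\<close> plus the sum of the other \<open>\<one> \<ominus> b j\<close>,
  because \<open>b l\<close> is minus the sum of the others; and M\<cdot>\<one> - b l is
  \<open>\<one> \<ominus> b l\<close> plus M - 1 units. Both have norm at most M, so
  \<open>b l\<close> divided by M satisfies \<open>self_adjoint_eq_zero\<close>.\<close>

lemma summand_eq_zero:
  assumes F: "finite F" "l \<in> F"
    and b: "\<And>j. j \<in> F \<Longrightarrow> b j \<in> carrier A" "\<And>j. j \<in> F \<Longrightarrow> star A (b j) = b j"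
      "\<And>j. j \<in> F \<Longrightarrow> cnorm A (\<one> \<ominus> b j) \<le> 1"
    and sum: "(\<Oplus>j\<in>F. b j) = \<zero>"
  shows "b l = \<zero>"
proof -
  have le: "cnorm A (of_nat (card G) \<odot>\<^bsub>A\<^esub> \<one> \<ominus> (\<Oplus>j\<in>G. b j)) \<le> real (card G)" if "finite G" "G \<subseteq> F" for G
    using that
  proof (induction G rule: finite_induct)
    case (insert j G)
    have c: "b j \<in> carrier A" "(\<Oplus>j\<in>G. b j) \<in> carrier A" using insert.prems b(1) by (auto intro!: finsum_closed)
    have "of_nat (card (insert j G)) \<odot>\<^bsub>A\<^esub> \<one> \<ominus> (\<Oplus>j\<in>insert j G. b j)
        = (\<one> \<oplus> of_nat (card G) \<odot>\<^bsub>A\<^esub> \<one>) \<ominus> (b j \<oplus> (\<Oplus>j\<in>G. b j))"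
      using insert b(1) by (subst finsum_insert) (auto simp: sm_add_left Pi_def)
    also have "\<dots> = (\<one> \<ominus> b j) \<oplus> (of_nat (card G) \<odot>\<^bsub>A\<^esub> \<one> \<ominus> (\<Oplus>j\<in>G. b j))"
      using c by (simp add: mi_add_add)
    finally have "cnorm A (of_nat (card (insert j G)) \<odot>\<^bsub>A\<^esub> \<one> \<ominus> (\<Oplus>j\<in>insert j G. b j))
        \<le> cnorm A (\<one> \<ominus> b j) + cnorm A (of_nat (card G) \<odot>\<^bsub>A\<^esub> \<one> \<ominus> (\<Oplus>j\<in>G. b j))"
      using c by (simp add: cnorm_triangle)
    also have "\<dots> \<le> 1 + real (card G)" using insert b(3) by (intro add_mono) auto
    finally show ?case using insert by simp
  qed simp
  define G where "G = F - {l}"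
  define s where "s = (\<Oplus>j\<in>G. b j)"
  have G: "finite G" "G \<subseteq> F" "l \<notin> G" "F = insert l G" using F by (auto simp: G_def)
  have c: "b l \<in> carrier A" "s \<in> carrier A" using G b(1) by (auto simp: s_def intro!: finsum_closed)
  have "b l \<oplus> s = \<zero>" using sum G b(1) unfolding s_def by (simp add: Pi_def)
  then have bs: "b l = \<ominus> s" using c by (metis minus_equality a_comm minus_minus)
  define M where "M = real (card F)"
  have M: "M = 1 + real (card G)" using G by (simp add: M_def)
  have M1: "M \<ge> 1" by (simp add: M)
  define x where "x = complex_of_real (1 / M) \<odot>\<^bsub>A\<^esub> b l"
  have nx: "cnorm A (\<one> \<oplus> t \<odot>\<^bsub>A\<^esub> x) \<le> 1" if "cnorm A (complex_of_real M \<odot>\<^bsub>A\<^esub> \<one> \<oplus> t \<odot>\<^bsub>A\<^esub> b l) \<le> M" for t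
  proof -
    have "complex_of_real M \<odot>\<^bsub>A\<^esub> (\<one> \<oplus> t \<odot>\<^bsub>A\<^esub> x) = complex_of_real M \<odot>\<^bsub>A\<^esub> \<one> \<oplus> t \<odot>\<^bsub>A\<^esub> b l"
      using c M1 by (simp add: x_def sm_add_right sm_sm)
    then have "M * cnorm A (\<one> \<oplus> t \<odot>\<^bsub>A\<^esub> x) \<le> M * 1"
      using that c M1 cnorm_smult[of "\<one> \<oplus> t \<odot>\<^bsub>A\<^esub> x" "complex_of_real M"] by (simp add: x_def)
    then show ?thesis using M1 by simp
  qed
  have Mone: "complex_of_real M \<odot>\<^bsub>A\<^esub> \<one> = \<one> \<oplus> of_nat (card G) \<odot>\<^bsub>A\<^esub> \<one>"
    using sm_add_left[of \<one> 1 "of_nat (card G)"] by (simp add: M)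
  have "x = \<zero>"
  proof (rule self_adjoint_eq_zero)
    show "x \<in> carrier A" "star A x = x" using c b(2) F by (auto simp: x_def star_smult)
    have "complex_of_real M \<odot>\<^bsub>A\<^esub> \<one> \<oplus> 1 \<odot>\<^bsub>A\<^esub> b l = \<one> \<oplus> (of_nat (card G) \<odot>\<^bsub>A\<^esub> \<one> \<ominus> s)"
      using c by (simp add: Mone bs a_minus_def a_assoc)
    then have "cnorm A (complex_of_real M \<odot>\<^bsub>A\<^esub> \<one> \<oplus> 1 \<odot>\<^bsub>A\<^esub> b l) \<le> cnorm A \<one> + cnorm A (of_nat (card G) \<odot>\<^bsub>A\<^esub> \<one> \<ominus> s)"
      using c by (simp add: cnorm_triangle)
    also have "\<dots> \<le> M" using one_norm_le le[OF G(1,2)] by (simp add: M s_def)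
    finally show "cnorm A (\<one> \<oplus> x) \<le> 1" using nx[of 1] c by (simp add: x_def)
    have "complex_of_real M \<odot>\<^bsub>A\<^esub> \<one> \<oplus> (-1) \<odot>\<^bsub>A\<^esub> b l = (\<one> \<ominus> b l) \<oplus> of_nat (card G) \<odot>\<^bsub>A\<^esub> \<one>"
      using c by (simp add: Mone minus_conv_sm a_ac)
    then have "cnorm A (complex_of_real M \<odot>\<^bsub>A\<^esub> \<one> \<oplus> (-1) \<odot>\<^bsub>A\<^esub> b l)
        \<le> cnorm A (\<one> \<ominus> b l) + real (card G) * cnorm A \<one>"
      using c cnorm_triangle[of "\<one> \<ominus> b l" "of_nat (card G) \<odot>\<^bsub>A\<^esub> \<one>"] by (simp add: cnorm_smult)
    also have "\<dots> \<le> 1 + real (card G) * 1"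
      using one_norm_le b(3)[OF F(2)] by (intro add_mono mult_left_mono) auto
    finally show "cnorm A (\<one> \<ominus> x) \<le> 1"
      using nx[of "-1"] c by (simp add: x_def minus_conv_sm M)
  qed
  then have "complex_of_real M \<odot>\<^bsub>A\<^esub> x = \<zero>" by simp
  then show ?thesis using c M1 by (simp add: x_def sm_sm)
qed

text \<open>Compress the range projections \<open>e j\<close> by \<open>w t\<close>. The
  compressions \<open>b j\<close> sum to the unit, and \<open>b t\<close> alone is the unit, so the
  others sum to zero; being positive in the sense of \<open>summand_eq_zero\<close>, each vanishes.
  Finally \<open>b s\<close> is the product of \<open>star A (w s) \<otimes> w t\<close> with its
  adjoint, so the C*-identity applies.\<close>

lemma isometries_orthogonal:
  assumes F: "finite F" "s \<in> F" "t \<in> F" "s \<noteq> t"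
    and w: "\<And>j. j \<in> F \<Longrightarrow> w j \<in> carrier A" "\<And>j. j \<in> F \<Longrightarrow> star A (w j) \<otimes> w j = \<one>"
    and sum: "(\<Oplus>j\<in>F. w j \<otimes> star A (w j)) = \<one>"
  shows "star A (w s) \<otimes> w t = \<zero>"
proof -
  define e where "e j = w j \<otimes> star A (w j)" for j
  define b where "b j = star A (w t) \<otimes> e j \<otimes> w t" for j
  note wt = w(1)[OF F(3)] star_closed[OF w(1)[OF F(3)]]
  have e: "e j \<in> carrier A" "star A (e j) = e j" "e j \<otimes> e j = e j" if "j \<in> F" for j
  proof -
    note c = w(1)[OF that] star_closed[OF w(1)[OF that]]
    show "e j \<in> carrier A" "star A (e j) = e j" using c by (simp_all add: e_def star_mult star_star)
    have "e j \<otimes> e j = w j \<otimes> (star A (w j) \<otimes> w j) \<otimes> star A (w j)"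
      unfolding e_def using c by (simp add: m_assoc)
    then show "e j \<otimes> e j = e j" using c w(2)[OF that] by (simp add: e_def)
  qed
  have b: "b j \<in> carrier A" "star A (b j) = b j" if "j \<in> F" for j
    using e[OF that] wt by (simp_all add: b_def star_mult star_star m_assoc)
  have wtn: "cnorm A (w t) \<le> 1" by (rule isometry_norm_le) (use w F in auto)
  have bn: "cnorm A (\<one> \<ominus> b j) \<le> 1" if "j \<in> F" for j
  proof -
    have q: "\<one> \<ominus> e j \<in> carrier A" using e[OF that] by simp
    have qn: "cnorm A (\<one> \<ominus> e j) \<le> 1"
    proof (rule projection_norm_le[OF q])
      show "star A (\<one> \<ominus> e j) = \<one> \<ominus> e j" using e[OF that] by (simp add: star_minus)
      show "(\<one> \<ominus> e j) \<otimes> (\<one> \<ominus> e j) = \<one> \<ominus> e j"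
        using e[OF that] by (simp add: mi_mult_left mi_mult_right)
    qed
    have "\<one> \<ominus> b j = star A (w t) \<otimes> (\<one> \<ominus> e j) \<otimes> w t"
      using wt e[OF that] w(2)[OF F(3)] by (simp add: b_def mi_mult_left mi_mult_right)
    also have "cnorm A (star A (w t) \<otimes> (\<one> \<ominus> e j) \<otimes> w t) \<le> cnorm A (star A (w t)) * cnorm A (\<one> \<ominus> e j) * cnorm A (w t)"
      using wt q by (intro order_trans[OF cnorm_mult] mult_right_mono cnorm_mult) (auto simp: cnorm_nonneg)
    also have "\<dots> \<le> 1 * 1 * 1"
      using wt q qn wtn by (intro mult_mono) (auto simp: cnorm_nonneg cnorm_star)
    finally show ?thesis by simp
  qed
  have bt: "b t = \<one>"
  proof -
    have "b t = (star A (w t) \<otimes> w t) \<otimes> (star A (w t) \<otimes> w t)"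
      unfolding b_def e_def using wt by (simp add: m_assoc)
    then show ?thesis using w(2)[OF F(3)] by simp
  qed
  have "(\<Oplus>j\<in>F. b j) = star A (w t) \<otimes> (\<Oplus>j\<in>F. e j) \<otimes> w t"
  proof -
    have "star A (w t) \<otimes> (\<Oplus>j\<in>F. e j) = (\<Oplus>j\<in>F. star A (w t) \<otimes> e j)"
      using F wt e by (intro finsum_rdistr) auto
    moreover have "(\<Oplus>j\<in>F. star A (w t) \<otimes> e j) \<otimes> w t = (\<Oplus>j\<in>F. b j)"
      unfolding b_def using F wt e by (intro finsum_ldistr) auto
    ultimately show ?thesis by simp
  qed
  also have "\<dots> = \<one>" using sum w(2)[OF F(3)] wt by (simp add: e_def)
  finally have bsum: "(\<Oplus>j\<in>F. b j) = \<one>" .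
  have "(\<Oplus>j\<in>F. b j) = b t \<oplus> (\<Oplus>j\<in>F - {t}. b j)"
    using F b finsum_insert[of "F - {t}" t b] by (auto simp: insert_absorb Pi_def)
  then have "\<one> \<oplus> (\<Oplus>j\<in>F - {t}. b j) = \<one>" using bsum bt by simp
  moreover have "(\<Oplus>j\<in>F - {t}. b j) \<in> carrier A" using b by (intro finsum_closed) auto
  ultimately have z: "(\<Oplus>j\<in>F - {t}. b j) = \<zero>" by (metis add.r_cancel_one' one_closed a_comm)
  have "b s = \<zero>"
    by (rule summand_eq_zero[OF _ _ _ _ _ z]) (use F b bn in auto)
  moreover have "b s = star A (star A (w s) \<otimes> w t) \<otimes> (star A (w s) \<otimes> w t)"
    unfolding b_def e_def using w(1)[OF F(2)] star_closed[OF w(1)[OF F(2)]] wt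
    by (simp add: star_mult star_star m_assoc)
  ultimately have "(cnorm A (star A (w s) \<otimes> w t))\<^sup>2 = 0"
    using w(1) F star_closed cstar_identity[of "star A (w s) \<otimes> w t"] by simp
  then show ?thesis using w(1) F star_closed by (simp add: cnorm_eq_zero)
qed

end

section \<open>Words in a Cuntz family\<close>

locale cuntz_family = lambda_tuple k n lam + A: unital_cstar_algebra A
  for k n lam and A :: "('a, 'm) cstar_algebra_scheme" (structure) +
  fixes W :: "nat \<Rightarrow> nat \<Rightarrow> 'a"
  assumes cuntz: "cuntz_relations k n lam A W"
begin

lemma W_closed [simp]: "i \<in> {1..k} \<Longrightarrow> s \<in> {1..n i} \<Longrightarrow> W i s \<in> carrier A"
  using cuntz by (simp add: cuntz_relations_def)

lemma W_star_closed [simp]: "i \<in> {1..k} \<Longrightarrow> s \<in> {1..n i} \<Longrightarrow> star A (W i s) \<in> carrier A"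
  using A.star_closed by simp

lemma W_iso: "i \<in> {1..k} \<Longrightarrow> s \<in> {1..n i} \<Longrightarrow> star A (W i s) \<otimes> W i s = \<one>"
  using cuntz by (simp add: cuntz_relations_def)

lemma W_sum: "i \<in> {1..k} \<Longrightarrow> (\<Oplus>s\<in>{1..n i}. W i s \<otimes> star A (W i s)) = \<one>"
  using cuntz by (simp add: cuntz_relations_def)

lemma W_star_W_same:
  assumes "i \<in> {1..k}" "s \<in> {1..n i}" "t \<in> {1..n i}"
  shows "star A (W i s) \<otimes> W i t = (if s = t then \<one> else \<zero>)"
  using A.isometries_orthogonal[of "{1..n i}" s t "W i"] assms W_iso W_sum by auto

lemma W_star_W_diff:
  assumes "i \<in> {1..k}" "j \<in> {1..k}" "i \<noteq> j" "s \<in> {1..n i}" "t \<in> {1..n j}"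
  shows "star A (W i s) \<otimes> W j t = cnj (lam i j s t) \<odot>\<^bsub>A\<^esub> (W j t \<otimes> star A (W i s))"
  using cuntz assms unfolding cuntz_relations_def by blast

text \<open>The norm of the difference of both sides vanishes by the C*-identity.\<close>
lemma W_comm:
  assumes a: "i \<in> {1..k}" "j \<in> {1..k}" "i \<noteq> j" "s \<in> {1..n i}" "t \<in> {1..n j}"
  shows "W i s \<otimes> W j t = lam i j s t \<odot>\<^bsub>A\<^esub> (W j t \<otimes> W i s)"
proof -
  define l where "l = lam i j s t"
  have ll: "cnj l * l = 1" using lam_mod[OF a] complex_norm_square[of l] by (simp add: l_def mult.commute)
  define u v where "u = W i s" and "v = W j t"
  have c: "u \<in> carrier A" "v \<in> carrier A" "star A u \<in> carrier A" "star A v \<in> carrier A"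
    using a by (simp_all add: u_def v_def)
  have iso: "star A u \<otimes> u = \<one>" "star A v \<otimes> v = \<one>" using a W_iso by (simp_all add: u_def v_def)
  have uv: "star A u \<otimes> v = cnj l \<odot>\<^bsub>A\<^esub> (v \<otimes> star A u)"
    using W_star_W_diff[OF a] by (simp add: u_def v_def l_def)
  define p q where "p = u \<otimes> v" and "q = v \<otimes> u"
  have pq: "p \<in> carrier A" "q \<in> carrier A" "star A p \<in> carrier A" "star A q \<in> carrier A"
    using c A.star_closed by (simp_all add: p_def q_def)
  have pp: "star A p \<otimes> p = \<one>"
  proof -
    have "star A p \<otimes> p = star A v \<otimes> (star A u \<otimes> u) \<otimes> v"
      using c by (simp add: p_def A.star_mult A.m_assoc)
    then show ?thesis using iso c by simp
  qed
  have qq: "star A q \<otimes> q = \<one>"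
  proof -
    have "star A q \<otimes> q = star A u \<otimes> (star A v \<otimes> v) \<otimes> u"
      using c by (simp add: q_def A.star_mult A.m_assoc)
    then show ?thesis using iso c by simp
  qed
  have pq1: "star A p \<otimes> q = cnj l \<odot>\<^bsub>A\<^esub> \<one>"
  proof -
    have "star A p \<otimes> q = star A v \<otimes> (star A u \<otimes> v) \<otimes> u"
      using c by (simp add: p_def q_def A.star_mult A.m_assoc)
    also have "\<dots> = cnj l \<odot>\<^bsub>A\<^esub> ((star A v \<otimes> v) \<otimes> (star A u \<otimes> u))"
      unfolding uv using c by (simp add: A.smult_mult_left A.smult_mult_right A.m_assoc)
    finally show ?thesis using iso by simp
  qed
  have qp1: "star A q \<otimes> p = l \<odot>\<^bsub>A\<^esub> \<one>"
  proof -
    have "star A q \<otimes> p = star A (star A p \<otimes> q)" using pq by (simp add: A.star_mult A.star_star)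
    then show ?thesis by (simp add: pq1 A.star_smult)
  qed
  define x where "x = p \<ominus> l \<odot>\<^bsub>A\<^esub> q"
  \<comment> \<open>With their scalars, all four products of \<open>p\<close> and \<open>q\<close>
    with the adjoints equal the unit, because \<open>l\<close> has modulus 1.\<close>
  have "star A x \<otimes> x = (\<one> \<ominus> \<one>) \<ominus> (\<one> \<ominus> \<one>)"
    unfolding x_def using pq
    by (simp add: A.star_minus A.star_smult A.mi_mult_left A.mi_mult_right A.smult_mult_left
        A.smult_mult_right pp qq pq1 qp1 A.sm_sm A.sm_minus_right ll mult.commute[of l] del: A.mi_self)
  then have "(cnorm A x)\<^sup>2 = 0"
    using pq A.cstar_identity[of x] by (simp add: x_def)
  then have "x = \<zero>" using pq A.cnorm_eq_zero[of x] by (simp add: x_def)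
  then show ?thesis using pq A.mi_eq_zero[of p "l \<odot>\<^bsub>A\<^esub> q"] by (simp add: x_def p_def q_def u_def v_def l_def)
qed

definition letters where "letters a = concat (map (\<lambda>i. map (Pair i) (a i)) [1..<Suc k])"
  for a :: "nat \<Rightarrow> nat list"

text \<open>The components are multiplied in increasing order. This fits the phases: a new letter of
  component \<open>i\<close> travels past the letters of the components before \<open>i\<close>, and
  these are the ones that \<open>phase\<close> counts.\<close>

definition word_op where "word_op a = foldr (\<lambda>(i, s) x. W i s \<otimes> x) (letters a) \<one>"

text \<open>The condition under which a letter prepended in component \<open>i\<close> becomes the
  leading factor of the whole word, so that no scalar arises.\<close>

definition empty_below where "empty_below i a \<longleftrightarrow> (\<forall>j\<in>{1..<i}. a j = [])" for i :: nat and a :: "nat \<Rightarrow> nat list"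

lemma empty_below_mono: "empty_below j a \<Longrightarrow> i \<le> j \<Longrightarrow> empty_below i a"
  by (auto simp: empty_below_def)

lemma empty_below_upd: "empty_below i a \<Longrightarrow> i \<le> j \<Longrightarrow> empty_below i (a(j := w))"
  by (auto simp: empty_below_def)

lemma letters_Cons:
  assumes i: "i \<in> {1..k}" and e: "empty_below i a"
  shows "letters (a(i := s # a i)) = (i, s) # letters a"
proof -
  have split: "[1..<Suc k] = [1..<i] @ i # [Suc i..<Suc k]"
    using i upt_add_eq_append[of 1 i "Suc k - i"] upt_conv_Cons[of i "Suc k"] by simp
  have 1: "concat (map (\<lambda>j. map (Pair j) ((a(i := v)) j)) [1..<i]) = []" for v
    using e by (auto simp: empty_below_def)
  have 2: "map (\<lambda>j. map (Pair j) ((a(i := v)) j)) [Suc i..<Suc k] = map (\<lambda>j. map (Pair j) (a j)) [Suc i..<Suc k]" for v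
    by (rule map_cong) auto
  have "letters (a(i := v)) = map (Pair i) v @ concat (map (\<lambda>j. map (Pair j) (a j)) [Suc i..<Suc k])" for v
    unfolding letters_def split
    by (simp only: map_append concat_append list.map concat.simps fun_upd_same 1 2 append_Nil)
  from this[of "s # a i"] this[of "a i"] show ?thesis by (simp del: fun_upd_apply upt_Suc)
qed

lemma word_op_Cons_first:
  assumes "i \<in> {1..k}" "empty_below i a"
  shows "word_op (a(i := s # a i)) = W i s \<otimes> word_op a"
  using letters_Cons[OF assms] by (simp add: word_op_def del: fun_upd_apply)

lemma word_op_empty: "empty_below (Suc k) a \<Longrightarrow> word_op a = \<one>"
proof -
  assume "empty_below (Suc k) a"
  then have "letters a = []" unfolding letters_def by (auto simp: empty_below_def simp del: upt_Suc)
  then show ?thesis by (simp add: word_op_def)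
qed

text \<open>Strips the first letter of the first nonempty component. In the induction step the new
  letter is thus always the leading factor of \<open>word_op\<close>.\<close>

lemma WT_induct [consumes 1, case_names empty Cons]:
  assumes a: "a \<in> WT"
    and empty: "\<And>a. a \<in> WT \<Longrightarrow> empty_below (Suc k) a \<Longrightarrow> Pr a"
    and Cons: "\<And>a i s. a \<in> WT \<Longrightarrow> i \<in> {1..k} \<Longrightarrow> s \<in> {1..n i} \<Longrightarrow>
      empty_below i a \<Longrightarrow> Pr a \<Longrightarrow> Pr (a(i := s # a i))"
  shows "Pr a"
  using a
proof (induction "\<Sum>i\<in>{1..k}. length (a i)" arbitrary: a rule: less_induct)
  case less
  show ?case
  proof (cases "\<exists>i\<in>{1..k}. a i \<noteq> []")
    case False
    then show ?thesis using less.prems by (intro empty) (auto simp: empty_below_def)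
  next
    case True
    define i where "i = (LEAST i. i \<in> {1..k} \<and> a i \<noteq> [])"
    have i: "i \<in> {1..k}" "a i \<noteq> []"
    proof -
      have "\<exists>i. i \<in> {1..k} \<and> a i \<noteq> []" using True by blast
      from LeastI_ex[OF this] show "i \<in> {1..k}" "a i \<noteq> []" unfolding i_def by blast+
    qed
    have e: "a j = []" if "j \<in> {1..<i}" for j
    proof -
      have "j < i" "j \<in> {1..k}" using that i by auto
      then show ?thesis
        using not_less_Least[of j "\<lambda>i. i \<in> {1..k} \<and> a i \<noteq> []"] unfolding i_def[symmetric] by blast
    qed
    define a' where "a' = a(i := tl (a i))"
    have "length (a' j) \<le> length (a j)" for j by (simp add: a'_def)
    moreover have "length (a' i) < length (a i)" using i by (simp add: a'_def)
    ultimately have "(\<Sum>j\<in>{1..k}. length (a' j)) < (\<Sum>j\<in>{1..k}. length (a j))"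
      using i by (intro sum_strict_mono_ex1) auto
    moreover have a': "a' \<in> WT" using less.prems i by (simp add: a'_def WT_tl)
    ultimately have "Pr a'" by (rule less.hyps)
    have "Pr (a'(i := hd (a i) # a' i))"
    proof (rule Cons[OF a' i(1) WT_hd[OF less.prems i] _ \<open>Pr a'\<close>])
      show "empty_below i a'" using e by (auto simp: empty_below_def a'_def)
    qed
    moreover have "a'(i := hd (a i) # a' i) = a" using i by (simp add: a'_def)
    ultimately show ?thesis by simp
  qed
qed

lemma word_op_closed [simp]: "a \<in> WT \<Longrightarrow> word_op a \<in> carrier A"
  by (induction a rule: WT_induct) (simp_all add: word_op_empty word_op_Cons_first del: fun_upd_apply)

lemma phase_eq_1: "empty_below i a \<Longrightarrow> phase i s a = 1"
  unfolding phase_def by (rule prod.neutral) (simp add: lam_word_def empty_below_def)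

text \<open>The letter \<open>W i s\<close> is moved to its place by \<open>W_comm\<close>,
  collecting one factor for each letter it passes. The result agrees with the action of
  \<open>S i s\<close> on \<open>chi a\<close>, the first instance of the correspondence
  \<open>acts\<close>.\<close>

lemma W_word_op:
  assumes "a \<in> WT" and i: "i \<in> {1..k}" "s \<in> {1..n i}"
  shows "W i s \<otimes> word_op a = phase i s a \<odot>\<^bsub>A\<^esub> word_op (a(i := s # a i))"
  using assms(1)
proof (induction a rule: WT_induct)
  case (empty a)
  then have "empty_below i a" using i by (auto intro: empty_below_mono)
  then show ?case using i empty WT_Cons[OF empty(1) i] by (simp add: word_op_Cons_first phase_eq_1 del: fun_upd_apply)
next
  case (Cons a j t)
  let ?a = "a(j := t # a j)"
  have aW: "?a \<in> WT" using Cons by (simp add: WT_Cons)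
  show ?case
  proof (cases "i \<le> j")
    case True
    have e: "empty_below i ?a" using empty_below_upd[OF empty_below_mono[OF Cons(4) True] True] .
    have "word_op (?a(i := s # ?a i)) = W i s \<otimes> word_op ?a" by (rule word_op_Cons_first[OF i(1) e])
    moreover have "phase i s ?a = 1" using e by (rule phase_eq_1)
    ultimately show ?thesis using i aW by (simp del: fun_upd_apply)
  next
    case False
    have ij: "i \<noteq> j" "j < i" using False by auto
    have sW: "a(i := s # a i) \<in> WT" using Cons(1) i by (rule WT_Cons)
    have e: "empty_below j (a(i := s # a i))" using Cons(4) ij by (auto simp: empty_below_def)
    have tw: "(a(i := s # a i))(j := t # (a(i := s # a i)) j) = ?a(i := s # ?a i)"
      using ij by (simp add: fun_upd_twist)
    have "W i s \<otimes> word_op ?a = W i s \<otimes> (W j t \<otimes> word_op a)"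
      using word_op_Cons_first[OF Cons(2,4)] by (simp del: fun_upd_apply)
    also have "\<dots> = lam i j s t \<odot>\<^bsub>A\<^esub> (W j t \<otimes> (W i s \<otimes> word_op a))"
      using Cons(1-3) i ij W_comm[OF i(1) Cons(2) ij(1) i(2) Cons(3)]
      by (metis A.m_assoc A.m_closed A.smult_mult_left W_closed word_op_closed)
    also have "W i s \<otimes> word_op a = phase i s a \<odot>\<^bsub>A\<^esub> word_op (a(i := s # a i))" by (rule Cons(5))
    also have "lam i j s t \<odot>\<^bsub>A\<^esub> (W j t \<otimes> (phase i s a \<odot>\<^bsub>A\<^esub> word_op (a(i := s # a i))))
        = (lam i j s t * phase i s a) \<odot>\<^bsub>A\<^esub> (W j t \<otimes> word_op (a(i := s # a i)))"
      using sW Cons by (simp add: A.smult_mult_right A.sm_sm)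
    also have "W j t \<otimes> word_op (a(i := s # a i)) = word_op (?a(i := s # ?a i))"
      using word_op_Cons_first[OF Cons(2) e, of t] tw by (simp del: fun_upd_apply)
    also have "lam i j s t * phase i s a = phase i s ?a"
      using phase_Cons[of j i s a t "a j"] ij Cons(2) by simp
    finally show ?thesis .
  qed
qed

lemma word_op_Cons:
  assumes a: "a \<in> WT" and i: "i \<in> {1..k}" "s \<in> {1..n i}"
  shows "word_op (a(i := s # a i)) = cnj (phase i s a) \<odot>\<^bsub>A\<^esub> (W i s \<otimes> word_op a)"
  using W_word_op[OF a i] phase_cnj[OF a i] WT_Cons[OF a i] by (simp add: A.sm_sm)

lemma W_star_word_op:
  assumes a: "a \<in> WT" and i: "i \<in> {1..k}" "s \<in> {1..n i}" "t \<in> {1..n i}"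
  shows "star A (W i s) \<otimes> word_op (a(i := t # a i))
    = (if s = t then cnj (phase i s a) \<odot>\<^bsub>A\<^esub> word_op a else \<zero>)"
proof -
  have "star A (W i s) \<otimes> word_op (a(i := t # a i)) = cnj (phase i t a) \<odot>\<^bsub>A\<^esub> ((star A (W i s) \<otimes> W i t) \<otimes> word_op a)"
    using a i by (simp add: word_op_Cons A.smult_mult_right A.m_assoc)
  then show ?thesis using W_star_W_same[OF i] a by simp
qed

section \<open>Words of one multi-length: orthogonality and resolution of the unit\<close>

definition level where "level m = {a \<in> WT. \<forall>i\<in>{1..k}. length (a i) = m i}" for m :: "nat \<Rightarrow> nat"

lemma level_WT: "a \<in> level m \<Longrightarrow> a \<in> WT"
  by (simp add: level_def)

lemma finite_level: "finite (level m)"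
proof (rule finite_subset)
  show "level m \<subseteq> (\<Pi>\<^sub>E i\<in>{1..k}. {w. set w \<subseteq> {1..n i} \<and> length w = m i})"
  proof
    fix a assume "a \<in> level m"
    then have "a \<in> WT" "\<forall>i\<in>{1..k}. length (a i) = m i" by (simp_all add: level_def)
    moreover from this(1) have "a \<in> extensional {1..k}" by (simp add: word_tuples_def PiE_iff)
    ultimately show "a \<in> (\<Pi>\<^sub>E i\<in>{1..k}. {w. set w \<subseteq> {1..n i} \<and> length w = m i})"
      unfolding PiE_iff using WT_letters by blast
  qed
  show "finite (\<Pi>\<^sub>E i\<in>{1..k}. {w. set w \<subseteq> {1..n i} \<and> length w = m i})"
    by (intro finite_PiE finite_lists_length_eq) auto
qed

lemma level_tl:
  assumes b: "b \<in> level m" and i: "i \<in> {1..k}"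
  shows "b(i := tl (b i)) \<in> level (m(i := m i - 1))"
proof -
  have "length (b j) = m j" if "j \<in> {1..k}" for j using b that by (simp add: level_def)
  then have "length ((b(i := tl (b i))) j) = (m(i := m i - 1)) j" if "j \<in> {1..k}" for j
    using that by simp
  then show ?thesis using WT_tl[OF level_WT[OF b] i] unfolding level_def by blast
qed

lemma level_eq_empty_tuple:
  assumes "a \<in> level m" "b \<in> level m" "\<forall>i\<in>{1..k}. m i = 0" shows "a = b"
proof (rule PiE_ext)
  show "a \<in> (\<Pi>\<^sub>E i\<in>{1..k}. lists {1..n i})" "b \<in> (\<Pi>\<^sub>E i\<in>{1..k}. lists {1..n i})"
    using assms(1,2) by (simp_all add: level_def word_tuples_def)
  fix i assume "i \<in> {1..k}"
  then have "length (a i) = 0" "length (b i) = 0" using assms by (simp_all add: level_def)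
  then show "a i = b i" by simp
qed

text \<open>Equal multi-lengths ensure that \<open>b\<close> also has a letter in the component
  where \<open>a\<close> begins. That letter can be brought to the front of \<open>b\<close>; the
  scalar this costs is 1 when the remaining tuples coincide, since \<open>a\<close> is empty in the
  earlier components.\<close>

lemma word_op_orth:
  assumes "a \<in> WT" "a \<in> level m" "b \<in> level m"
  shows "star A (word_op a) \<otimes> word_op b = (if a = b then \<one> else \<zero>)"
  using assms
proof (induction a arbitrary: b m rule: WT_induct)
  case (empty a)
  then have "\<forall>i\<in>{1..k}. m i = 0" by (auto simp: level_def empty_below_def)
  then have "a = b" using level_eq_empty_tuple empty.prems by blast
  then show ?case using empty.hyps by (simp add: word_op_empty)
next
  case (Cons a i s)
  have bW: "b \<in> WT" using Cons.prems level_WT by simp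
  have "length ((a(i := s # a i)) i) = m i" "length (b i) = m i"
    using Cons.prems Cons.hyps(2) unfolding level_def by blast+
  then have "length (b i) = Suc (length (a i))" by simp
  then obtain t w where bi: "b i = t # w" by (cases "b i") auto
  define b' where "b' = b(i := w)"
  have b'W: "b' \<in> WT" using WT_tl[OF bW Cons.hyps(2)] bi by (simp add: b'_def)
  have t: "t \<in> {1..n i}" using WT_hd[OF bW Cons.hyps(2)] bi by simp
  have b: "b = b'(i := t # b' i)" using bi by (auto simp: b'_def)
  have lev: "a \<in> level (m(i := m i - 1))" "b' \<in> level (m(i := m i - 1))"
    using level_tl[OF Cons.prems(1) Cons.hyps(2)] level_tl[OF Cons.prems(2) Cons.hyps(2)] bi
    by (simp_all add: b'_def fun_upd_same del: fun_upd_apply)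
  have "star A (word_op (a(i := s # a i))) \<otimes> word_op b = star A (word_op a) \<otimes> (star A (W i s) \<otimes> word_op (b'(i := t # b' i)))"
    using Cons.hyps bW b by (simp add: word_op_Cons_first A.star_mult A.m_assoc A.star_closed del: fun_upd_apply)
  also have "\<dots> = (if s = t then cnj (phase i s b') \<odot>\<^bsub>A\<^esub> (star A (word_op a) \<otimes> word_op b') else \<zero>)"
    using Cons.hyps b'W t by (simp add: W_star_word_op A.smult_mult_right A.star_closed del: fun_upd_apply)
  also have "\<dots> = (if s = t \<and> a = b' then \<one> else \<zero>)"
    using Cons.IH[OF lev] phase_eq_1[OF Cons.hyps(4), of s] by auto
  also have "s = t \<and> a = b' \<longleftrightarrow> a(i := s # a i) = b"
    unfolding b by (metis fun_upd_same fun_upd_upd list.inject fun_upd_triv)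
  finally show ?case .
qed

lemma word_op_iso: "a \<in> WT \<Longrightarrow> star A (word_op a) \<otimes> word_op a = \<one>"
  using word_op_orth[of a "\<lambda>i. length (a i)" a] by (simp add: level_def)

lemma word_op_norm_le: "a \<in> WT \<Longrightarrow> cnorm A (word_op a) \<le> 1"
  using A.isometry_norm_le word_op_iso by simp

text \<open>The level is split by the first letter of a component of nonzero length. The phase
  cancels between a word and its adjoint, the inner sum is the unit by induction, and the sum over
  letters is \<open>W_sum\<close>.\<close>

lemma word_op_sum: "(\<Oplus>a\<in>level m. word_op a \<otimes> star A (word_op a)) = \<one>"
proof (induction "\<Sum>i\<in>{1..k}. m i" arbitrary: m rule: less_induct)
  case less
  show ?case
  proof (cases "\<exists>i\<in>{1..k}. m i \<noteq> 0")
    case False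
    define a where "a = (\<lambda>i\<in>{1..k}. [] :: nat list)"
    have a: "a \<in> level m" using False by (auto simp: a_def level_def word_tuples_def)
    have "\<forall>i\<in>{1..k}. m i = 0" using False by blast
    then have "level m = {a}" using level_eq_empty_tuple[of _ m a] a by blast
    moreover have "word_op a = \<one>" by (rule word_op_empty) (simp add: a_def empty_below_def)
    ultimately show ?thesis by simp
  next
    case True
    then obtain i where i: "i \<in> {1..k}" "m i \<noteq> 0" by blast
    define m' where "m' = m(i := m i - 1)"
    have lt: "(\<Sum>j\<in>{1..k}. m' j) < (\<Sum>j\<in>{1..k}. m j)"
      using i by (intro sum_strict_mono_ex1) (auto simp: m'_def)
    define ins where "ins s a = a(i := s # a i)" for s and a :: "nat \<Rightarrow> nat list"
    have inj: "inj_on (ins s) (level m')" for s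
    proof (rule inj_onI)
      fix a b assume "ins s a = ins s b"
      then have "(ins s a)(i := tl (ins s a i)) = (ins s b)(i := tl (ins s b i))" by simp
      then show "a = b" by (simp add: ins_def)
    qed
    have level: "level m = (\<Union>s\<in>{1..n i}. ins s ` level m')"
    proof (intro equalityI subsetI)
      fix b assume b: "b \<in> level m"
      then have bW: "b \<in> WT" "length (b i) = m i" using i by (auto simp: level_def)
      then have ne: "b i \<noteq> []" using i by auto
      have "b(i := tl (b i)) \<in> level m'" using level_tl[OF b i(1)] by (simp add: m'_def)
      moreover have "b = ins (hd (b i)) (b(i := tl (b i)))" using ne by (simp add: ins_def)
      ultimately show "b \<in> (\<Union>s\<in>{1..n i}. ins s ` level m')" using WT_hd[OF bW(1) i(1) ne] by blast
    next
      fix b assume "b \<in> (\<Union>s\<in>{1..n i}. ins s ` level m')"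
      then obtain s a where "s \<in> {1..n i}" "a \<in> level m'" "b = ins s a" by blast
      then show "b \<in> level m" using i WT_Cons[of a i s] by (auto simp: level_def ins_def m'_def)
    qed
    have WC: "word_op b \<otimes> star A (word_op b) \<in> carrier A" if "b \<in> level l" for b l
      using level_WT[OF that] by (simp add: A.star_closed)
    have insL: "ins s a \<in> level m" if "s \<in> {1..n i}" "a \<in> level m'" for s a using that level by blast
    have "(\<Oplus>b\<in>level m. word_op b \<otimes> star A (word_op b)) = (\<Oplus>s\<in>{1..n i}. \<Oplus>b\<in>ins s ` level m'. word_op b \<otimes> star A (word_op b))"
      unfolding level
    proof (rule A.add.finprod_UN_disjoint)
      show "finite (ins s ` level m')" for s using finite_level by blast
      have "ins s a \<noteq> ins t b" if "s \<noteq> t" for s t a b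
      proof
        assume "ins s a = ins t b"
        then have "ins s a i = ins t b i" by (rule fun_cong)
        then show False using that by (simp add: ins_def)
      qed
      then show "pairwise (\<lambda>s t. disjnt (ins s ` level m') (ins t ` level m')) {1..n i}"
        by (intro pairwiseI) (auto simp: disjnt_iff)
      show "word_op b \<otimes> star A (word_op b) \<in> carrier A" if "s \<in> {1..n i}" "b \<in> ins s ` level m'" for s b
      proof -
        have "b \<in> level m" using that insL by blast
        then show ?thesis using WC by simp
      qed
    qed simp
    also have "\<dots> = (\<Oplus>s\<in>{1..n i}. W i s \<otimes> star A (W i s))"
    proof (rule A.finsum_cong')
      fix s assume s: "s \<in> {1..n i}"
      note Wc = W_closed[OF i(1) s] W_star_closed[OF i(1) s]
      have "(\<Oplus>b\<in>ins s ` level m'. word_op b \<otimes> star A (word_op b)) = (\<Oplus>a\<in>level m'. word_op (ins s a) \<otimes> star A (word_op (ins s a)))"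
        using WC insL[OF s] by (intro A.finsum_reindex[OF _ inj]) blast
      also have "\<dots> = (\<Oplus>a\<in>level m'. W i s \<otimes> (word_op a \<otimes> star A (word_op a)) \<otimes> star A (W i s))"
      proof (rule A.finsum_cong')
        fix a assume "a \<in> level m'"
        then have a: "a \<in> WT" by (rule level_WT)
        note ac = word_op_closed[OF a] A.star_closed[OF word_op_closed[OF a]]
        have "word_op (ins s a) \<otimes> star A (word_op (ins s a))
          = (phase i s a * cnj (phase i s a)) \<odot>\<^bsub>A\<^esub> (W i s \<otimes> word_op a \<otimes> star A (W i s \<otimes> word_op a))"
          unfolding ins_def using word_op_Cons[OF a i(1) s] Wc ac
          by (simp add: A.star_smult A.smult_mult_left A.smult_mult_right A.sm_sm A.star_mult mult.commute)
        then show "word_op (ins s a) \<otimes> star A (word_op (ins s a)) = W i s \<otimes> (word_op a \<otimes> star A (word_op a)) \<otimes> star A (W i s)"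
          using phase_cnj[OF a i(1) s] Wc ac by (simp add: A.star_mult A.m_assoc)
      qed (use WC Wc in auto)
      also have "\<dots> = W i s \<otimes> (\<Oplus>a\<in>level m'. word_op a \<otimes> star A (word_op a)) \<otimes> star A (W i s)"
        using finite_level WC Wc by (subst A.finsum_rdistr, simp, simp, blast, subst A.finsum_ldistr) auto
      also have "\<dots> = W i s \<otimes> star A (W i s)"
        using less[OF lt] Wc by simp
      finally show "(\<Oplus>b\<in>ins s ` level m'. word_op b \<otimes> star A (word_op b)) = W i s \<otimes> star A (W i s)" .
    qed (use i in auto)
    finally show ?thesis using W_sum[OF i(1)] by simp
  qed
qed

text \<open>Shows that an element of \<open>A\<close> is determined by its products with the words
  of a single level.\<close>

lemma level_expansion:
  assumes y: "y \<in> carrier A"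
  shows "y = (\<Oplus>a\<in>level m. (y \<otimes> word_op a) \<otimes> star A (word_op a))"
proof -
  have c: "word_op a \<in> carrier A" "star A (word_op a) \<in> carrier A" if "a \<in> level m" for a
    using level_WT[OF that] by (simp_all add: A.star_closed)
  have "y = y \<otimes> (\<Oplus>a\<in>level m. word_op a \<otimes> star A (word_op a))" using y by (simp add: word_op_sum)
  also have "\<dots> = (\<Oplus>a\<in>level m. y \<otimes> (word_op a \<otimes> star A (word_op a)))"
    using y c finite_level by (intro A.finsum_rdistr) auto
  also have "\<dots> = (\<Oplus>a\<in>level m. (y \<otimes> word_op a) \<otimes> star A (word_op a))"
    using y c by (intro A.finsum_cong') (auto simp: A.m_assoc)
  finally show ?thesis .
qed

end

section \<open>Comparing the actions of the two families on words\<close>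

lemma ell2_norm_chi_le: "a \<in> I \<Longrightarrow> ell2_norm I (chi a) \<le> 1"
proof (rule ell2_bounded_finite_sums(2))
  fix F :: "'a set" assume "finite F" "F \<subseteq> I"
  have "(\<Sum>x\<in>F. (cmod (chi a x))\<^sup>2) = (\<Sum>x\<in>F. if x = a then 1 else 0)"
    by (rule sum.cong) (auto simp: chi_def)
  then show "(\<Sum>x\<in>F. (cmod (chi a x))\<^sup>2) \<le> 1\<^sup>2" using \<open>finite F\<close> by simp
qed (auto simp: chi_def)

lemma star_entry:
  assumes "x \<in> carrier (op_algebra I)" "a \<in> I" "b \<in> I"
  shows "star (op_algebra I) x (chi b) a = cnj (x (chi a) b)"
  using assms op_star[of x I] chi_in_ell2[of a I] chi_in_ell2[of b I]
    op_star(2)[of x I "chi a" "chi b"]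
  by (simp add: carrier_op_algebra ell2_inner_chi bounded_opsD(1))

context cuntz_family
begin

lemma chi_ell2 [simp]: "a \<in> WT \<Longrightarrow> chi a \<in> ell2 WT"
  by (rule chi_in_ell2)

definition fin_supp where "fin_supp f \<longleftrightarrow> finite {b. f b \<noteq> 0} \<and> {b. f b \<noteq> 0} \<subseteq> WT"
  for f :: "(nat \<Rightarrow> nat list) \<Rightarrow> complex"

text \<open>The linear extension of \<open>chi b\<close> to \<open>word_op b\<close> over finitely
  supported vectors. It stands in for vectors, since \<open>A\<close> does not act on the sequence
  space.\<close>

definition word_sum where "word_sum f = (\<Oplus>b\<in>{b. f b \<noteq> 0}. f b \<odot>\<^bsub>A\<^esub> word_op b)"

lemma fin_suppI: "finite F \<Longrightarrow> F \<subseteq> WT \<Longrightarrow> (\<And>b. b \<notin> F \<Longrightarrow> f b = 0) \<Longrightarrow> fin_supp f"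
  unfolding fin_supp_def by (metis (mono_tags, lifting) finite_subset mem_Collect_eq subsetI subset_trans)

lemma word_sum_eq:
  assumes "finite F" "F \<subseteq> WT" "\<And>b. b \<notin> F \<Longrightarrow> f b = 0"
  shows "word_sum f = (\<Oplus>b\<in>F. f b \<odot>\<^bsub>A\<^esub> word_op b)"
proof -
  have "word_op b \<in> carrier A" if "f b \<noteq> 0" for b using assms(2,3) that by (metis word_op_closed subsetD)
  then show ?thesis
    unfolding word_sum_def
    by (intro A.finsum_mono_neutral[symmetric]) (use assms in auto)
qed

lemma word_sum_closed [simp]: "fin_supp f \<Longrightarrow> word_sum f \<in> carrier A"
  unfolding word_sum_def fin_supp_def by (intro A.finsum_closed) auto

lemma word_sum_add:
  assumes "fin_supp f" "fin_supp g" shows "fin_supp (\<lambda>b. f b + g b)" "word_sum (\<lambda>b. f b + g b) = word_sum f \<oplus> word_sum g"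
proof -
  define F where "F = {b. f b \<noteq> 0} \<union> {b. g b \<noteq> 0}"
  have F: "finite F" "F \<subseteq> WT" using assms by (auto simp: F_def fin_supp_def)
  have z: "f b = 0" "g b = 0" if "b \<notin> F" for b using that by (auto simp: F_def)
  show "fin_supp (\<lambda>b. f b + g b)" by (rule fin_suppI[OF F]) (simp add: z)
  have c: "b \<in> F \<Longrightarrow> word_op b \<in> carrier A" for b using F by auto
  have "word_sum (\<lambda>b. f b + g b) = (\<Oplus>b\<in>F. (f b + g b) \<odot>\<^bsub>A\<^esub> word_op b)"
    by (rule word_sum_eq[OF F]) (simp add: z)
  also have "\<dots> = (\<Oplus>b\<in>F. f b \<odot>\<^bsub>A\<^esub> word_op b \<oplus> g b \<odot>\<^bsub>A\<^esub> word_op b)"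
    using c by (intro A.finsum_cong') (auto simp: A.sm_add_left)
  also have "\<dots> = (\<Oplus>b\<in>F. f b \<odot>\<^bsub>A\<^esub> word_op b) \<oplus> (\<Oplus>b\<in>F. g b \<odot>\<^bsub>A\<^esub> word_op b)"
    using c by (intro A.finsum_addf) auto
  also have "\<dots> = word_sum f \<oplus> word_sum g"
    using word_sum_eq[OF F, of f] word_sum_eq[OF F, of g] z by simp
  finally show "word_sum (\<lambda>b. f b + g b) = word_sum f \<oplus> word_sum g" .
qed

lemma word_sum_cmult:
  assumes "fin_supp f" shows "fin_supp (\<lambda>b. c * f b)" "word_sum (\<lambda>b. c * f b) = c \<odot>\<^bsub>A\<^esub> word_sum f"
proof -
  define F where "F = {b. f b \<noteq> 0}"
  have F: "finite F" "F \<subseteq> WT" using assms by (auto simp: F_def fin_supp_def)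
  have z: "f b = 0" if "b \<notin> F" for b using that by (auto simp: F_def)
  show "fin_supp (\<lambda>b. c * f b)" by (rule fin_suppI[OF F]) (simp add: z)
  have w: "b \<in> F \<Longrightarrow> word_op b \<in> carrier A" for b using F by auto
  have "word_sum (\<lambda>b. c * f b) = (\<Oplus>b\<in>F. (c * f b) \<odot>\<^bsub>A\<^esub> word_op b)"
    by (rule word_sum_eq[OF F]) (simp add: z)
  also have "\<dots> = (\<Oplus>b\<in>F. c \<odot>\<^bsub>A\<^esub> (f b \<odot>\<^bsub>A\<^esub> word_op b))"
    using w by (intro A.finsum_cong') (auto simp: A.sm_sm)
  also have "\<dots> = c \<odot>\<^bsub>A\<^esub> word_sum f"
  proof -
    have "word_sum f = (\<Oplus>b\<in>F. f b \<odot>\<^bsub>A\<^esub> word_op b)" by (rule word_sum_eq[OF F]) (simp add: z)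
    then show ?thesis using A.sm_finsum[OF F(1), of "\<lambda>b. f b \<odot>\<^bsub>A\<^esub> word_op b" c] w by simp
  qed
  finally show "word_sum (\<lambda>b. c * f b) = c \<odot>\<^bsub>A\<^esub> word_sum f" .
qed

lemma word_sum_zero: "fin_supp (\<lambda>b. 0)" "word_sum (\<lambda>b. 0) = \<zero>"
  by (simp_all add: fin_supp_def word_sum_def)

lemma word_sum_sum:
  assumes "finite F" "\<And>i. i \<in> F \<Longrightarrow> fin_supp (g i)"
  shows "fin_supp (\<lambda>b. \<Sum>i\<in>F. c i * g i b) \<and> word_sum (\<lambda>b. \<Sum>i\<in>F. c i * g i b) = (\<Oplus>i\<in>F. c i \<odot>\<^bsub>A\<^esub> word_sum (g i))"
  using assms
proof (induction F rule: finite_induct)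
  case (insert i F)
  have "(\<lambda>i. c i \<odot>\<^bsub>A\<^esub> word_sum (g i)) \<in> F \<rightarrow> carrier A" using insert.prems by auto
  then show ?case
    using insert word_sum_add[OF word_sum_cmult(1)[of "g i" "c i"]] word_sum_cmult[of "g i" "c i"] by simp
qed (simp add: word_sum_zero)

lemma word_sum_chi: "a \<in> WT \<Longrightarrow> fin_supp (chi a)" "a \<in> WT \<Longrightarrow> word_sum (chi a) = word_op a"
proof -
  assume a: "a \<in> WT"
  show "fin_supp (chi a)" by (rule fin_suppI[of "{a}"]) (use a in \<open>auto simp: chi_def\<close>)
  have "word_sum (chi a) = (\<Oplus>b\<in>{a}. chi a b \<odot>\<^bsub>A\<^esub> word_op b)"
    by (rule word_sum_eq) (use a in \<open>auto simp: chi_def\<close>)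
  then show "word_sum (chi a) = word_op a" using a by (simp add: chi_def)
qed

lemma mult_word_sum:
  assumes y: "y \<in> carrier A" and F: "finite F" "F \<subseteq> WT" "\<And>b. b \<notin> F \<Longrightarrow> f b = 0"
  shows "y \<otimes> word_sum f = (\<Oplus>b\<in>F. f b \<odot>\<^bsub>A\<^esub> (y \<otimes> word_op b))"
proof -
  have w: "b \<in> F \<Longrightarrow> word_op b \<in> carrier A" for b using F by auto
  have "y \<otimes> word_sum f = y \<otimes> (\<Oplus>b\<in>F. f b \<odot>\<^bsub>A\<^esub> word_op b)" using word_sum_eq[of F f] F by simp
  also have "\<dots> = (\<Oplus>b\<in>F. y \<otimes> (f b \<odot>\<^bsub>A\<^esub> word_op b))"
    using y w F by (intro A.finsum_rdistr) auto
  also have "\<dots> = (\<Oplus>b\<in>F. f b \<odot>\<^bsub>A\<^esub> (y \<otimes> word_op b))"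
    using y w by (intro A.finsum_cong') (auto simp: A.smult_mult_right)
  finally show ?thesis .
qed

text \<open>Left multiplication by \<open>y\<close> has on the word of \<open>a\<close> the
  coefficients that \<open>x\<close> has on \<open>chi a\<close>. Requiring finite support keeps the
  sum in \<open>A\<close> algebraic.\<close>

definition acts where "acts x y a \<longleftrightarrow> fin_supp (x (chi a)) \<and> y \<otimes> word_op a = word_sum (x (chi a))"

lemma apply_fin_supp:
  assumes x: "x \<in> carrier B" and F: "finite F" "F \<subseteq> WT" "\<And>b. b \<notin> F \<Longrightarrow> f b = 0"
  shows "x f = (\<lambda>z. \<Sum>b\<in>F. f b * x (chi b) z)"
proof -
  have "f = (\<lambda>z. \<Sum>b\<in>F. f b * chi b z)"
    using F by (auto simp: sum_mult_chi)
  moreover have "x (\<lambda>z. \<Sum>b\<in>F. f b * chi b z) = (\<lambda>z. \<Sum>b\<in>F. f b * x (chi b) z)"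
    by (rule bounded_ops_sum) (use x F in \<open>auto simp: carrier_op_algebra\<close>)
  ultimately show ?thesis by metis
qed

text \<open>The image of \<open>chi a\<close> under \<open>x'\<close> is a finite combination, so
  the correspondence for \<open>x\<close> is used only at the indices it reaches. The second
  conclusion follows supports through products, as the count of degrees will require.\<close>

lemma acts_mult:
  assumes c: "x \<in> carrier B" "x' \<in> carrier B" "y \<in> carrier A" "y' \<in> carrier A" and a: "a \<in> WT"
    and 1: "acts x' y' a" and 2: "\<And>b. x' (chi a) b \<noteq> 0 \<Longrightarrow> acts x y b"
  shows "acts (x \<otimes>\<^bsub>B\<^esub> x') (y \<otimes> y') a"
    "(x \<otimes>\<^bsub>B\<^esub> x') (chi a) z \<noteq> 0 \<Longrightarrow> \<exists>b. x' (chi a) b \<noteq> 0 \<and> x (chi b) z \<noteq> 0"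
proof -
  define f where "f = x' (chi a)"
  define F where "F = {b. f b \<noteq> 0}"
  have F: "finite F" "F \<subseteq> WT" using 1 by (auto simp: acts_def fin_supp_def F_def f_def)
  have z: "f b = 0" if "b \<notin> F" for b using that by (simp add: F_def)
  have xf: "(x \<otimes>\<^bsub>B\<^esub> x') (chi a) = (\<lambda>z. \<Sum>b\<in>F. f b * x (chi b) z)"
    using apply_fin_supp[OF c(1) F z] a by (simp add: f_def)
  have ab: "acts x y b" if "b \<in> F" for b using 2 that by (simp add: F_def f_def)
  then have fsb: "fin_supp (x (chi b))" "y \<otimes> word_op b = word_sum (x (chi b))" if "b \<in> F" for b
    using that by (auto simp: acts_def)
  have S: "fin_supp (\<lambda>z. \<Sum>b\<in>F. f b * x (chi b) z)"
    "word_sum (\<lambda>z. \<Sum>b\<in>F. f b * x (chi b) z) = (\<Oplus>b\<in>F. f b \<odot>\<^bsub>A\<^esub> word_sum (x (chi b)))"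
    using word_sum_sum[OF F(1), of "\<lambda>b. x (chi b)" f] fsb by auto
  have "y \<otimes> y' \<otimes> word_op a = y \<otimes> word_sum f"
    using 1 c a by (simp add: acts_def f_def A.m_assoc)
  also have "\<dots> = (\<Oplus>b\<in>F. f b \<odot>\<^bsub>A\<^esub> (y \<otimes> word_op b))" by (rule mult_word_sum[OF c(3) F z])
  also have "\<dots> = (\<Oplus>b\<in>F. f b \<odot>\<^bsub>A\<^esub> word_sum (x (chi b)))"
    using fsb by (intro A.finsum_cong') auto
  finally show "acts (x \<otimes>\<^bsub>B\<^esub> x') (y \<otimes> y') a"
    using S xf by (simp add: acts_def)
  assume "(x \<otimes>\<^bsub>B\<^esub> x') (chi a) z \<noteq> 0"
  then obtain b where "b \<in> F" "f b * x (chi b) z \<noteq> 0" unfolding xf by (meson sum.neutral)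
  then show "\<exists>b. x' (chi a) b \<noteq> 0 \<and> x (chi b) z \<noteq> 0" by (auto simp: f_def)
qed

section \<open>Matrix blocks\<close>

definition level_proj where "level_proj m = op_proj WT (level m)"

lemma level_proj_closed [simp]: "level_proj m \<in> carrier B"
  by (simp add: level_proj_def)

lemma level_proj_idem: "level_proj m \<otimes>\<^bsub>B\<^esub> level_proj m = level_proj m"
  by (rule op_eqI[of _ WT]) (auto simp: level_proj_def ell2_If)

lemma level_proj_star: "star B (level_proj m) = level_proj m"
  by (simp add: level_proj_def op_proj_star)

lemma level_proj_apply: "f \<in> ell2 WT \<Longrightarrow> level_proj m f = (\<lambda>b. if b \<in> level m then f b else 0)"
  by (simp add: level_proj_def)

lemma level_proj_norm_le: "cnorm B (level_proj m) \<le> 1"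
  by (simp add: level_proj_def op_proj_norm_le)

lemma level_proj_mult_chi:
  assumes "x \<in> carrier B" "a \<in> WT"
  shows "(level_proj m \<otimes>\<^bsub>B\<^esub> x) (chi a) = (\<lambda>b. if b \<in> level m then x (chi a) b else 0)"
  using assms op_apply_ell2[of x WT "chi a"] by (simp add: level_proj_apply)

lemma fin_supp_level: "fin_supp (\<lambda>b. if b \<in> level m then f b else 0)"
  by (rule fin_suppI[OF finite_level]) (auto simp: level_WT)

lemma word_sum_level: "word_sum (\<lambda>b. if b \<in> level m then f b else 0) = (\<Oplus>b\<in>level m. f b \<odot>\<^bsub>A\<^esub> word_op b)"
proof -
  have "word_sum (\<lambda>b. if b \<in> level m then f b else 0)
      = (\<Oplus>b\<in>level m. (if b \<in> level m then f b else 0) \<odot>\<^bsub>A\<^esub> word_op b)"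
    by (rule word_sum_eq[OF finite_level]) (auto simp: level_WT)
  also have "\<dots> = (\<Oplus>b\<in>level m. f b \<odot>\<^bsub>A\<^esub> word_op b)"
    by (rule A.finsum_cong') (auto simp: level_WT)
  finally show ?thesis .
qed

text \<open>Orthogonality within a level reads off a coefficient, as pairing with
  \<open>chi b\<close> does for vectors.\<close>

lemma word_op_star_word_sum:
  assumes b: "b \<in> level m"
  shows "star A (word_op b) \<otimes> word_sum (\<lambda>b. if b \<in> level m then f b else 0) = f b \<odot>\<^bsub>A\<^esub> \<one>"
proof -
  have "star A (word_op b) \<otimes> word_sum (\<lambda>b. if b \<in> level m then f b else 0)
      = (\<Oplus>c\<in>level m. (if c \<in> level m then f c else 0) \<odot>\<^bsub>A\<^esub> (star A (word_op b) \<otimes> word_op c))"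
    using level_WT[OF b] by (intro mult_word_sum finite_level) (auto simp: level_WT A.star_closed)
  also have "\<dots> = (\<Oplus>c\<in>level m. if b = c then f c \<odot>\<^bsub>A\<^esub> \<one> else \<zero>)"
    using word_op_orth[OF level_WT[OF b] b] by (intro A.finsum_cong') auto
  also have "\<dots> = f b \<odot>\<^bsub>A\<^esub> \<one>"
    using A.finsum_singleton[OF b finite_level, of "\<lambda>c. f c \<odot>\<^bsub>A\<^esub> \<one>"] by simp
  finally show ?thesis .
qed

text \<open>The entry of \<open>z\<close> at (b, a) is the scalar in
  \<open>star A (word_op b) \<otimes> (z \<otimes> word_op a)\<close>. Its adjoint gives the entries
  of \<open>star A z\<close>, and inserting the resolution of the unit on level \<open>m\<close>
  reassembles them into a sum of words.\<close>

lemma block_star: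
  assumes x: "x \<in> carrier B" and z: "z \<in> carrier A"
    and acts: "\<And>a. a \<in> level m \<Longrightarrow> acts (level_proj m' \<otimes>\<^bsub>B\<^esub> x) z a" and b: "b \<in> level m'"
  shows "acts (level_proj m \<otimes>\<^bsub>B\<^esub> star B x) (star A z) b"
proof -
  have bW: "b \<in> WT" using b by (rule level_WT)
  have sx: "star B x \<in> carrier B" using x by (rule B.star_closed)
  have entry: "star A (word_op a) \<otimes> (star A z \<otimes> word_op b) = cnj (x (chi a) b) \<odot>\<^bsub>A\<^esub> \<one>" if a: "a \<in> level m" for a
  proof -
    have aW: "a \<in> WT" using a by (rule level_WT)
    have "star A (word_op b) \<otimes> (z \<otimes> word_op a) = x (chi a) b \<odot>\<^bsub>A\<^esub> \<one>"
      using acts[OF a] word_op_star_word_sum[OF b] level_proj_mult_chi[OF x aW] by (simp add: acts_def)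
    then have "star A (star A (word_op b) \<otimes> (z \<otimes> word_op a)) = cnj (x (chi a) b) \<odot>\<^bsub>A\<^esub> \<one>"
      by (simp add: A.star_smult)
    then show ?thesis using aW bW z by (simp add: A.star_mult A.star_star A.star_closed A.m_assoc)
  qed
  have wc: "word_op a \<in> carrier A" "star A (word_op a) \<in> carrier A" if "a \<in> level m" for a
    using level_WT[OF that] by (simp_all add: A.star_closed)
  define w where "w = star A z \<otimes> word_op b"
  have w: "w \<in> carrier A" using z bW by (simp add: w_def A.star_closed)
  have "w = (\<Oplus>a\<in>level m. word_op a \<otimes> star A (word_op a)) \<otimes> w" using w by (simp add: word_op_sum)
  also have "\<dots> = (\<Oplus>a\<in>level m. (word_op a \<otimes> star A (word_op a)) \<otimes> w)"
    using w wc finite_level by (intro A.finsum_ldistr) auto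
  also have "\<dots> = (\<Oplus>a\<in>level m. cnj (x (chi a) b) \<odot>\<^bsub>A\<^esub> word_op a)"
  proof (rule A.finsum_cong')
    fix a assume a: "a \<in> level m"
    then show "(word_op a \<otimes> star A (word_op a)) \<otimes> w = cnj (x (chi a) b) \<odot>\<^bsub>A\<^esub> word_op a"
      using w wc[OF a] entry[OF a] by (simp add: A.m_assoc A.smult_mult_right flip: w_def)
  qed (use wc in auto)
  also have "\<dots> = (\<Oplus>a\<in>level m. star B x (chi b) a \<odot>\<^bsub>A\<^esub> word_op a)"
    using wc bW x by (intro A.finsum_cong') (auto simp: star_entry level_WT)
  finally show ?thesis
    unfolding acts_def level_proj_mult_chi[OF sx bW] word_sum_level w_def[symmetric] using fin_supp_level by simp
qed

lemma acts_apply_chi_eq: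
  "x (chi a) = x' (chi a) \<Longrightarrow> acts x y a \<longleftrightarrow> acts x' y a"
  by (simp add: acts_def)

text \<open>For a finite matrix on one level any bound by a constant multiple of
  \<open>cnorm B x\<close> improves to a contraction under squaring, here with exponent 0 and an
  idle degree. The conditions with \<open>level_proj m\<close> keep \<open>x\<close> and its adjoint
  within the level, so that squaring stays inside the relation.\<close>

lemma square_block_norm_le:
  assumes x: "x \<in> carrier B" "level_proj m \<otimes>\<^bsub>B\<^esub> x = x" "x \<otimes>\<^bsub>B\<^esub> level_proj m = x" and z: "z \<in> carrier A"
    and acts: "\<And>a. a \<in> level m \<Longrightarrow> acts x z a"
  shows "cnorm A z \<le> cnorm B x"
proof -
  define R where "R d x z \<longleftrightarrow> x \<in> carrier B \<and> level_proj m \<otimes>\<^bsub>B\<^esub> x = x \<and> x \<otimes>\<^bsub>B\<^esub> level_proj m = x \<and> z \<in> carrier A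
    \<and> (\<forall>a\<in>level m. acts x z a)" for d :: nat and x z
  show ?thesis
  proof (rule contractive_of_poly_bound[of B A R "real (card (level m)) * real (card (level m))" 0])
    fix d x z assume R: "R d x z"
    note x = R[unfolded R_def, THEN conjunct1] and px = R[unfolded R_def, THEN conjunct2, THEN conjunct1]
      and xp = R[unfolded R_def, THEN conjunct2, THEN conjunct2, THEN conjunct1]
    have z: "z \<in> carrier A" and ac: "\<And>a. a \<in> level m \<Longrightarrow> acts x z a" using R by (auto simp: R_def)
    note sx = B.star_closed[OF x] and sz = A.star_closed[OF z]
    show "x \<in> carrier B \<and> z \<in> carrier A" using x z by simp
    have psx: "level_proj m \<otimes>\<^bsub>B\<^esub> star B x = star B x"
      using B.star_mult[OF x level_proj_closed, of m] xp level_proj_star by simp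
    have acs: "acts (star B x) (star A z) b" if "b \<in> level m" for b
      using block_star[OF x z _ that, of m] ac px psx by simp
    have supp: "b \<in> level m" if "x (chi a) b \<noteq> 0" "a \<in> level m" for a b
      using level_proj_mult_chi[OF x level_WT[OF that(2)], of m] that(1) unfolding px by (metis (full_types))
    have "acts (star B x \<otimes>\<^bsub>B\<^esub> x) (star A z \<otimes> z) a" if a: "a \<in> level m" for a
      by (rule acts_mult(1)[OF sx x sz z level_WT[OF a] ac[OF a] acs]) (use supp a in blast)
    moreover have "level_proj m \<otimes>\<^bsub>B\<^esub> (star B x \<otimes>\<^bsub>B\<^esub> x) = star B x \<otimes>\<^bsub>B\<^esub> x"
      using psx x sx B.m_assoc[of "level_proj m" "star B x" x] by simp
    moreover have "(star B x \<otimes>\<^bsub>B\<^esub> x) \<otimes>\<^bsub>B\<^esub> level_proj m = star B x \<otimes>\<^bsub>B\<^esub> x"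
      using xp x sx B.m_assoc[of "star B x" x "level_proj m"] by simp
    ultimately show "R (2 * d) (star B x \<otimes>\<^bsub>B\<^esub> x) (star A z \<otimes> z)"
      using x z sx sz by (simp add: R_def)
    have Wn: "cnorm A (star A (word_op a)) \<le> 1" "star A (word_op a) \<in> carrier A" "word_op a \<in> carrier A" if "a \<in> level m" for a
      using word_op_norm_le[OF level_WT[OF that]] level_WT[OF that] by (simp_all add: A.cnorm_star A.star_closed)
    \<comment> \<open>One factor \<open>card (level m)\<close> comes from expanding \<open>z\<close>
      over the words \<open>a\<close>, the other from the coefficients of each
      \<open>z \<otimes> word_op a\<close>; every coefficient is at most
      \<open>cnorm B x\<close>.\<close>
    have "cnorm A z \<le> (\<Sum>a\<in>level m. real (card (level m)) * cnorm B x)"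
    proof (subst level_expansion[OF z, of m], rule A.nrm_finsum_le[OF finite_level])
      fix a assume a: "a \<in> level m"
      show "z \<otimes> word_op a \<otimes> star A (word_op a) \<in> carrier A" using z Wn[OF a] by simp
      have xa: "x (chi a) = (\<lambda>b. if b \<in> level m then x (chi a) b else 0)"
        using level_proj_mult_chi[OF x level_WT[OF a], of m] px by simp
      have "z \<otimes> word_op a = (\<Oplus>b\<in>level m. x (chi a) b \<odot>\<^bsub>A\<^esub> word_op b)"
        using ac[OF a] word_sum_level[of m "x (chi a)"] xa by (simp add: acts_def)
      also have "cnorm A \<dots> \<le> (\<Sum>b\<in>level m. cnorm B x)"
      proof (rule A.nrm_finsum_le[OF finite_level])
        fix b assume b: "b \<in> level m"
        have "cmod (x (chi a) b) \<le> cnorm B x * ell2_norm WT (chi a)"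
          using x level_WT[OF a] by (intro op_coord_le) (auto simp: carrier_op_algebra)
        also have "\<dots> \<le> cnorm B x * 1"
          using ell2_norm_chi_le[OF level_WT[OF a]] x by (intro mult_left_mono) (auto intro: B.cnorm_nonneg)
        finally have "cmod (x (chi a) b) * cnorm A (word_op b) \<le> cnorm B x * 1"
          using word_op_norm_le[OF level_WT[OF b]] x by (intro mult_mono) (auto intro: B.cnorm_nonneg A.cnorm_nonneg level_WT b word_op_closed)
        then show "cnorm A (x (chi a) b \<odot>\<^bsub>A\<^esub> word_op b) \<le> cnorm B x"
          using level_WT[OF b] by (simp add: A.cnorm_smult)
        show "x (chi a) b \<odot>\<^bsub>A\<^esub> word_op b \<in> carrier A" using level_WT[OF b] by simp
      qed
      finally have "cnorm A (z \<otimes> word_op a) * cnorm A (star A (word_op a)) \<le> (real (card (level m)) * cnorm B x) * 1"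
        using Wn[OF a] x z by (intro mult_mono) (auto intro!: A.cnorm_nonneg B.cnorm_nonneg mult_nonneg_nonneg)
      then show "cnorm A (z \<otimes> word_op a \<otimes> star A (word_op a)) \<le> real (card (level m)) * cnorm B x"
        using A.cnorm_mult[of "z \<otimes> word_op a" "star A (word_op a)"] z Wn[OF a] by simp
    qed
    then show "cnorm A z \<le> real (card (level m)) * real (card (level m)) * real (2 * d + 1) ^ 0 * cnorm B x"
      by (simp add: mult.assoc)
  next
    show "R 0 x z" using assms by (simp add: R_def)
  qed (rule B.cstar_algebra_axioms A.cstar_algebra_axioms)+
qed

text \<open>A rectangular block is made square by passing to \<open>star A z \<otimes> z\<close>,
  whose counterpart is a compression of a product bounded by the square of
  \<open>cnorm B x\<close>.\<close>

lemma block_norm_le: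
  assumes x: "x \<in> carrier B" and z: "z \<in> carrier A"
    and acts: "\<And>a. a \<in> level m \<Longrightarrow> acts (level_proj m' \<otimes>\<^bsub>B\<^esub> x) z a"
  shows "cnorm A z \<le> cnorm B x"
proof -
  note sx = B.star_closed[OF x] and sz = A.star_closed[OF z]
  define p q where "p = level_proj m' \<otimes>\<^bsub>B\<^esub> x" and "q = level_proj m \<otimes>\<^bsub>B\<^esub> star B x"
  have pq: "p \<in> carrier B" "q \<in> carrier B" using x sx by (simp_all add: p_def q_def)
  \<comment> \<open>The last factor does not change the action on level \<open>m\<close>, but it
    cuts the operator off elsewhere, as a square block requires.\<close>
  define h where "h = (q \<otimes>\<^bsub>B\<^esub> p) \<otimes>\<^bsub>B\<^esub> level_proj m"
  have h: "h \<in> carrier B" using pq by (simp add: h_def)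
  have "acts (q \<otimes>\<^bsub>B\<^esub> p) (star A z \<otimes> z) a" if a: "a \<in> level m" for a
  proof (rule acts_mult(1)[OF pq(2,1) sz z level_WT[OF a]])
    show "acts p z a" using acts[OF a] by (simp add: p_def)
    fix b assume "p (chi a) b \<noteq> 0"
    then have "b \<in> level m'" using level_proj_mult_chi[OF x level_WT[OF a], of m'] by (auto simp: p_def split: if_splits)
    then show "acts q (star A z) b" unfolding q_def using x z acts by (intro block_star[of x z m m' b]) auto
  qed
  moreover have "h (chi a) = (q \<otimes>\<^bsub>B\<^esub> p) (chi a)" if a: "a \<in> level m" for a
  proof -
    have "level_proj m (chi a) = chi a"
      using a unfolding level_proj_apply[OF chi_ell2[OF level_WT[OF a]]] by (auto simp: chi_def)
    then show ?thesis using level_WT[OF a] by (simp add: h_def)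
  qed
  ultimately have ac: "acts h (star A z \<otimes> z) a" if "a \<in> level m" for a
    using that acts_apply_chi_eq by blast
  have "cnorm A (star A z \<otimes> z) \<le> cnorm B h"
  proof (rule square_block_norm_le[OF h])
    have "level_proj m \<otimes>\<^bsub>B\<^esub> q = q" using B.m_assoc[of "level_proj m" "level_proj m" "star B x"] sx level_proj_idem by (simp add: q_def)
    then show "level_proj m \<otimes>\<^bsub>B\<^esub> h = h" using pq
      by (metis B.m_assoc B.m_closed level_proj_closed h_def)
    show "h \<otimes>\<^bsub>B\<^esub> level_proj m = h" using pq B.m_assoc[of "q \<otimes>\<^bsub>B\<^esub> p" "level_proj m" "level_proj m"] level_proj_idem by (simp add: h_def)
  qed (use ac z sz in auto)
  also have "\<dots> \<le> (cnorm B q * cnorm B p) * cnorm B (level_proj m)"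
    unfolding h_def using pq
    by (intro order_trans[OF B.cnorm_mult] mult_right_mono B.cnorm_mult) (auto intro: B.cnorm_nonneg)
  also have "\<dots> \<le> (cnorm B x * cnorm B x) * 1"
  proof -
    have "cnorm B p \<le> 1 * cnorm B x" "cnorm B q \<le> 1 * cnorm B (star B x)"
      unfolding p_def q_def using x sx level_proj_norm_le
      by (intro order_trans[OF B.cnorm_mult] mult_right_mono; auto intro: B.cnorm_nonneg)+
    then show ?thesis
      using x pq level_proj_norm_le by (intro mult_mono) (auto intro: B.cnorm_nonneg simp: B.cnorm_star)
  qed
  finally have "(cnorm A z)\<^sup>2 \<le> (cnorm B x)\<^sup>2"
    using z by (simp add: A.cstar_identity power2_eq_square)
  then show ?thesis using B.cnorm_nonneg[OF x] power2_le_imp_le by blast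
qed

text \<open>The prescribed values on the words of the level are multiplied by the adjoint words and
  summed; orthogonality singles out one term at each word.\<close>

lemma block_exists:
  assumes x: "x \<in> carrier B"
  obtains z where "z \<in> carrier A" "\<And>a. a \<in> level m \<Longrightarrow> acts (level_proj m' \<otimes>\<^bsub>B\<^esub> x) z a"
proof -
  define g where "g a = word_sum ((level_proj m' \<otimes>\<^bsub>B\<^esub> x) (chi a))" for a
  have f: "fin_supp ((level_proj m' \<otimes>\<^bsub>B\<^esub> x) (chi a))" if "a \<in> level m" for a
    unfolding level_proj_mult_chi[OF x level_WT[OF that]] by (rule fin_supp_level)
  have g: "g a \<in> carrier A" if "a \<in> level m" for a using f[OF that] by (simp add: g_def)
  have wc: "word_op a \<in> carrier A" "star A (word_op a) \<in> carrier A" if "a \<in> level m" for a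
    using level_WT[OF that] by (simp_all add: A.star_closed)
  define z where "z = (\<Oplus>a\<in>level m. g a \<otimes> star A (word_op a))"
  have z: "z \<in> carrier A" unfolding z_def using g wc by (intro A.finsum_closed) auto
  have "z \<otimes> word_op a = g a" if a: "a \<in> level m" for a
  proof -
    have "z \<otimes> word_op a = (\<Oplus>c\<in>level m. (g c \<otimes> star A (word_op c)) \<otimes> word_op a)"
      unfolding z_def using g wc a finite_level by (intro A.finsum_ldistr) auto
    also have "\<dots> = (\<Oplus>c\<in>level m. if a = c then g c else \<zero>)"
    proof (rule A.finsum_cong')
      fix c assume c: "c \<in> level m"
      have "(g c \<otimes> star A (word_op c)) \<otimes> word_op a = g c \<otimes> (star A (word_op c) \<otimes> word_op a)"
        using g[OF c] wc[OF c] wc[OF a] by (simp add: A.m_assoc)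
      then show "(g c \<otimes> star A (word_op c)) \<otimes> word_op a = (if a = c then g c else \<zero>)"
        using word_op_orth[OF level_WT[OF c] c a] g[OF c] by auto
    qed (use g in auto)
    also have "\<dots> = g a" using A.finsum_singleton[OF a finite_level, of g] g by auto
    finally show ?thesis .
  qed
  then show ?thesis using that[of z] z f by (simp add: acts_def g_def)
qed

section \<open>Corresponding polynomials\<close>

text \<open>The degree of a polynomial as seen by its matrix: \<open>d\<close> letters or adjoints
  change the length of each component by at most \<open>d\<close>.\<close>

definition near where "near d a b \<longleftrightarrow> b \<in> WT \<and>
  (\<forall>i\<in>{1..k}. length (b i) \<le> length (a i) + d \<and> length (a i) \<le> length (b i) + d)"
  for a b :: "nat \<Rightarrow> nat list"

text \<open>Only words of length at least \<open>d\<close> are tested: on shorter words the adjoints of the \<open>S\<^sub>i\<^sub>,\<^sub>s\<close> annihilate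
  empty components, which the \<open>W\<^sub>i\<^sub>,\<^sub>s\<close> cannot do.\<close>
definition local_action where "local_action d x y \<longleftrightarrow> (\<forall>a\<in>WT. min_length d a \<longrightarrow> acts x y a \<and> (\<forall>b. x (chi a) b \<noteq> 0 \<longrightarrow> near d a b))"

lemma local_actionD: "local_action d x y \<Longrightarrow> a \<in> WT \<Longrightarrow> min_length d a \<Longrightarrow> acts x y a"
  "local_action d x y \<Longrightarrow> a \<in> WT \<Longrightarrow> min_length d a \<Longrightarrow> x (chi a) b \<noteq> 0 \<Longrightarrow> near d a b"
  by (auto simp: local_action_def)

text \<open>The level \<open>(d, \<dots>, d)\<close> meets at most \<open>(2d+1)\<^sup>k\<close> levels under \<open>x\<close>, and each of the
  corresponding blocks is bounded by \<open>\<parallel>x\<parallel>\<close>.\<close>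
lemma local_action_norm_le:
  assumes local_action: "local_action d x y" and x: "x \<in> carrier B" and y: "y \<in> carrier A"
  shows "cnorm A y \<le> real (2 * d + 1) ^ k * cnorm B x"
proof -
  \<comment> \<open>The shortest words that \<open>local_action d\<close> covers. By
    \<open>level_expansion\<close> this one level already determines \<open>y\<close>.\<close>
  define m where "m = (\<lambda>i::nat. d)"
  \<comment> \<open>The multi-lengths within distance \<open>d\<close> of (d, ..., d). Taking them
    extensional makes the multi-length of a tuple unique in \<open>M\<close>, so that the blocks are
    disjoint.\<close>
  define M where "M = (\<Pi>\<^sub>E i\<in>{1..k}. {0..2 * d})"
  have M: "finite M" "card M = (2 * d + 1) ^ k" by (auto simp: M_def card_PiE intro: finite_PiE)
  have "\<forall>m'. \<exists>z. z \<in> carrier A \<and> (\<forall>a\<in>level m. acts (level_proj m' \<otimes>\<^bsub>B\<^esub> x) z a)"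
    using block_exists[OF x] by metis
  then obtain z where z: "\<And>m'. z m' \<in> carrier A" "\<And>m' a. a \<in> level m \<Longrightarrow> acts (level_proj m' \<otimes>\<^bsub>B\<^esub> x) (z m') a"
    by metis
  have eq: "y \<otimes> word_op a = (\<Oplus>m'\<in>M. z m') \<otimes> word_op a" if a: "a \<in> level m" for a
  proof -
    have aW: "a \<in> WT" and ad: "min_length d a" using a by (auto simp: level_def m_def min_length_def)
    have supp: "\<exists>m'\<in>M. b \<in> level m'" if "x (chi a) b \<noteq> 0" for b
    proof
      have nb: "near d a b" using local_actionD(2)[OF local_action aW ad that] .
      have "length (a i) = d" if "i \<in> {1..k}" for i using a that by (simp add: level_def m_def)
      then show "(\<lambda>i\<in>{1..k}. length (b i)) \<in> M" using nb by (fastforce simp: M_def near_def)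
      show "b \<in> level (\<lambda>i\<in>{1..k}. length (b i))" using nb by (simp add: level_def near_def)
    qed
    have uniq: "m' = m''" if "b \<in> level m'" "b \<in> level m''" "m' \<in> M" "m'' \<in> M" for b m' m''
    proof (rule PiE_ext)
      show "m' \<in> (\<Pi>\<^sub>E i\<in>{1..k}. {0..2 * d})" "m'' \<in> (\<Pi>\<^sub>E i\<in>{1..k}. {0..2 * d})"
        using that by (simp_all add: M_def)
      show "m' i = m'' i" if "i \<in> {1..k}" for i
        using \<open>b \<in> level m'\<close> \<open>b \<in> level m''\<close> that by (simp add: level_def)
    qed
    have dec: "x (chi a) = (\<lambda>b. \<Sum>m'\<in>M. 1 * (if b \<in> level m' then x (chi a) b else 0))"
    proof
      fix b
      show "x (chi a) b = (\<Sum>m'\<in>M. 1 * (if b \<in> level m' then x (chi a) b else 0))"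
      proof (cases "x (chi a) b = 0")
        case False
        then obtain m' where m': "m' \<in> M" "b \<in> level m'" using supp by blast
        have "(\<Sum>m''\<in>M. 1 * (if b \<in> level m'' then x (chi a) b else 0))
            = (\<Sum>m''\<in>M. if m'' = m' then x (chi a) b else 0)"
          using uniq m' by (intro sum.cong) auto
        then show ?thesis using M m' by simp
      qed (simp add: sum.neutral)
    qed
    have "y \<otimes> word_op a = word_sum (x (chi a))" using local_actionD(1)[OF local_action aW ad] by (simp add: acts_def)
    also have "\<dots> = word_sum (\<lambda>b. \<Sum>m'\<in>M. 1 * (if b \<in> level m' then x (chi a) b else 0))"
      using dec by (rule arg_cong)
    also have "\<dots> = (\<Oplus>m'\<in>M. 1 \<odot>\<^bsub>A\<^esub> word_sum (\<lambda>b. if b \<in> level m' then x (chi a) b else 0))"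
      by (rule conjunct2[OF word_sum_sum[OF M(1)]]) (rule fin_supp_level)
    also have "\<dots> = (\<Oplus>m'\<in>M. z m' \<otimes> word_op a)"
    proof (rule A.finsum_cong')
      fix m' show "1 \<odot>\<^bsub>A\<^esub> word_sum (\<lambda>b. if b \<in> level m' then x (chi a) b else 0) = z m' \<otimes> word_op a"
        using z(2)[OF a, of m'] fin_supp_level level_proj_mult_chi[OF x aW, of m'] by (simp add: acts_def)
    qed (use z aW in auto)
    also have "\<dots> = (\<Oplus>m'\<in>M. z m') \<otimes> word_op a"
      using z aW M by (intro A.finsum_ldistr[symmetric]) auto
    finally show ?thesis .
  qed
  have zs: "(\<Oplus>m'\<in>M. z m') \<in> carrier A" using z by (intro A.finsum_closed) auto
  have "y = (\<Oplus>a\<in>level m. (y \<otimes> word_op a) \<otimes> star A (word_op a))" by (rule level_expansion[OF y])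
  also have "\<dots> = (\<Oplus>a\<in>level m. ((\<Oplus>m'\<in>M. z m') \<otimes> word_op a) \<otimes> star A (word_op a))"
    using zs eq by (intro A.finsum_cong') (auto simp: level_WT A.star_closed)
  also have "\<dots> = (\<Oplus>m'\<in>M. z m')" by (rule level_expansion[OF zs, symmetric])
  finally have "cnorm A y = cnorm A (\<Oplus>m'\<in>M. z m')" by simp
  also have "\<dots> \<le> (\<Sum>m'\<in>M. cnorm B x)"
    by (rule A.nrm_finsum_le[OF M(1) z(1)]) (use block_norm_le[OF x z(1) z(2)] in blast)
  also have "\<dots> = real (2 * d + 1) ^ k * cnorm B x" using M by simp
  finally show ?thesis .
qed

lemma near_trans: "near d a b \<Longrightarrow> near e b c \<Longrightarrow> near (d + e) a c"
  unfolding near_def by fastforce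

lemma near_mono: "near d a b \<Longrightarrow> d \<le> e \<Longrightarrow> near e a b"
  unfolding near_def by fastforce

lemma min_length_mono: "min_length e a \<Longrightarrow> d \<le> e \<Longrightarrow> min_length d a"
  unfolding min_length_def by fastforce

lemma min_length_near: "min_length (d + e) a \<Longrightarrow> near d a b \<Longrightarrow> min_length e b"
  unfolding min_length_def near_def by fastforce

lemma local_action_mono: "local_action d x y \<Longrightarrow> d \<le> e \<Longrightarrow> local_action e x y"
  unfolding local_action_def using min_length_mono near_mono by blast

text \<open>The right factor may shorten a word by \<open>e\<close>, so length \<open>d + e\<close>
  is needed at the start to retain \<open>d\<close> for the left factor. Hence degrees add.\<close>

lemma local_action_mult:
  assumes "local_action d x y" "local_action e x' y'"
    and c: "x \<in> carrier B" "x' \<in> carrier B" "y \<in> carrier A" "y' \<in> carrier A"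
  shows "local_action (d + e) (x \<otimes>\<^bsub>B\<^esub> x') (y \<otimes> y')"
  unfolding local_action_def
proof (intro ballI impI conjI allI)
  fix a assume a: "a \<in> WT" "min_length (d + e) a"
  have ea: "min_length e a" using min_length_mono[OF a(2)] by simp
  have b: "b \<in> WT \<and> min_length d b \<and> near e a b" if "x' (chi a) b \<noteq> 0" for b
    using local_actionD(2)[OF assms(2) a(1) ea that] min_length_near[of e d a b] a(2) by (simp add: add.commute near_def)
  note am = acts_mult[OF c a(1) local_actionD(1)[OF assms(2) a(1) ea]]
  show "acts (x \<otimes>\<^bsub>B\<^esub> x') (y \<otimes> y') a"
    by (rule am(1)) (use b local_actionD(1)[OF assms(1)] in blast)
  fix z assume "(x \<otimes>\<^bsub>B\<^esub> x') (chi a) z \<noteq> 0"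
  then obtain b' where b': "x' (chi a) b' \<noteq> 0" "x (chi b') z \<noteq> 0"
    using am(2)[of z] b local_actionD(1)[OF assms(1)] by blast
  have "near (e + d) a z" using near_trans b[OF b'(1)] local_actionD(2)[OF assms(1) _ _ b'(2)] by blast
  then show "near (d + e) a z" by (simp add: add.commute)
qed

lemma local_action_add:
  assumes "local_action d x y" "local_action d x' y'"
    and c: "x \<in> carrier B" "x' \<in> carrier B" "y \<in> carrier A" "y' \<in> carrier A"
  shows "local_action d (x \<oplus>\<^bsub>B\<^esub> x') (y \<oplus> y')"
  unfolding local_action_def
proof (intro ballI impI conjI allI)
  fix a assume a: "a \<in> WT" "min_length d a"
  show "acts (x \<oplus>\<^bsub>B\<^esub> x') (y \<oplus> y') a"
    using local_actionD(1)[OF assms(1) a] local_actionD(1)[OF assms(2) a] a c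
    by (simp add: acts_def word_sum_add A.l_distr)
  fix b assume "(x \<oplus>\<^bsub>B\<^esub> x') (chi a) b \<noteq> 0"
  then have "x (chi a) b \<noteq> 0 \<or> x' (chi a) b \<noteq> 0" using a by auto
  then show "near d a b" using local_actionD(2)[OF assms(1) a] local_actionD(2)[OF assms(2) a] by blast
qed

lemma local_action_smult:
  assumes "local_action d x y" and c: "x \<in> carrier B" "y \<in> carrier A"
  shows "local_action d (c \<odot>\<^bsub>B\<^esub> x) (c \<odot>\<^bsub>A\<^esub> y)"
  unfolding local_action_def
proof (intro ballI impI conjI allI)
  fix a assume a: "a \<in> WT" "min_length d a"
  show "acts (c \<odot>\<^bsub>B\<^esub> x) (c \<odot>\<^bsub>A\<^esub> y) a"
    using local_actionD(1)[OF assms(1) a] a c by (simp add: acts_def word_sum_cmult A.smult_mult_left)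
  fix b assume "(c \<odot>\<^bsub>B\<^esub> x) (chi a) b \<noteq> 0"
  then show "near d a b" using local_actionD(2)[OF assms(1) a] a by auto
qed

lemma local_action_one: "local_action 0 \<one>\<^bsub>B\<^esub> \<one>"
  unfolding local_action_def
proof (intro ballI impI conjI allI)
  fix a assume a: "a \<in> WT"
  have one: "\<one>\<^bsub>B\<^esub> (chi a) = chi a" using a by simp
  show "acts \<one>\<^bsub>B\<^esub> \<one> a" using a by (simp add: acts_def one word_sum_chi)
  fix b assume "\<one>\<^bsub>B\<^esub> (chi a) b \<noteq> 0"
  then have "b = a" unfolding one by (auto simp: chi_def split: if_splits)
  then show "near 0 a b" using a by (simp add: near_def)
qed

lemma S_chi:
  assumes a: "a \<in> WT" and i: "i \<in> {1..k}" "s \<in> {1..n i}"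
  shows "S i s (chi a) = (\<lambda>b. phase i s a * chi (a(i := s # a i)) b)"
  using std_isometry_chi[OF i a] by (simp add: phase_def)

lemma S_star_chi:
  assumes a: "a \<in> WT" "a(i := t # a i) \<in> WT" and i: "i \<in> {1..k}" "s \<in> {1..n i}"
  shows "S_star i s (chi (a(i := t # a i))) = (\<lambda>b. (if s = t then cnj (phase i s a) else 0) * chi a b)"
proof
  fix b
  have "b(i := s # b i) = a(i := t # a i) \<longleftrightarrow> s = t \<and> b = a"
  proof
    assume e: "b(i := s # b i) = a(i := t # a i)"
    have "(b(i := s # b i)) i = (a(i := t # a i)) i" by (rule fun_cong[OF e])
    moreover have "(b(i := s # b i))(i := b i) = (a(i := t # a i))(i := b i)" using e by (rule arg_cong)
    ultimately show "s = t \<and> b = a" by (metis fun_upd_same fun_upd_triv fun_upd_upd list.inject)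
  qed auto
  then show "S_star i s (chi (a(i := t # a i))) b = (if s = t then cnj (phase i s a) else 0) * chi a b"
    unfolding S_star_apply[OF chi_ell2[OF a(2)]] using a by (auto simp: chi_def)
qed

lemma local_action_S:
  assumes i: "i \<in> {1..k}" "s \<in> {1..n i}" shows "local_action 1 (S i s) (W i s)"
  unfolding local_action_def
proof (intro ballI impI conjI allI)
  fix a assume a: "a \<in> WT"
  have aW: "a(i := s # a i) \<in> WT" using a i by (rule WT_Cons)
  show "acts (S i s) (W i s) a"
    unfolding acts_def S_chi[OF a i] word_sum_cmult(2)[OF word_sum_chi(1)[OF aW]] word_sum_chi(2)[OF aW]
    using word_sum_cmult(1)[OF word_sum_chi(1)[OF aW]] W_word_op[OF a i] by blast
  fix b assume "S i s (chi a) b \<noteq> 0"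
  then have "b = a(i := s # a i)" unfolding S_chi[OF a i] by (auto simp: chi_def split: if_splits)
  then show "near 1 a b" using aW by (simp add: near_def)
qed

text \<open>Degree 1 guarantees a first letter in component \<open>i\<close>. It is then removed or
  annihilated in the same way on both sides; on an empty component this would fail.\<close>

lemma local_action_S_star:
  assumes i: "i \<in> {1..k}" "s \<in> {1..n i}" shows "local_action 1 (S_star i s) (star A (W i s))"
  unfolding local_action_def
proof (intro ballI impI conjI allI)
  fix c assume c: "c \<in> WT" "min_length 1 c"
  have ne: "c i \<noteq> []" using c(2) i unfolding min_length_def by fastforce
  define a t where "a = c(i := tl (c i))" and "t = hd (c i)"
  have a: "a \<in> WT" using WT_tl[OF c(1) i(1)] by (simp add: a_def)
  have t: "t \<in> {1..n i}" using WT_hd[OF c(1) i(1) ne] by (simp add: t_def)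
  have ca: "c = a(i := t # a i)" using ne by (simp add: a_def t_def)
  have ch: "S_star i s (chi c) = (\<lambda>b. (if s = t then cnj (phase i s a) else 0) * chi a b)"
    unfolding ca by (rule S_star_chi[OF a _ i]) (use c ca in simp)
  show "acts (S_star i s) (star A (W i s)) c"
    unfolding acts_def ch word_sum_cmult(2)[OF word_sum_chi(1)[OF a]] word_sum_chi(2)[OF a]
    using word_sum_cmult(1)[OF word_sum_chi(1)[OF a]] W_star_word_op[OF a i t] a by (simp add: ca[symmetric])
  fix b assume "S_star i s (chi c) b \<noteq> 0"
  then have "b = a" unfolding ch by (auto simp: chi_def split: if_splits)
  then show "near 1 c b" using a by (auto simp: near_def a_def)
qed

text \<open>Stands in for \<open>q(S)\<close> and \<open>q(W)\<close> with one polynomial of degree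
  \<open>d\<close> in the generators and adjoints, recording only what the estimates use. The
  condition on the adjoints is built in so that the relation is closed under the star.\<close>

definition poly_pair where "poly_pair d x y \<longleftrightarrow> x \<in> carrier C \<and> y \<in> carrier A \<and> local_action d x y \<and> local_action d (star B x) (star A y)"

lemma poly_pair_D: "poly_pair d x y \<Longrightarrow> x \<in> carrier C" "poly_pair d x y \<Longrightarrow> x \<in> carrier B" "poly_pair d x y \<Longrightarrow> y \<in> carrier A"
  by (auto simp: poly_pair_def C_sub)

lemma poly_pair_star: "poly_pair d x y \<Longrightarrow> poly_pair d (star B x) (star A y)"
  using C.star_closed[of x] by (auto simp: poly_pair_def C_sub B.star_star A.star_star A.star_closed)

lemma poly_pair_mult:
  assumes "poly_pair d x y" "poly_pair e x' y'" shows "poly_pair (d + e) (x \<otimes>\<^bsub>B\<^esub> x') (y \<otimes> y')"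
proof -
  note D = poly_pair_D[OF assms(1)] poly_pair_D[OF assms(2)] poly_pair_D[OF poly_pair_star[OF assms(1)]] poly_pair_D[OF poly_pair_star[OF assms(2)]]
  have "local_action (e + d) (star B x' \<otimes>\<^bsub>B\<^esub> star B x) (star A y' \<otimes> star A y)"
    using assms D by (intro local_action_mult) (auto simp: poly_pair_def)
  moreover have "local_action (d + e) (x \<otimes>\<^bsub>B\<^esub> x') (y \<otimes> y')"
    using assms D by (intro local_action_mult) (auto simp: poly_pair_def)
  ultimately show ?thesis
    using D C.m_closed[of x x'] by (simp add: poly_pair_def B.star_mult A.star_mult add.commute)
qed

lemma poly_pair_add:
  assumes "poly_pair d x y" "poly_pair e x' y'" shows "poly_pair (d + e) (x \<oplus>\<^bsub>B\<^esub> x') (y \<oplus> y')"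
proof -
  note D = poly_pair_D[OF assms(1)] poly_pair_D[OF assms(2)] poly_pair_D[OF poly_pair_star[OF assms(1)]] poly_pair_D[OF poly_pair_star[OF assms(2)]]
  have i: "local_action (d + e) x y" "local_action (d + e) x' y'" "local_action (d + e) (star B x) (star A y)" "local_action (d + e) (star B x') (star A y')"
    using assms local_action_mono[of d _ _ "d + e"] local_action_mono[of e _ _ "d + e"] by (auto simp: poly_pair_def)
  show ?thesis
    using D C.a_closed[of x x'] local_action_add[OF i(1,2)] local_action_add[OF i(3,4)]
    by (simp add: poly_pair_def B.star_add A.star_add)
qed

lemma poly_pair_smult: assumes "poly_pair d x y" shows "poly_pair d (c \<odot>\<^bsub>B\<^esub> x) (c \<odot>\<^bsub>A\<^esub> y)"
  using assms poly_pair_D[OF assms] poly_pair_D[OF poly_pair_star[OF assms]] C.sm_closed[of x c] local_action_smult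
  by (simp add: poly_pair_def B.star_smult A.star_smult)

lemma poly_pair_one: "poly_pair 0 \<one>\<^bsub>B\<^esub> \<one>"
  using local_action_one C.one_closed by (simp add: poly_pair_def)

lemma poly_pair_S: "i \<in> {1..k} \<Longrightarrow> s \<in> {1..n i} \<Longrightarrow> poly_pair 1 (S i s) (W i s)"
  using local_action_S local_action_S_star by (simp add: poly_pair_def star_S)

lemma poly_pair_norm_le: "poly_pair d x y \<Longrightarrow> cnorm A y \<le> cnorm B x"
proof (rule contractive_of_poly_bound[of B A poly_pair 1 k])
  fix d x y assume poly_pair: "poly_pair d x y"
  show "x \<in> carrier B \<and> y \<in> carrier A" using poly_pair_D[OF poly_pair] by simp
  show "poly_pair (2 * d) (star B x \<otimes>\<^bsub>B\<^esub> x) (star A y \<otimes> y)"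
    using poly_pair_mult[OF poly_pair_star[OF poly_pair] poly_pair] by (simp add: mult_2)
  show "cnorm A y \<le> 1 * real (2 * d + 1) ^ k * cnorm B x"
    using local_action_norm_le[of d x y] poly_pair poly_pair_D[OF poly_pair] by (simp add: poly_pair_def)
qed (auto simp: B.cstar_algebra_axioms A.cstar_algebra_axioms)

section \<open>The canonical homomorphism\<close>

text \<open>The closure of the graph of the passage from \<open>q(S)\<close> to \<open>q(W)\<close>.
  Working with a relation postpones the question whether \<open>q(W)\<close> depends only on
  \<open>q(S)\<close>; contractivity settles it in \<open>limit_pair_unique\<close>.\<close>

definition limit_pair where "limit_pair x y \<longleftrightarrow> (\<exists>d u v. (\<forall>j::nat. poly_pair (d j) (u j) (v j)) \<and> clim B u x \<and> clim A v y)"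

lemma limit_pair_D:
  assumes "limit_pair x y" shows "x \<in> carrier C" "x \<in> carrier B" "y \<in> carrier A" "cnorm A y \<le> cnorm B x"
proof -
  obtain d u v where *: "\<forall>j::nat. poly_pair (d j) (u j) (v j)" "clim B u x" "clim A v y"
    using assms unfolding limit_pair_def by blast
  show "x \<in> carrier C"
    using B.unital_cstar_subalgebraD(8)[OF C_subalgebra, of u x] * poly_pair_D by blast
  then show "x \<in> carrier B" by (rule C_sub)
  show "y \<in> carrier A" using A.climD[OF *(3)] by simp
  \<comment> \<open>The degrees \<open>d j\<close> may be unbounded along the sequence. The bound
    survives because its constant no longer depends on the degree.\<close>
  show "cnorm A y \<le> cnorm B x"
    by (rule LIMSEQ_le[OF A.clim_nrm[OF *(3)] B.clim_nrm[OF *(2)]]) (use * poly_pair_norm_le in blast)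
qed

lemma limit_pair_poly_pair: "poly_pair d x y \<Longrightarrow> limit_pair x y"
  unfolding limit_pair_def
  by (intro exI[of _ "\<lambda>_. d"] exI[of _ "\<lambda>_. x"] exI[of _ "\<lambda>_. y"])
    (auto intro: B.clim_const A.clim_const dest: poly_pair_D)

lemma limit_pair_add: assumes "limit_pair x y" "limit_pair x' y'" shows "limit_pair (x \<oplus>\<^bsub>B\<^esub> x') (y \<oplus> y')"
proof -
  obtain d u v where 1: "\<forall>j::nat. poly_pair (d j) (u j) (v j)" "clim B u x" "clim A v y"
    using assms(1) unfolding limit_pair_def by blast
  obtain d' u' v' where 2: "\<forall>j::nat. poly_pair (d' j) (u' j) (v' j)" "clim B u' x'" "clim A v' y'"
    using assms(2) unfolding limit_pair_def by blast
  show ?thesis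
    unfolding limit_pair_def
    by (intro exI[of _ "\<lambda>j. d j + d' j"] exI[of _ "\<lambda>j. u j \<oplus>\<^bsub>B\<^esub> u' j"] exI[of _ "\<lambda>j. v j \<oplus> v' j"]
        conjI B.clim_add A.clim_add allI poly_pair_add) (use 1 2 in auto)
qed

lemma limit_pair_mult: assumes "limit_pair x y" "limit_pair x' y'" shows "limit_pair (x \<otimes>\<^bsub>B\<^esub> x') (y \<otimes> y')"
proof -
  obtain d u v where 1: "\<forall>j::nat. poly_pair (d j) (u j) (v j)" "clim B u x" "clim A v y"
    using assms(1) unfolding limit_pair_def by blast
  obtain d' u' v' where 2: "\<forall>j::nat. poly_pair (d' j) (u' j) (v' j)" "clim B u' x'" "clim A v' y'"
    using assms(2) unfolding limit_pair_def by blast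
  show ?thesis
    unfolding limit_pair_def
    by (intro exI[of _ "\<lambda>j. d j + d' j"] exI[of _ "\<lambda>j. u j \<otimes>\<^bsub>B\<^esub> u' j"] exI[of _ "\<lambda>j. v j \<otimes> v' j"]
        conjI B.clim_mult A.clim_mult allI poly_pair_mult) (use 1 2 in auto)
qed

lemma limit_pair_smult: assumes "limit_pair x y" shows "limit_pair (c \<odot>\<^bsub>B\<^esub> x) (c \<odot>\<^bsub>A\<^esub> y)"
proof -
  obtain d u v where 1: "\<forall>j::nat. poly_pair (d j) (u j) (v j)" "clim B u x" "clim A v y"
    using assms(1) unfolding limit_pair_def by blast
  show ?thesis
    unfolding limit_pair_def
    by (intro exI[of _ d] exI[of _ "\<lambda>j. c \<odot>\<^bsub>B\<^esub> u j"] exI[of _ "\<lambda>j. c \<odot>\<^bsub>A\<^esub> v j"]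
        conjI B.clim_smult A.clim_smult allI poly_pair_smult) (use 1 in auto)
qed

lemma limit_pair_star: assumes "limit_pair x y" shows "limit_pair (star B x) (star A y)"
proof -
  obtain d u v where 1: "\<forall>j::nat. poly_pair (d j) (u j) (v j)" "clim B u x" "clim A v y"
    using assms(1) unfolding limit_pair_def by blast
  show ?thesis
    unfolding limit_pair_def
    by (intro exI[of _ d] exI[of _ "\<lambda>j. star B (u j)"] exI[of _ "\<lambda>j. star A (v j)"]
        conjI B.clim_star A.clim_star allI poly_pair_star) (use 1 in auto)
qed

lemma limit_pair_minus: assumes "limit_pair x y" "limit_pair x' y'" shows "limit_pair (x \<ominus>\<^bsub>B\<^esub> x') (y \<ominus> y')"
  using limit_pair_add[OF assms(1) limit_pair_smult[OF assms(2), of "-1"]] limit_pair_D[OF assms(1)] limit_pair_D[OF assms(2)]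
  by (simp add: B.minus_conv_sm A.minus_conv_sm)

lemma limit_pair_unique: assumes "limit_pair x y" "limit_pair x y'" shows "y = y'"
proof -
  have "cnorm A (y \<ominus> y') \<le> 0"
    using limit_pair_D(4)[OF limit_pair_minus[OF assms]] limit_pair_D[OF assms(1)] by simp
  then have "cnorm A (y \<ominus> y') = 0"
    using A.cnorm_nonneg[of "y \<ominus> y'"] limit_pair_D[OF assms(1)] limit_pair_D[OF assms(2)] by simp
  then show ?thesis
    using limit_pair_D[OF assms(1)] limit_pair_D[OF assms(2)] by (simp add: A.cnorm_eq_zero A.mi_eq_zero)
qed

text \<open>Contractivity on differences makes the second components Cauchy. A diagonal choice then
  takes, for each \<open>j\<close>, a polynomial pair within 1/(j+1) of the j-th pair in both
  components at once.\<close>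

lemma limit_pair_limit:
  assumes limit_pair: "\<And>j. limit_pair (u j) (v j)" and u: "clim B u x"
  shows "\<exists>y. limit_pair x y"
proof -
  note c = limit_pair_D[OF limit_pair]
  have "ccauchy A v"
    unfolding ccauchy_def
  proof (intro conjI allI impI)
    fix e :: real assume "e > 0"
    then obtain K where K: "\<forall>m\<ge>K. \<forall>j\<ge>K. cnorm B (u m \<ominus>\<^bsub>B\<^esub> u j) < e"
      using B.clim_ccauchy[OF u] unfolding ccauchy_def by blast
    then show "\<exists>K. \<forall>m\<ge>K. \<forall>j\<ge>K. cnorm A (v m \<ominus> v j) < e"
      using limit_pair_D(4)[OF limit_pair_minus[OF limit_pair limit_pair]] by (meson order_le_less_trans)
  qed (use c in auto)
  then obtain y where y: "clim A v y" using A.ccauchy_converges by blast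
  note xy = B.climD[OF u] A.climD[OF y]
  have "\<exists>d x' y'. poly_pair d x' y' \<and> cnorm B (x' \<ominus>\<^bsub>B\<^esub> u j) < inverse (real (Suc j))
      \<and> cnorm A (y' \<ominus> v j) < inverse (real (Suc j))" for j
  proof -
    obtain d u' v' where *: "\<forall>l::nat. poly_pair (d l) (u' l) (v' l)" "clim B u' (u j)" "clim A v' (v j)"
      using limit_pair[of j] unfolding limit_pair_def by blast
    have p: "inverse (real (Suc j)) > 0" by simp
    have "\<forall>\<^sub>F l in sequentially. cnorm B (u' l \<ominus>\<^bsub>B\<^esub> u j) < inverse (real (Suc j))"
      using order_tendstoD(2)[OF B.climD(3)[OF *(2)] p] .
    moreover have "\<forall>\<^sub>F l in sequentially. cnorm A (v' l \<ominus> v j) < inverse (real (Suc j))"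
      using order_tendstoD(2)[OF A.climD(3)[OF *(3)] p] .
    ultimately have "\<forall>\<^sub>F l in sequentially. cnorm B (u' l \<ominus>\<^bsub>B\<^esub> u j) < inverse (real (Suc j))
        \<and> cnorm A (v' l \<ominus> v j) < inverse (real (Suc j))" by (rule eventually_conj)
    then obtain l where "cnorm B (u' l \<ominus>\<^bsub>B\<^esub> u j) < inverse (real (Suc j))
        \<and> cnorm A (v' l \<ominus> v j) < inverse (real (Suc j))"
      using eventually_happens'[OF sequentially_bot] by blast
    then show ?thesis using *(1) by blast
  qed
  then obtain d u' v' where poly_pair: "\<And>j. poly_pair (d j) (u' j) (v' j)"
    and lt: "\<And>j. cnorm B (u' j \<ominus>\<^bsub>B\<^esub> u j) < inverse (real (Suc j))"
      "\<And>j. cnorm A (v' j \<ominus> v j) < inverse (real (Suc j))"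
    by metis
  note RD = poly_pair_D[OF poly_pair]
  have "clim B u' x"
  proof (rule B.climI)
    show "(\<lambda>j. inverse (real (Suc j)) + cnorm B (u j \<ominus>\<^bsub>B\<^esub> x)) \<longlonglongrightarrow> 0"
      using tendsto_add[OF LIMSEQ_inverse_real_of_nat xy(3)] by simp
    show "cnorm B (u' j \<ominus>\<^bsub>B\<^esub> x) \<le> inverse (real (Suc j)) + cnorm B (u j \<ominus>\<^bsub>B\<^esub> x)" for j
      using B.nrm_mi_triangle[of "u' j" "u j" x] lt(1)[of j] RD xy by (smt (verit))
  qed (use RD xy in auto)
  moreover have "clim A v' y"
  proof (rule A.climI)
    show "(\<lambda>j. inverse (real (Suc j)) + cnorm A (v j \<ominus> y)) \<longlonglongrightarrow> 0"
      using tendsto_add[OF LIMSEQ_inverse_real_of_nat xy(6)] by simp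
    show "cnorm A (v' j \<ominus> y) \<le> inverse (real (Suc j)) + cnorm A (v j \<ominus> y)" for j
      using A.nrm_mi_triangle[of "v' j" "v j" y] lt(2)[of j] RD xy by (smt (verit))
  qed (use RD xy in auto)
  ultimately show ?thesis unfolding limit_pair_def using poly_pair by blast
qed

lemma limit_pair_total: "x \<in> carrier C \<Longrightarrow> \<exists>y. limit_pair x y"
proof -
  define D where "D = {x. \<exists>y. limit_pair x y}"
  have "unital_cstar_subalgebra B D"
  proof (rule B.unital_cstar_subalgebraI)
    show "D \<subseteq> carrier B" using limit_pair_D by (auto simp: D_def)
    show "\<one>\<^bsub>B\<^esub> \<in> D" using limit_pair_poly_pair[OF poly_pair_one] by (auto simp: D_def)
    fix u x assume u: "range u \<subseteq> D" "clim B u x"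
    then have "\<forall>j. \<exists>y. limit_pair (u j) y" by (auto simp: D_def)
    then obtain v where "\<And>j. limit_pair (u j) (v j)" by metis
    then show "x \<in> D" using limit_pair_limit[of u v x] u(2) by (simp add: D_def)
  qed (use limit_pair_add limit_pair_mult limit_pair_smult limit_pair_star in \<open>fastforce simp: D_def\<close>)+
  then have "carrier C \<subseteq> D"
    by (rule C_induct) (use limit_pair_poly_pair[OF poly_pair_S] in \<open>auto simp: D_def\<close>)
  then show "x \<in> carrier C \<Longrightarrow> \<exists>y. limit_pair x y" by (auto simp: D_def)
qed

definition canonical where "canonical x = (THE y. limit_pair x y)"

lemma canonical_eq: "limit_pair x y \<Longrightarrow> canonical x = y"
  unfolding canonical_def using limit_pair_unique by blast

lemma canonical_limit_pair: "x \<in> carrier C \<Longrightarrow> limit_pair x (canonical x)"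
  using limit_pair_total canonical_eq by metis

lemma canonical_star_hom: "canonical \<in> star_hom C A"
  unfolding star_hom_def
proof (clarsimp, intro conjI ballI allI)
  show "canonical \<in> carrier C \<rightarrow> carrier A" using canonical_limit_pair limit_pair_D by blast
qed (use canonical_limit_pair canonical_eq limit_pair_add limit_pair_mult limit_pair_smult limit_pair_star in metis)+

lemma canonical_S: "i \<in> {1..k} \<Longrightarrow> s \<in> {1..n i} \<Longrightarrow> canonical (S i s) = W i s"
  using canonical_eq limit_pair_poly_pair poly_pair_S by metis

lemma canonical_norm_le: "x \<in> carrier C \<Longrightarrow> cnorm A (canonical x) \<le> cnorm B x"
  using canonical_limit_pair limit_pair_D(4) by blast

lemma canonical_one: "canonical \<one>\<^bsub>B\<^esub> = \<one>"
  using canonical_eq limit_pair_poly_pair poly_pair_one by metis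

end

section \<open>Exactness\<close>

lemma (in lambda_tuple) cstar_algebra_defect_ideal: "cstar_algebra (defect_ideal k n lam)"
proof -
  have "cstar_algebra (C\<lparr>carrier := J\<rparr>)"
  proof (rule cstar_algebra_restrict[OF C.cstar_algebra_axioms J_closed])
    show "\<zero>\<^bsub>C\<^esub> \<in> J" "\<And>x y. x \<in> J \<Longrightarrow> y \<in> J \<Longrightarrow> x \<oplus>\<^bsub>C\<^esub> y \<in> J"
      using J_ideal by (auto simp: additive_subgroup.zero_closed additive_subgroup.a_closed ideal.axioms(1)
          simp del: C_simps)
    show "\<And>x y. x \<in> J \<Longrightarrow> y \<in> J \<Longrightarrow> x \<otimes>\<^bsub>C\<^esub> y \<in> J"
      by (rule ideal.I_l_closed[OF J_ideal]) (auto intro: J_C)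
    show "\<And>c x. x \<in> J \<Longrightarrow> c \<odot>\<^bsub>C\<^esub> x \<in> J" by (rule C.ideal_smult[OF J_ideal])
    show "\<And>x. x \<in> J \<Longrightarrow> star C x \<in> J" by (rule J_star)
  qed
  then show ?thesis by (simp add: defect_ideal_def Let_def)
qed

context cuntz_family
begin

lemma canonical_minus: "x \<in> carrier C \<Longrightarrow> y \<in> carrier C \<Longrightarrow> canonical (x \<ominus>\<^bsub>C\<^esub> y) = canonical x \<ominus> canonical y"
  by (rule star_hom_minus[OF C.unital_cstar_algebra_axioms A.unital_cstar_algebra_axioms canonical_star_hom])

text \<open>The kernel is a closed ideal and contains the defects, since the sum relation for
  \<open>W\<close> sends them to zero; minimality of \<open>J\<close> does the rest.\<close>

lemma canonical_J: assumes "x \<in> J" shows "canonical x = \<zero>"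
proof -
  note D = star_homD[OF canonical_star_hom]
  note uc = C.unital_cstar_algebra_axioms A.unital_cstar_algebra_axioms canonical_star_hom
  define K where "K = {x \<in> carrier C. canonical x = \<zero>}"
  have "J \<subseteq> K"
  proof (rule C.closed_ideal_generated_minimal)
    show "ideal K C"
    proof (rule C.ideal_closedI)
      show "\<zero>\<^bsub>C\<^esub> \<in> K" using star_hom_zero[OF uc] C.zero_closed by (simp add: K_def)
      show "x \<oplus>\<^bsub>C\<^esub> y \<in> K" if "x \<in> K" "y \<in> K" for x y
        using that D(2) C.a_closed unfolding K_def by (simp del: C_simps)
      show "x \<otimes>\<^bsub>C\<^esub> b \<in> K" "b \<otimes>\<^bsub>C\<^esub> x \<in> K" if "x \<in> K" "b \<in> carrier C" for x b
        using that D(1,3) C.m_closed unfolding K_def by (simp_all del: C_simps)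
    qed (auto simp: K_def)
    show "closed_in_norm C K"
      unfolding C.closed_in_norm_iff
    proof (intro conjI allI impI)
      fix u x assume u: "range u \<subseteq> K" "clim C u x"
      have "clim A (\<lambda>j. canonical (u j)) (canonical x)" by (rule star_hom_clim[OF uc u(2)])
      moreover have "(\<lambda>j. canonical (u j)) = (\<lambda>j. \<zero>)" using u(1) by (auto simp: K_def)
      ultimately have "canonical x = \<zero>" using A.clim_unique A.clim_const by (metis A.zero_closed)
      then show "x \<in> K" using C.climD[OF u(2)] by (simp add: K_def)
    qed (auto simp: K_def)
    have "canonical (P i) = \<zero>" if i: "i \<in> {1..k}" for i
    proof -
      have m: "S i s \<otimes>\<^bsub>C\<^esub> star C (S i s) \<in> carrier C" if "s \<in> {1..n i}" for s
        using i that by (intro C.m_closed C.star_closed) auto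
      have "canonical (\<Oplus>\<^bsub>C\<^esub>s\<in>{1..n i}. S i s \<otimes>\<^bsub>C\<^esub> star C (S i s))
          = (\<Oplus>s\<in>{1..n i}. canonical (S i s \<otimes>\<^bsub>C\<^esub> star C (S i s)))"
        by (rule star_hom_finsum[OF C.normed_module_axioms A.normed_module_axioms canonical_star_hom])
          (use m in auto)
      also have "\<dots> = (\<Oplus>s\<in>{1..n i}. W i s \<otimes> star A (W i s))"
      proof (rule A.finsum_cong')
        fix s assume s: "s \<in> {1..n i}"
        show "canonical (S i s \<otimes>\<^bsub>C\<^esub> star C (S i s)) = W i s \<otimes> star A (W i s)"
          using S_C[OF i s] C.star_closed[OF S_C[OF i s]] canonical_S[OF i s] by (simp only: D)
      qed (use i in auto)
      also have "\<dots> = \<one>" by (rule W_sum[OF i])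
      finally have "canonical (\<Oplus>\<^bsub>C\<^esub>s\<in>{1..n i}. S i s \<otimes>\<^bsub>C\<^esub> star C (S i s)) = \<one>" .
      moreover have "(\<Oplus>\<^bsub>C\<^esub>s\<in>{1..n i}. S i s \<otimes>\<^bsub>C\<^esub> star C (S i s)) \<in> carrier C"
        using m by (intro C.finsum_closed) auto
      ultimately show ?thesis
        unfolding defect_projection_eq(2)[OF i, symmetric]
        using canonical_minus[OF C.one_closed] canonical_one by simp
    qed
    then show "defect_projection k n lam ` {1..k} \<subseteq> K"
      using P_C defect_projection_eq(1) by (auto simp: K_def)
  qed
  then show ?thesis using assms by (auto simp: K_def)
qed

section \<open>Kernel and range, given the homomorphism back into the quotient\<close>

context
  fixes \<rho> :: "(((nat \<Rightarrow> nat list) \<Rightarrow> complex) \<Rightarrow> ((nat \<Rightarrow> nat list) \<Rightarrow> complex)) \<Rightarrow> 'b" and \<psi> :: "'a \<Rightarrow> 'b"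
    and i0 s0 :: nat
  assumes I: "cstar_ideal C J \<rho>"
    and \<psi>: "\<psi> \<in> star_hom A (cstar_ideal.quot C J \<rho>)"
    and \<psi>_W: "\<And>i s. i \<in> {1..k} \<Longrightarrow> s \<in> {1..n i} \<Longrightarrow> \<psi> (W i s) = \<rho> (S i s)"
    and generators: "i0 \<in> {1..k}" "s0 \<in> {1..n i0}"
begin

interpretation I: cstar_ideal C J \<rho> by (rule I)
interpretation Q: unital_cstar_algebra I.quot by (rule I.unital_cstar_algebra_quot)

text \<open>Both sides are homomorphisms agreeing on the generators. Contractivity makes them
  continuous, so they agree on a closed star-subalgebra.\<close>

lemma psi_canonical:
  assumes "x \<in> carrier C" shows "\<psi> (canonical x) = \<rho> x"
proof -
  note D = star_homD[OF canonical_star_hom] and E = star_homD[OF \<psi>] and F = star_homD[OF I.rho_star_hom]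
  note hA = C.unital_cstar_algebra_axioms A.unital_cstar_algebra_axioms canonical_star_hom
  note hQ = A.unital_cstar_algebra_axioms Q.unital_cstar_algebra_axioms \<psi>
  note hR = C.unital_cstar_algebra_axioms Q.unital_cstar_algebra_axioms I.rho_star_hom
  define K where "K = {x \<in> carrier C. \<psi> (canonical x) = \<rho> x}"
  have KC: "x \<in> K \<Longrightarrow> x \<in> carrier C" and Keq: "x \<in> K \<Longrightarrow> \<psi> (canonical x) = \<rho> x" for x
    by (auto simp: K_def)
  have KI: "x \<in> carrier C \<Longrightarrow> \<psi> (canonical x) = \<rho> x \<Longrightarrow> x \<in> K" for x by (simp add: K_def)
  have SK: "S i s \<in> K" if "i \<in> {1..k}" "s \<in> {1..n i}" for i s
    using that by (intro KI S_C) (simp_all only: canonical_S \<psi>_W)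
  have mult: "x \<otimes>\<^bsub>C\<^esub> y \<in> K" if "x \<in> K" "y \<in> K" for x y
    by (rule KI[OF C.m_closed[OF KC[OF that(1)] KC[OF that(2)]]])
      (simp only: D E F KC[OF that(1)] KC[OF that(2)] Keq[OF that(1)] Keq[OF that(2)])
  have add: "x \<oplus>\<^bsub>C\<^esub> y \<in> K" if "x \<in> K" "y \<in> K" for x y
    by (rule KI[OF C.a_closed[OF KC[OF that(1)] KC[OF that(2)]]])
      (simp only: D E F KC[OF that(1)] KC[OF that(2)] Keq[OF that(1)] Keq[OF that(2)])
  have smult: "c \<odot>\<^bsub>C\<^esub> x \<in> K" if "x \<in> K" for c x
    by (rule KI[OF C.sm_closed[OF KC[OF that]]]) (simp only: D E F KC[OF that] Keq[OF that])
  have star: "star C x \<in> K" if "x \<in> K" for x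
    by (rule KI[OF C.star_closed[OF KC[OF that]]]) (simp only: D E F KC[OF that] Keq[OF that])
  have "unital_cstar_subalgebra B K"
  proof (rule B.unital_cstar_subalgebraI)
    show "K \<subseteq> carrier B" using C_sub by (auto simp: K_def)
    \<comment> \<open>A homomorphism is not unital by definition, so the unit is reached through one
      generator, as its adjoint times itself.\<close>
    have "star C (S i0 s0) \<otimes>\<^bsub>C\<^esub> S i0 s0 \<in> K" by (intro mult star SK generators)
    then show "\<one>\<^bsub>B\<^esub> \<in> K" using generators by (simp add: star_S S_star_S_same)
    fix u x assume u: "range u \<subseteq> K" "clim B u x"
    have uC: "range u \<subseteq> carrier C" using u(1) KC by blast
    have x: "x \<in> carrier C"
      by (rule B.unital_cstar_subalgebraD(8)[OF C_subalgebra uC u(2)])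
    have lim: "clim C u x" using C_clim x uC u(2) by blast
    have "(\<lambda>j. \<psi> (canonical (u j))) = (\<lambda>j. \<rho> (u j))" using u(1) Keq by blast
    then have "\<psi> (canonical x) = \<rho> x"
      using star_hom_clim[OF hQ star_hom_clim[OF hA lim]] star_hom_clim[OF hR lim]
      by (metis Q.clim_unique)
    then show "x \<in> K" using x by (rule KI[rotated])
  qed (use mult add smult star in simp_all)
  then have "carrier C \<subseteq> K" by (rule C_induct) (rule SK)
  then show ?thesis using assms by (auto simp: K_def)
qed

lemma kernel_canonical: "a_kernel C A canonical = J"
proof -
  have "x \<in> J" if x: "x \<in> carrier C" "canonical x = \<zero>" for x
  proof -
    have "\<rho> x = \<psi> \<zero>" using psi_canonical[OF x(1)] x(2) by simp
    also have "\<dots> = \<psi> (canonical \<zero>\<^bsub>C\<^esub>)"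
      using canonical_J[of "\<zero>\<^bsub>C\<^esub>"] I.J_zero by simp
    also have "\<dots> = \<rho> \<zero>\<^bsub>C\<^esub>" by (rule psi_canonical[OF C.zero_closed])
    finally show ?thesis using I.rho_eq_iff[OF x(1) C.zero_closed] x(1) C.mi_zero by metis
  qed
  then show ?thesis
    unfolding a_kernel_def' using J_C canonical_J by blast
qed

text \<open>Subtracting elements of \<open>J\<close> does not change the image, so the bound by
  \<open>cnorm\<close> passes to the infimum. With \<psi> contractive this makes the induced map on
  the quotient isometric.\<close>

lemma canonical_coset_norm:
  assumes x: "x \<in> carrier C" shows "cnorm A (canonical x) \<le> cnorm I.quot (\<rho> x)"
  unfolding I.quot_norm[OF x]
proof (rule I.qnorm_ge[OF x])
  fix j assume j: "j \<in> J"
  have "canonical (x \<ominus>\<^bsub>C\<^esub> j) = canonical x"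
    using canonical_minus[OF x J_C[OF j]] canonical_J[OF j] star_homD(1)[OF canonical_star_hom x] by simp
  then show "cnorm A (canonical x) \<le> cnorm C (x \<ominus>\<^bsub>C\<^esub> j)"
    using canonical_norm_le[OF C.mi_closed[OF x J_C[OF j]]] by simp
qed

text \<open>The point is that the range is closed. If images of \<open>v j\<close> converge to
  \<open>y\<close>, then the cosets of \<open>v j\<close> converge to \<psi> of \<open>y\<close>,
  which is the coset of some \<open>x\<close>; as the coset norm controls the images, these converge
  to the image of \<open>x\<close>, which must be \<open>y\<close>.\<close>

lemma canonical_surj:
  assumes gen: "cstar_generated A {W i s |i s. i \<in> {1..k} \<and> s \<in> {1..n i}} = carrier A"
  shows "canonical ` carrier C = carrier A"
proof
  note D = star_homD[OF canonical_star_hom]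
  show "canonical ` carrier C \<subseteq> carrier A" using D(1) by blast
  have "unital_cstar_subalgebra A (canonical ` carrier C)"
  proof (rule A.unital_cstar_subalgebraI)
    show "canonical ` carrier C \<subseteq> carrier A" using D(1) by blast
    show "\<one> \<in> canonical ` carrier C" using canonical_one C.one_closed by (metis C_simps(2) image_eqI)
    fix x y c assume "x \<in> canonical ` carrier C"
    then obtain a where a: "x = canonical a" "a \<in> carrier C" by (rule imageE)
    show "c \<odot>\<^bsub>A\<^esub> x \<in> canonical ` carrier C"
      unfolding a(1) D(4)[OF a(2), symmetric] by (rule imageI[OF C.sm_closed[OF a(2)]])
    show "star A x \<in> canonical ` carrier C"
      unfolding a(1) D(5)[OF a(2), symmetric] by (rule imageI[OF C.star_closed[OF a(2)]])
    assume "y \<in> canonical ` carrier C"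
    then obtain b where b: "y = canonical b" "b \<in> carrier C" by (rule imageE)
    show "x \<oplus> y \<in> canonical ` carrier C"
      unfolding a(1) b(1) D(2)[OF a(2) b(2), symmetric] by (rule imageI[OF C.a_closed[OF a(2) b(2)]])
    show "x \<otimes> y \<in> canonical ` carrier C"
      unfolding a(1) b(1) D(3)[OF a(2) b(2), symmetric] by (rule imageI[OF C.m_closed[OF a(2) b(2)]])
  next
    fix u y assume u: "range u \<subseteq> canonical ` carrier C" "clim A u y"
    have yc: "y \<in> carrier A" using A.climD[OF u(2)] by simp
    have "\<exists>x. x \<in> carrier C \<and> canonical x = u j" for j
    proof -
      have "u j \<in> canonical ` carrier C" by (rule subsetD[OF u(1) rangeI])
      then obtain x where "u j = canonical x" "x \<in> carrier C" by (rule imageE)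
      then show ?thesis by metis
    qed
    then obtain v where v: "\<And>j. v j \<in> carrier C" "\<And>j. canonical (v j) = u j" by metis
    \<comment> \<open>The limit of the cosets is known in advance: \<psi> maps into the quotient,
      and every element there is a coset of \<open>C\<close>.\<close>
    obtain x where x: "x \<in> carrier C" "\<rho> x = \<psi> y"
    proof -
      have "\<psi> y \<in> \<rho> ` carrier C" using star_homD(1)[OF \<psi> yc] unfolding I.quot_carrier .
      then obtain x where "\<psi> y = \<rho> x" "x \<in> carrier C" by (rule imageE)
      then show ?thesis using that[of x] by metis
    qed
    have "clim A u (canonical x)"
    proof (rule A.climI[OF _ _ A.climD(3)[OF u(2)]])
      fix j
      have uj: "u j \<in> carrier A" using A.climD[OF u(2)] by simp
      have "u j \<ominus> canonical x = canonical (v j \<ominus>\<^bsub>C\<^esub> x)"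
        using canonical_minus[OF v(1) x(1)] v(2) by simp
      then have "cnorm A (u j \<ominus> canonical x) \<le> cnorm I.quot (\<rho> (v j \<ominus>\<^bsub>C\<^esub> x))"
        using canonical_coset_norm[OF C.mi_closed[OF v(1) x(1)]] by simp
      also have "\<rho> (v j \<ominus>\<^bsub>C\<^esub> x) = \<rho> (v j) \<ominus>\<^bsub>I.quot\<^esub> \<rho> x"
        by (rule I.quot_minus[OF v(1) x(1), symmetric])
      also have "\<dots> = \<psi> (u j) \<ominus>\<^bsub>I.quot\<^esub> \<psi> y"
        using psi_canonical[OF v(1)] v(2) x(2) by simp
      also have "\<dots> = \<psi> (u j \<ominus> y)"
        by (rule star_hom_minus[OF A.unital_cstar_algebra_axioms Q.unital_cstar_algebra_axioms \<psi> uj yc, symmetric])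
      also have "cnorm I.quot (\<psi> (u j \<ominus> y)) \<le> cnorm A (u j \<ominus> y)"
        by (rule star_hom_contractive[OF A.unital_cstar_algebra_axioms Q.unital_cstar_algebra_axioms \<psi>])
          (use uj yc in simp)
      finally show "cnorm A (u j \<ominus> canonical x) \<le> cnorm A (u j \<ominus> y)" .
    qed (use A.climD[OF u(2)] D(1) x in auto)
    then show "y \<in> canonical ` carrier C" using A.clim_unique[OF u(2)] x(1) by blast
  qed
  moreover have "{W i s |i s. i \<in> {1..k} \<and> s \<in> {1..n i}} \<subseteq> canonical ` carrier C"
  proof clarify
    fix i s assume i: "i \<in> {1..k}" "s \<in> {1..n i}"
    show "W i s \<in> canonical ` carrier C"
      unfolding canonical_S[OF i, symmetric] by (rule imageI[OF S_C[OF i]])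
  qed
  ultimately show "carrier A \<subseteq> canonical ` carrier C"
    using A.cstar_generated_minimal gen by blast
qed

end

end

theorem theorem4p15:
  fixes k :: nat and n :: "nat \<Rightarrow> nat"
    and lam :: "nat \<Rightarrow> nat \<Rightarrow> nat \<Rightarrow> nat \<Rightarrow> complex"
    and A :: "'a cstar_algebra" and W :: "nat \<Rightarrow> nat \<Rightarrow> 'a"
  assumes "k \<ge> 1"
    and "\<And>i. i \<in> {1..k} \<Longrightarrow> n i \<ge> 1"
    and "\<And>i j s t. \<lbrakk>i \<in> {1..k}; j \<in> {1..k}; i \<noteq> j; s \<in> {1..n i}; t \<in> {1..n j}\<rbrakk>
           \<Longrightarrow> cmod (lam i j s t) = 1"
    and "\<And>i j s t. \<lbrakk>i \<in> {1..k}; j \<in> {1..k}; i \<noteq> j; s \<in> {1..n i}; t \<in> {1..n j}\<rbrakk>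
           \<Longrightarrow> lam j i t s = cnj (lam i j s t)"
    and "is_universal_cuntz k n lam A W"
  shows "\<exists>\<pi>. (\<forall>i\<in>{1..k}. \<forall>s\<in>{1..n i}. \<pi> (std_isometry k n lam i s) = W i s) \<and>
    short_exact_cstar (defect_ideal k n lam) (std_cstar_algebra k n lam) A (\<lambda>T. T) \<pi>"
proof -
  interpret lambda_tuple k n lam
    by unfold_locales (use assms(3,4) in blast)+
  have A: "unital_cstar_algebra A" and W: "cuntz_relations k n lam A W"
    and gen: "cstar_generated A {W i s |i s. i \<in> {1..k} \<and> s \<in> {1..n i}} = carrier A"
    and univ: "\<And>(D :: (nat \<Rightarrow> complex) cstar_algebra) V. unital_cstar_algebra D \<Longrightarrow>
      cuntz_relations k n lam D V \<Longrightarrow> \<exists>\<phi>\<in>star_hom A D. \<forall>i\<in>{1..k}. \<forall>s\<in>{1..n i}. \<phi> (W i s) = V i s"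
    using assms(5) unfolding is_universal_cuntz_def by blast+
  interpret A: unital_cstar_algebra A by (rule A)
  interpret F: cuntz_family k n lam A W
    by unfold_locales (rule W)
  obtain \<rho> :: "(((nat \<Rightarrow> nat list) \<Rightarrow> complex) \<Rightarrow> ((nat \<Rightarrow> nat list) \<Rightarrow> complex)) \<Rightarrow> nat \<Rightarrow> complex"
    where I: "cstar_ideal C J \<rho>" using defect_quotient_exists by blast
  \<comment> \<open>The quotient is an admissible test algebra: it satisfies the relations and is
    carried by a subset of \<open>nat \<Rightarrow> complex\<close>.\<close>
  obtain \<psi> where \<psi>: "\<psi> \<in> star_hom A (cstar_ideal.quot C J \<rho>)"
    "\<forall>i\<in>{1..k}. \<forall>s\<in>{1..n i}. \<psi> (W i s) = \<rho> (S i s)"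
    using univ[OF cstar_ideal.unital_cstar_algebra_quot[OF I] cuntz_relations_quotient[OF I]] by blast
  \<comment> \<open>The generator through which the unit is reached in
    \<open>psi_canonical\<close>.\<close>
  have g: "(1::nat) \<in> {1..k}" "(1::nat) \<in> {1..n 1}" using assms(1,2) by auto
  have \<psi>W: "\<psi> (W i s) = \<rho> (S i s)" if "i \<in> {1..k}" "s \<in> {1..n i}" for i s
    using \<psi>(2) that by blast
  have ker: "a_kernel C A F.canonical = J"
    by (rule F.kernel_canonical[OF I \<psi>(1) _ g]) (rule \<psi>W)
  have surj: "F.canonical ` carrier C = carrier A"
    by (rule F.canonical_surj[OF I \<psi>(1) _ g gen]) (rule \<psi>W)
  have "short_exact_cstar (defect_ideal k n lam) C A (\<lambda>T. T) F.canonical"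
    unfolding short_exact_cstar_def
  proof (intro conjI)
    have eq: "defect_ideal k n lam = C\<lparr>carrier := J\<rparr>" by (simp add: defect_ideal_def Let_def)
    show "(\<lambda>T. T) \<in> star_hom (defect_ideal k n lam) C"
      unfolding eq star_hom_def using J_C by auto
    show "(\<lambda>T. T) ` carrier (defect_ideal k n lam) = a_kernel C A F.canonical"
      unfolding ker eq by simp
  qed (use cstar_algebra_defect_ideal C.cstar_algebra_axioms A.cstar_algebra_axioms
      F.canonical_star_hom surj in auto)
  then show ?thesis using F.canonical_S by blast
qed

end
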